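(* Let $\mathcal F$ be one of the classes $\mathsf{Full}$, $\mathsf{Normal}$, $\mathsf{Tight}$ of epistemic logic programs (ELPs), and let (a) $i=2$ if $\mathcal F=\mathsf{Full}$ and (b) $i=1$ if $\mathcal F\in\{\mathsf{Normal},\mathsf{Tight}\}$. Let $P\in\mathcal F$ be an arbitrary ELP of bounded arity $a$ over a domain of size $d=|\mathrm{dom}(P)|$, and let $k$ be the treewidth of the primal graph $G_P$. Then deciding world view existence of $\mathrm{grd}(P)$, as well as computing the plausibility level $L(P,\emptyset)$ of $\mathrm{grd}(P)$, can be done in time $$\exp\bigl(i+1,\,d^{\,\mathcal O(k)}\bigr)\cdot \mathrm{poly}(|\mathrm{at}(P)|).$$
   Context: Syntax. Atoms are $p(t_1,\dots,t_n)$ with $p$ a predicate symbol of arity $n\ge 0$ and each $t_j$ a constant or a variable (no function symbols). A literal is an atom $a$ or its negation $\neg a$, with $\neg\neg a=a$. An epistemic literal is an expression $\mathbf{not}\,\ell$ with $\ell$ a literal; $\mathbf K\ell$ abbreviates $\neg\,\mathbf{not}\,\ell$ and $\mathbf M\ell$ abbreviates $\mathbf{not}\,\neg\ell$. An ELP is a finite set of rules $a_1\vee\dots\vee a_k\leftarrow \beta_1,\dots,\beta_n$ where the $a_j$ are atoms ($k=0$ is allowed: a constraint) and each body element $\beta_j$ is a literal, an epistemic literal, or a negated epistemic literal. A program without epistemic literals is a logic program. For a rule $r$: $H_r$ is the set of head atoms, $B_r^+$ (resp. $B_r^-$) the set of atoms occurring in the body as non-epistemic positive (resp. negated) literals. Safety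 is assumed: $\mathrm{vars}(H_r\cup B^-_r)\subseteq \mathrm{vars}(B^+_r)$ (this can be ensured by a unary domain predicate holding for all constants). $\mathrm{at}(\cdot)$ denotes the set of atoms occurring in an object, and $\mathrm{lits}(P)=\mathrm{at}(P)\cup\{\neg a: a\in \mathrm{at}(P)\}$. "Bounded arity $a$" means that all predicates of $P$ have arity at most $a$, for an arbitrary but fixed constant $a$. Grounding. The domain $\mathrm{dom}(P)$ is the Herbrand universe, i.e. the set of constants occurring in $P$ (an arbitrary single constant if there are none); $\mathrm{grd}(P)$ is obtained by replacing in each rule all variables in all possible ways by elements of the Herbrand universe. Answer sets. For a ground logic program $P$, a set $M$ of ground atoms satisfies a rule $r$ if $(H_r\cup B_r^-)\cap M\ne\emptyset$ or $B_r^+\not\subseteq M$; $M$ is an answer set of $P$ if $M$ is a $\subseteq$-minimal model of $P^M=\{H_r\leftarrow B_r^+ : r\in P,\ B_r^-\cap M=\emptyset\}$. $AS(P)$ is the set of answer sets. World views. Let $P$ be a ground ELP. A world view interpretation (WVI) is a consistent set $I\subseteq\mathrm{lits}(P)$ (no $a,\neg a$ both in $I$). The epistemic reduct $P^I$ results from $P$ by replacing each epistemic literal $\mathbf{not}\,\ell$ by $\neg\ell$ if $\ell\in I$, and by $\top$ otherwise; double negation cancels. $I$ is a world view of $P$ if it is compatible with $\mathcal I=AS(P^I)$, i.e. (i) $\mathcal I\neq\emptyset$, and for each atom $a$: (ii) $a\in I$ implies $a\in J$ for all $J\in\mathcal I$; (iii) $\neg a\in I$ implies $a\notin J$ for all $J\in\mathcal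 I$; (iv) if $a\in\mathrm{at}(P)$ and neither $a$ nor $\neg a$ is in $I$, then $a\in J$ and $a\notin J'$ for some $J,J'\in\mathcal I$. The world views of a non-ground ELP are those of its grounding. World view existence is the problem of deciding whether a world view exists. Plausibility level. $\#\mathrm{WV}(P)$ is the number of world views of $P$. An epistemic query $Q$ is a set of expressions $\mathbf M\ell$ or $\mathbf K\ell$ with $\ell$ a literal; $P\sqcup Q=P\cup\{v\leftarrow\mathbf{not}\,v,\neg q : q\in Q\}$ for a fresh atom $v$; and $L(P,Q)=\#\mathrm{WV}(P\sqcup Q)$. In particular $L(P,\emptyset)=\#\mathrm{WV}(P)$. Classes. $\mathsf{Full}$: all ELPs. $\mathsf{Normal}$: all ELPs with $|H_r|\le1$ for every rule. $\mathsf{Tight}$: all ELPs whose dependency graph is acyclic, where the dependency graph is the digraph on atoms having, for each rule $r$ and each $b\in H_r$, an edge $(a,b)$ for each $a\in B_r^+$ and each $a$ such that $\mathbf{not}\,\neg a$ or $\neg\,\mathbf{not}\,a$ occurs in the body of $r$; a non-ground program is tight if its grounding is. Primal graph. For non-ground $P$, $G_P$ has as vertices the predicate names occurring in $P$, and an edge $\{p_1,p_2\}$ whenever $p_1\ne p_2$ jointly occur in a rule of $P$; for ground $P$, its vertices are the atoms of $P$, with an edge between distinct atoms jointly occurring in a rule. Treewidth is the usual graph treewidth. Notation. $\exp(0,n)=n$ and $\exp(k,n)=2^{\exp(k-1,n)}$ for $k\ge1$.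
   Formalization: The input is the ground program grd(P), and for a domain of size d = 1 the base of d^O(k) is taken to be 2, since the literal bound, poly(|at(P)|), is then too small even to read exponentially many rules; O(k) may be a nonzero constant at k = 0. *)

theory Defs
  imports Complex_Main
    "HOL-Library.FSet"
    "HOL-Library.Landau_Symbols"
    "HOL-Computational_Algebra.Polynomial"
begin

section \<open>Epistemic logic programs\<close>

datatype 'a lit = Pos 'a | Neg 'a

fun compl :: "'a lit \<Rightarrow> 'a lit" where
  "compl (Pos a) = Neg a"
| "compl (Neg a) = Pos a"

text \<open>\<^term>\<open>ENot l\<close> is the epistemic literal \<open>not l\<close>, and \<^term>\<open>NegENot l\<close> is its negation.\<close>

datatype 'a body_elem = Lit "'a lit" | ENot "'a lit" | NegENot "'a lit"

datatype 'a rule = Rule (head: "'a fset") (body: "'a body_elem fset")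

type_synonym 'a prog = "'a rule set"

text \<open>The semantics is defined for programs over an arbitrary type of atoms; these are the ground
  programs. Programs with variables have atoms built from terms.\<close>

datatype trm = Var nat | Const nat

type_synonym atom = "nat \<times> trm list"
type_synonym gatom = "nat \<times> nat list"

definition pos_body :: "'a rule \<Rightarrow> 'a set" where
  "pos_body r = {a. Lit (Pos a) |\<in>| body r}"

definition neg_body :: "'a rule \<Rightarrow> 'a set" where
  "neg_body r = {a. Lit (Neg a) |\<in>| body r}"

definition atoms :: "'a prog \<Rightarrow> 'a set" where
  "atoms P = (\<Union>r\<in>P. set_rule r)"

definition lits :: "'a prog \<Rightarrow> 'a lit set" where
  "lits P = Pos ` atoms P \<union> Neg ` atoms P"

definition atom_vars :: "atom \<Rightarrow> nat set" where
  "atom_vars A = {v. Var v \<in> set (snd A)}"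

definition safe :: "atom rule \<Rightarrow> bool" where
  "safe r \<longleftrightarrow> (\<Union>A\<in>fset (head r) \<union> neg_body r. atom_vars A) \<subseteq> (\<Union>A\<in>pos_body r. atom_vars A)"

definition elp :: "atom prog \<Rightarrow> bool" where
  "elp P \<longleftrightarrow> finite P \<and> (\<forall>r\<in>P. safe r) \<and>
     (\<exists>ar. \<forall>(p, ts)\<in>atoms P. length ts = ar p)"

definition bounded_arity :: "nat \<Rightarrow> atom prog \<Rightarrow> bool" where
  "bounded_arity a P \<longleftrightarrow> (\<forall>(p, ts)\<in>atoms P. length ts \<le> a)"

definition preds :: "(nat \<times> 'b) prog \<Rightarrow> nat set" where
  "preds P = fst ` atoms P"


subsection \<open>Grounding\<close>

definition herbrand :: "atom prog \<Rightarrow> nat set" where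
  "herbrand P = (let C = {c. \<exists>(p, ts)\<in>atoms P. Const c \<in> set ts} in if C = {} then {0} else C)"

fun inst_trm :: "(nat \<Rightarrow> nat) \<Rightarrow> trm \<Rightarrow> nat" where
  "inst_trm \<sigma> (Var v) = \<sigma> v"
| "inst_trm \<sigma> (Const c) = c"

definition inst :: "(nat \<Rightarrow> nat) \<Rightarrow> atom \<Rightarrow> gatom" where
  "inst \<sigma> A = (fst A, map (inst_trm \<sigma>) (snd A))"

definition grd :: "atom prog \<Rightarrow> gatom prog" where
  "grd P = {map_rule (inst \<sigma>) r | r \<sigma>. r \<in> P \<and> range \<sigma> \<subseteq> herbrand P}"


subsection \<open>Answer sets\<close>

definition satisfies :: "'a set \<Rightarrow> 'a rule \<Rightarrow> bool" where
  "satisfies M r \<longleftrightarrow> (fset (head r) \<union> neg_body r) \<inter> M \<noteq> {} \<or> \<not> pos_body r \<subseteq> M"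

definition model :: "'a set \<Rightarrow> 'a prog \<Rightarrow> bool" where
  "model M P \<longleftrightarrow> (\<forall>r\<in>P. satisfies M r)"

definition gl_reduct :: "'a prog \<Rightarrow> 'a set \<Rightarrow> 'a prog" where
  "gl_reduct P M =
     {Rule (head r) (ffilter (\<lambda>b. \<exists>a. b = Lit (Pos a)) (body r)) | r. r \<in> P \<and> neg_body r \<inter> M = {}}"

definition answer_sets :: "'a prog \<Rightarrow> 'a set set" where
  "answer_sets P = {M. model M (gl_reduct P M) \<and> (\<forall>N. N \<subset> M \<longrightarrow> \<not> model N (gl_reduct P M))}"


subsection \<open>World views\<close>

text \<open>In the epistemic reduct, \<open>not l\<close> becomes the complement of \<open>l\<close> if \<open>l \<in> I\<close> and is
  dropped (being true) otherwise. Its negation becomes \<open>l\<close> if \<open>l \<in> I\<close>, by cancellation of the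
  double negation; otherwise it is false, and the rule, whose body cannot hold, is dropped.\<close>

fun reduce_elem :: "'a body_elem \<Rightarrow> 'a body_elem" where
  "reduce_elem (Lit l) = Lit l"
| "reduce_elem (ENot l) = Lit (compl l)"
| "reduce_elem (NegENot l) = Lit l"

definition epistemic_reduct :: "'a prog \<Rightarrow> 'a lit set \<Rightarrow> 'a prog" where
  "epistemic_reduct P I =
     {Rule (head r) (reduce_elem |`| ffilter (\<lambda>b. \<forall>l. b = ENot l \<longrightarrow> l \<in> I) (body r)) | r.
        r \<in> P \<and> (\<forall>l. NegENot l |\<in>| body r \<longrightarrow> l \<in> I)}"

definition wvi :: "'a prog \<Rightarrow> 'a lit set \<Rightarrow> bool" where
  "wvi P I \<longleftrightarrow> I \<subseteq> lits P \<and> (\<forall>a. \<not> (Pos a \<in> I \<and> Neg a \<in> I))"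

definition compatible :: "'a prog \<Rightarrow> 'a lit set \<Rightarrow> 'a set set \<Rightarrow> bool" where
  "compatible P I \<J> \<longleftrightarrow> \<J> \<noteq> {} \<and>
     (\<forall>a. (Pos a \<in> I \<longrightarrow> (\<forall>J\<in>\<J>. a \<in> J)) \<and>
          (Neg a \<in> I \<longrightarrow> (\<forall>J\<in>\<J>. a \<notin> J)) \<and>
          (a \<in> atoms P \<and> Pos a \<notin> I \<and> Neg a \<notin> I \<longrightarrow> (\<exists>J\<in>\<J>. a \<in> J) \<and> (\<exists>J\<in>\<J>. a \<notin> J)))"

definition world_views :: "'a prog \<Rightarrow> 'a lit set set" where
  "world_views P = {I. wvi P I \<and> compatible P I (answer_sets (epistemic_reduct P I))}"


subsection \<open>Epistemic queries and plausibility level\<close>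

text \<open>\<^term>\<open>Poss l\<close> is \<open>M l\<close>, that is, \<open>not \<not>l\<close>; \<^term>\<open>Know l\<close> is \<open>K l\<close>, that is, \<open>\<not> not l\<close>.\<close>

datatype 'a query_elem = Poss "'a lit" | Know "'a lit"

fun negate_query :: "'a query_elem \<Rightarrow> 'a body_elem" where
  "negate_query (Poss l) = NegENot (compl l)"
| "negate_query (Know l) = ENot l"

definition add_query :: "'a prog \<Rightarrow> 'a query_elem set \<Rightarrow> 'a prog" where
  "add_query P Q =
     (let v = (SOME v. v \<notin> atoms P \<and> v \<notin> (\<Union>q\<in>Q. set_query_elem q))
      in P \<union> {Rule {|v|} {|ENot (Pos v), negate_query q|} | q. q \<in> Q})"

definition plausibility :: "'a prog \<Rightarrow> 'a query_elem set \<Rightarrow> nat" where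
  "plausibility P Q = card (world_views (add_query P Q))"


subsection \<open>Classes of programs\<close>

definition dependency_graph :: "'a prog \<Rightarrow> ('a \<times> 'a) set" where
  "dependency_graph P = {(a, b). \<exists>r\<in>P. b |\<in>| head r \<and>
     (a \<in> pos_body r \<or> ENot (Neg a) |\<in>| body r \<or> NegENot (Pos a) |\<in>| body r)}"

definition Full :: "atom prog set" where
  "Full = {P. elp P}"

definition Normal :: "atom prog set" where
  "Normal = {P. elp P \<and> (\<forall>r\<in>P. fcard (head r) \<le> 1)}"

definition Tight :: "atom prog set" where
  "Tight = {P. elp P \<and> acyclic (dependency_graph (grd P))}"


section \<open>Treewidth\<close>

text \<open>A simple undirected graph is given by a vertex set and a set of two-element edges.\<close>

definition simple_graph :: "'v set \<Rightarrow> 'v set set \<Rightarrow> bool" where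
  "simple_graph V E \<longleftrightarrow> (\<forall>e\<in>E. \<exists>u\<in>V. \<exists>v\<in>V. u \<noteq> v \<and> e = {u, v})"

text \<open>Connectedness of the subgraph induced by \<open>S\<close>.\<close>

definition connected_on :: "'v set \<Rightarrow> 'v set set \<Rightarrow> bool" where
  "connected_on S E \<longleftrightarrow> (\<forall>u\<in>S. \<forall>v\<in>S. (u, v) \<in> {(x, y). x \<in> S \<and> y \<in> S \<and> {x, y} \<in> E}\<^sup>*)"

definition has_cycle :: "'v set set \<Rightarrow> bool" where
  "has_cycle E \<longleftrightarrow> (\<exists>c. 3 \<le> length c \<and> distinct c \<and>
     (\<forall>i<length c. {c ! i, c ! (Suc i mod length c)} \<in> E))"

definition is_tree :: "'v set \<Rightarrow> 'v set set \<Rightarrow> bool" where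
  "is_tree N T \<longleftrightarrow> finite N \<and> N \<noteq> {} \<and> simple_graph N T \<and> connected_on N T \<and> \<not> has_cycle T"

definition tree_decomposition ::
    "'v set \<Rightarrow> 'v set set \<Rightarrow> nat set \<Rightarrow> nat set set \<Rightarrow> (nat \<Rightarrow> 'v set) \<Rightarrow> bool" where
  "tree_decomposition V E N T bag \<longleftrightarrow> is_tree N T \<and> (\<Union>n\<in>N. bag n) = V \<and>
     (\<forall>e\<in>E. \<exists>n\<in>N. e \<subseteq> bag n) \<and> (\<forall>v\<in>V. connected_on {n\<in>N. v \<in> bag n} T)"

definition treewidth :: "'v set \<Rightarrow> 'v set set \<Rightarrow> nat" where
  "treewidth V E =
     (LEAST w. \<exists>N T bag. tree_decomposition V E N T bag \<and> (\<forall>n\<in>N. card (bag n) \<le> w + 1))"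

definition primal_edges :: "atom prog \<Rightarrow> nat set set" where
  "primal_edges P = {{p, q} | p q. p \<noteq> q \<and> (\<exists>r\<in>P. p \<in> fst ` set_rule r \<and> q \<in> fst ` set_rule r)}"

definition primal_treewidth :: "atom prog \<Rightarrow> nat" where
  "primal_treewidth P = treewidth (preds P) (primal_edges P)"


section \<open>Model of computation\<close>

text \<open>
  Algorithms are first-order recursive programs over binary trees, evaluated call by value, in
  the style of Jones, \<^emph>\<open>Computability and Complexity from a Programming Perspective\<close>. An
  algorithm is a finite list of function bodies, the first of which is the main function, applied
  to the input. Variables are de Bruijn indices: the body of a function sees its arguments,
  \<open>ELet\<close> binds one more variable and the second branch of \<open>ECase\<close> binds the two
  subtrees.

  The running time is the number of evaluation steps. An environment has a length bounded in terms
  of the algorithm alone, and with values represented by pointers a step takes a constant number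
  of pointer operations and allocates at most one new cell; hence the running time agrees with that
  of multi-tape Turing machines up to a polynomial.
\<close>

datatype tree = Leaf | Node tree tree

datatype expr =
    EVar nat
  | ELeaf
  | ENode expr expr
  | ECase expr expr expr
  | ELet expr expr
  | ECall nat "expr list"

type_synonym algorithm = "expr list"

inductive
  eval :: "algorithm \<Rightarrow> tree list \<Rightarrow> expr \<Rightarrow> tree \<Rightarrow> nat \<Rightarrow> bool" and
  eval_list :: "algorithm \<Rightarrow> tree list \<Rightarrow> expr list \<Rightarrow> tree list \<Rightarrow> nat \<Rightarrow> bool"
  for A :: algorithm
where
  eval_EVar: "i < length \<rho> \<Longrightarrow> eval A \<rho> (EVar i) (\<rho> ! i) 1"
| eval_ELeaf: "eval A \<rho> ELeaf Leaf 1"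
| eval_ENode: "eval A \<rho> e x s \<Longrightarrow> eval A \<rho> f y t \<Longrightarrow> eval A \<rho> (ENode e f) (Node x y) (s + t + 1)"
| eval_ECase_Leaf: "eval A \<rho> e Leaf s \<Longrightarrow> eval A \<rho> f v t \<Longrightarrow> eval A \<rho> (ECase e f g) v (s + t + 1)"
| eval_ECase_Node: "eval A \<rho> e (Node x y) s \<Longrightarrow> eval A (x # y # \<rho>) g v t \<Longrightarrow>
    eval A \<rho> (ECase e f g) v (s + t + 1)"
| eval_ELet: "eval A \<rho> e x s \<Longrightarrow> eval A (x # \<rho>) f v t \<Longrightarrow> eval A \<rho> (ELet e f) v (s + t + 1)"
| eval_ECall: "j < length A \<Longrightarrow> eval_list A \<rho> es xs s \<Longrightarrow> eval A xs (A ! j) v t \<Longrightarrow>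
    eval A \<rho> (ECall j es) v (s + t + 1)"
| eval_list_Nil: "eval_list A \<rho> [] [] 0"
| eval_list_Cons: "eval A \<rho> e x s \<Longrightarrow> eval_list A \<rho> es xs t \<Longrightarrow>
    eval_list A \<rho> (e # es) (x # xs) (s + t)"

definition outputs_within :: "algorithm \<Rightarrow> tree \<Rightarrow> tree \<Rightarrow> nat \<Rightarrow> bool" where
  "outputs_within A x y b \<longleftrightarrow> (\<exists>t\<le>b. eval A [x] (ECall 0 [EVar 0]) y t)"


subsection \<open>Encodings\<close>

fun enc_bool :: "bool \<Rightarrow> tree" where
  "enc_bool False = Leaf"
| "enc_bool True = Node Leaf Leaf"

fun enc_list :: "('b \<Rightarrow> tree) \<Rightarrow> 'b list \<Rightarrow> tree" where
  "enc_list f [] = Leaf"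
| "enc_list f (x # xs) = Node (f x) (enc_list f xs)"

text \<open>Binary notation, least significant bit first.\<close>

fun bits :: "nat \<Rightarrow> bool list" where
  "bits n = (if n = 0 then [] else odd n # bits (n div 2))"

declare bits.simps [simp del]

definition enc_nat :: "nat \<Rightarrow> tree" where
  "enc_nat n = enc_list enc_bool (bits n)"

definition enc_atom :: "(nat \<Rightarrow> nat) \<Rightarrow> (nat \<Rightarrow> nat) \<Rightarrow> gatom \<Rightarrow> tree" where
  "enc_atom \<pi> \<kappa> A = Node (enc_nat (\<pi> (fst A))) (enc_list (enc_nat \<circ> \<kappa>) (snd A))"

fun enc_lit :: "('a \<Rightarrow> tree) \<Rightarrow> 'a lit \<Rightarrow> tree" where
  "enc_lit f (Pos a) = Node (enc_bool True) (f a)"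
| "enc_lit f (Neg a) = Node (enc_bool False) (f a)"

fun enc_body_elem :: "('a \<Rightarrow> tree) \<Rightarrow> 'a body_elem \<Rightarrow> tree" where
  "enc_body_elem f (Lit l) = Node (enc_nat 0) (enc_lit f l)"
| "enc_body_elem f (ENot l) = Node (enc_nat 1) (enc_lit f l)"
| "enc_body_elem f (NegENot l) = Node (enc_nat 2) (enc_lit f l)"

text \<open>Finite sets are encoded by repetition-free lists in an arbitrary order, so that these
  encodings are relations.\<close>

definition encodes_rule :: "('a \<Rightarrow> tree) \<Rightarrow> 'a rule \<Rightarrow> tree \<Rightarrow> bool" where
  "encodes_rule f r x \<longleftrightarrow> (\<exists>hs bs. distinct hs \<and> set hs = fset (head r) \<and>
     distinct bs \<and> set bs = fset (body r) \<and>
     x = Node (enc_list f hs) (enc_list (enc_body_elem f) bs))"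

text \<open>Names of predicates and constants are arbitrary numbers in a program. In an encoding they are
  replaced by consecutive indices, in an arbitrary order, so that the length of an encoding does not
  depend on the size of the names.\<close>

definition encodes_prog :: "gatom prog \<Rightarrow> tree \<Rightarrow> bool" where
  "encodes_prog G x \<longleftrightarrow> (\<exists>\<pi> \<kappa> rs xs.
     bij_betw \<pi> (preds G) {..<card (preds G)} \<and>
     (let C = (\<Union>A\<in>atoms G. set (snd A)) in bij_betw \<kappa> C {..<card C}) \<and>
     distinct rs \<and> set rs = G \<and> list_all2 (encodes_rule (enc_atom \<pi> \<kappa>)) rs xs \<and>
     x = enc_list id xs)"


section \<open>Time bounds\<close>

fun exp_tower :: "nat \<Rightarrow> nat \<Rightarrow> nat" where
  "exp_tower 0 n = n"
| "exp_tower (Suc m) n = 2 ^ exp_tower m n"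

text \<open>
  \<open>computable_in_tower_time a F g i\<close>: the function \<open>g\<close> of the grounding of programs in \<open>F\<close> of arity at
  most \<open>a\<close> can be computed, given the grounding, in time \<open>exp(i, d ^ O(k)) \<cdot> poly(|at(P)|)\<close>. The
  function \<open>h\<close> is the exponent \<open>O(k)\<close>. Bounds of the form \<open>d ^ O(k)\<close> presuppose \<open>d \<ge> 2\<close>; over a
  single constant, where a power of \<open>d\<close> is 1 irrespective of the exponent, the base is taken to
  be 2.
\<close>

definition computable_in_tower_time ::
    "nat \<Rightarrow> atom prog set \<Rightarrow> (gatom prog \<Rightarrow> tree) \<Rightarrow> nat \<Rightarrow> bool" where
  "computable_in_tower_time a F g i \<longleftrightarrow>
     (\<exists>(A :: algorithm) (h :: nat \<Rightarrow> nat) (p :: nat poly).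
        (\<lambda>k. real (h k)) \<in> O(\<lambda>k. real k) \<and>
        (\<forall>P\<in>F. bounded_arity a P \<longrightarrow> (\<forall>x. encodes_prog (grd P) x \<longrightarrow>
           outputs_within A x (g (grd P))
             (exp_tower i (max 2 (card (herbrand P)) ^ h (primal_treewidth P))
              * poly p (card (atoms P))))))"

end

theory Submission imports Defs begin

text \<open>
  The atoms of a grounded rule lie over the predicates of one clique of \<open>G_P\<close>, so
  replacing every predicate in a bag by its at most \<open>d^a\<close> ground atoms bounds the width
  of the ground program by \<open>(k + 1) d^a\<close>, which is \<open>d^O(k)\<close> as \<open>d
  \<ge> 2\<close>. An elimination order of the ground atoms whose width exceeds this by a constant
  factor is found in single exponential time by balanced separators, which are minimum cuts between
  two parts of a small set of atoms.

  Along this order, world views are counted by dynamic programming. Answer sets under a guess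
  \<open>I\<close> are recognised by a tree automaton: for disjunctive programs, a state holds the
  trace of a candidate model and the traces of all submodels of its reduct (doubly exponentially
  many states in the width); for normal and tight programs, it holds the order in which the true
  atoms are derived and those already derived (singly exponentially many in a polynomial of the
  width). A table entry consists of the guess on the boundary, the set \<open>S\<close> of reachable
  states, and a set \<open>R \<subseteq> S\<close> guessed to be the states that extend to an answer
  set of the whole program. Compatibility of an atom with the answer sets can be checked when it is
  eliminated, since it only refers to \<open>R\<close>; joining two parts multiplies their numbers.
  The sets \<open>S\<close> and \<open>R\<close> account for one more exponential.

  Running times are controlled by showing that functions computable in time polynomial in the size
  of the argument and an extra parameter are closed under composition, case distinction, iteration
  and operations on finite sets.
\<close>

text \<open>Two things are unknown to the algorithm: the treewidth of the non-ground program and,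
  while a part is processed, which of its candidates survive in the whole program. The first is met
  by never using a width: the order is grown by splitting whenever a good split exists, and the
  least possible width enters the analysis only. The second is why \<open>R\<close> is guessed:
  compatibility of an atom depends on all answer sets, hence on the other parts. A later
  \<open>R\<close> determines the earlier ones backwards, so each guess is counted in exactly one
  entry. With at most \<open>qn w\<close> states over \<open>w\<close> atoms, all costs are
  polynomial in \<open>2 ^ qn w\<close>; \<open>qn w\<close> is \<open>2 ^ (w + 2 * 2 ^ w)\<close>
  for disjunctive programs and \<open>2 ^ (w * w + w)\<close> for ordered ones, and the square of a
  number \<open>d ^ O(k)\<close> is again one. The bound speaks of the atoms of \<open>P\<close>,
  not of the rules of the input: an order of small width leaves room for only
  \<open>2 ^ O(w)\<close> rules per ground atom. Atoms of the input stay the trees that encode them,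
  as injective renaming preserves the number of world views.\<close>

section \<open>Encoding of data types as binary trees\<close>

class enc =
  fixes enc :: "'a => tree"
  assumes enc_inject [simp]: "enc x = enc y \<longleftrightarrow> x = y"

instantiation tree :: enc
begin
definition enc_tree :: "tree => tree" where [simp]: "enc_tree t = t"
instance by standard simp
end

instantiation bool :: enc
begin
definition enc_bool' : "enc = enc_bool"
instance by standard (case_tac x; case_tac y; simp add: enc_bool')
end

lemma enc_bool_simps [simp]: "enc True = Node Leaf Leaf" "enc False = Leaf"
  by (simp_all add: enc_bool')

instantiation prod :: (enc, enc) enc
begin
definition enc_prod :: "'a \<times> 'b => tree" where "enc_prod z = Node (enc (fst z)) (enc (snd z))"
instance by standard (auto simp: enc_prod_def prod_eq_iff)
end

lemma enc_Pair [simp]: "enc (x, y) = Node (enc x) (enc y)"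
  by (simp add: enc_prod_def)

lemma enc_list_inject: "(!!x y. f x = f y ==> x = y) ==> enc_list f xs = enc_list f ys \<longleftrightarrow> xs = ys"
proof (induction xs arbitrary: ys)
  case Nil thus ?case by (cases ys) auto
next
  case (Cons x xs) thus ?case by (cases ys) auto
qed

instantiation list :: (enc) enc
begin
definition enc_list' : "enc = enc_list enc"
instance
proof
  fix x y :: "'a list"
  show "enc x = enc y \<longleftrightarrow> x = y"
    unfolding enc_list' by (rule enc_list_inject) simp
qed
end

lemma enc_list_simps [simp]: "enc [] = Leaf" "enc (x # xs) = Node (enc x) (enc xs)"
  by (simp_all add: enc_list')

definition bits_val :: "bool list => nat" where
  "bits_val bs = foldr (%b n. of_bool b + 2 * n) bs 0"

lemma bits_val_simps [simp]: "bits_val [] = 0" "bits_val (b # bs) = of_bool b + 2 * bits_val bs"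
  by (simp_all add: bits_val_def)

lemma bits_val_bits [simp]: "bits_val (bits n) = n"
proof (induction n rule: less_induct)
  case (less n)
  show ?case
  proof (cases "n = 0")
    case False
    hence "bits_val (bits n) = of_bool (odd n) + 2 * (n div 2)"
      using less[of "n div 2"] by (subst bits.simps) simp
    thus ?thesis by (metis add.commute div_mult_mod_eq mod_2_eq_odd mult.commute)
  qed (simp add: bits.simps)
qed

instantiation nat :: enc
begin
definition enc_nat' : "enc = enc_nat"
instance
proof
  fix x y :: nat
  show "enc x = enc y \<longleftrightarrow> x = y"
    unfolding enc_nat' enc_nat_def
    by (metis bits_val_bits enc_bool' enc_inject enc_list_inject)
qed
end

text \<open>A number and its list of bits are the same tree, so arithmetic can work on bit lists
  without conversion.\<close>

lemma enc_nat_bits: "enc (n :: nat) = enc (bits n)"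
  by (simp add: enc_nat' enc_list' enc_nat_def enc_bool')

instantiation lit :: (enc) enc
begin
definition enc_lit' : "enc = enc_lit enc"
instance by standard (case_tac x; case_tac y; simp add: enc_lit')
end

lemma enc_lit_simps [simp]: "enc (Pos a) = Node (Node Leaf Leaf) (enc a)" "enc (Neg a) = Node Leaf (enc a)"
  by (simp_all add: enc_lit')

lemma enc_nat_0_1_2: "enc_nat 0 = Leaf" "enc_nat (Suc 0) = Node (Node Leaf Leaf) Leaf"
  "enc_nat 2 = Node Leaf (Node (Node Leaf Leaf) Leaf)"
  by (simp_all add: enc_nat_def bits.simps)

instantiation body_elem :: (enc) enc
begin
definition enc_body_elem' : "enc = enc_body_elem enc"
instance
  by standard (case_tac x; case_tac y; simp add: enc_body_elem' enc_nat_0_1_2 flip: enc_lit')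
end

lemma enc_body_elem_simps [simp]:
  "enc (Lit l) = Node Leaf (enc l)"
  "enc (ENot l) = Node (Node (Node Leaf Leaf) Leaf) (enc l)"
  "enc (NegENot l) = Node (Node Leaf (Node (Node Leaf Leaf) Leaf)) (enc l)"
  by (simp_all add: enc_body_elem' enc_nat_0_1_2 enc_lit')

fun tsize :: "tree => nat" where
  "tsize Leaf = 1"
| "tsize (Node x y) = tsize x + tsize y + 1"

abbreviation sz :: "'a::enc => nat" where "sz x \<equiv> tsize (enc x)"

lemma tsize_pos [simp]: "tsize x > 0" "tsize x >= Suc 0" "tsize x ~= 0"
  by (induction x) auto

section \<open>A calculus of functions computable in polynomial time\<close>

subsection \<open>Polynomial domination\<close>

text \<open>The summand 2 keeps the base at least 2, so that a larger exponent absorbs constants,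
  sums and products.\<close>

definition pbd :: "'a set => ('a => nat) => ('a => nat) => bool" where
  "pbd D f g \<longleftrightarrow> (EX c. \<forall>x\<in>D. f x <= (g x + 2) ^ c)"

lemma pbd_const [simp, intro]: "pbd D (%x. c) g"
proof -
  have "c <= (g x + 2) ^ c" for x
  proof -
    have "c <= 2 ^ c" by (rule less_imp_le) (rule less_exp)
    also have "... <= (g x + 2) ^ c" by (rule power_mono) auto
    finally show ?thesis .
  qed
  thus ?thesis unfolding pbd_def by blast
qed

lemma pbd_le: "(!!x. x \<in> D ==> f x <= g x) ==> pbd D f g"
  unfolding pbd_def by (rule exI[of _ 1]) force

lemma pbd_trans [trans]:
  assumes "pbd D f g" "pbd D g h" shows "pbd D f h"
proof -
  obtain c where c: "!!x. x \<in> D ==> f x <= (g x + 2) ^ c" using assms(1) unfolding pbd_def by blast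
  obtain d where d: "!!x. x \<in> D ==> g x <= (h x + 2) ^ d" using assms(2) unfolding pbd_def by blast
  have "f x <= (h x + 2) ^ ((d + 2) * c)" if "x \<in> D" for x
  proof -
    let ?n = "h x + 2"
    have "g x + 2 <= ?n ^ d + ?n" using d[OF that] by linarith
    also have "... <= ?n ^ (d+1) + ?n ^ (d+1)" by (intro add_mono power_increasing) (use self_le_power[of ?n "d+1"] in auto)
    also have "... = 2 * ?n ^ (d+1)" by simp
    also have "... <= ?n * ?n ^ (d+1)" by (rule mult_right_mono) auto
    finally have *: "g x + 2 <= ?n ^ (d+2)" by simp
    have "f x <= (g x + 2) ^ c" using c[OF that] .
    also have "... <= (?n ^ (d+2)) ^ c" using * by (rule power_mono) simp
    finally show ?thesis by (simp only: power_mult)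
  qed
  thus ?thesis unfolding pbd_def by blast
qed

lemma pbd_mono: "pbd D f' g ==> (!!x. x \<in> D ==> f x <= f' x) ==> pbd D f g"
  unfolding pbd_def by (meson order_trans)

lemma pbd_mono2: "pbd D f g ==> (!!x. x \<in> D ==> g x <= g' x) ==> pbd D f g'"
  by (meson pbd_le pbd_trans)

lemma pbd_mult [intro]:
  assumes "pbd D f h" "pbd D g h" shows "pbd D (%x. f x * g x) h"
proof -
  obtain c where c: "!!x. x \<in> D ==> f x <= (h x + 2) ^ c" using assms(1) unfolding pbd_def by blast
  obtain d where d: "!!x. x \<in> D ==> g x <= (h x + 2) ^ d" using assms(2) unfolding pbd_def by blast
  have "f x * g x <= (h x + 2) ^ (c + d)" if "x \<in> D" for x
    using c[OF that] d[OF that] by (simp add: power_add mult_mono)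
  thus ?thesis unfolding pbd_def by blast
qed

lemma pbd_add [intro]:
  assumes "pbd D f h" "pbd D g h" shows "pbd D (%x. f x + g x) h"
proof -
  have "pbd D (%x. (f x + 1) * (g x + 1)) h" if "pbd D (%x. f x + 1) h" "pbd D (%x. g x + 1) h"
    using pbd_mult[OF that] .
  moreover have "pbd D (%x. f x + 1) h" if f: "pbd D f h" for f
  proof -
    have "pbd D (%x. f x + 1) f" unfolding pbd_def by (rule exI[of _ 1]) auto
    thus ?thesis using f pbd_trans by blast
  qed
  ultimately have "pbd D (%x. (f x + 1) * (g x + 1)) h" using assms by blast
  thus ?thesis by (rule pbd_mono) (simp add: algebra_simps)
qed

lemma pbd_Suc [intro]: "pbd D f h ==> pbd D (%x. Suc (f x)) h"
  using pbd_add[of D f h "%_. 1"] by simp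

lemma pbd_power: "pbd D f h ==> pbd D (%x. f x ^ c) h"
  by (induction c) auto

lemma pbd_cases:
  assumes "pbd {x\<in>D. P x} f g" "pbd {x\<in>D. ~ P x} f g" shows "pbd D f g"
proof -
  obtain c1 c2 where c: "!!x. x \<in> D ==> P x ==> f x <= (g x + 2) ^ c1" "!!x. x \<in> D ==> ~ P x ==> f x <= (g x + 2) ^ c2"
    using assms unfolding pbd_def by blast
  have "f x <= (g x + 2) ^ (c1 + c2)" if "x \<in> D" for x
  proof (cases "P x")
    case True
    thus ?thesis using c(1)[OF that True] power_increasing[of c1 "c1 + c2" "g x + 2"] by linarith
  next
    case False
    thus ?thesis using c(2)[OF that False] power_increasing[of c2 "c1 + c2" "g x + 2"] by linarith
  qed
  thus ?thesis unfolding pbd_def by blast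
qed

lemma pbd_subset: "pbd D f g ==> E <= D ==> pbd E f g"
  unfolding pbd_def by blast

lemma pbd_compose: "pbd D f g ==> (!!x. x \<in> E ==> k x \<in> D) ==> pbd E (%x. f (k x)) (%x. g (k x))"
  unfolding pbd_def by blast

subsection \<open>Linking\<close>

text \<open>Calls refer to absolute positions in the list of function bodies; placing one algorithm
  behind others therefore relocates its calls, while variables are untouched.\<close>

fun shift_calls :: "nat => expr => expr" where
  "shift_calls k (EVar i) = EVar i"
| "shift_calls k ELeaf = ELeaf"
| "shift_calls k (ENode e f) = ENode (shift_calls k e) (shift_calls k f)"
| "shift_calls k (ECase e f g) = ECase (shift_calls k e) (shift_calls k f) (shift_calls k g)"
| "shift_calls k (ELet e f) = ELet (shift_calls k e) (shift_calls k f)"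
| "shift_calls k (ECall j es) = ECall (k + j) (map (shift_calls k) es)"

lemma eval_VarI: "i < length \<rho> ==> v = \<rho> ! i ==> t = 1 ==> eval A \<rho> (EVar i) v t"
  using eval_EVar by blast

lemma eval_LeafI: "t = 1 ==> eval A \<rho> ELeaf Leaf t"
  using eval_ELeaf by blast

lemma eval_NodeI: "eval A \<rho> e x s ==> eval A \<rho> f y t ==> n = s + t + 1 ==> eval A \<rho> (ENode e f) (Node x y) n"
  using eval_ENode by blast

lemma eval_CallI: "j < length A ==> eval_list A \<rho> es xs s ==> eval A xs (A ! j) v t ==> n = s + t + 1 ==>
  eval A \<rho> (ECall j es) v n"
  using eval_ECall by blast

lemma eval_shift:
  assumes "!!i. i < length A ==> k + i < length A' & A' ! (k + i) = shift_calls k (A ! i)"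
  shows "eval A \<rho> e v t ==> eval A' \<rho> (shift_calls k e) v t"
    and "eval_list A \<rho> es vs t ==> eval_list A' \<rho> (map (shift_calls k) es) vs t"
proof (induction rule: eval_eval_list.inducts)
  case (eval_ECall j \<rho> es xs s v t)
  thus ?case using assms[of j] by (auto intro!: eval_CallI)
qed (simp_all only: shift_calls.simps list.map eval_eval_list.intros)

definition computes_at :: "algorithm => nat => 'a::enc set => ('a => 'b::enc) => ('a => nat) => bool" where
  "computes_at A j D f tm \<longleftrightarrow> j < length A & (\<forall>x\<in>D. \<exists>t\<le>tm x. eval A [enc x] (A ! j) (enc (f x)) t)"

text \<open>\<open>T\<close> is a parameter that the time may also depend on polynomially. The size of the result is
  bounded as well because compositions are timed in terms of it.\<close>

definition ptime :: "'a::enc set => ('a => nat) => ('a => 'b::enc) => bool" where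
  "ptime D T f \<longleftrightarrow> (EX A tm. computes_at A 0 D f tm & pbd D tm (%x. sz x + T x)) &
     pbd D (%x. sz (f x)) (%x. sz x + T x)"

lemma computes_at_shift:
  assumes "computes_at A 0 D f tm" "length es = m"
  shows "computes_at (es @ map (shift_calls m) A @ B) m D f tm"
  using assms eval_shift(1)[of A m "es @ map (shift_calls m) A @ B"]
  by (fastforce simp: computes_at_def nth_append)

lemma computes_at_I:
  "j < length A ==> (!!x. x \<in> D ==> \<exists>t\<le>tm x. eval A [enc x] (A ! j) (enc (f x)) t) ==> computes_at A j D f tm"
  by (auto simp: computes_at_def)

text \<open>The linked code and its entry point depend only on the number \<open>m\<close> of new
  function bodies, so these bodies can be written afterwards and call into it.\<close>

lemma link1:
  assumes "ptime D T f"
  obtains L tm where "!!es. length es = m ==> computes_at (es @ L) m D f tm"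
    "pbd D tm (%x. sz x + T x)"
proof -
  obtain A tm where A: "computes_at A 0 D f tm" "pbd D tm (%x. sz x + T x)"
    using assms by (auto simp: ptime_def)
  show thesis
    by (rule that[of "map (shift_calls m) A"]) (use A computes_at_shift[OF A(1), of _ m "[]"] in auto)
qed

lemma link2:
  assumes "ptime D T f" "ptime D' T' g"
  obtains L j tm tm' where "!!es. length es = m ==> computes_at (es @ L) m D f tm"
    "!!es. length es = m ==> computes_at (es @ L) j D' g tm'"
    "pbd D tm (%x. sz x + T x)" "pbd D' tm' (%x. sz x + T' x)"
proof -
  obtain A tm where A: "computes_at A 0 D f tm" "pbd D tm (%x. sz x + T x)"
    using assms by (auto simp: ptime_def)
  obtain B tm' where B: "computes_at B 0 D' g tm'" "pbd D' tm' (%x. sz x + T' x)"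
    using assms by (auto simp: ptime_def)
  let ?L = "map (shift_calls m) A @ map (shift_calls (m + length A)) B"
  show thesis
  proof (rule that[of ?L tm "m + length A" tm'])
    fix es :: algorithm assume es: "length es = m"
    show "computes_at (es @ ?L) m D f tm" by (rule computes_at_shift[OF A(1) es])
    show "computes_at (es @ ?L) (m + length A) D' g tm'"
      using computes_at_shift[OF B(1), of "es @ map (shift_calls m) A" "m + length A" "[]"] es by simp
  qed (use A B in auto)
qed

lemma eval_list1: "eval A \<rho> e x s ==> eval_list A \<rho> [e] [x] s"
  using eval_list_Cons[OF _ eval_list_Nil, of A \<rho> e x s] by simp

lemma eval_call_var:
  assumes "eval A [\<rho> ! i] (A ! j) v t" "i < length \<rho>" "j < length A"
  shows "eval A \<rho> (ECall j [EVar i]) v (t + 2)"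
  using eval_ECall[OF assms(3) eval_list1[OF eval_EVar[OF assms(2)]] assms(1)] by simp

lemma computes_atD:
  "computes_at A j D f tm ==> x \<in> D ==> \<exists>t\<le>tm x. eval A [enc x] (A ! j) (enc (f x)) t"
  "computes_at A j D f tm ==> j < length A"
  by (auto simp: computes_at_def)

lemma computes_at_call:
  assumes "computes_at A j D f tm" "x \<in> D" "i < length \<rho>" "\<rho> ! i = enc x"
  shows "\<exists>t\<le>tm x + 2. eval A \<rho> (ECall j [EVar i]) (enc (f x)) t"
proof -
  obtain t where "t <= tm x" "eval A [enc x] (A ! j) (enc (f x)) t"
    using computes_atD(1)[OF assms(1,2)] by blast
  thus ?thesis using eval_call_var[of A \<rho> i j _ t] assms computes_atD(2)[OF assms(1)]
    by (intro exI[of _ "t+2"]) auto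
qed

lemma computes_at_call_expr:
  assumes "computes_at A j D f tm" "x \<in> D" "eval A \<rho> e (enc x) s"
  shows "\<exists>t\<le>tm x + s + 1. eval A \<rho> (ECall j [e]) (enc (f x)) t"
proof -
  obtain t where t: "t <= tm x" "eval A [enc x] (A ! j) (enc (f x)) t"
    using computes_atD(1)[OF assms(1,2)] by blast
  have "eval A \<rho> (ECall j [e]) (enc (f x)) (s + t + 1)"
    by (rule eval_ECall[OF computes_atD(2)[OF assms(1)] eval_list1[OF assms(3)] t(2)])
  thus ?thesis using t(1) by (intro exI[of _ "s+t+1"]) auto
qed

lemma compI:
  assumes "computes_at A 0 D f tm" "pbd D tm (%x. sz x + T x)" "pbd D (%x. sz (f x)) (%x. sz x + T x)"
  shows "ptime D T f"
  using assms by (auto simp: ptime_def)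

lemma comp_size: "ptime D T f ==> pbd D (%x. sz (f x)) (%x. sz x + T x)"
  by (auto simp: ptime_def)

lemma pbd_sz [simp, intro]: "pbd D (%x. sz x) (%x. sz x + T x)"
  by (rule pbd_le) simp

lemma pbd_T [simp, intro]: "pbd D (%x. T x) (%x. sz x + T x)"
  by (rule pbd_le) simp

subsection \<open>Basic closure properties\<close>

named_theorems comp_intros

lemma comp_id [comp_intros]: "ptime D T (%x. x)"
  by (rule compI[of "[EVar 0]" _ _ "%_. 1"])
    (auto simp: computes_at_def intro!: exI[of _ 1] eval_VarI)

fun tree_expr :: "tree => expr" where
  "tree_expr Leaf = ELeaf"
| "tree_expr (Node x y) = ENode (tree_expr x) (tree_expr y)"

lemma eval_tree_expr: "eval A \<rho> (tree_expr x) x (tsize x)"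
  by (induction x) (auto intro: eval_LeafI eval_NodeI)

lemma comp_const [comp_intros]: "ptime D T (%x. c)"
  by (rule compI[of "[tree_expr (enc c)]" _ _ "%_. sz c"])
    (auto simp: computes_at_def intro!: exI[of _ "sz c"] eval_tree_expr)

text \<open>An evaluation sees trees only, so a function may be exchanged for another one, even with
  values of another type, if the encodings of the values coincide.\<close>

lemma comp_recode:
  assumes "ptime D T f" "!!x. x \<in> D ==> enc (g x) = enc (f x)" shows "ptime D T g"
  using assms unfolding ptime_def computes_at_def pbd_def by simp

lemma comp_cong:
  assumes "ptime D T f" "!!x. x \<in> D ==> g x = f x" shows "ptime D T g"
  using assms unfolding ptime_def computes_at_def pbd_def by simp

lemma comp_weaken:
  assumes "ptime D' T' f" "D <= D'" "pbd D T' (%x. sz x + T x)" shows "ptime D T f"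
proof -
  have *: "pbd D (%x. sz x + T' x) (%x. sz x + T x)"
    using assms by auto
  have "pbd D h (%x. sz x + T x)" if "pbd D' h (%x. sz x + T' x)" for h
    using pbd_trans[OF pbd_subset[OF that assms(2)] *] .
  thus ?thesis using assms(1,2) unfolding ptime_def computes_at_def by blast
qed

lemma comp_compose:
  fixes f :: "'a::enc => 'b::enc" and g :: "'b => 'c::enc"
  assumes "ptime D' T' g" "ptime D T f" "!!x. x \<in> D ==> f x \<in> D'" "pbd D (%x. T' (f x)) (%x. sz x + T x)"
  shows "ptime D T (%x. g (f x))"
proof -
  obtain L j tm tm' where L:
    "!!es. length es = 1 ==> computes_at (es @ L) 1 D f tm"
    "!!es. length es = 1 ==> computes_at (es @ L) j D' g tm'"
    and pb: "pbd D tm (%x. sz x + T x)" "pbd D' tm' (%x. sz x + T' x)"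
    by (rule link2[OF assms(2,1), of 1]) blast
  let ?e = "[ECall j [ECall 1 [EVar 0]]]"
  have c: "computes_at (?e @ L) 1 D f tm" "computes_at (?e @ L) j D' g tm'" by (rule L; simp)+
  have *: "pbd D (%x. sz (f x) + T' (f x)) (%x. sz x + T x)"
    using assms(4) comp_size[OF assms(2)] by auto
  show ?thesis
  proof (rule compI[of "?e @ L" _ _ "%x. tm' (f x) + tm x + 3"])
    show "computes_at (?e @ L) 0 D (%x. g (f x)) (%x. tm' (f x) + tm x + 3)"
    proof (rule computes_at_I)
      fix x assume x: "x \<in> D"
      obtain t where t: "t <= tm x + 2" "eval (?e @ L) [enc x] (ECall 1 [EVar 0]) (enc (f x)) t"
        using computes_at_call[OF c(1) x, of 0 "[enc x]"] by auto
      show "\<exists>t\<le>tm' (f x) + tm x + 3. eval (?e @ L) [enc x] ((?e @ L) ! 0) (enc (g (f x))) t"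
        using computes_at_call_expr[OF c(2) assms(3)[OF x] t(2)] t(1)
        by (elim exE conjE) (rule exI, rule conjI, rule order_trans, assumption, simp_all)
    qed simp
    show "pbd D (%x. tm' (f x) + tm x + 3) (%x. sz x + T x)"
      using pbd_trans[OF pbd_compose[OF pb(2)] *] assms(3) pb(1) by auto
    show "pbd D (%x. sz (g (f x))) (%x. sz x + T x)"
      using pbd_trans[OF pbd_compose[OF comp_size[OF assms(1)]] *] assms(3) by auto
  qed
qed

lemma comp_op1:
  assumes "ptime UNIV (%_. 0) g" "ptime D T f" shows "ptime D T (%x. g (f x))"
  by (rule comp_compose[OF assms]) auto

lemma comp_pair [comp_intros]:
  fixes f :: "'a::enc => 'b::enc" and g :: "'a => 'c::enc"
  assumes "ptime D T f" "ptime D T g"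
  shows "ptime D T (%x. (f x, g x))"
proof -
  obtain L j tm tm' where L:
    "!!es. length es = 1 ==> computes_at (es @ L) 1 D f tm"
    "!!es. length es = 1 ==> computes_at (es @ L) j D g tm'"
    and pb: "pbd D tm (%x. sz x + T x)" "pbd D tm' (%x. sz x + T x)"
    by (rule link2[OF assms(1,2), of 1]) blast
  let ?e = "[ENode (ECall 1 [EVar 0]) (ECall j [EVar 0])]"
  have c: "computes_at (?e @ L) 1 D f tm" "computes_at (?e @ L) j D g tm'" by (rule L; simp)+
  show ?thesis
  proof (rule compI[of "?e @ L" _ _ "%x. tm x + tm' x + 5"])
    show "computes_at (?e @ L) 0 D (%x. (f x, g x)) (%x. tm x + tm' x + 5)"
    proof (rule computes_at_I)
      fix x assume x: "x \<in> D"
      obtain t where t: "t <= tm x + 2" "eval (?e @ L) [enc x] (ECall 1 [EVar 0]) (enc (f x)) t"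
        using computes_at_call[OF c(1) x, of 0 "[enc x]"] by auto
      obtain s where s: "s <= tm' x + 2" "eval (?e @ L) [enc x] (ECall j [EVar 0]) (enc (g x)) s"
        using computes_at_call[OF c(2) x, of 0 "[enc x]"] by auto
      show "\<exists>t\<le>tm x + tm' x + 5. eval (?e @ L) [enc x] ((?e @ L) ! 0) (enc (f x, g x)) t"
        using eval_ENode[OF t(2) s(2)] t(1) s(1) by (intro exI[of _ "t+s+1"]) auto
    qed simp
  qed (use pb comp_size[OF assms(1)] comp_size[OF assms(2)] in auto)
qed

lemma comp_tree_case:
  assumes "enc (F Leaf) = Leaf" "!!A x y. eval A [x, y, Node x y] f (enc (F (Node x y))) k" "!!t. sz (F t) <= tsize t + k"
  shows "ptime UNIV (%_. 0) F"
proof (rule compI[of "[ECase (EVar 0) ELeaf f]" _ _ "%_. k + 3"])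
  let ?A = "[ECase (EVar 0) ELeaf f]"
  have v: "eval ?A [t] (EVar 0) t 1" for t by (rule eval_VarI) auto
  have "\<exists>s\<le>k + 3. eval ?A [t] (ECase (EVar 0) ELeaf f) (enc (F t)) s" for t
  proof (cases t)
    case Leaf
    thus ?thesis using eval_ECase_Leaf[OF v[of Leaf] eval_ELeaf, of f] assms(1) by (intro exI[of _ 3]) (simp add: numeral_eq_Suc)
  next
    case (Node x y)
    thus ?thesis using eval_ECase_Node[OF v[of "Node x y"] assms(2), of ELeaf] by (intro exI[of _ "1 + k + 1"]) simp
  qed
  thus "computes_at ?A 0 UNIV F (%_. k + 3)" by (simp add: computes_at_def)
  show "pbd UNIV (%t. sz (F t)) (%t. sz t + 0)"
    by (rule pbd_mono[of _ "%t. sz t + k"]) (intro pbd_add pbd_sz pbd_const, use assms(3) in simp)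
qed auto

fun tree_fst :: "tree => tree" where "tree_fst Leaf = Leaf" | "tree_fst (Node x y) = x"

fun tree_snd :: "tree => tree" where "tree_snd Leaf = Leaf" | "tree_snd (Node x y) = y"

lemma comp_enc [comp_intros]: "ptime D T f ==> ptime D T (%x. enc (f x))"
  by (rule comp_recode) auto

lemma comp_tree_fst: "ptime D T f ==> ptime D T (%x. tree_fst (f x))"
proof (erule comp_op1[rotated], rule comp_tree_case[where f="EVar 0" and k=1])
  show "sz (tree_fst t) <= tsize t + 1" for t by (cases t) auto
qed (auto intro: eval_VarI)

lemma comp_tree_snd: "ptime D T f ==> ptime D T (%x. tree_snd (f x))"
proof (erule comp_op1[rotated], rule comp_tree_case[where f="EVar 1" and k=1])
  show "sz (tree_snd t) <= tsize t + 1" for t by (cases t) auto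
qed (auto intro: eval_VarI)

lemma comp_nonleaf: "ptime D T f ==> ptime D T (%x. f x ~= Leaf)"
proof (erule comp_op1[rotated], rule comp_tree_case[where f="ENode ELeaf ELeaf" and k=3])
  show "sz (t ~= Leaf) <= tsize t + 3" for t by (cases t) auto
  show "eval A [x, y, Node x y] (ENode ELeaf ELeaf) (enc (Node x y ~= Leaf)) 3" for A x y
    by (auto intro!: eval_NodeI eval_LeafI)
qed simp

lemma comp_fst [comp_intros]: "ptime D T f ==> ptime D T (%x. fst (f x))"
  by (rule comp_recode[OF comp_tree_fst[OF comp_enc]]) (auto simp: enc_prod_def)

lemma comp_snd [comp_intros]: "ptime D T f ==> ptime D T (%x. snd (f x))"
  by (rule comp_recode[OF comp_tree_snd[OF comp_enc]]) (auto simp: enc_prod_def)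

abbreviation "ptime2 h \<equiv> ptime UNIV (%_. 0) (%z. h (fst z) (snd z))"

abbreviation "ptime3 h \<equiv> ptime UNIV (%_. 0) (%z. h (fst z) (fst (snd z)) (snd (snd z)))"

abbreviation "ptime4 h \<equiv> ptime UNIV (%_. 0) (%z. h (fst z) (fst (snd z)) (fst (snd (snd z))) (snd (snd (snd z))))"

lemma comp_op2:
  assumes "ptime2 h" "ptime D T f" "ptime D T g"
  shows "ptime D T (%x. h (f x) (g x))"
  using comp_op1[OF assms(1) comp_pair[OF assms(2,3)]] by simp

lemma comp_op3:
  assumes "ptime3 h"
    "ptime D T f" "ptime D T g" "ptime D T k"
  shows "ptime D T (%x. h (f x) (g x) (k x))"
  using comp_op1[OF assms(1) comp_pair[OF assms(2) comp_pair[OF assms(3,4)]]] by simp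

lemma comp_op4:
  assumes "ptime4 h"
    "ptime D T f" "ptime D T g" "ptime D T k" "ptime D T l"
  shows "ptime D T (%x. h (f x) (g x) (k x) (l x))"
  using comp_op1[OF assms(1) comp_pair[OF assms(2) comp_pair[OF assms(3) comp_pair[OF assms(4,5)]]]] by simp

text \<open>Each branch has to be fast only on the inputs that reach it; hence the domain depends on
  the truth value stored beside the argument.\<close>

lemma comp_if_base:
  fixes f g :: "'a::enc => 'b::enc"
  assumes "ptime D T f" "ptime E T g"
  shows "ptime {z. if fst z then snd z \<in> D else snd z \<in> E} (%z. T (snd z))
    (%z. if fst z then f (snd z) else g (snd z))" (is "ptime ?D ?T ?h")
proof -
  obtain L j tm tm' where L:
    "!!es. length es = 1 ==> computes_at (es @ L) 1 D f tm"
    "!!es. length es = 1 ==> computes_at (es @ L) j E g tm'"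
    and pb: "pbd D tm (%x. sz x + T x)" "pbd E tm' (%x. sz x + T x)"
    by (rule link2[OF assms(1,2), of 1]) blast
  \<comment> \<open>The outer case unpacks the pair, so its leaf branch is never taken. A false
    condition is a leaf and leaves the argument at index 1; a true one binds two more subtrees and
    moves it to index 3.\<close>
  let ?b = "ECase (EVar 0) ELeaf (ECase (EVar 0) (ECall j [EVar 1]) (ECall 1 [EVar 3]))"
  let ?e = "[?b]"
  have c: "computes_at (?e @ L) 1 D f tm" "computes_at (?e @ L) j E g tm'" by (rule L; simp)+
  let ?tm = "%z. if fst z then tm (snd z) + 6 else tm' (snd z) + 6"
  have pI: "pbd ?D h (%z. sz z + ?T z)" if h: "!!z. h z = (if fst z then h1 (snd z) else h2 (snd z))"
    "pbd D h1 (%x. sz x + T x)" "pbd E h2 (%x. sz x + T x)" for h h1 h2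
  proof -
    have "pbd {z\<in>?D. fst z} h (%z. sz (snd z) + T (snd z))"
      by (rule pbd_mono[OF pbd_compose[OF h(2), of _ snd]]) (auto simp: h(1))
    moreover have "pbd {z\<in>?D. ~ fst z} h (%z. sz (snd z) + T (snd z))"
      by (rule pbd_mono[OF pbd_compose[OF h(3), of _ snd]]) (auto simp: h(1))
    ultimately have "pbd ?D h (%z. sz (snd z) + T (snd z))" by (rule pbd_cases)
    thus ?thesis by (rule pbd_mono2) (simp add: enc_prod_def)
  qed
  show ?thesis
  proof (rule compI[of "?e @ L" _ _ ?tm])
    show "computes_at (?e @ L) 0 ?D ?h ?tm"
    proof (rule computes_at_I)
      fix z assume z: "z \<in> ?D"
      obtain b x where bx: "z = (b, x)" by (cases z)
      let ?A = "?e @ L"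
      let ?r1 = "[enc b, enc x, enc z]"
      have v: "eval ?A [enc z] (EVar 0) (Node (enc b) (enc x)) 1" by (auto intro!: eval_VarI simp: bx)
      show "\<exists>t\<le>?tm z. eval ?A [enc z] (?A ! 0) (enc (?h z)) t"
      proof (cases b)
        case True
        have v1: "eval ?A ?r1 (EVar 0) (Node Leaf Leaf) 1" by (auto intro!: eval_VarI simp: bx True)
        obtain s where s: "s <= tm x + 2" "eval ?A (Leaf # Leaf # ?r1) (ECall 1 [EVar 3]) (enc (f x)) s"
          using computes_at_call[OF c(1), of x 3 "Leaf # Leaf # ?r1"] z bx True by (auto simp: numeral_eq_Suc)
        show ?thesis
          using eval_ECase_Node[OF v eval_ECase_Node[OF v1 s(2)], of ELeaf "ECall j [EVar 1]"] s(1) True bx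
          by (intro exI[of _ "1+(1+s+1)+1"]) auto
      next
        case False
        have v1: "eval ?A ?r1 (EVar 0) Leaf 1" by (auto intro!: eval_VarI simp: bx False)
        obtain s where s: "s <= tm' x + 2" "eval ?A ?r1 (ECall j [EVar 1]) (enc (g x)) s"
          using computes_at_call[OF c(2), of x 1 ?r1] z bx False by (auto simp: numeral_eq_Suc)
        show ?thesis
          using eval_ECase_Node[OF v eval_ECase_Leaf[OF v1 s(2)], of ELeaf "ECall 1 [EVar 3]"] s(1) False bx
          by (intro exI[of _ "1+(1+s+1)+1"]) auto
      qed
    qed simp
    show "pbd ?D ?tm (%x. sz x + ?T x)"
      by (rule pI[of _ "%x. tm x + 6" "%x. tm' x + 6"]) (use pb in auto)
    show "pbd ?D (%z. sz (?h z)) (%x. sz x + ?T x)"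
      by (rule pI[of _ "%x. sz (f x)" "%x. sz (g x)"]) (use comp_size assms in auto)
  qed
qed

lemma comp_if:
  assumes "ptime D T b" "ptime {x\<in>D. b x} T f" "ptime {x\<in>D. ~ b x} T g"
  shows "ptime D T (%x. if b x then f x else g x)"
proof -
  have "ptime D T (%x. (%z. if fst z then f (snd z) else g (snd z)) (b x, x))"
    by (rule comp_compose[OF comp_if_base[OF assms(2,3)] comp_pair[OF assms(1) comp_id]]) auto
  thus ?thesis by (simp cong: if_cong)
qed

lemma comp_subset: "ptime D T f ==> E <= D ==> ptime E T f"
  by (rule comp_weaken[of D T]) auto

lemma comp_if' [comp_intros]:
  assumes "ptime D T b" "ptime D T f" "ptime D T g"
  shows "ptime D T (%x. if b x then f x else g x)"
  by (rule comp_if) (use assms in \<open>auto elim: comp_subset\<close>)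

lemma comp_conj [comp_intros]:
  assumes "ptime D T f" "ptime D T g" shows "ptime D T (%x. f x & g x)"
  by (rule comp_cong[OF comp_if'[OF assms(1) assms(2) comp_const[of _ _ False]]]) auto

lemma comp_disj [comp_intros]:
  assumes "ptime D T f" "ptime D T g" shows "ptime D T (%x. f x | g x)"
  by (rule comp_cong[OF comp_if'[OF assms(1) comp_const[of _ _ True] assms(2)]]) auto

lemma comp_not [comp_intros]:
  assumes "ptime D T f" shows "ptime D T (%x. ~ f x)"
  by (rule comp_cong[OF comp_if'[OF assms(1) comp_const[of _ _ False] comp_const[of _ _ True]]]) auto

lemma comp_imp [comp_intros]:
  assumes "ptime D T f" "ptime D T g" shows "ptime D T (%x. f x --> g x)"
  by (rule comp_cong[OF comp_disj[OF comp_not[OF assms(1)] assms(2)]]) auto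

subsection \<open>Iteration over lists\<close>

lemma sz_list: "sz (xs :: 'a::enc list) = 1 + (\<Sum>x\<leftarrow>xs. sz x + 1)"
  by (induction xs) auto

lemma sz_list_mem: "x \<in> set xs ==> sz x <= sz xs"
  by (induction xs) auto

lemma length_le_sz: "length xs <= sz xs"
  by (induction xs) auto

lemma bex_leI: "P t ==> t <= n ==> \<exists>t\<le>n. P t" for t :: nat
  by blast

lemma eval_list3: "eval A \<rho> a x s ==> eval A \<rho> b y t ==> eval A \<rho> c z u ==> n = s + t + u ==>
  eval_list A \<rho> [a, b, c] [x, y, z] n"
  using eval_list_Cons[OF _ eval_list_Cons[OF _ eval_list1]] by (metis add.assoc)

lemma eval_CaseNodeI: "eval A \<rho> e (Node x y) s ==> eval A (x # y # \<rho>) g v t ==> n = s + t + 1 ==> eval A \<rho> (ECase e f g) v n"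
  using eval_ECase_Node by blast

lemma eval_CaseLeafI: "eval A \<rho> e Leaf s ==> eval A \<rho> f v t ==> n = s + t + 1 ==> eval A \<rho> (ECase e f g) v n"
  using eval_ECase_Leaf by blast

text \<open>Iterating a polynomial step may blow up the state exponentially, so a bound on
  intermediate states is assumed. Both the bound and the cost of the step concern only states that a
  prefix of the actual list produces from the actual start value.\<close>

lemma comp_foldl_base:
  fixes F :: "'a::enc => 's::enc => 'e::enc => 's" and l :: "'a => 'e list" and i :: "'a => 's" and T :: "'a => nat" and D
  defines "D1 \<equiv> {z. fst z \<in> D & (EX ys zs. l (fst z) = ys @ snd (snd z) # zs & fst (snd z) = foldl (F (fst z)) (i (fst z)) ys)}"
  assumes l: "ptime D T l"
    and step: "ptime D1 (%z. T (fst z)) (%z. F (fst z) (fst (snd z)) (snd (snd z)))"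
    and bd: "pbd {z. fst z \<in> D & (EX ys zs. l (fst z) = ys @ zs & snd z = foldl (F (fst z)) (i (fst z)) ys)}
      (%z. sz (snd z)) (%z. sz (fst z) + T (fst z))"
  shows "ptime {z. fst z \<in> D & fst (snd z) = i (fst z) & snd (snd z) = l (fst z)} (%z. T (fst z))
    (%z. foldl (F (fst z)) (fst (snd z)) (snd (snd z)))"
    (is "ptime ?E ?T ?h")
proof -
  obtain L tm where L: "!!es. length es = 2 ==>
     computes_at (es @ L) 2 D1 (%z. F (fst z) (fst (snd z)) (snd (snd z))) tm"
    and pb: "pbd D1 tm (%z. sz z + T (fst z))"
    by (rule link1[OF step, of 2]) blast
  let ?main = "ECase (EVar 0) ELeaf (ECase (EVar 1) ELeaf (ECall 1 [EVar 2, EVar 0, EVar 1]))"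
  \<comment> \<open>The loop has the arguments input, accumulator and remaining list. The case binds
    head and tail in front, which moves input and accumulator to the indices 2 and 3.\<close>
  let ?rec = "ECase (EVar 2) (EVar 1) (ECall 1 [EVar 2, ECall 2 [ENode (EVar 2) (ENode (EVar 3) (EVar 0))], EVar 1])"
  let ?A = "[?main, ?rec] @ L"
  have c: "computes_at ?A 2 D1 (%z. F (fst z) (fst (snd z)) (snd (snd z))) tm"
    by (rule L) simp
  let ?R = "%z. sz (fst z) + T (fst z)"
  have le: "sz e <= sz (l x)" if "l x = ys @ e # zs" for x ys e zs
    using sz_list_mem[of e "l x"] that by simp
  have pe: "pbd D1 (%z. sz (snd (snd z))) ?R"
    by (rule pbd_mono[OF pbd_compose[OF comp_size[OF l], of _ fst]]) (auto simp: D1_def intro!: sz_list_mem)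
  have ps: "pbd D1 (%z. sz (fst (snd z))) ?R"
    using pbd_compose[OF bd, of D1 "%z. (fst z, fst (snd z))"] by (force simp: D1_def)
  have "pbd D1 (%z. sz z + T (fst z)) (%z. sz (fst z) + sz (fst (snd z)) + sz (snd (snd z)) + 2 + T (fst z))"
    by (rule pbd_le) (auto simp: enc_prod_def)
  also have "pbd D1 ... ?R"
    using pe ps by (intro pbd_add pbd_const) (auto intro: pbd_le)
  finally have "pbd D1 tm ?R" using pb pbd_trans by blast
  then obtain c0 where c0: "!!z. z \<in> D1 ==> tm z <= (?R z + 2) ^ c0" unfolding pbd_def by blast
  define B where "B x = (sz x + T x + 2) ^ c0" for x
  have rec: "\<exists>t\<le>length xs * (B x + 20) + 5. eval ?A [enc x, enc s, enc xs] ?rec (enc (foldl (F x) s xs)) t"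
    if "x \<in> D" "l x = ys @ xs" "s = foldl (F x) (i x) ys" for x xs ys s
    using that(2,3)
  proof (induction xs arbitrary: ys s)
    case Nil
    show ?case
      by (rule exI[of _ 3]) (auto intro!: eval_CaseLeafI eval_VarI)
  next
    case (Cons e xs)
    let ?\<rho> = "[enc e, enc xs, enc x, enc s, enc (e # xs)]"
    have d: "(x, s, e) \<in> D1" using Cons.prems that(1) by (auto simp: D1_def)
    have 1: "eval ?A ?\<rho> (ENode (EVar 2) (ENode (EVar 3) (EVar 0))) (enc (x, s, e)) 5"
      by (auto intro!: eval_NodeI eval_VarI)
    obtain t where t: "t <= B x + 6" "eval ?A ?\<rho> (ECall 2 [ENode (EVar 2) (ENode (EVar 3) (EVar 0))]) (enc (F x s e)) t"
      proof -
      have "tm (x, s, e) + 5 + 1 <= B x + 6" using c0[OF d] by (simp add: B_def)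
      moreover obtain t where "t <= tm (x, s, e) + 5 + 1"
        "eval ?A ?\<rho> (ECall 2 [ENode (EVar 2) (ENode (EVar 3) (EVar 0))]) (enc (F x s e)) t"
        using computes_at_call_expr[OF c d 1] by (simp only: fst_conv snd_conv) blast
      ultimately show thesis using that order_trans by blast
    qed
    obtain u where u: "u <= length xs * (B x + 20) + 5"
      "eval ?A [enc x, enc (F x s e), enc xs] ?rec (enc (foldl (F x) (F x s e) xs)) u"
      using Cons.IH[of "ys @ [e]" "F x s e"] Cons.prems by auto
    have "eval ?A ?\<rho> (ECall 1 [EVar 2, ECall 2 [ENode (EVar 2) (ENode (EVar 3) (EVar 0))], EVar 1]) (enc (foldl (F x) (F x s e) xs)) (1 + t + 1 + u + 1)"
      by (rule eval_CallI[OF _ eval_list3[OF eval_VarI t(2) eval_VarI]]) (use u(2) in auto)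
    hence "eval ?A [enc x, enc s, enc (e # xs)] ?rec (enc (foldl (F x) s (e # xs))) (1 + (1 + t + 1 + u + 1) + 1)"
      by (intro eval_CaseNodeI[where s=1]) (auto intro!: eval_VarI)
    thus ?case using t(1) u(1) by (intro bex_leI) (assumption | linarith | simp)+
  qed
  show ?thesis
  proof (rule compI[of ?A _ _ "%z. length (l (fst z)) * (B (fst z) + 20) + 20"])
    show "computes_at ?A 0 ?E ?h (%z. length (l (fst z)) * (B (fst z) + 20) + 20)"
    proof (rule computes_at_I)
      fix z assume z: "z \<in> ?E"
      obtain x s xs where zz: "z = (x, s, xs)" by (cases z)
      have x: "x \<in> D" "xs = l x" "s = i x" using z zz by auto
      obtain t where t: "t <= length xs * (B x + 20) + 5" "eval ?A [enc x, enc s, enc xs] ?rec (enc (foldl (F x) s xs)) t"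
        using rec[of x "[]" xs s] x by auto
      have "eval ?A [enc s, enc xs, enc x, enc (s, xs), enc z] (ECall 1 [EVar 2, EVar 0, EVar 1]) (enc (foldl (F x) s xs)) (3 + t + 1)"
        by (rule eval_CallI[OF _ eval_list3[OF eval_VarI eval_VarI eval_VarI]]) (use t(2) in auto)
      hence "eval ?A [enc z] ?main (enc (foldl (F x) s xs)) (1 + (1 + (3 + t + 1) + 1) + 1)"
        by (intro eval_CaseNodeI[where s=1]) (auto intro!: eval_VarI simp: zz)
      thus "\<exists>t\<le>length (l (fst z)) * (B (fst z) + 20) + 20. eval ?A [enc z] (?A ! 0) (enc (?h z)) t"
        using t(1) x by (intro bex_leI) (assumption | linarith | simp add: zz)+
    qed simp
    have R: "pbd ?E ?R (%z. sz z + T (fst z))" by (rule pbd_le) (simp add: enc_prod_def)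
    have "pbd ?E (%z. length (l (fst z))) ?R"
      by (rule pbd_mono[OF pbd_compose[OF comp_size[OF l], of _ fst]]) (auto simp: length_le_sz)
    moreover have "pbd ?E (%z. B (fst z)) ?R"
      unfolding B_def pbd_def by (rule exI[of _ c0]) auto
    ultimately have "pbd ?E (%z. length (l (fst z)) * (B (fst z) + 20) + 20) ?R" by (intro pbd_add pbd_mult pbd_const)
    thus "pbd ?E (%z. length (l (fst z)) * (B (fst z) + 20) + 20) (%z. sz z + T (fst z))"
      using R pbd_trans by blast
    have "pbd ?E (%z. sz (?h z)) ?R"
      using pbd_compose[OF bd, of ?E "%z. (fst z, ?h z)"] by force
    thus "pbd ?E (%z. sz (?h z)) (%z. sz z + T (fst z))" using R pbd_trans by blast
  qed
qed

lemma comp_foldl: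
  fixes F :: "'a::enc => 's::enc => 'e::enc => 's"
  assumes i: "ptime D T i" and l: "ptime D T l"
    and step: "ptime {z. fst z \<in> D & (EX ys zs. l (fst z) = ys @ snd (snd z) # zs & fst (snd z) = foldl (F (fst z)) (i (fst z)) ys)}
      (%z. T (fst z)) (%z. F (fst z) (fst (snd z)) (snd (snd z)))"
    and bd: "pbd {z. fst z \<in> D & (EX ys zs. l (fst z) = ys @ zs & snd z = foldl (F (fst z)) (i (fst z)) ys)}
      (%z. sz (snd z)) (%z. sz (fst z) + T (fst z))"
  shows "ptime D T (%x. foldl (F x) (i x) (l x))"
proof -
  have "ptime D T (%x. (%z. foldl (F (fst z)) (fst (snd z)) (snd (snd z))) (x, i x, l x))"
    by (rule comp_compose[OF comp_foldl_base[OF l step bd] comp_pair[OF comp_id comp_pair[OF i l]]]) auto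
  thus ?thesis by simp
qed

lemma comp_foldl_simple:
  fixes F :: "'a::enc => 's::enc => 'e::enc => 's"
  assumes "ptime D T i" "ptime D T l"
    and step: "ptime {z. fst z \<in> D & snd (snd z) \<in> set (l (fst z))} (%z. T (fst z)) (%z. F (fst z) (fst (snd z)) (snd (snd z)))"
    and bd: "pbd {z. fst z \<in> D & (EX ys zs. l (fst z) = ys @ zs & snd z = foldl (F (fst z)) (i (fst z)) ys)}
      (%z. sz (snd z)) (%z. sz (fst z) + T (fst z))"
  shows "ptime D T (%x. foldl (F x) (i x) (l x))"
  by (rule comp_foldl[OF assms(1,2) comp_subset[OF step] bd]) auto

lemma comp_Cons [comp_intros]:
  assumes "ptime D T f" "ptime D T g" shows "ptime D T (%x. f x # g x)"
  by (rule comp_recode[OF comp_pair[OF assms]]) simp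

lemma comp_hd [comp_intros]: "ptime D T f ==> ptime D T (%x. hd (f x))"
proof (rule comp_recode)
  assume f: "ptime D T f"
  \<comment> \<open>The head of the empty list is an unspecified but fixed value, so it can be
    written into the code as a constant.\<close>
  show "ptime D T (%x. if enc (f x) ~= Leaf then tree_fst (enc (f x)) else enc (hd [] :: 'b))"
    by (intro comp_intros comp_nonleaf comp_tree_fst f)
  show "enc (hd (f x)) = enc (if enc (f x) ~= Leaf then tree_fst (enc (f x)) else enc (hd [] :: 'b))" for x
    by (cases "f x") auto
qed

lemma comp_tl [comp_intros]: "ptime D T f ==> ptime D T (%x. tl (f x))"
proof (rule comp_recode[OF comp_tree_snd[OF comp_enc]])
  show "enc (tl (f x)) = enc (tree_snd (enc (f x)))" for x by (cases "f x") auto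
qed

subsection \<open>A linear order on trees\<close>

fun tless :: "tree => tree => bool" where
  "tless x Leaf = False"
| "tless Leaf (Node c d) = True"
| "tless (Node a b) (Node c d) = (tless a c | a = c & tless b d)"

instantiation tree :: linorder
begin
definition less_tree where "less_tree = tless"
definition less_eq_tree where "x <= y \<longleftrightarrow> tless x y | x = (y :: tree)"
instance
proof
  have irr: "~ tless x x" for x by (induction x) auto
  have asym: "tless x y ==> ~ tless y x" for x y by (induction x y rule: tless.induct) (auto simp: irr)
  have trans: "tless x y ==> tless y z ==> tless x z" for x y z
  proof (induction x arbitrary: y z)
    case Leaf thus ?case by (cases y; cases z) auto
  next
    case (Node a b) thus ?case by (cases y; cases z; fastforce)
  qed
  fix x y z :: tree
  show "x < y \<longleftrightarrow> x <= y & ~ y <= x" using irr asym by (auto simp: less_tree_def less_eq_tree_def)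
  show "x <= x" by (simp add: less_eq_tree_def)
  show "x <= y ==> y <= z ==> x <= z" using trans by (auto simp: less_eq_tree_def)
  show "x <= y ==> y <= x ==> x = y" using asym by (auto simp: less_eq_tree_def)
  show "x <= y | y <= x"
  proof (induction x arbitrary: y)
    case Leaf thus ?case by (cases y) (auto simp: less_eq_tree_def)
  next
    case (Node a b) thus ?case by (cases y) (auto simp: less_eq_tree_def)
  qed
qed
end

lemma less_tree_simps [simp]: "~ x < Leaf" "Leaf < Node c d" "Node a b < Node c d \<longleftrightarrow> a < c | a = c & b < d"
  by (auto simp: less_tree_def)

text \<open>Order and equality are decided in one pass: each pair of subtrees is compared at most
  once, which makes the cost linear in the first tree.\<close>

definition tcmp :: "tree => tree => tree" where
  "tcmp x y = (if x < y then Leaf else if x = y then Node Leaf Leaf else Node Leaf (Node Leaf Leaf))"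

lemma comp_tcmp_base: "ptime UNIV (%_. 0) (%z. tcmp (fst z) (snd z))"
proof -
  let ?EQ = "ENode ELeaf ELeaf"
  let ?GT = "ENode ELeaf (ENode ELeaf ELeaf)"
  let ?in = "ECase (EVar 1) (ECall 1 [EVar 5, EVar 3]) ?GT"
  let ?md = "ECase (ECall 1 [EVar 2, EVar 0]) ELeaf ?in"
  let ?rec = "ECase (EVar 0) (ECase (EVar 1) ?EQ ELeaf) (ECase (EVar 3) ?GT ?md)"
  let ?main = "ECase (EVar 0) ELeaf (ECall 1 [EVar 0, EVar 1])"
  let ?A = "[?main, ?rec]"
  have eq: "eval ?A \<rho> ?EQ (Node Leaf Leaf) 3" for \<rho>
    by (auto intro!: eval_NodeI eval_LeafI)
  have gt: "eval ?A \<rho> ?GT (Node Leaf (Node Leaf Leaf)) 5" for \<rho>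
    by (auto intro!: eval_NodeI eval_LeafI)
  have l2: "eval_list ?A \<rho> [EVar i, EVar j] [\<rho> ! i, \<rho> ! j] 2" if "i < length \<rho>" "j < length \<rho>" for \<rho> i j
    using eval_list_Cons[OF eval_EVar[OF that(1)] eval_list1[OF eval_EVar[OF that(2)]]] by (simp add: numeral_eq_Suc)
  have rec: "\<exists>t\<le>30 * tsize x. eval ?A [x, y] ?rec (tcmp x y) t" for x y
  proof (induction x arbitrary: y)
    case Leaf
    show ?case
    proof (cases y)
      case Leaf
      thus ?thesis by (intro exI[of _ "1+(1+3+1)+1"]) (auto intro!: eval_CaseLeafI eval_VarI eval_NodeI eval_LeafI simp: tcmp_def)
    next
      case (Node c d)
      have "eval ?A [Leaf, y] ?rec Leaf (1+(1+1+1)+1)"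
        by (rule eval_CaseLeafI[OF eval_VarI eval_CaseNodeI[OF eval_VarI eval_LeafI]]) (auto simp: Node)
      thus ?thesis by (intro exI[of _ "1+(1+1+1)+1"]) (auto simp: tcmp_def Node)
    qed
  next
    case (Node a b)
    show ?case
    proof (cases y)
      case Leaf
      have "eval ?A [Node a b, y] ?rec (Node Leaf (Node Leaf Leaf)) (1+(1+5+1)+1)"
        by (rule eval_CaseNodeI[OF eval_VarI eval_CaseLeafI[OF eval_VarI gt]]) (auto simp: Leaf)
      thus ?thesis by (intro exI[of _ "1+(1+5+1)+1"]) (auto simp: tcmp_def Leaf)
    next
      case y: (Node c d)
      let ?\<rho> = "[c, d, a, b, Node a b, y]"
      obtain t where t: "t <= 30 * tsize a" "eval ?A [a, c] ?rec (tcmp a c) t" using Node.IH(1)[of c] by blast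
      obtain u where u: "u <= 30 * tsize b" "eval ?A [b, d] ?rec (tcmp b d) u" using Node.IH(2)[of d] by blast
      have 1: "eval ?A ?\<rho> (ECall 1 [EVar 2, EVar 0]) (tcmp a c) (2 + t + 1)"
        by (rule eval_CallI[OF _ l2]) (use t(2) in auto)
      have 2: "eval ?A (Leaf # Leaf # ?\<rho>) ?in (tcmp b d) (1 + (2 + u + 1) + 1)"
        by (rule eval_CaseLeafI[OF eval_VarI eval_CallI[OF _ l2]]) (use u(2) in auto)
      have 3: "eval ?A (Leaf # Node Leaf Leaf # ?\<rho>) ?in (Node Leaf (Node Leaf Leaf)) (1 + 5 + 1)"
        by (rule eval_CaseNodeI[OF eval_VarI gt]) auto
      have "\<exists>s\<le>t + u + 15. eval ?A ?\<rho> ?md (tcmp (Node a b) y) s"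
      proof (cases "a < c")
        case True
        hence "tcmp a c = Leaf" "tcmp (Node a b) y = Leaf" by (auto simp: tcmp_def y)
        hence "eval ?A ?\<rho> ?md (tcmp (Node a b) y) ((2 + t + 1) + 1 + 1)"
          using eval_CaseLeafI[OF 1[unfolded \<open>tcmp a c = Leaf\<close>] eval_LeafI refl] by simp
        thus ?thesis by (intro bex_leI) (assumption | linarith | simp)+
      next
        case nless: False
        show ?thesis
        proof (cases "a = c")
          case True
          have "eval ?A ?\<rho> ?md (tcmp b d) ((2 + t + 1) + (1 + (2 + u + 1) + 1) + 1)"
          proof -
            have e: "tcmp a c = Node Leaf Leaf" using True by (simp add: tcmp_def)
            show ?thesis by (rule eval_CaseNodeI[OF 1[unfolded e] 2 refl])
          qed
          moreover have "tcmp (Node a b) y = tcmp b d" using True by (simp add: tcmp_def y)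
          ultimately show ?thesis by (intro bex_leI) (assumption | linarith | simp)+
        next
          case False
          have "eval ?A ?\<rho> ?md (Node Leaf (Node Leaf Leaf)) ((2 + t + 1) + (1 + 5 + 1) + 1)"
          proof -
            have e: "tcmp a c = Node Leaf (Node Leaf Leaf)" using False nless by (simp add: tcmp_def)
            show ?thesis by (rule eval_CaseNodeI[OF 1[unfolded e] 3 refl])
          qed
          moreover have "tcmp (Node a b) y = Node Leaf (Node Leaf Leaf)" using False nless by (simp add: tcmp_def y)
          ultimately show ?thesis by (intro bex_leI) (assumption | linarith | simp)+
        qed
      qed
      then obtain s where s: "s <= t + u + 15" "eval ?A ?\<rho> ?md (tcmp (Node a b) y) s" by blast
      have "eval ?A [Node a b, y] ?rec (tcmp (Node a b) y) (1 + (1 + s + 1) + 1)"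
        by (rule eval_CaseNodeI[OF eval_VarI eval_CaseNodeI[OF eval_VarI s(2)]]) (auto simp: y)
      thus ?thesis using s(1) t(1) u(1) by (intro bex_leI) (assumption | linarith | simp)+
    qed
  qed
  show ?thesis
  proof (rule compI[of ?A _ _ "%z. 30 * sz z + 20"])
    show "computes_at ?A 0 UNIV (%z. tcmp (fst z) (snd z)) (%z. 30 * sz z + 20)"
    proof (rule computes_at_I)
      fix z :: "tree \<times> tree"
      obtain x y where z: "z = (x, y)" by (cases z)
      obtain t where t: "t <= 30 * tsize x" "eval ?A [x, y] ?rec (tcmp x y) t" using rec by blast
      have "eval ?A [enc z] ?main (tcmp x y) (1 + (2 + t + 1) + 1)"
        by (rule eval_CaseNodeI[OF eval_VarI eval_CallI[OF _ l2]]) (use t(2) in \<open>auto simp: z\<close>)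
      thus "\<exists>t\<le>30 * sz z + 20. eval ?A [enc z] (?A ! 0) (enc (tcmp (fst z) (snd z))) t"
        using t(1) z by (intro exI[of _ "1 + (2 + t + 1) + 1"]) simp
    qed simp
    show "pbd UNIV (%z. 30 * sz z + 20) (%z. sz z + 0)" by (intro pbd_add pbd_mult pbd_const pbd_sz)
    show "pbd UNIV (%z. sz (tcmp (fst z) (snd z))) (%z. sz z + 0)"
      by (rule pbd_mono[of _ "%_. 5"]) (auto simp: tcmp_def)
  qed
qed

lemmas comp_tcmp = comp_op2[OF comp_tcmp_base]

lemma sz_bool: "sz (b :: bool) <= 3"
  by (cases b) auto

lemma comp_enc_less [comp_intros]:
  assumes "ptime D T f" "ptime D T g" shows "ptime D T (%x. enc (f x) < enc (g x))"
proof -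
  have "ptime D T (%x. ~ (tcmp (enc (f x)) (enc (g x)) ~= Leaf))"
    by (intro comp_not comp_nonleaf comp_tcmp comp_enc assms)
  thus ?thesis by (rule comp_cong) (auto simp: tcmp_def)
qed

lemma comp_eq [comp_intros]:
  assumes "ptime D T f" "ptime D T g" shows "ptime D T (%x. f x = g x)"
proof -
  have "ptime D T (%x. ~ enc (f x) < enc (g x) & ~ enc (g x) < enc (f x))"
    by (intro comp_not comp_conj comp_enc_less assms)
  thus ?thesis
  proof (rule comp_cong)
    show "f x = g x \<longleftrightarrow> ~ enc (f x) < enc (g x) & ~ enc (g x) < enc (f x)" for x
      unfolding enc_inject[of "f x" "g x", symmetric] by (auto simp del: enc_inject elim: linorder_neqE)
  qed
qed

subsection \<open>Operations on lists\<close>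

lemma comp_foldl_bd:
  fixes F :: "'a::enc => 's::enc => 'e::enc => 's"
  assumes "ptime D T i" "ptime D T l"
    and "ptime {z. fst z \<in> D & snd (snd z) \<in> set (l (fst z))} (%z. T (fst z)) (%z. F (fst z) (fst (snd z)) (snd (snd z)))"
    and B: "pbd D B (%x. sz x + T x)" "!!x ys zs. x \<in> D ==> l x = ys @ zs ==> sz (foldl (F x) (i x) ys) <= B x"
  shows "ptime D T (%x. foldl (F x) (i x) (l x))"
  by (rule comp_foldl_simple[OF assms(1-3)], rule pbd_mono[OF pbd_compose[OF B(1), of _ fst]]) (use B(2) in auto)

text \<open>An element of \<open>l x\<close> is no larger than \<open>l x\<close>, whose size is
  polynomial; bounds for the pair of input and element thus become uniform bounds in the input
  alone.\<close>

lemma pbd_elem: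
  assumes "pbd {z. fst z \<in> D & snd z \<in> set (l (fst z))} g (%z. sz z + T (fst z))" "ptime D T l"
  obtains B where "pbd D B (%x. sz x + T x)" "!!x e. x \<in> D ==> e \<in> set (l x) ==> g (x, e) <= B x"
proof -
  obtain c where c: "!!x e. x \<in> D ==> e \<in> set (l x) ==> g (x, e) <= (sz (x, e) + T x + 2) ^ c"
    using assms(1) unfolding pbd_def by fastforce
  define B where "B x = (sz x + sz (l x) + 1 + T x + 2) ^ c" for x
  have "pbd D B (%x. sz x + T x)" unfolding B_def
    by (intro pbd_power pbd_add pbd_const pbd_sz pbd_T comp_size assms)
  moreover have "g (x, e) <= B x" if "x \<in> D" "e \<in> set (l x)" for x e
    using c[OF that] sz_list_mem[OF that(2)] unfolding B_def
    by (elim order_trans) (rule power_mono, auto)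
  ultimately show ?thesis using that by blast
qed

lemma comp_elem_state:
  assumes "ptime {z. fst z \<in> D & snd z \<in> set (l (fst z))} (%z. T (fst z)) (%z. F (fst z) (snd z))"
  shows "ptime {z. fst z \<in> D & snd (snd z) \<in> set (l (fst z))} (%z. T (fst z)) (%z. F (fst z) (snd (snd z)))"
proof -
  have "ptime {z. fst z \<in> D & snd (snd z) \<in> set (l (fst z))} (%z. T (fst z)) (%z. (%z. F (fst z) (snd z)) (fst z, snd (snd z)))"
    by (rule comp_compose[OF assms]) (auto intro!: comp_intros)
  thus ?thesis by simp
qed

lemma foldl_rev: "foldl (%a e. e # a) as xs = rev xs @ as"
  by (induction xs arbitrary: as) auto

lemma sz_rev [simp]: "sz (rev xs) = sz xs"
  by (induction xs) (auto simp: sz_list)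

lemma sz_prefix: "sz ys <= sz (ys @ zs)"
  by (simp add: sz_list)

lemma sz_append: "sz (xs @ ys) <= sz xs + sz ys"
  by (simp add: sz_list)

lemma comp_rev_append:
  assumes "ptime D T f" "ptime D T g" shows "ptime D T (%x. rev (f x) @ g x)"
proof -
  have "ptime D T (%x. foldl (%a e. e # a) (g x) (f x))"
    by (rule comp_foldl_bd[where B="%x. sz (f x) + sz (g x)"])
      (intro assms comp_intros pbd_add comp_size |
        auto simp: foldl_rev intro!: order_trans[OF sz_append] sz_prefix)+
  thus ?thesis by (simp add: foldl_rev)
qed

lemma comp_rev [comp_intros]: "ptime D T f ==> ptime D T (%x. rev (f x))"
  using comp_rev_append[OF _ comp_const, of D T f "[]"] by simp

lemma comp_append [comp_intros]: "ptime D T f ==> ptime D T g ==> ptime D T (%x. f x @ g x)"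
  using comp_rev_append[OF comp_rev, of D T f g] by simp

lemma sum_list_bound: "(!!x. x \<in> set xs ==> f x <= B) ==> (\<Sum>x\<leftarrow>xs. f x) <= length xs * (B :: nat)"
  by (induction xs) (auto, fastforce intro: add_mono)

lemma foldl_map_rev: "foldl (%a e. f e # a) as xs = rev (map f xs) @ as"
  by (induction xs arbitrary: as) auto

lemma comp_map [comp_intros]:
  assumes l: "ptime D T l" and F: "ptime {z. fst z \<in> D & snd z \<in> set (l (fst z))} (%z. T (fst z)) (%z. F (fst z) (snd z))"
  shows "ptime D T (%x. map (F x) (l x))"
proof -
  obtain B where B: "pbd D B (%x. sz x + T x)" "!!x e. x \<in> D ==> e \<in> set (l x) ==> sz (F x e) <= B x"
    using pbd_elem[OF comp_size[OF F] l] by auto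
  have "ptime D T (%x. foldl (%a e. F x e # a) [] (l x))"
  proof (rule comp_foldl_bd[where B="%x. 1 + sz (l x) * (B x + 1)"])
    show "pbd D (%x. 1 + sz (l x) * (B x + 1)) (%x. sz x + T x)"
      by (intro pbd_add pbd_mult pbd_const comp_size l B)
    fix x ys zs assume x: "x \<in> D" "l x = ys @ zs"
    have "(\<Sum>e\<leftarrow>ys. sz (F x e) + 1) <= length ys * (B x + 1)"
      by (rule sum_list_bound) (use B(2)[OF x(1)] x in auto)
    also have "... <= sz (l x) * (B x + 1)"
      by (rule mult_right_mono) (use length_le_sz[of "l x"] x in auto)
    finally show "sz (foldl (%a e. F x e # a) [] ys) <= 1 + sz (l x) * (B x + 1)"
      unfolding foldl_map_rev append_Nil2 sz_rev by (simp add: sz_list comp_def)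
  qed (intro comp_intros l comp_elem_state[OF F])+
  hence "ptime D T (%x. rev (foldl (%a e. F x e # a) [] (l x)))" by (rule comp_rev)
  thus ?thesis by (simp add: foldl_map_rev)
qed

lemma foldl_filter_rev: "foldl (%a e. if P e then e # a else a) as xs = rev (filter P xs) @ as"
  by (induction xs arbitrary: as) auto

lemma sz_filter: "sz (filter P xs) <= sz xs"
  by (induction xs) auto

lemma comp_filter [comp_intros]:
  assumes l: "ptime D T l" and P: "ptime {z. fst z \<in> D & snd z \<in> set (l (fst z))} (%z. T (fst z)) (%z. P (fst z) (snd z))"
  shows "ptime D T (%x. filter (P x) (l x))"
proof -
  have "ptime D T (%x. foldl (%a e. if P x e then e # a else a) [] (l x))"
  proof (rule comp_foldl_bd[where B="%x. sz (l x)"])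
    fix x ys zs assume x: "x \<in> D" "l x = ys @ zs"
    have "sz (filter P ys) <= sz (l x)" for P
      by (rule order_trans[OF sz_filter]) (simp add: x sz_list)
    thus "sz (foldl (%a e. if P x e then e # a else a) [] ys) <= sz (l x)"
      by (simp add: foldl_filter_rev)
  qed (intro comp_intros l comp_size comp_elem_state[OF P])+
  hence "ptime D T (%x. rev (foldl (%a e. if P x e then e # a else a) [] (l x)))" by (rule comp_rev)
  thus ?thesis by (simp add: foldl_filter_rev)
qed

lemma foldl_disj: "foldl (%a e. a | P e) b xs \<longleftrightarrow> b | (\<exists>e\<in>set xs. P e)"
  by (induction xs arbitrary: b) auto

lemma comp_list_bex [comp_intros]:
  assumes l: "ptime D T l" and P: "ptime {z. fst z \<in> D & snd z \<in> set (l (fst z))} (%z. T (fst z)) (%z. P (fst z) (snd z))"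
  shows "ptime D T (%x. \<exists>e\<in>set (l x). P x e)"
proof -
  have "ptime D T (%x. foldl (%a e. a | P x e) False (l x))"
    by (rule comp_foldl_bd[where B="%x. 3"]) (intro comp_intros l comp_elem_state[OF P] pbd_const sz_bool)+
  thus ?thesis by (simp add: foldl_disj)
qed

lemma comp_list_ball [comp_intros]:
  assumes l: "ptime D T l" and P: "ptime {z. fst z \<in> D & snd z \<in> set (l (fst z))} (%z. T (fst z)) (%z. P (fst z) (snd z))"
  shows "ptime D T (%x. \<forall>e\<in>set (l x). P x e)"
  by (rule comp_cong[OF comp_not[OF comp_list_bex[OF l comp_not[OF P]]]]) auto

lemma foldl_append': "foldl (@) as xs = as @ concat xs"
  by (induction xs arbitrary: as) auto

lemma sz_concat: "sz (concat xs) <= sz xs"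
proof (induction xs)
  case (Cons x xs)
  thus ?case using sz_append[of x "concat xs"] by simp
qed simp

lemma comp_concat [comp_intros]:
  assumes l: "ptime D T l" shows "ptime D T (%x. concat (l x))"
proof -
  have "ptime D T (%x. foldl (%a e. a @ e) [] (l x))"
  proof (rule comp_foldl_bd[where B="%x. sz (l x)"])
    fix x ys zs assume x: "x \<in> D" "l x = ys @ zs"
    have "sz (concat ys) <= sz (l x)" by (rule order_trans[OF sz_concat]) (simp add: x sz_list)
    thus "sz (foldl (@) [] ys) <= sz (l x)" by (simp add: foldl_append')
  qed (intro comp_intros l comp_size)+
  thus ?thesis by (simp add: foldl_append')
qed

subsection \<open>Finite sets\<close>

text \<open>A finite set is encoded by the sorted list of the encodings of its elements, so that equal sets
  have equal encodings.\<close>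

instantiation fset :: (enc) enc
begin
definition enc_fset :: "'a fset => tree" where "enc_fset S = enc (sorted_list_of_set (enc ` fset S))"
instance
proof
  fix x y :: "'a fset"
  have "enc ` fset x = enc ` fset y \<longleftrightarrow> fset x = fset y" by (rule inj_image_eq_iff) (simp add: inj_def)
  moreover have "sorted_list_of_set (enc ` fset x) = sorted_list_of_set (enc ` fset y) \<longleftrightarrow> enc ` fset x = enc ` fset y"
    by (metis finite_fset finite_imageI set_sorted_list_of_set)
  ultimately show "enc x = enc y \<longleftrightarrow> x = y" by (simp add: enc_fset_def fset_inject)
qed
end

definition elems :: "'a::enc fset => 'a list" where
  "elems S = map (inv enc) (sorted_list_of_set (enc ` fset S))"

lemma inj_enc: "inj enc" by (simp add: inj_def)

lemma inv_enc [simp]: "inv enc (enc x) = x" by (rule inv_f_f[OF inj_enc])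

lemma map_enc_elems: "map enc (elems S) = sorted_list_of_set (enc ` fset S)"
proof -
  have "map enc (map (inv enc :: tree => 'a) (sorted_list_of_set (enc ` fset S))) = map id (sorted_list_of_set (enc ` fset S))"
    unfolding map_map by (rule map_cong) auto
  thus ?thesis by (simp add: elems_def)
qed

lemma enc_list_map: "enc (map enc xs) = enc xs"
  by (induction xs) auto

text \<open>A finite set and its canonical list are the same tree, so passing from the set to the
  list costs nothing.\<close>

lemma enc_elems [simp]: "enc (elems S) = enc S"
  using enc_list_map[of "elems S"] by (simp add: map_enc_elems enc_fset_def)

lemma set_elems [simp]: "set (elems S) = fset S"
proof -
  have "enc ` set (elems S) = enc ` fset S"
    by (metis finite_fset finite_imageI list.set_map map_enc_elems set_sorted_list_of_set)
  thus ?thesis by (simp add: inj_image_eq_iff[OF inj_enc])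
qed

lemma distinct_elems [simp]: "distinct (elems S)"
  using distinct_sorted_list_of_set[of "enc ` fset S"] unfolding map_enc_elems[symmetric] by (simp add: distinct_map)

lemma length_elems [simp]: "length (elems S) = fcard S"
  using distinct_card[OF distinct_elems, of S] by (simp add: fcard.rep_eq)

lemma sz_fset: "sz S = 1 + (\<Sum>x\<in>fset S. sz x + 1)"
proof -
  have "sz S = sz (elems S)" by simp
  also have "... = 1 + (\<Sum>x\<in>set (elems S). sz x + 1)"
    unfolding sz_list by (subst sum_list_distinct_conv_sum_set) auto
  finally show ?thesis by simp
qed

lemma sz_fset_mem: "x |\<in>| S ==> sz x <= sz S"
  using sz_list_mem[of x "elems S"] by simp

lemma fcard_le_sz: "fcard S <= sz S"
  using length_le_sz[of "elems S"] by simp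

lemma sz_fset_le: "(!!x. x |\<in>| S ==> sz x <= B) ==> sz S <= 1 + fcard S * (B + 1)"
  unfolding sz_fset using sum_bounded_above[of "fset S" "%x. sz x + 1" "B + 1"] by (simp add: fcard.rep_eq)

lemma sz_fset_mono: "S |\<subseteq>| S' ==> sz S <= sz S'"
  unfolding sz_fset by (rule add_left_mono) (auto intro!: sum_mono2 simp: less_eq_fset.rep_eq)

lemma comp_elems [comp_intros]: "ptime D T f ==> ptime D T (%x. elems (f x))"
  by (rule comp_recode) auto

text \<open>An element equal to \<open>e\<close> passes neither filter, so duplicates disappear
  without a separate test.\<close>

definition ins :: "'a::enc list => 'a => 'a list" where
  "ins L e = filter (%y. enc y < enc e) L @ e # filter (%y. enc e < enc y) L"

lemma set_ins: "set (ins L e) = insert e (set L)"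
  unfolding ins_def using enc_inject neq_iff by fastforce

lemma sorted_ins: "sorted_wrt (%x y. enc x < enc y) L ==> sorted_wrt (%x y. enc x < enc y) (ins L e)"
  unfolding ins_def by (auto simp: sorted_wrt_append intro: sorted_wrt_filter)

lemma foldl_ins: "sorted_wrt (%x y. enc x < enc y) L ==>
  sorted_wrt (%x y. enc x < enc y) (foldl ins L xs) & set (foldl ins L xs) = set L Un set xs"
  by (induction xs arbitrary: L) (auto simp: sorted_ins set_ins)

lemma sorted_unique_enc:
  assumes "sorted_wrt (%x y. enc x < enc y) L" shows "elems (fset_of_list L) = L"
proof -
  have "sorted_wrt (<) (map enc L)" using assms by (simp add: sorted_wrt_map)
  hence "sorted_list_of_set (set (map enc L)) = map enc L"
    using sorted_list_of_set.idem_if_sorted_distinct strict_sorted_iff by blast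
  hence "map enc (elems (fset_of_list L)) = map enc L" by (simp add: map_enc_elems fset_of_list.rep_eq)
  thus ?thesis by (simp add: inj_map_eq_map[OF inj_enc])
qed

lemma foldl_ins_elems: "foldl ins [] xs = elems (fset_of_list xs)"
proof -
  have 1: "sorted_wrt (%x y. enc x < enc y) (foldl ins [] xs)" "set (foldl ins [] xs) = set xs"
    using foldl_ins[of "[]" xs] by auto
  have "fset_of_list (foldl ins [] xs) = fset_of_list xs"
    using 1(2) by (intro fset_eqI) (simp add: fset_of_list_elem)
  thus ?thesis using sorted_unique_enc[OF 1(1)] by simp
qed

lemma sz_fset_of_list: "sz (fset_of_list xs) <= sz xs"
proof (induction xs)
  case (Cons x xs)
  have "sz (finsert x (fset_of_list xs)) <= sz (fset_of_list xs) + sz x + 1"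
    by (cases "x |\<in>| fset_of_list xs") (simp_all add: sz_fset finsert_absorb)
  thus ?case using Cons by simp
qed (simp add: sz_fset)

lemma comp_fset_of_list [comp_intros]:
  assumes l: "ptime D T l" shows "ptime D T (%x. fset_of_list (l x))"
proof -
  have "ptime D T (%x. foldl (%L e. ins L e) [] (l x))"
  proof (rule comp_foldl_bd[where B="%x. sz (l x)"])
    fix x ys zs assume x: "x \<in> D" "l x = ys @ zs"
    have "sz (fset_of_list ys) <= sz (l x)" by (rule order_trans[OF sz_fset_of_list]) (simp add: x sz_list)
    thus "sz (foldl ins [] ys) <= sz (l x)" by (simp add: foldl_ins_elems)
  next
    show "ptime {z. fst z \<in> D & snd (snd z) \<in> set (l (fst z))} (%z. T (fst z)) (%z. ins (fst (snd z)) (snd (snd z)))"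
      unfolding ins_def by (intro comp_intros)
  qed (intro comp_intros l comp_size)+
  hence "ptime D T (%x. elems (fset_of_list (l x)))" by (simp add: foldl_ins_elems)
  thus ?thesis by (rule comp_recode) simp
qed

context
  fixes D :: "'a::enc set" and T S
  assumes S: "ptime D T (S :: 'a => 'e::enc fset)"
begin

lemma comp_fimage:
  assumes "ptime {z. fst z \<in> D & snd z |\<in>| S (fst z)} (%z. T (fst z)) (%z. F (fst z) (snd z))"
  shows "ptime D T (%x. F x |`| S x)"
proof -
  have "F x |`| S x = fset_of_list (map (F x) (elems (S x)))" for x
    by (rule fset_eqI) (auto simp: fset_of_list_elem)
  thus ?thesis
    by (simp del: fset_of_list_map) (intro comp_intros S, use assms in simp)
qed

lemma comp_ffilter:
  assumes "ptime {z. fst z \<in> D & snd z |\<in>| S (fst z)} (%z. T (fst z)) (%z. P (fst z) (snd z))"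
  shows "ptime D T (%x. ffilter (P x) (S x))"
proof -
  have "ffilter (P x) (S x) = fset_of_list (filter (P x) (elems (S x)))" for x
    by (rule fset_eqI) (auto simp: fset_of_list_elem)
  thus ?thesis
    by (simp del: fset_of_list_filter) (intro comp_intros S, use assms in simp)
qed

lemma comp_fBex:
  assumes "ptime {z. fst z \<in> D & snd z |\<in>| S (fst z)} (%z. T (fst z)) (%z. P (fst z) (snd z))"
  shows "ptime D T (%x. fBex (S x) (P x))"
  using comp_list_bex[OF comp_elems[OF S], of P] assms by simp

lemma comp_fBall:
  assumes "ptime {z. fst z \<in> D & snd z |\<in>| S (fst z)} (%z. T (fst z)) (%z. P (fst z) (snd z))"
  shows "ptime D T (%x. fBall (S x) (P x))"
  using comp_list_ball[OF comp_elems[OF S], of P] assms by simp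

end

lemmas [comp_intros] = comp_fimage comp_ffilter comp_fBex comp_fBall

lemma comp_fmember [comp_intros]:
  assumes "ptime D T f" "ptime D T g" shows "ptime D T (%x. f x |\<in>| g x)"
proof -
  have "ptime UNIV (%_. 0) (%z. fBex (snd z) (%e. e = fst z))" by (intro comp_intros)
  from comp_op2[OF this assms] show ?thesis by simp
qed

lemma comp_list_member [comp_intros]:
  assumes "ptime D T f" "ptime D T g" shows "ptime D T (%x. f x \<in> set (g x))"
proof -
  have "ptime UNIV (%_. 0) (%z. \<exists>e\<in>set (snd z). e = fst z)" by (intro comp_intros)
  from comp_op2[OF this assms] show ?thesis by simp
qed

lemma comp_finsert [comp_intros]:
  assumes "ptime D T f" "ptime D T g" shows "ptime D T (%x. finsert (f x) (g x))"
proof -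
  have "finsert (f x) (g x) = fset_of_list (f x # elems (g x))" for x
    by (rule fset_eqI) (auto simp: fset_of_list_elem)
  thus ?thesis by (simp del: fset_of_list_simps) (intro comp_intros assms)
qed

lemma comp_funion [comp_intros]:
  assumes "ptime D T f" "ptime D T g" shows "ptime D T (%x. f x |\<union>| g x)"
proof -
  have "f x |\<union>| g x = fset_of_list (elems (f x) @ elems (g x))" for x
    by (rule fset_eqI) (auto simp: fset_of_list_elem)
  thus ?thesis by (simp del: fset_of_list_append) (intro comp_intros assms)
qed

lemma comp_fminus [comp_intros]:
  assumes "ptime D T f" "ptime D T g" shows "ptime D T (%x. f x |-| g x)"
proof -
  have "ptime UNIV (%_. 0) (%z. ffilter (%e. ~ e |\<in>| snd z) (fst z))" by (intro comp_intros)
  from comp_op2[OF this assms] show ?thesis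
    by (rule comp_cong) auto
qed

lemma comp_finter [comp_intros]:
  assumes "ptime D T f" "ptime D T g" shows "ptime D T (%x. f x |\<inter>| g x)"
proof -
  have "ptime UNIV (%_. 0) (%z. ffilter (%e. e |\<in>| snd z) (fst z))" by (intro comp_intros)
  from comp_op2[OF this assms] show ?thesis
    by (rule comp_cong) auto
qed

lemma comp_ffUnion [comp_intros]:
  assumes "ptime D T f" shows "ptime D T (%x. ffUnion (f x))"
proof -
  have "ffUnion (f x) = fset_of_list (concat (map elems (elems (f x))))" for x
    by (rule fset_eqI) (auto simp: fset_of_list_elem ffUnion.rep_eq)
  thus ?thesis by simp (intro comp_intros assms)
qed

lemma sz_suffix: "sz zs <= sz (ys @ zs)"
  by (simp add: sz_list)

lemma sz_drop: "sz (drop n L) <= sz L"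
  using sz_suffix[of "drop n L" "take n L"] by simp

lemma foldl_tl: "foldl (%a e. tl a) as xs = drop (length xs) as"
  by (induction xs arbitrary: as) (auto simp: drop_Suc)

lemma comp_fcard_less [comp_intros]:
  assumes "ptime D T f" "ptime D T g" shows "ptime D T (%x. fcard (f x) < fcard (g x))"
proof -
  \<comment> \<open>Cardinalities are compared without numbers, by dropping one element of the
    second list for each element of the first.\<close>
  have "ptime D T (%x. foldl (%a e. tl a) (elems (g x)) (elems (f x)))"
  proof (rule comp_foldl_bd[where B="%x. sz (g x)"])
    fix x ys zs assume "x \<in> D"
    show "sz (foldl (%a e. tl a) (elems (g x)) ys) <= sz (g x)"
      using sz_drop[of "length ys" "elems (g x)"] by (simp add: foldl_tl)
  qed (intro comp_intros assms comp_size)+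
  hence "ptime D T (%x. foldl (%a e. tl a) (elems (g x)) (elems (f x)) ~= [])"
    by (intro comp_intros)
  thus ?thesis by (rule comp_cong) (auto simp: foldl_tl)
qed

lemma foldl_pow: "fset_of_list (foldl (%a e. a @ map (finsert e) a) [{||}] xs) = fPow (fset_of_list xs)"
proof (induction xs rule: rev_induct)
  case (snoc x xs)
  thus ?case by (simp add: fPow_finsert)
qed simp

lemma length_foldl_pow: "length (foldl (%a e. a @ map (finsert e) a) [{||}] xs) = 2 ^ length xs"
  by (induction xs rule: rev_induct) auto

lemma comp_fPow:
  assumes S: "ptime D T S" and b: "pbd D (%x. 2 ^ fcard (S x)) (%x. sz x + T x)"
  shows "ptime D T (%x. fPow (S x))"
proof -
  have "ptime D T (%x. foldl (%a e. a @ map (finsert e) a) [{||}] (elems (S x)))"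
  proof (rule comp_foldl_bd[where B="%x. 1 + 2 ^ fcard (S x) * (sz (S x) + 1)"])
    fix x ys zs assume x: "x \<in> D" "elems (S x) = ys @ zs"
    let ?L = "foldl (%a e. a @ map (finsert e) a) [{||}] ys"
    have "sz A <= sz (S x)" if "A \<in> set ?L" for A
    proof (rule sz_fset_mono)
      have "A |\<in>| fset_of_list ?L" using that by (simp add: fset_of_list_elem)
      hence "A |\<subseteq>| fset_of_list ys" unfolding foldl_pow by simp
      also have "... |\<subseteq>| fset_of_list (elems (S x))" by (auto simp: x fset_of_list_elem)
      also have "fset_of_list (elems (S x)) = S x" by (rule fset_eqI) (simp add: fset_of_list_elem)
      finally show "A |\<subseteq>| S x" .
    qed
    hence "(\<Sum>A\<leftarrow>?L. sz A + 1) <= length ?L * (sz (S x) + 1)" by (intro sum_list_bound) auto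
    also have "... <= 2 ^ fcard (S x) * (sz (S x) + 1)"
      unfolding length_foldl_pow using arg_cong[OF x(2), of length] by (intro mult_right_mono power_increasing) auto
    finally show "sz ?L <= 1 + 2 ^ fcard (S x) * (sz (S x) + 1)"
      by (simp add: sz_list)
  next
    show "pbd D (%x. 1 + 2 ^ fcard (S x) * (sz (S x) + 1)) (%x. sz x + T x)"
      by (intro pbd_add pbd_mult pbd_const b comp_size S)
  qed (intro comp_intros S)+
  hence "ptime D T (%x. fset_of_list (foldl (%a e. a @ map (finsert e) a) [{||}] (elems (S x))))"
    by (rule comp_fset_of_list)
  moreover have "fset_of_list (elems (S x)) = S x" for x by (rule fset_eqI) (simp add: fset_of_list_elem)
  ultimately show ?thesis by (simp add: foldl_pow)
qed

subsection \<open>Binary numbers\<close>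

lemma comp_bits: "ptime D T f ==> ptime D T (%x. bits (f x))"
  using comp_recode[of D T f "%x. bits (f x)"] by (simp add: enc_nat_bits)

definition dbl :: "bool => nat => nat" where "dbl b n = of_bool b + 2 * n"

lemma bits_0 [simp]: "bits 0 = []" by (simp add: bits.simps)

lemma bits_dbl: "bits (dbl b n) = (if n = 0 & ~ b then [] else b # bits n)"
proof -
  have "dbl b n div 2 = n" "odd (dbl b n) \<longleftrightarrow> b" "dbl b n = 0 \<longleftrightarrow> n = 0 & ~ b" by (auto simp: dbl_def of_bool_def)
  thus ?thesis by (cases b; subst bits.simps; simp)
qed

lemma comp_dbl [comp_intros]:
  assumes "ptime D T f" "ptime D T g" shows "ptime D T (%x. dbl (f x) (g x))"
proof -
  have "ptime D T (%x. if g x = 0 & ~ f x then [] else f x # bits (g x))"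
    by (intro comp_intros comp_bits assms)
  thus ?thesis by (rule comp_recode) (simp add: enc_nat_bits bits_dbl)
qed

lemma length_bits_le: "n < 2 ^ k ==> length (bits n) <= k"
proof (induction k arbitrary: n)
  case (Suc k)
  have "n div 2 < 2 ^ k" using Suc.prems by auto
  thus ?case using Suc.IH by (subst bits.simps) auto
qed simp

lemma less_2_length_bits: "n < 2 ^ length (bits n)"
proof (induction n rule: less_induct)
  case (less n)
  show ?case
  proof (cases "n = 0")
    case False
    have "n = 2 * (n div 2) + n mod 2" by simp
    moreover have "n div 2 < 2 ^ length (bits (n div 2))" using less False by simp
    ultimately have "n < 2 * 2 ^ length (bits (n div 2))" by linarith
    thus ?thesis using False by (subst bits.simps) simp
  qed simp
qed

lemma sz_bools: "sz (bs :: bool list) <= 1 + 4 * length bs"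
  unfolding sz_list using sum_list_bound[of bs "%b. sz b + 1" 4] sz_bool by (auto simp: mult.commute)

lemma sz_nat_le: "n < 2 ^ k ==> sz (n :: nat) <= 1 + 4 * k"
  using sz_bools[of "bits n"] length_bits_le[of n k] by (simp add: enc_nat_bits)

lemma length_bits_le_sz: "length (bits n) <= sz n"
  using length_le_sz[of "bits n"] by (simp add: enc_nat_bits)

lemma less_2_sz: "n < 2 ^ sz (n :: nat)"
  using less_2_length_bits[of n] length_bits_le_sz[of n] by (meson less_le_trans one_le_numeral power_increasing)

text \<open>One column of schoolbook addition: carry, the remaining digits of both summands, and the
  digits produced so far with the latest in front.\<close>

definition add_step :: "(bool \<times> bool list \<times> bool list) \<times> bool list => bool => (bool \<times> bool list \<times> bool list) \<times> bool list" where
  "add_step s e = (let c = fst (fst s); ms = fst (snd (fst s)); ns = snd (snd (fst s));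
      m = (ms ~= [] & hd ms); n = (ns ~= [] & hd ns)
    in (((m & n | m & c | n & c), tl ms, tl ns), ((m ~= n) ~= c) # snd s))"

lemma bits_val_head: "bits_val ms = of_bool (ms ~= [] & hd ms) + 2 * bits_val (tl ms)"
  by (cases ms) auto

lemma add_step_val:
  assumes "add_step ((c, ms, ns), out) e = ((c', ms', ns'), out')"
  shows "EX b. out' = b # out & of_bool c + bits_val ms + bits_val ns = of_bool b + 2 * (of_bool c' + bits_val ms' + bits_val ns')"
    "ms' = tl ms" "ns' = tl ns"
proof -
  define m n where "m = (ms ~= [] & hd ms)" and "n = (ns ~= [] & hd ns)"
  have eq: "out' = ((m ~= n) ~= c) # out" "c' = (m & n | m & c | n & c)" and t: "ms' = tl ms" "ns' = tl ns"
    using assms by (auto simp: add_step_def Let_def m_def n_def)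
  show "ms' = tl ms" "ns' = tl ns" by (fact t)+
  have "of_bool c + of_bool m + of_bool n = of_bool ((m ~= n) ~= c) + 2 * (of_bool c' :: nat)"
    unfolding eq by (cases c; cases m; cases n; simp)
  moreover have "bits_val ms = of_bool m + 2 * bits_val ms'" "bits_val ns = of_bool n + 2 * bits_val ns'"
    unfolding t m_def n_def by (rule bits_val_head)+
  ultimately show "EX b. out' = b # out & of_bool c + bits_val ms + bits_val ns = of_bool b + 2 * (of_bool c' + bits_val ms' + bits_val ns')"
    unfolding eq(1) by (intro exI[of _ "(m ~= n) ~= c"]) (simp only: distrib_left add.assoc, presburger)
qed

lemma bits_val_append: "bits_val (xs @ ys) = bits_val xs + 2 ^ length xs * bits_val ys"
  by (induction xs) (auto simp: algebra_simps)

lemma foldl_dbl: "foldl (%a b. dbl b a) 0 out = bits_val (rev out)"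
proof (induction out rule: rev_induct)
  case (snoc x xs)
  thus ?case by (simp add: dbl_def)
qed simp

lemma add_steps:
  "case foldl add_step ((c, ms, ns), out) es of ((c', ms', ns'), out') =>
     bits_val (rev out') + 2 ^ length out' * (of_bool c' + bits_val ms' + bits_val ns') =
     bits_val (rev out) + 2 ^ length out * (of_bool c + bits_val ms + bits_val ns) &
     length out' = length out + length es & ms' = drop (length es) ms & ns' = drop (length es) ns &
     (length ms < length es & length ns < length es --> ~ c')"
proof (induction es arbitrary: c ms ns out)
  case (Cons e es)
  obtain c1 ms1 ns1 out1 where 1: "add_step ((c, ms, ns), out) e = ((c1, ms1, ns1), out1)" by (metis surj_pair)
  obtain b where b: "out1 = b # out" "of_bool c + bits_val ms + bits_val ns = of_bool b + 2 * (of_bool c1 + bits_val ms1 + bits_val ns1)"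
    using add_step_val(1)[OF 1] by blast
  note ms = add_step_val(2,3)[OF 1]
  have c1: "~ c1" if "ms = []" "ns = []" using 1 that by (auto simp: add_step_def Let_def)
  obtain c2 ms2 ns2 out2 where 2: "foldl add_step ((c1, ms1, ns1), out1) es = ((c2, ms2, ns2), out2)" by (metis surj_pair)
  have IH: "bits_val (rev out2) + 2 ^ length out2 * (of_bool c2 + bits_val ms2 + bits_val ns2) =
     bits_val (rev out1) + 2 ^ length out1 * (of_bool c1 + bits_val ms1 + bits_val ns1)"
     "length out2 = length out1 + length es" "ms2 = drop (length es) ms1" "ns2 = drop (length es) ns1"
     "length ms1 < length es & length ns1 < length es --> ~ c2"
    using Cons.IH[where c=c1 and ms=ms1 and ns=ns1 and out=out1] unfolding 2 by auto
  have "bits_val (rev out1) + 2 ^ length out1 * (of_bool c1 + bits_val ms1 + bits_val ns1) =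
    bits_val (rev out) + 2 ^ length out * (of_bool c + bits_val ms + bits_val ns)"
    unfolding b by (simp add: bits_val_append algebra_simps)
  moreover have "~ c2" if "length ms < Suc (length es)" "length ns < Suc (length es)"
  proof (cases "es = []")
    case True
    thus ?thesis using that c1 2 by simp
  next
    case False
    thus ?thesis using IH(5) that ms by (cases ms; cases ns) auto
  qed
  moreover have "length out2 = length out + length (e # es)" "ms2 = drop (length (e # es)) ms" "ns2 = drop (length (e # es)) ns"
    using IH(2-4) b(1) ms by (simp_all add: drop_Suc)
  ultimately show ?case unfolding foldl_Cons 1 2 prod.case using IH(1) by simp
qed auto

text \<open>The list folded over is a clock, longer than either summand, so that the carry is
  consumed in the end. The outer fold reads the digits from the most significant one by Horner's
  scheme, which removes leading zeros.\<close>

definition add_alg :: "nat => nat => nat" where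
  "add_alg m n = foldl (%a b. dbl b a) 0
     (snd (foldl add_step ((False, bits m, bits n), []) (bits m @ bits n @ [True])))"

lemma add_alg: "add_alg m n = m + n"
proof -
  obtain c ms ns out where 1: "foldl add_step ((False, bits m, bits n), []) (bits m @ bits n @ [True]) = ((c, ms, ns), out)"
    by (metis surj_pair)
  show ?thesis using add_steps[where c=False and ms="bits m" and ns="bits n" and out="[]" and es="bits m @ bits n @ [True]"]
    unfolding add_alg_def 1 foldl_dbl by auto
qed

lemma comp_add [comp_intros]:
  assumes "ptime D T f" "ptime D T g" shows "ptime D T (%x. f x + g x :: nat)"
proof -
  have 1: "ptime UNIV (%_. 0) (%z. foldl add_step ((False, bits (fst z), bits (snd z)), []) (bits (fst z) @ bits (snd z) @ [True]))"
  proof (rule comp_foldl_bd[where B="%z. 30 * sz z + 30"])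
    show "pbd UNIV (%z. 30 * sz z + 30) (%z. sz z + 0)" by (intro pbd_add pbd_mult pbd_const pbd_sz)
    show "ptime {z. fst z \<in> UNIV & snd (snd z) \<in> set (bits (fst (fst z)) @ bits (snd (fst z)) @ [True])} (%z. 0)
      (%z. add_step (fst (snd z)) (snd (snd z)))"
      unfolding add_step_def Let_def by (intro comp_intros)
    fix z :: "nat \<times> nat" and ys zs
    assume e: "bits (fst z) @ bits (snd z) @ [True] = ys @ zs"
    obtain c ms ns out where 1: "foldl add_step ((False, bits (fst z), bits (snd z)), []) ys = ((c, ms, ns), out)"
      by (metis surj_pair)
    have *: "length out = length ys" "ms = drop (length ys) (bits (fst z))" "ns = drop (length ys) (bits (snd z))"
      using add_steps[where c=False and ms="bits (fst z)" and ns="bits (snd z)" and out="[]" and es=ys] unfolding 1 by auto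
    have "length ys <= length (bits (fst z)) + length (bits (snd z)) + 1"
      using arg_cong[OF e, of length] by simp
    hence "length out <= sz z"
      using length_bits_le_sz[of "fst z"] length_bits_le_sz[of "snd z"] * by (simp add: enc_prod_def)
    moreover have "sz ms <= sz z" "sz ns <= sz z" using * sz_drop[of _ "bits (fst z)"] sz_drop[of _ "bits (snd z)"]
      by (auto simp: enc_prod_def enc_nat_bits intro: trans_le_add1 trans_le_add2 le_SucI)
    ultimately show "sz (foldl add_step ((False, bits (fst z), bits (snd z)), []) ys) <= 30 * sz z + 30"
      unfolding 1 using sz_bools[of out] sz_bool[of c] by simp
  qed (intro comp_intros comp_bits)+
  have 2: "ptime UNIV (%_. 0) (%out. foldl (%a b. dbl b a) 0 out)"
  proof (rule comp_foldl_bd[where B="%z. 4 * sz z + 1"])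
    show "pbd UNIV (%z. 4 * sz z + 1) (%z. sz z + 0)" by (intro pbd_add pbd_mult pbd_const pbd_sz)
    fix z ys zs :: "bool list" assume e: "z = ys @ zs"
    have "bits_val (rev ys) < 2 ^ length ys" for ys
    proof (induction ys rule: rev_induct)
      case (snoc b ys) thus ?case by (cases b) auto
    qed simp
    from sz_nat_le[OF this[of ys]] show "sz (foldl (%a b. dbl b a) 0 ys) <= 4 * sz z + 1"
      using length_le_sz[of z] by (simp add: foldl_dbl e)
  qed (intro comp_intros)+
  have "ptime UNIV (%_. 0) (%z. add_alg (fst z) (snd z))"
    unfolding add_alg_def by (intro comp_op1[OF 2] comp_snd 1)
  from comp_op2[OF this assms] show ?thesis by (simp add: add_alg)
qed

lemma foldl_mult: "foldl (%a b. (a + a) + (if b then n else 0)) 0 bs = bits_val (rev bs) * n" for n :: nat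
  by (induction bs rule: rev_induct) (auto simp: algebra_simps)

lemma bits_val_less: "bits_val bs < 2 ^ length bs"
  by (induction bs) (auto simp: of_bool_def)

lemma comp_mult [comp_intros]:
  assumes "ptime D T f" "ptime D T g" shows "ptime D T (%x. f x * g x :: nat)"
proof -
  have "ptime UNIV (%_. 0) (%z :: nat \<times> nat. foldl (%a b. (a + a) + (if b then snd z else 0)) 0 (rev (bits (fst z))))"
  proof (rule comp_foldl_bd[where B="%z. 1 + 4 * sz z"])
    show "pbd UNIV (%z. 1 + 4 * sz z) (%z. sz z + 0)" by (intro pbd_add pbd_mult pbd_const pbd_sz)
    fix z :: "nat \<times> nat" and ys zs assume e: "rev (bits (fst z)) = ys @ zs"
    have "bits_val (rev ys) * snd z < 2 ^ length ys * 2 ^ length (bits (snd z))"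
      using bits_val_less[of "rev ys"] less_2_length_bits[of "snd z"] by (intro mult_strict_mono) auto
    also have "... = 2 ^ (length ys + length (bits (snd z)))" by (simp add: power_add)
    finally have "sz (bits_val (rev ys) * snd z) <= 1 + 4 * (length ys + length (bits (snd z)))"
      by (rule sz_nat_le)
    also have "... <= 1 + 4 * sz z"
      using length_bits_le_sz[of "fst z"] length_bits_le_sz[of "snd z"] arg_cong[OF e, of length] by (simp add: enc_prod_def)
    finally show "sz (foldl (%a b. (a + a) + (if b then snd z else 0)) 0 ys) <= 1 + 4 * sz z"
      by (simp only: foldl_mult)
  qed (intro comp_intros comp_bits)+
  from comp_op2[OF this assms] show ?thesis by (simp add: foldl_mult)
qed

lemma foldl_sum: "foldl (%a e. a + f e) a xs = a + (\<Sum>e\<leftarrow>xs. f e :: nat)"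
  by (induction xs arbitrary: a) auto

text \<open>The summands may be exponentially large numbers; only their binary length is bounded. A
  sum of \<open>n\<close> numbers of length at most \<open>B\<close> stays below
  \<open>2 ^ (n + B)\<close>.\<close>

lemma comp_fsum [comp_intros]:
  assumes S: "ptime D T S" and F: "ptime {z. fst z \<in> D & snd z |\<in>| S (fst z)} (%z. T (fst z)) (%z. F (fst z) (snd z))"
  shows "ptime D T (%x. \<Sum>e\<in>fset (S x). F x e :: nat)"
proof -
  have F': "ptime {z. fst z \<in> D & snd z \<in> set (elems (S (fst z)))} (%z. T (fst z)) (%z. F (fst z) (snd z))"
    using F by simp
  obtain B where B: "pbd D B (%x. sz x + T x)" "!!x e. x \<in> D ==> e \<in> set (elems (S x)) ==> sz (F x e) <= B x"
    using pbd_elem[OF comp_size[OF F'] comp_elems[OF S]] by auto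
  have "ptime D T (%x. foldl (%a e. a + F x e) 0 (elems (S x)))"
  proof (rule comp_foldl_bd[where B="%x. 1 + 4 * (sz (S x) + B x)"])
    show "pbd D (%x. 1 + 4 * (sz (S x) + B x)) (%x. sz x + T x)"
      by (intro pbd_add pbd_mult pbd_const comp_size S B)
    fix x ys zs assume x: "x \<in> D" "elems (S x) = ys @ zs"
    have "(\<Sum>e\<leftarrow>ys. F x e) <= length ys * 2 ^ B x"
    proof (rule sum_list_bound)
      fix e assume "e \<in> set ys"
      hence "e \<in> set (elems (S x))" by (simp add: x del: set_elems)
      hence "sz (F x e) <= B x" using B(2) x by blast
      hence "2 ^ sz (F x e) <= (2::nat) ^ B x" by (rule power_increasing) simp
      thus "F x e <= 2 ^ B x" using less_2_sz[of "F x e"] by linarith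
    qed
    also have "... < 2 ^ length ys * 2 ^ B x" by (rule mult_strict_right_mono) (auto intro: less_exp)
    also have "... = 2 ^ (length ys + B x)" by (simp add: power_add)
    finally have "sz (\<Sum>e\<leftarrow>ys. F x e) <= 1 + 4 * (length ys + B x)" by (rule sz_nat_le)
    also have "length ys <= sz (S x)" using length_le_sz[of "elems (S x)"] arg_cong[OF x(2), of length] by simp
    finally show "sz (foldl (%a e. a + F x e) 0 ys) <= 1 + 4 * (sz (S x) + B x)"
      by (simp add: foldl_sum)
  qed (intro comp_intros S comp_elem_state[OF F'])+
  moreover have "(\<Sum>e\<leftarrow>elems (S x). F x e) = (\<Sum>e\<in>fset (S x). F x e)" for x
    by (subst sum_list_distinct_conv_sum_set) auto
  ultimately show ?thesis by (simp add: foldl_sum)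
qed

subsection \<open>Literals and body elements\<close>

text \<open>The pair is the same tree as the literal, so a case distinction on literals becomes a
  test of the first component.\<close>

fun lit_pair :: "'a lit => bool \<times> 'a" where
  "lit_pair (Pos a) = (True, a)"
| "lit_pair (Neg a) = (False, a)"

lemma comp_lit_pair:
  assumes "ptime D T f" shows "ptime D T (%x. lit_pair (f x))"
proof (rule comp_recode[OF assms])
  show "enc (lit_pair (f x)) = enc (f x)" for x by (cases "f x") auto
qed

lemma comp_Pos [comp_intros]: "ptime D T f ==> ptime D T (%x. Pos (f x))"
  using comp_recode[OF comp_pair[OF comp_const[of D T True]], of f "%x. Pos (f x)"] by simp

lemma comp_Neg [comp_intros]: "ptime D T f ==> ptime D T (%x. Neg (f x))"
  using comp_recode[OF comp_pair[OF comp_const[of D T False]], of f "%x. Neg (f x)"] by simp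

text \<open>The branches of a case distinction see the input besides the bound variable; handing
  over both as a pair reduces this to composition.\<close>

lemma comp_closure:
  assumes "ptime {z. fst z \<in> D} (%z. T (fst z)) (%z. F (fst z) (snd z))" "ptime D T f"
  shows "ptime D T (%x. F x (f x))"
proof -
  have "ptime D T (%x. (%z. F (fst z) (snd z)) (x, f x))"
    by (rule comp_compose[OF assms(1)]) (auto intro!: comp_intros assms)
  thus ?thesis by simp
qed

lemma comp_case_lit [comp_intros]:
  assumes "ptime D T l" "ptime {z. fst z \<in> D} (%z. T (fst z)) (%z. P (fst z) (snd z))"
    "ptime {z. fst z \<in> D} (%z. T (fst z)) (%z. N (fst z) (snd z))"
  shows "ptime D T (%x. case l x of Pos a => P x a | Neg a => N x a)"
proof -
  have "ptime D T (%x. if fst (lit_pair (l x)) then P x (snd (lit_pair (l x))) else N x (snd (lit_pair (l x))))"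
    using comp_fst[OF comp_lit_pair[OF assms(1)]] comp_closure[OF assms(2) comp_snd[OF comp_lit_pair[OF assms(1)]]]
      comp_closure[OF assms(3) comp_snd[OF comp_lit_pair[OF assms(1)]]] by (rule comp_if')
  thus ?thesis by (rule comp_cong) (auto split: lit.splits)
qed

fun body_elem_pair :: "'a body_elem => tree \<times> 'a lit" where
  "body_elem_pair (Lit l) = (Leaf, l)"
| "body_elem_pair (ENot l) = (enc [True], l)"
| "body_elem_pair (NegENot l) = (enc [False, True], l)"

lemma comp_body_elem_pair:
  assumes "ptime D T f" shows "ptime D T (%x. body_elem_pair (f x))"
proof (rule comp_recode[OF assms])
  show "enc (body_elem_pair (f x)) = enc (f x)" for x by (cases "f x") auto
qed

lemma comp_case_body_elem [comp_intros]:
  assumes "ptime D T b" "ptime {z. fst z \<in> D} (%z. T (fst z)) (%z. L (fst z) (snd z))"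
    "ptime {z. fst z \<in> D} (%z. T (fst z)) (%z. E (fst z) (snd z))"
    "ptime {z. fst z \<in> D} (%z. T (fst z)) (%z. N (fst z) (snd z))"
  shows "ptime D T (%x. case b x of Lit l => L x l | ENot l => E x l | NegENot l => N x l)"
proof -
  have "ptime D T (%x. if fst (body_elem_pair (b x)) = Leaf then L x (snd (body_elem_pair (b x)))
    else if fst (body_elem_pair (b x)) = enc [True] then E x (snd (body_elem_pair (b x)))
    else N x (snd (body_elem_pair (b x))))"
  proof -
    note p = comp_body_elem_pair[OF assms(1)]
    note t = comp_eq[OF comp_fst[OF p] comp_const]
    show ?thesis
      using t comp_closure[OF assms(2) comp_snd[OF p]]
        comp_if'[OF t comp_closure[OF assms(3) comp_snd[OF p]] comp_closure[OF assms(4) comp_snd[OF p]]]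
      by (rule comp_if')
  qed
  thus ?thesis by (rule comp_cong) (auto split: body_elem.splits)
qed

section \<open>Elimination orders, separators and the approximation of treewidth\<close>

subsection \<open>Elimination orders\<close>

definition hits :: "'a => 'a set set => 'a set" where
  "hits v H = \<Union>{h\<in>H. v \<in> h}"

definition elim :: "'a => 'a set set => 'a set set" where
  "elim v H = insert (hits v H - {v}) {h\<in>H. v ~: h}"

text \<open>The vertex being eliminated is counted as well, so \<open>b\<close> plays the role of a
  bag size, that is, of treewidth plus one.\<close>

fun elim_width :: "nat => 'a list => 'a set set => bool" where
  "elim_width b [] H \<longleftrightarrow> True"
| "elim_width b (v # vs) H \<longleftrightarrow> finite (hits v H) & card (hits v H) <= b & elim_width b vs (elim v H)"

lemma Union_elim: "\<Union>(elim v H) = \<Union>H - {v}"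
  by (auto simp: elim_def hits_def)

text \<open>Until its first vertex is eliminated an edge stays intact, and at that moment it is
  contained in the set of merged edges. These sets, one per vertex, act as the bags of a
  decomposition.\<close>

lemma elim_width_cover:
  assumes "elim_width b vs H" "\<Union>H <= set vs"
  shows "EX K. finite K & card K <= length vs & (\<forall>k\<in>K. finite k & card k <= b) & (\<forall>h\<in>H. h ~= {} --> (\<exists>k\<in>K. h <= k))"
  using assms
proof (induction vs arbitrary: H)
  case Nil
  thus ?case by (intro exI[of _ "{}"]) auto
next
  case (Cons v vs)
  have "\<Union>(elim v H) <= set vs" using Cons.prems(2) by (auto simp: Union_elim)
  then obtain K where K: "finite K" "card K <= length vs" "\<forall>k\<in>K. finite k & card k <= b"
    "\<forall>h\<in>elim v H. h ~= {} --> (\<exists>k\<in>K. h <= k)"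
    using Cons.IH[of "elim v H"] Cons.prems(1) by auto
  have "\<exists>k\<in>insert (hits v H) K. h <= k" if "h \<in> H" "h ~= {}" for h
    using that K(4) by (cases "v \<in> h") (auto simp: elim_def hits_def)
  thus ?case using K Cons.prems(1)
    by (intro exI[of _ "insert (hits v H) K"]) (auto intro: order_trans[OF card_insert_le_m1] simp: card_insert_if)
qed

subsection \<open>Tree decompositions yield elimination orders\<close>

text \<open>Take the first vertex of a longest path. Its neighbours lie on the path, by maximality,
  and a neighbour beyond the second position would close a cycle.\<close>

lemma tree_leaf:
  assumes "finite N" "2 <= card N" "connected_on N T" "simple_graph N T" "~ has_cycle T"
  obtains l n where "l \<in> N" "n \<in> N" "l ~= n" "!!m. {l, m} \<in> T ==> m = n"
proof -
  define P where "P c \<longleftrightarrow> c ~= [] & distinct c & set c <= N & (ALL i. Suc i < length c --> {c ! i, c ! Suc i} \<in> T)" for c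
  have len: "length c < Suc (card N)" if "P c" for c
    using that card_mono[OF assms(1), of "set c"] by (auto simp: P_def distinct_card)
  obtain x0 where "x0 \<in> N" using assms(2) by fastforce
  hence "P [x0]" by (auto simp: P_def)
  then obtain c where c: "P c" and max: "!!c'. P c' ==> length c' <= length c"
    using ex_has_greatest_nat[of P "[x0]" length "Suc (card N)"] len less_imp_le by metis
  let ?x = "c ! 0"
  have x: "?x \<in> N" using c by (auto simp: P_def)
  have "~ N <= {?x}"
    using assms(2) card_mono[of "{?x}" N] by auto
  then obtain z where z: "z \<in> N" "z ~= ?x" by blast
  hence "(?x, z) \<in> {(x, y). x \<in> N & y \<in> N & {x, y} \<in> T}\<^sup>*" using assms(3) x by (auto simp: connected_on_def)
  then obtain y where y: "{?x, y} \<in> T" "y \<in> N" using z(2) by (auto elim: converse_rtranclE)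
  have nb: "y' = c ! 1 & 1 < length c" if e: "{?x, y'} \<in> T" for y'
  proof -
    have y': "y' \<in> N" "y' ~= ?x" using e assms(4) unfolding simple_graph_def by (fastforce simp: doubleton_eq_iff)+
    have "y' \<in> set c"
    proof (rule ccontr)
      assume "y' ~: set c"
      hence "P (y' # c)" using c e y' unfolding P_def
        by (auto simp: nth_Cons insert_commute split: nat.splits)
      thus False using max by force
    qed
    then obtain j where j: "j < length c" "c ! j = y'" by (auto simp: in_set_conv_nth)
    moreover have "j ~= 0" using j y' by metis
    moreover have "~ 2 <= j"
    proof
      assume j2: "2 <= j"
      let ?d = "take (Suc j) c"
      have "{?d ! i, ?d ! (Suc i mod length ?d)} \<in> T" if "i < length ?d" for i
      proof (cases "i = j")
        case True thus ?thesis using e j that by (simp add: insert_commute)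
      next
        case False thus ?thesis using c j that by (auto simp: P_def)
      qed
      hence "has_cycle T" unfolding has_cycle_def using c j j2
        by (intro exI[of _ ?d]) (auto simp: P_def)
      thus False using assms(5) by blast
    qed
    ultimately have "j = 1" by linarith
    thus ?thesis using j by auto
  qed
  show thesis
  proof (rule that[of ?x "c ! 1"])
    show "c ! 1 \<in> N" "c ! 0 \<in> N" using c nb[OF y(1)] by (auto simp: P_def)
    show "c ! 0 ~= c ! 1" using c nb[OF y(1)] by (auto simp: P_def nth_eq_iff_index_eq)
  qed (use nb in blast)
qed

text \<open>A walk enters and leaves the leaf \<open>l\<close> through \<open>n\<close>, so detours
  to \<open>l\<close> can be cut out; while the walk stands at \<open>l\<close>, the induction keeps
  \<open>n\<close> as its current vertex.\<close>

lemma connected_on_remove_leaf: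
  assumes "connected_on S T" "l ~= n" "!!m. {l, m} \<in> T ==> m = n"
  shows "connected_on (S - {l}) {e\<in>T. l ~: e}"
proof -
  let ?R = "{(x, y). x \<in> S & y \<in> S & {x, y} \<in> T}"
  let ?R' = "{(x, y). x \<in> S - {l} & y \<in> S - {l} & {x, y} \<in> {e\<in>T. l ~: e}}"
  have *: "(v ~= l --> (u, v) \<in> ?R'\<^sup>*) & (v = l --> (u, n) \<in> ?R'\<^sup>*)" if "(u, v) \<in> ?R\<^sup>*" "u ~= l" for u v
    using that(1)
  proof (induction rule: rtrancl_induct)
    case base thus ?case using that(2) by auto
  next
    case (step y z)
    have e: "{y, z} \<in> T" "y \<in> S" "z \<in> S" using step(2) by auto
    show ?case
    proof (cases "y = l")
      case True
      hence "z = n" using assms(3) e by auto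
      thus ?thesis using step(3) True assms(2) by auto
    next
      case y: False
      show ?thesis
      proof (cases "z = l")
        case True
        hence "y = n" using assms(3)[of y] e by (simp add: insert_commute)
        thus ?thesis using step(3) y True by auto
      next
        case False
        hence "(y, z) \<in> ?R'" using e y by auto
        thus ?thesis using step(3) y False by (auto intro: rtrancl_into_rtrancl)
      qed
    qed
  qed
  show ?thesis unfolding connected_on_def using assms(1)[unfolded connected_on_def] * by blast
qed

lemma tree_elim_order:
  fixes N :: "'n set" and bag :: "'n => 'a set"
  assumes "finite N" "N ~= {}" "connected_on N T" "simple_graph N T" "~ has_cycle T"
    and "!!v. connected_on {n\<in>N. v \<in> bag n} T" "!!n. n \<in> N ==> finite (bag n) & card (bag n) <= b"
    and "!!h u v. h \<in> H ==> u \<in> h ==> v \<in> h ==> \<exists>n\<in>N. u \<in> bag n & v \<in> bag n"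
  shows "EX vs. distinct vs & set vs = (\<Union>n\<in>N. bag n) & elim_width b vs H"
  using assms
proof (induction "card N + (\<Sum>n\<in>N. card (bag n))" arbitrary: N T bag H rule: less_induct)
  case less
  note [simp] = less.prems(1)
  show ?case
  proof (cases "\<exists>l\<in>N. \<exists>v\<in>bag l. \<forall>m\<in>N. v \<in> bag m --> m = l")
    case True
    then obtain l v where lv: "l \<in> N" "v \<in> bag l" and only: "!!m. m \<in> N ==> v \<in> bag m ==> m = l" by blast
    have hits: "hits v H <= bag l" unfolding hits_def using less.prems(8) only by blast
    have fin: "finite (bag l)" "card (bag l) <= b" using less.prems(7) lv by auto
    let ?bag = "bag(l := bag l - {v})"
    have "card (?bag l) < card (bag l)" using card_Diff1_less[OF fin(1) lv(2)] by simp
    hence "(\<Sum>n\<in>N. card (?bag n)) < (\<Sum>n\<in>N. card (bag n))"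
      using lv by (intro sum_strict_mono_ex1) (auto intro!: bexI[of _ l])
    hence dec: "card N + (\<Sum>n\<in>N. card (?bag n)) < card N + (\<Sum>n\<in>N. card (bag n))" by simp
    have conn: "connected_on {n\<in>N. u \<in> ?bag n} T" for u
    proof (cases "u = v")
      case True
      have eq: "{n\<in>N. u \<in> ?bag n} = {}" using True only by auto
      show ?thesis unfolding eq by (simp add: connected_on_def)
    next
      case False
      have eq: "{n\<in>N. u \<in> ?bag n} = {n\<in>N. u \<in> bag n}" using False by auto
      show ?thesis unfolding eq by (rule less.prems(6))
    qed
    have cov: "\<exists>n\<in>N. u \<in> ?bag n & w \<in> ?bag n" if h: "h \<in> elim v H" "u \<in> h" "w \<in> h" for h u w
    proof (cases "h = hits v H - {v}")
      case True
      thus ?thesis using h hits lv by (intro bexI[of _ l]) auto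
    next
      case False
      hence "h \<in> H" "v ~: h" using h by (auto simp: elim_def)
      then obtain n where "n \<in> N" "u \<in> bag n" "w \<in> bag n" using less.prems(8)[of h u w] h by blast
      moreover have "u ~= v" "w ~= v" using h \<open>v ~: h\<close> by auto
      ultimately show ?thesis by (intro bexI[of _ n]) auto
    qed
    have sz: "finite (?bag n) & card (?bag n) <= b" if "n \<in> N" for n
      using less.prems(7)[OF that] card_mono[of "bag n" "bag n - {v}"] by (cases "n = l") (force simp: card_Diff_singleton_if)+
    have "EX vs. distinct vs & set vs = (\<Union>n\<in>N. ?bag n) & elim_width b vs (elim v H)"
      by (rule less.hyps[OF dec less.prems(1-5) conn sz cov])
    then obtain vs where vs: "distinct vs" "set vs = (\<Union>n\<in>N. ?bag n)" "elim_width b vs (elim v H)"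
      by (elim exE conjE)
    have "?bag n = bag n - {v}" if "n \<in> N" for n using only[OF that] by auto
    hence "(\<Union>n\<in>N. ?bag n) = (\<Union>n\<in>N. bag n - {v})" by (intro SUP_cong) auto
    hence sv: "set vs = (\<Union>n\<in>N. bag n) - {v}" unfolding vs(2) by blast
    have v: "v \<in> (\<Union>n\<in>N. bag n)" using lv by blast
    have "finite (hits v H)" "card (hits v H) <= b"
      using finite_subset[OF hits fin(1)] card_mono[OF fin(1) hits] fin(2) by auto
    hence "elim_width b (v # vs) H" using vs(3) by simp
    moreover have "distinct (v # vs)" "set (v # vs) = (\<Union>n\<in>N. bag n)" using vs(1) v by (auto simp: sv)
    ultimately show ?thesis by blast
  next
    case nex: False
    show ?thesis
    proof (cases "card N < 2")
      case True
      hence "card N = 1" using less.prems(2) card_0_eq[OF less.prems(1)] by linarith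
      then obtain l where "N = {l}" by (auto simp: card_1_singleton_iff)
      hence "bag l = {}" using nex by auto
      thus ?thesis using \<open>N = {l}\<close> by (intro exI[of _ "[]"]) auto
    next
      case False
      then obtain l n where ln: "l \<in> N" "n \<in> N" "l ~= n" "!!m. {l, m} \<in> T ==> m = n"
        using tree_leaf[OF less.prems(1) _ less.prems(3-5)] by (metis linorder_not_less)
      have sub: "bag l <= bag n"
      proof
        fix v assume v: "v \<in> bag l"
        then obtain m where m: "m \<in> N" "v \<in> bag m" "m ~= l" using nex ln(1) by blast
        hence "(l, m) \<in> {(x, y). x \<in> {n\<in>N. v \<in> bag n} & y \<in> {n\<in>N. v \<in> bag n} & {x, y} \<in> T}\<^sup>*"
          using less.prems(6)[of v] v ln(1) by (auto simp: connected_on_def)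
        then obtain y where "v \<in> bag y" "{l, y} \<in> T" using m(3) by (auto elim: converse_rtranclE)
        thus "v \<in> bag n" using ln(4) by auto
      qed
      let ?N = "N - {l}" and ?T = "{e\<in>T. l ~: e}"
      have un: "(\<Union>n\<in>?N. bag n) = (\<Union>n\<in>N. bag n)" using sub ln by auto
      have "card ?N < card N" using card_Diff1_less[OF less.prems(1) ln(1)] by simp
      moreover have "(\<Sum>n\<in>?N. card (bag n)) <= (\<Sum>n\<in>N. card (bag n))" by (rule sum_mono2) auto
      ultimately have dec: "card ?N + (\<Sum>n\<in>?N. card (bag n)) < card N + (\<Sum>n\<in>N. card (bag n))" by linarith
      have c1: "connected_on ?N ?T" by (rule connected_on_remove_leaf[OF less.prems(3) ln(3,4)])
      have c2: "connected_on {n\<in>?N. v \<in> bag n} ?T" for v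
        using connected_on_remove_leaf[OF less.prems(6)[of v] ln(3,4)] by (rule back_subst[of "%S. connected_on S ?T"]) auto
      have sg: "simple_graph ?N ?T" using less.prems(4) unfolding simple_graph_def by (fastforce simp: doubleton_eq_iff)
      have cyc: "~ has_cycle ?T" using less.prems(5) unfolding has_cycle_def by blast
      have cov: "\<exists>n\<in>?N. u \<in> bag n & w \<in> bag n" if h: "h \<in> H" "u \<in> h" "w \<in> h" for h u w
        using less.prems(8)[OF h] sub ln(2,3) by (metis DiffI empty_iff insert_iff subsetD)
      have "finite ?N" "?N ~= {}" using ln by auto
      from less.hyps[OF dec this c1 sg cyc c2 _ cov] show ?thesis unfolding un using less.prems(7) by simp
    qed
  qed
qed

text \<open>The decomposition with a single bag shows that the minimum in the definition of
  treewidth is attained.\<close>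

lemma treewidth_decomposition:
  assumes "finite V" "!!e. e \<in> E ==> e <= V"
  obtains N T bag where "tree_decomposition V E N T bag" "!!n. n \<in> N ==> card (bag n) <= treewidth V E + 1"
proof -
  have "~ has_cycle ({} :: nat set set)" unfolding has_cycle_def by force
  hence "tree_decomposition V E {0} {} (%_. V)"
    using assms by (auto simp: tree_decomposition_def is_tree_def simple_graph_def connected_on_def)
  hence "EX w N T bag. tree_decomposition V E N T bag & (\<forall>n\<in>N. card (bag n) <= w + 1)"
    by (intro exI[of _ "card V"] exI[of _ "{0}"] exI[of _ "{}"] exI[of _ "%_. V"]) auto
  from LeastI_ex[OF this] show thesis using that unfolding treewidth_def by blast
qed

subsection \<open>Balanced separations\<close>

definition adj :: "'a set set => 'a => 'a => bool" where
  "adj H u v \<longleftrightarrow> (\<exists>h\<in>H. u \<in> h & v \<in> h)"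

definition separates :: "'a set set => 'a set => 'a set => bool" where
  "separates H U X \<longleftrightarrow> (\<forall>u\<in>U. ALL y. adj H u y --> y \<in> U Un X)"

lemma separates_Union: "(!!U. U \<in> \<U> ==> separates H U X) ==> separates H (\<Union>\<U>) X"
  unfolding separates_def by blast

text \<open>Blocks of weight below \<open>m\<close> are added one by one; the first union that
  reaches \<open>m\<close> exceeds it by less than one block.\<close>

lemma union_weight:
  assumes "finite \<U>" "!!U. U \<in> \<U> ==> card (U Int W) < m" "finite W" "m <= card (\<Union>\<U> Int W)" "0 < m"
  shows "\<exists>\<U>'\<subseteq>\<U>. m <= card (\<Union>\<U>' Int W) & card (\<Union>\<U>' Int W) < 2 * m"
  using assms(1,2,4)
proof (induction \<U> rule: finite_induct)
  case (insert U \<U>)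
  show ?case
  proof (cases "m <= card (\<Union>\<U> Int W)")
    case True
    thus ?thesis using insert by blast
  next
    case False
    have "card (\<Union>(insert U \<U>) Int W) <= card (U Int W) + card (\<Union>\<U> Int W)"
      by (simp add: Int_Un_distrib2 card_Un_le)
    hence "card (\<Union>(insert U \<U>) Int W) < 2 * m" using False insert.prems(1)[of U] by simp
    thus ?thesis using insert.prems by blast
  qed
qed (use assms(5) in auto)

text \<open>A block \<open>(U, h)\<close> is a set of eliminated vertices with its frontier.
  Eliminating \<open>v\<close> merges \<open>v\<close> with all blocks that have \<open>v\<close> on
  their frontier. As long as the result is lighter than \<open>m\<close>, the elimination goes on;
  when the merged blocks reach \<open>m\<close>, some of them have the right weight and are
  separated by \<open>hits v\<close>, and when only \<open>v\<close> makes the weight reach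
  \<open>m\<close>, the new block itself will do. In the end all frontiers are empty and a union of
  blocks has the right weight.\<close>

lemma balanced_blocks:
  assumes "elim_width b vs (snd ` \<B>)" "finite \<B>" "finite W"
    and "!!U h. (U, h) \<in> \<B> ==> separates H U h & card (U Int W) < m"
    and "!!u y. u \<in> set vs ==> y \<in> set vs ==> adj H u y ==> EX U h. (U, h) \<in> \<B> & u \<in> h & y \<in> h"
    and "!!u y. adj H u y ==> y \<in> \<Union>(fst ` \<B>) Un set vs"
    and "distinct vs" "\<Union>(fst ` \<B>) Int set vs = {}" "W <= \<Union>(fst ` \<B>) Un set vs" "m <= card W"
    and "\<Union>(snd ` \<B>) <= set vs" "!!v. v \<in> set vs ==> adj H v v" "0 < m"
  shows "EX U X. finite X & card X <= b & separates H U X & m <= card (U Int W) & card (U Int W) < 2 * m"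
  using assms
proof (induction vs arbitrary: \<B>)
  case Nil
  have "\<exists>\<U>\<subseteq>fst ` \<B>. m <= card (\<Union>\<U> Int W) & card (\<Union>\<U> Int W) < 2 * m"
  proof (rule union_weight)
    have "W <= \<Union>(fst ` \<B>)" using Nil.prems(9) by simp
    hence "\<Union>(fst ` \<B>) Int W = W" by blast
    thus "m <= card (\<Union>(fst ` \<B>) Int W)" using Nil.prems(10) by simp
  qed (use Nil.prems in auto)
  then obtain \<U> where U: "\<U> <= fst ` \<B>" "m <= card (\<Union>\<U> Int W)" "card (\<Union>\<U> Int W) < 2 * m" by blast
  have "separates H U {}" if U: "U \<in> fst ` \<B>" for U
  proof -
    obtain h where h: "(U, h) \<in> \<B>" using U by force
    hence "h = {}" using Nil.prems(11) by force
    thus ?thesis using Nil.prems(4)[OF h] by simp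
  qed
  hence "separates H (\<Union>\<U>) {}" using U(1) by (intro separates_Union) blast
  thus ?case using U by (intro exI[of _ "\<Union>\<U>"] exI[of _ "{}"]) auto
next
  case (Cons v vs)
  let ?hit = "{B\<in>\<B>. v \<in> snd B}"
  let ?h = "hits v (snd ` \<B>)"
  let ?U = "insert v (\<Union>(fst ` ?hit))"
  have hd: "?h = \<Union>(snd ` ?hit)" by (auto simp: hits_def)
  have sepU: "separates H U ?h" if U: "U \<in> fst ` ?hit" for U
  proof -
    obtain h where h: "(U, h) \<in> \<B>" "v \<in> h" using U by force
    hence "h <= ?h" by (force simp: hits_def)
    thus ?thesis using Cons.prems(4)[OF h(1)] unfolding separates_def by blast
  qed
  have nv: "y \<in> ?U Un (?h - {v})" if y: "adj H v y" for y
  proof -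
    have "y \<in> \<Union>(fst ` \<B>) | y = v | y \<in> set vs" using Cons.prems(6)[OF y] by auto
    then consider "y = v" | "y \<in> set vs" | U h where "(U, h) \<in> \<B>" "y \<in> U" by force
    thus ?thesis
    proof cases
      case 1 thus ?thesis by simp
    next
      case 2
      then obtain U h where "(U, h) \<in> \<B>" "v \<in> h" "y \<in> h" using Cons.prems(5)[of v y] y by auto
      hence "y \<in> ?h" by (force simp: hits_def)
      thus ?thesis by auto
    next
      case 3
      have "adj H y v" using y by (auto simp: adj_def)
      hence "v \<in> U Un h" using Cons.prems(4)[OF 3(1)] 3(2) by (auto simp: separates_def)
      moreover have "v ~: U" using Cons.prems(8) 3(1) by force
      ultimately have "U \<in> fst ` ?hit" using 3(1) by force
      thus ?thesis using 3(2) by blast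
    qed
  qed
  have sepn: "separates H ?U (?h - {v})"
    unfolding separates_def using nv sepU unfolding separates_def by blast
  have finh: "finite ?h" "card ?h <= b" using Cons.prems(1) by auto
  show ?case
  proof (cases "m <= card (\<Union>(fst ` ?hit) Int W)")
    case True
    have "\<exists>\<U>\<subseteq>fst ` ?hit. m <= card (\<Union>\<U> Int W) & card (\<Union>\<U> Int W) < 2 * m"
      by (rule union_weight) (use Cons.prems(2,3,4,13) True in auto)
    then obtain \<U> where U: "\<U> <= fst ` ?hit" "m <= card (\<Union>\<U> Int W)" "card (\<Union>\<U> Int W) < 2 * m" by blast
    have "separates H (\<Union>\<U>) ?h" using U(1) sepU by (intro separates_Union) blast
    thus ?thesis using U finh by blast
  next
    case light: False
    have "card (?U Int W) <= card (insert v (\<Union>(fst ` ?hit) Int W))"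
      using Cons.prems(3) by (intro card_mono) auto
    also have "... <= Suc (card (\<Union>(fst ` ?hit) Int W))" by (simp add: card_insert_if Cons.prems(3))
    finally have le: "card (?U Int W) <= m" using light by simp
    show ?thesis
    proof (cases "card (?U Int W) = m")
      case True
      have "m ~= 0" using light by simp
      thus ?thesis using sepn finh True card_mono[of ?h "?h - {v}"]
        by (intro exI[of _ ?U] exI[of _ "?h - {v}"]) auto
    next
      case False
      let ?B = "insert (?U, ?h - {v}) {B\<in>\<B>. v ~: snd B}"
      have "v \<in> ?h" using Cons.prems(5)[of v v] Cons.prems(12)[of v] by (force simp: hits_def)
      have im: "snd ` ?B = elim v (snd ` \<B>)" by (auto simp: elim_def)
      have fstB: "\<Union>(fst ` ?B) = insert v (\<Union>(fst ` \<B>))" by auto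
      show ?thesis
      proof (rule Cons.IH[of ?B])
        show "elim_width b vs (snd ` ?B)" unfolding im using Cons.prems(1) by simp
        show "separates H U h & card (U Int W) < m" if "(U, h) \<in> ?B" for U h
          using that sepn Cons.prems(4) le False by auto
        show "EX U h. (U, h) \<in> ?B & u \<in> h & y \<in> h" if uy: "u \<in> set vs" "y \<in> set vs" "adj H u y" for u y
        proof -
          obtain U h where h: "(U, h) \<in> \<B>" "u \<in> h" "y \<in> h" using Cons.prems(5)[of u y] uy by auto
          show ?thesis
          proof (cases "v \<in> h")
            case True
            hence "h <= ?h" using h(1) by (force simp: hits_def)
            thus ?thesis using h uy Cons.prems(7) by auto
          next
            case False
            thus ?thesis using h by auto
          qed
        qed
        show "W <= \<Union>(fst ` ?B) Un set vs" "\<Union>(fst ` ?B) Int set vs = {}"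
          "!!u y. adj H u y ==> y \<in> \<Union>(fst ` ?B) Un set vs"
          unfolding fstB using Cons.prems by auto
        show "\<Union>(snd ` ?B) <= set vs" unfolding im Union_elim using Cons.prems(11) by auto
      qed (use Cons.prems in auto)
    qed
  qed
qed

lemma balanced_separation:
  assumes "elim_width b vs H" "finite H" "distinct vs" "set vs = \<Union>H" "W <= \<Union>H" "m <= card W" "0 < m"
  shows "EX U X. finite X & card X <= b & separates H U X & m <= card (U Int W) & card (U Int W) < 2 * m"
proof (rule balanced_blocks[of b vs "(%h. ({}, h)) ` H"])
  show "finite W" using assms(4,5) finite_subset[OF _ finite_set[of vs]] by simp
  show "elim_width b vs (snd ` (%h. ({}, h)) ` H)" using assms by (simp add: image_image)
qed (use assms in \<open>auto simp: separates_def adj_def\<close>)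

subsection \<open>Minimum cuts\<close>

definition resid :: "('v \<times> 'v) fset => ('v \<times> 'v) fset => ('v \<times> 'v) fset" where
  "resid D F = ffilter (%e. ~ e |\<in>| F) D |\<union>| (%e. (snd e, fst e)) |`| F"

text \<open>A search state lists the nodes reached so far, each with the reversed list of arcs of a path to it.\<close>

definition ext_arc :: "('v \<times> ('v \<times> 'v) list) list => 'v \<times> 'v => ('v \<times> ('v \<times> 'v) list) list" where
  "ext_arc ps e = (if (\<exists>p\<in>set ps. fst p = fst e) & ~ (\<exists>p\<in>set ps. fst p = snd e)
     then (snd e, e # snd (hd (filter (%p. fst p = fst e) ps))) # ps else ps)"

text \<open>Instead of a queue, all arcs are scanned as many times as there are arcs; the cost is
  still polynomial.\<close>

definition search :: "('v::enc \<times> 'v) fset => 'v fset => ('v \<times> ('v \<times> 'v) list) list" where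
  "search R src = foldl ext_arc (map (%s. (s, [])) (elems src)) (concat (map (%_. elems R) (elems R)))"

text \<open>Paths are simple and read from their end. Simplicity is what keeps the remaining arcs
  residual when one arc of an augmenting path is flipped.\<close>

fun pth :: "('v \<times> 'v) set => 'v set => 'v => ('v \<times> 'v) list => bool" where
  "pth R src v [] \<longleftrightarrow> v \<in> src"
| "pth R src v (e # es) \<longleftrightarrow> v = snd e & e \<in> R & fst e ~= v & (\<forall>e'\<in>set es. fst e' ~= v & snd e' ~= v) & pth R src (fst e) es"

abbreviation heads :: "('v \<times> ('v \<times> 'v) list) list => 'v set" where
  "heads ps \<equiv> fst ` set ps"

definition search_inv :: "('v \<times> 'v) set => 'v set => ('v \<times> ('v \<times> 'v) list) list => bool" where
  "search_inv R src ps \<longleftrightarrow> src <= heads ps & heads ps <= src Un snd ` R & distinct (map fst ps) &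
     (\<forall>p\<in>set ps. pth R src (fst p) (snd p) & (\<forall>e\<in>set (snd p). fst e \<in> heads ps & snd e \<in> heads ps))"

lemma ext_arc_inv:
  assumes "search_inv R src ps" "e \<in> R" shows "search_inv R src (ext_arc ps e)"
proof (cases "(\<exists>p\<in>set ps. fst p = fst e) & ~ (\<exists>p\<in>set ps. fst p = snd e)")
  case True
  let ?p = "hd (filter (%p. fst p = fst e) ps)"
  have "filter (%p. fst p = fst e) ps ~= []" using True by (auto simp: filter_empty_conv)
  hence "?p \<in> set (filter (%p. fst p = fst e) ps)" by (rule hd_in_set)
  hence p: "?p \<in> set ps" "fst ?p = fst e" by auto
  have pp: "pth R src (fst e) (snd ?p)" "\<forall>e\<in>set (snd ?p). fst e \<in> heads ps & snd e \<in> heads ps"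
    using assms(1) p unfolding search_inv_def by metis+
  have new: "snd e ~: heads ps" using True by auto
  have "pth R src (snd e) (e # snd ?p)" using pp new assms(2) p True by fastforce
  moreover have "fst e \<in> heads ps" using True by force
  ultimately show ?thesis using True assms new pp(2) unfolding search_inv_def ext_arc_def by auto
qed (use assms in \<open>auto simp: ext_arc_def\<close>)

lemma foldl_ext_inv:
  "search_inv R src ps ==> set es <= R ==> search_inv R src (foldl ext_arc ps es)"
  by (induction es arbitrary: ps) (auto intro: ext_arc_inv)

lemma heads_mono: "heads ps <= heads (foldl ext_arc ps es)"
proof (induction es arbitrary: ps)
  case (Cons e es)
  have "heads ps <= heads (ext_arc ps e)" by (auto simp: ext_arc_def)
  thus ?case using Cons[of "ext_arc ps e"] by auto
qed simp

lemma heads_step: "e \<in> set es ==> fst e \<in> heads ps ==> snd e \<in> heads (foldl ext_arc ps es)"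
proof (induction es arbitrary: ps)
  case (Cons e' es)
  show ?case
  proof (cases "e = e'")
    case True
    hence "snd e \<in> heads (ext_arc ps e)" using Cons.prems by (force simp: ext_arc_def)
    thus ?thesis using heads_mono[of "ext_arc ps e" es] True by auto
  next
    case False
    have "fst e \<in> heads (ext_arc ps e')" using Cons.prems(2) heads_mono[of ps "[e']"] by auto
    thus ?thesis using Cons.IH[of "ext_arc ps e'"] Cons.prems False by auto
  qed
qed simp

definition closed_under :: "('v \<times> 'v) set => 'v set => bool" where
  "closed_under R X \<longleftrightarrow> (\<forall>e\<in>R. fst e \<in> X --> snd e \<in> X)"

lemma closed_stable: "closed_under R (heads ps) ==> set es <= R ==> foldl ext_arc ps es = ps"
proof (induction es)
  case (Cons e es)
  have "~ ((\<exists>p\<in>set ps. fst p = fst e) & ~ (\<exists>p\<in>set ps. fst p = snd e))"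
    using Cons.prems unfolding closed_under_def by (force simp: image_iff)
  hence "ext_arc ps e = ps" unfolding ext_arc_def by (rule if_not_P)
  thus ?case using Cons by simp
qed simp

text \<open>A pass that reaches no new arc target proves that the reached set is closed; every other
  pass adds a target.\<close>

lemma passes_closed:
  assumes "finite R" "set es = R" "search_inv R src ps"
  shows "closed_under R (heads (foldl ext_arc ps (concat (map (%_. es) ks)))) |
     length ks <= card (heads (foldl ext_arc ps (concat (map (%_. es) ks))) Int snd ` R)"
proof (induction ks rule: rev_induct)
  case (snoc k ks)
  let ?q = "foldl ext_arc ps (concat (map (%_. es) ks))"
  let ?q' = "foldl ext_arc ?q es"
  have inv: "search_inv R src ?q" by (rule foldl_ext_inv[OF assms(3)]) (use assms(2) in auto)
  have inv': "search_inv R src ?q'" by (rule foldl_ext_inv[OF inv]) (use assms(2) in auto)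
  have "closed_under R (heads ?q') | Suc (length ks) <= card (heads ?q' Int snd ` R)"
  proof (cases "closed_under R (heads ?q)")
    case True
    thus ?thesis using closed_stable[OF True] assms(2) by simp
  next
    case nc: False
    hence le: "length ks <= card (heads ?q Int snd ` R)" using snoc by blast
    show ?thesis
    proof (cases "heads ?q' Int snd ` R = heads ?q Int snd ` R")
      case True
      have "closed_under R (heads ?q)" unfolding closed_under_def
      proof (intro ballI impI)
        fix e assume e: "e \<in> R" "fst e \<in> heads ?q"
        hence "snd e \<in> heads ?q' Int snd ` R" using heads_step[of e es ?q] assms(2) by auto
        thus "snd e \<in> heads ?q" using True by blast
      qed
      thus ?thesis using nc by blast
    next
      case False
      hence "heads ?q Int snd ` R \<subset> heads ?q' Int snd ` R" using heads_mono[of ?q es] by blast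
      hence "card (heads ?q Int snd ` R) < card (heads ?q' Int snd ` R)"
        using assms(1) by (intro psubset_card_mono) auto
      thus ?thesis using le by linarith
    qed
  qed
  thus ?case by simp
qed simp

lemma search_init: "search_inv R (fset src) (map (%s. (s, [])) (elems src))"
  by (auto simp: search_inv_def comp_def image_image)

lemma search_spec:
  shows "search_inv (fset R) (fset src) (search R src)" "closed_under (fset R) (heads (search R src))"
proof -
  let ?q = "search R src"
  show inv: "search_inv (fset R) (fset src) ?q"
    unfolding search_def by (rule foldl_ext_inv[OF search_init]) auto
  have "closed_under (fset R) (heads ?q) | fcard R <= card (heads ?q Int snd ` fset R)"
    unfolding search_def using passes_closed[OF finite_fset _ search_init, of "elems R" R src "elems R"] by simp
  \<comment> \<open>As many reached targets as there are arcs means that every arc target has been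
    reached.\<close>
  moreover have "closed_under (fset R) (heads ?q)" if "fcard R <= card (heads ?q Int snd ` fset R)"
  proof -
    have "card (snd ` fset R) <= fcard R" unfolding fcard.rep_eq by (rule card_image_le) simp
    hence "heads ?q Int snd ` fset R = snd ` fset R"
      using that by (intro card_seteq) auto
    thus ?thesis by (auto simp: closed_under_def)
  qed
  ultimately show "closed_under (fset R) (heads ?q)" by blast
qed

definition toggle :: "('v \<times> 'v) fset => 'v \<times> 'v => ('v \<times> 'v) fset" where
  "toggle F e = (if (snd e, fst e) |\<in>| F then F |-| {|(snd e, fst e)|} else finsert e F)"

definition net :: "('v \<times> 'v) set => 'v => int" where
  "net F x = int (card {y. (x, y) \<in> F}) - int (card {y. (y, x) \<in> F})"

lemma finite_sections: "finite F ==> finite {y. (x, y) \<in> F}" "finite F ==> finite {y. (y, x) \<in> F}"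
proof -
  show "finite {y. (x, y) \<in> F}" if "finite F"
    by (rule finite_subset[OF _ finite_imageI[OF that, of snd]]) force
  show "finite {y. (y, x) \<in> F}" if "finite F"
    by (rule finite_subset[OF _ finite_imageI[OF that, of fst]]) force
qed

lemma net_insert:
  assumes "finite F" "(u, v) ~: F" "u ~= v"
  shows "net (insert (u, v) F) x = net F x + of_bool (x = u) - of_bool (x = v)"
proof -
  have "{y. (x, y) \<in> insert (u, v) F} = (if x = u then insert v {y. (x, y) \<in> F} else {y. (x, y) \<in> F})"
    "{y. (y, x) \<in> insert (u, v) F} = (if x = v then insert u {y. (y, x) \<in> F} else {y. (y, x) \<in> F})" by auto
  thus ?thesis using assms finite_sections[OF assms(1), of x] by (auto simp: net_def)
qed

lemma net_toggle:
  assumes "fst e ~= snd e" "(snd e, fst e) |\<in>| F | e |\<notin>| F"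
  shows "net (fset (toggle F e)) x = net (fset F) x + of_bool (x = fst e) - of_bool (x = snd e)"
proof (cases "(snd e, fst e) |\<in>| F")
  case True
  let ?G = "fset F - {(snd e, fst e)}"
  have "net (fset F) x = net ?G x + of_bool (x = snd e) - of_bool (x = fst e)"
    using net_insert[of ?G "snd e" "fst e" x] True assms(1) by (auto simp: insert_absorb)
  thus ?thesis using True by (simp add: toggle_def)
next
  case False
  thus ?thesis using net_insert[of "fset F" "fst e" "snd e" x] assms by (simp add: toggle_def)
qed

lemma toggle_other: "e ~= e' ==> e ~= (snd e', fst e') ==> e |\<in>| toggle F e' \<longleftrightarrow> e |\<in>| F"
  by (auto simp: toggle_def)

lemma resid_toggle_other:
  assumes "e ~= e'" "e ~= (snd e', fst e')" shows "e |\<in>| resid D (toggle F e') \<longleftrightarrow> e |\<in>| resid D F"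
proof -
  have in_resid: "e |\<in>| resid D F \<longleftrightarrow> e |\<in>| D & e |\<notin>| F | (snd e, fst e) |\<in>| F" for F
    by (cases e) (force simp: resid_def)
  show ?thesis unfolding in_resid using toggle_other[of e e' F] toggle_other[of "(snd e, fst e)" e' F] assms
    by (cases e; cases e') auto
qed

text \<open>Flipping the last arc moves one unit of flow to its head and leaves the residual status
  of the other arcs alone, as they avoid that vertex; the effects at inner vertices of the path
  cancel.\<close>

lemma augment:
  assumes "pth (fset (resid D F)) src v es" "F |\<subseteq>| D"
  shows "foldl toggle F es |\<subseteq>| D &
    (\<exists>s\<in>src. ALL x. net (fset (foldl toggle F es)) x = net (fset F) x + of_bool (x = s) - of_bool (x = v))"
  using assms
proof (induction es arbitrary: v F)
  case Nil
  thus ?case by (auto intro!: bexI[of _ v])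
next
  case (Cons e es)
  have e: "v = snd e" "e |\<in>| resid D F" "fst e ~= v" "!!e'. e' \<in> set es ==> fst e' ~= v & snd e' ~= v"
    and p: "pth (fset (resid D F)) src (fst e) es" using Cons.prems by auto
  have "pth (fset (resid D (toggle F e))) src u es" if "pth (fset (resid D F)) src u es"
    "!!e'. e' \<in> set es ==> fst e' ~= snd e & snd e' ~= snd e" for u es
    using that
  proof (induction es arbitrary: u)
    case (Cons e' es)
    have "e' |\<in>| resid D (toggle F e) \<longleftrightarrow> e' |\<in>| resid D F"
      using Cons.prems(2)[of e'] by (intro resid_toggle_other) auto
    thus ?case using Cons by auto
  qed simp
  hence p': "pth (fset (resid D (toggle F e))) src (fst e) es" using p e by auto
  have "toggle F e |\<subseteq>| D" using e(2) Cons.prems(2) by (auto simp: toggle_def resid_def)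
  moreover have "(snd e, fst e) |\<in>| F | e |\<notin>| F" using e(2) by (auto simp: resid_def)
  hence "net (fset (toggle F e)) x = net (fset F) x + of_bool (x = fst e) - of_bool (x = snd e)" for x
    using e by (intro net_toggle) auto
  ultimately show ?case using Cons.IH[OF p'] e(1) by auto
qed

definition aug_step :: "('v::enc \<times> 'v) fset => 'v fset => 'v fset => ('v \<times> 'v) fset => ('v \<times> 'v) fset" where
  "aug_step D src snk F = (let qs = filter (%p. fst p |\<in>| snk) (search (resid D F) src)
     in if qs = [] then F else foldl toggle F (snd (hd qs)))"

text \<open>With unit capacities the value never exceeds the number of arcs, and each successful
  round raises it by one; one round more than there are arcs therefore ends without an augmenting
  path.\<close>

definition maxflow :: "('v::enc \<times> 'v) fset => 'v fset => 'v fset => ('v \<times> 'v) fset" where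
  "maxflow D src snk = foldl (%F _. aug_step D src snk F) {||} (True # map (%_. True) (elems D))"

definition mincut :: "('v::enc \<times> 'v) fset => 'v fset => 'v fset => 'v fset" where
  "mincut D src snk = fset_of_list (map fst (search (resid D (maxflow D src snk)) src))"

definition leaving :: "('v \<times> 'v) set => 'v set => ('v \<times> 'v) set" where
  "leaving D S = {e\<in>D. fst e \<in> S & snd e ~: S}"

definition entering :: "('v \<times> 'v) set => 'v set => ('v \<times> 'v) set" where
  "entering D S = {e\<in>D. fst e ~: S & snd e \<in> S}"

text \<open>Arcs with both ends in \<open>S\<close> contribute once as outgoing and once as
  incoming, and cancel.\<close>

lemma sum_net:
  assumes "finite F" "finite S"
  shows "(\<Sum>x\<in>S. net F x) = int (card (leaving F S)) - int (card (entering F S))"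
proof -
  let ?I = "{e\<in>F. fst e \<in> S & snd e \<in> S}"
  have out: "(\<Sum>x\<in>S. card {y. (x, y) \<in> F}) = card {e\<in>F. fst e \<in> S}"
  proof -
    have "(\<Sum>x\<in>S. card {y. (x, y) \<in> F}) = card (SIGMA x:S. {y. (x, y) \<in> F})"
      using assms finite_sections by (intro card_SigmaI[symmetric]) auto
    also have "(SIGMA x:S. {y. (x, y) \<in> F}) = {e\<in>F. fst e \<in> S}" by auto
    finally show ?thesis .
  qed
  have inn: "(\<Sum>x\<in>S. card {y. (y, x) \<in> F}) = card {e\<in>F. snd e \<in> S}"
  proof -
    have "(\<Sum>x\<in>S. card {y. (y, x) \<in> F}) = card (SIGMA x:S. {y. (y, x) \<in> F})"
      using assms finite_sections by (intro card_SigmaI[symmetric]) auto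
    also have "... = card (prod.swap ` (SIGMA x:S. {y. (y, x) \<in> F}))" by (rule card_image[symmetric]) (simp add: inj_on_def)
    also have "prod.swap ` (SIGMA x:S. {y. (y, x) \<in> F}) = {e\<in>F. snd e \<in> S}" by force
    finally show ?thesis .
  qed
  have "{e\<in>F. fst e \<in> S} = ?I Un leaving F S" "?I Int leaving F S = {}" by (auto simp: leaving_def)
  hence 1: "card {e\<in>F. fst e \<in> S} = card ?I + card (leaving F S)"
    using assms(1) card_Un_disjoint[of ?I "leaving F S"] by (simp add: leaving_def)
  have "{e\<in>F. snd e \<in> S} = ?I Un entering F S" "?I Int entering F S = {}" by (auto simp: entering_def)
  hence 2: "card {e\<in>F. snd e \<in> S} = card ?I + card (entering F S)"
    using assms(1) card_Un_disjoint[of ?I "entering F S"] by (simp add: entering_def)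
  have "(\<Sum>x\<in>S. net F x) = int (\<Sum>x\<in>S. card {y. (x, y) \<in> F}) - int (\<Sum>x\<in>S. card {y. (y, x) \<in> F})"
    unfolding net_def sum_subtractf by simp
  thus ?thesis unfolding out inn 1 2 by simp
qed

context
  fixes D :: "('v::enc \<times> 'v) fset" and src snk :: "'v fset"
  assumes disj: "src |\<inter>| snk = {||}"
begin

definition flow :: "('v \<times> 'v) fset => bool" where
  "flow F \<longleftrightarrow> F |\<subseteq>| D & (ALL x. x |\<notin>| src --> x |\<notin>| snk --> net (fset F) x = 0)"

definition val :: "('v \<times> 'v) fset => int" where
  "val F = (\<Sum>x\<in>fset src. net (fset F) x)"

lemma aug_step_cases:
  assumes "flow F"
  shows "flow (aug_step D src snk F) &
     (aug_step D src snk F = F & heads (search (resid D F) src) Int fset snk = {} | val (aug_step D src snk F) = val F + 1)"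
proof -
  let ?ps = "search (resid D F) src"
  let ?qs = "filter (%p. fst p |\<in>| snk) ?ps"
  show ?thesis
  proof (cases "?qs = []")
    case True
    hence "aug_step D src snk F = F" by (simp add: aug_step_def)
    moreover have "heads ?ps Int fset snk = {}" using True by (auto simp: filter_empty_conv)
    ultimately show ?thesis using assms by simp
  next
    case False
    let ?p = "hd ?qs"
    let ?F = "foldl toggle F (snd ?p)"
    have "?p \<in> set ?qs" using False by (rule hd_in_set)
    hence p: "?p \<in> set ?ps" "fst ?p |\<in>| snk" by auto
    have "pth (fset (resid D F)) (fset src) (fst ?p) (snd ?p)"
      using search_spec(1)[of "resid D F" src] p(1) unfolding search_inv_def by blast
    from augment[OF this] obtain s where F: "?F |\<subseteq>| D" and s: "s |\<in>| src"
      and net: "!!x. net (fset ?F) x = net (fset F) x + of_bool (x = s) - of_bool (x = fst ?p)"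
      using assms unfolding flow_def by blast
    have "fst ?p |\<notin>| src" using p(2) disj by blast
    hence "val ?F = val F + 1" using s
      unfolding val_def net by (simp add: sum.distrib sum_subtractf of_bool_def sum.delta)
    moreover have "flow ?F" using F assms net s p(2) unfolding flow_def by auto
    moreover have "aug_step D src snk F = ?F" using False by (simp add: aug_step_def)
    ultimately show ?thesis by simp
  qed
qed

lemma val_le: "flow F ==> val F <= int (fcard D)"
proof -
  assume F: "flow F"
  have "val F <= int (card (leaving (fset F) (fset src)))"
    unfolding val_def by (subst sum_net) auto
  also have "card (leaving (fset F) (fset src)) <= card (fset D)"
    using F by (intro card_mono) (auto simp: leaving_def flow_def)
  finally show ?thesis by (simp add: fcard.rep_eq)
qed

lemma foldl_aug:
  defines "G \<equiv> %ks :: bool list. foldl (%F _. aug_step D src snk F) {||} ks"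
  shows "flow (G ks) & (aug_step D src snk (G ks) = G ks & heads (search (resid D (G ks)) src) Int fset snk = {} | val (G ks) = int (length ks))"
proof (induction ks rule: rev_induct)
  case Nil
  have "flow {||}" by (simp add: flow_def net_def)
  moreover have "val {||} = 0" by (simp add: val_def net_def)
  ultimately show ?case by (simp add: G_def)
next
  case (snoc k ks)
  have e: "G (ks @ [k]) = aug_step D src snk (G ks)" by (simp add: G_def)
  moreover have "flow (G ks)" using snoc by blast
  note c = aug_step_cases[OF this]
  ultimately show ?case
  proof (cases "aug_step D src snk (G ks) = G ks & heads (search (resid D (G ks)) src) Int fset snk = {}")
    case True
    hence "G (ks @ [k]) = G ks" using e by simp
    thus ?thesis using True c by simp
  next
    case False
    hence "val (aug_step D src snk (G ks)) = int (length ks) + 1" using c snoc by auto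
    thus ?thesis using c e by simp
  qed
qed

lemma maxflow: "flow (maxflow D src snk)" "heads (search (resid D (maxflow D src snk)) src) Int fset snk = {}"
proof -
  have "length (True # map (%_. True) (elems D)) = Suc (fcard D)" by simp
  thus "flow (maxflow D src snk)" "heads (search (resid D (maxflow D src snk)) src) Int fset snk = {}"
    using foldl_aug[of "True # map (%_. True) (elems D)"] val_le[of "maxflow D src snk"] unfolding maxflow_def by auto
qed

lemma val_flow:
  assumes "flow F" "src |\<subseteq>| S" "S |\<inter>| snk = {||}"
  shows "val F = int (card (leaving (fset F) (fset S))) - int (card (entering (fset F) (fset S)))"
proof -
  have "(\<Sum>x\<in>fset S. net (fset F) x) = val F"
    unfolding val_def using assms by (intro sum.mono_neutral_right) (auto simp: flow_def)
  thus ?thesis using sum_net[of "fset F" "fset S"] by simp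
qed

text \<open>The set reached in the residual network is closed, so every arc leaving it carries flow
  and no flow enters it. Its capacity thus equals the value of the flow, which is at most the
  capacity of any other cut.\<close>

theorem mincut:
  shows "src |\<subseteq>| mincut D src snk" "mincut D src snk |\<inter>| snk = {||}"
    "src |\<subseteq>| S ==> S |\<inter>| snk = {||} ==>
      card (leaving (fset D) (fset (mincut D src snk))) <= card (leaving (fset D) (fset S))"
proof -
  let ?F = "maxflow D src snk"
  let ?ps = "search (resid D ?F) src"
  let ?S = "mincut D src snk"
  have S: "fset ?S = heads ?ps" unfolding mincut_def by (simp add: fset_of_list.rep_eq)
  show 1: "src |\<subseteq>| ?S" using search_spec(1)[of "resid D ?F" src] by (auto simp: search_inv_def S less_eq_fset.rep_eq)
  show 2: "?S |\<inter>| snk = {||}" using maxflow(2) S by (metis bot_fset.rep_eq fset_inject inf_fset.rep_eq)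
  assume S': "src |\<subseteq>| S" "S |\<inter>| snk = {||}"
  have cl: "closed_under (fset (resid D ?F)) (fset ?S)" using search_spec(2)[of "resid D ?F" src] S by simp
  have F: "?F |\<subseteq>| D" using maxflow(1) by (simp add: flow_def)
  have "leaving (fset D) (fset ?S) = leaving (fset ?F) (fset ?S)"
    using cl F by (auto simp: leaving_def closed_under_def resid_def)
  moreover have "entering (fset ?F) (fset ?S) = {}"
    using cl by (force simp: entering_def closed_under_def resid_def)
  ultimately have "int (card (leaving (fset D) (fset ?S))) = val ?F"
    using val_flow[OF maxflow(1) 1 2] by simp
  also have "... <= int (card (leaving (fset ?F) (fset S)))"
    using val_flow[OF maxflow(1) S'] by simp
  also have "card (leaving (fset ?F) (fset S)) <= card (leaving (fset D) (fset S))"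
    using F by (intro card_mono) (auto simp: leaving_def)
  finally show "card (leaving (fset D) (fset ?S)) <= card (leaving (fset D) (fset S))" by simp
qed

end

lemma pth_distinct: "pth R src v es ==> distinct (map snd es) & set es <= R"
  by (induction R src v es rule: pth.induct) auto

text \<open>Each reached node is listed once, and the arcs of its simple path are distinct.\<close>

lemma sz_search_state:
  assumes "search_inv (fset R) (fset src) ps"
  shows "sz ps <= 1 + (sz R + sz src) * ((sz R + sz src) + 1 + sz R * (sz R + 1) + 1 + 1)"
proof -
  let ?n = "sz R + sz src"
  have snd_le: "sz (snd e) <= sz R" if "e |\<in>| R" for e
    using sz_fset_mem[OF that] by (simp add: enc_prod_def)
  have "card (heads ps) <= card (fset src Un snd ` fset R)"
    using assms by (intro card_mono) (auto simp: search_inv_def)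
  also have "... <= card (fset src) + card (snd ` fset R)" by (rule card_Un_le)
  also have "card (snd ` fset R) <= card (fset R)" by (rule card_image_le) simp
  finally have "length ps <= fcard src + fcard R"
    using assms distinct_card[of "map fst ps"] by (simp add: search_inv_def fcard.rep_eq)
  hence len: "length ps <= ?n" using fcard_le_sz[of src] fcard_le_sz[of R] by linarith
  have "sz p + 1 <= ?n + 1 + sz R * (sz R + 1) + 1 + 1" if p: "p \<in> set ps" for p
  proof -
    have "fst p \<in> fset src Un snd ` fset R" using assms p by (auto simp: search_inv_def)
    hence 1: "sz (fst p) <= ?n" using sz_fset_mem[of "fst p" src] snd_le by fastforce
    have "pth (fset R) (fset src) (fst p) (snd p)" using assms p by (auto simp: search_inv_def)
    from pth_distinct[OF this] have d: "distinct (snd p)" "set (snd p) <= fset R" by (auto simp: distinct_map)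
    have "length (snd p) <= fcard R" using d card_mono[OF finite_fset d(2)] by (simp add: distinct_card fcard.rep_eq)
    hence l: "length (snd p) <= sz R" using fcard_le_sz[of R] by linarith
    have "(\<Sum>e\<leftarrow>snd p. sz e + 1) <= length (snd p) * (sz R + 1)"
      by (rule sum_list_bound) (use d sz_fset_mem[of _ R] in auto)
    also have "... <= sz R * (sz R + 1)" using l by (rule mult_right_mono) simp
    finally have "sz (snd p) <= 1 + sz R * (sz R + 1)" by (simp add: sz_list)
    thus ?thesis using 1 by (simp add: enc_prod_def)
  qed
  hence "(\<Sum>p\<leftarrow>ps. sz p + 1) <= length ps * (?n + 1 + sz R * (sz R + 1) + 1 + 1)" by (intro sum_list_bound) auto
  also have "... <= ?n * (?n + 1 + sz R * (sz R + 1) + 1 + 1)" using len by (rule mult_right_mono) simp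
  finally show ?thesis by (simp add: sz_list)
qed

lemma comp_search_base: "ptime UNIV (%_. 0) (%z. search (fst z) (snd z))"
  unfolding search_def
proof (rule comp_foldl_bd[where B="%z. 1 + (sz (fst z) + sz (snd z)) * ((sz (fst z) + sz (snd z)) + 1 + sz (fst z) * (sz (fst z) + 1) + 1 + 1)"])
  fix z :: "('a \<times> 'a) fset \<times> 'a fset" and ys zs
  assume e: "concat (map (%_. elems (fst z)) (elems (fst z))) = ys @ zs"
  have "set ys <= set (concat (map (%_. elems (fst z)) (elems (fst z))))" unfolding e by auto
  hence "set ys <= fset (fst z)" by auto
  from foldl_ext_inv[OF search_init this, of "snd z"]
  show "sz (foldl ext_arc (map (%s. (s, [])) (elems (snd z))) ys)
    <= 1 + (sz (fst z) + sz (snd z)) * ((sz (fst z) + sz (snd z)) + 1 + sz (fst z) * (sz (fst z) + 1) + 1 + 1)"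
    by (rule sz_search_state)
qed ((unfold ext_arc_def)?, intro comp_intros pbd_add pbd_mult pbd_const comp_size)+

lemma comp_resid [comp_intros]:
  assumes "ptime D T f" "ptime D T g" shows "ptime D T (%x. resid (f x) (g x))"
proof -
  have "ptime UNIV (%_. 0) (%z. resid (fst z) (snd z))" unfolding resid_def by (intro comp_intros)
  from comp_op2[OF this assms] show ?thesis .
qed

lemma comp_toggle [comp_intros]:
  assumes "ptime D T f" "ptime D T g" shows "ptime D T (%x. toggle (f x) (g x))"
proof -
  have "ptime UNIV (%_. 0) (%z. toggle (fst z) (snd z))" unfolding toggle_def by (intro comp_intros)
  from comp_op2[OF this assms] show ?thesis .
qed

lemma sz_finsert: "sz (finsert x S) <= sz S + sz x + 1"
  by (cases "x |\<in>| S") (simp_all add: sz_fset finsert_absorb)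

lemma sz_toggles: "sz (foldl toggle F es) <= sz F + sz es"
proof (induction es arbitrary: F)
  case (Cons e es)
  have "sz (toggle F e) <= sz F + sz e + 1"
    using sz_fset_mono[OF fminus_fsubset, of F "{|(snd e, fst e)|}"] sz_finsert[of e F] by (auto simp: toggle_def)
  thus ?case using Cons[of "toggle F e"] by simp
qed simp

lemma comp_toggles [comp_intros]:
  assumes "ptime D T f" "ptime D T g" shows "ptime D T (%x. foldl toggle (f x) (g x))"
proof (rule comp_foldl_bd[where B="%x. sz (f x) + sz (g x)"])
  fix x ys zs assume "g x = ys @ zs"
  thus "sz (foldl toggle (f x) ys) <= sz (f x) + sz (g x)"
    using sz_toggles[of "f x" ys] sz_prefix[of ys zs] by simp
qed (intro comp_intros assms pbd_add comp_size)+

lemma comp_aug_step [comp_intros]: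
  assumes "ptime D T f" "ptime D T g" "ptime D T h" "ptime D T k" shows "ptime D T (%x. aug_step (f x) (g x) (h x) (k x))"
proof -
  have "ptime UNIV (%_. 0) (%z. aug_step (fst z) (fst (snd z)) (fst (snd (snd z))) (snd (snd (snd z))))"
    unfolding aug_step_def Let_def by (intro comp_intros comp_op2[OF comp_search_base])
  from comp_op4[OF this assms] show ?thesis .
qed

lemma comp_maxflow_base: "ptime UNIV (%_. 0) (%z. maxflow (fst z) (fst (snd z)) (snd (snd z)))"
    unfolding maxflow_def
  proof (rule comp_foldl_bd[where B="%z. sz (fst z)"])
    fix z :: "('a \<times> 'a) fset \<times> 'a fset \<times> 'a fset" and ys zs
    \<comment> \<open>Augmentation keeps the flow inside the network, which bounds the size of all
      intermediate flows.\<close>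
    have sub: "aug_step D src snk F |\<subseteq>| D" if "F |\<subseteq>| D" for D :: "('a \<times> 'a) fset" and src snk F
    proof -
      let ?qs = "filter (%p. fst p |\<in>| snk) (search (resid D F) src)"
      show ?thesis
      proof (cases "?qs = []")
        case False
        hence "hd ?qs \<in> set (search (resid D F) src)" using hd_in_set[of ?qs] by auto
        hence "pth (fset (resid D F)) (fset src) (fst (hd ?qs)) (snd (hd ?qs))"
          using search_spec(1)[of "resid D F" src] unfolding search_inv_def by blast
        from augment[OF this that] show ?thesis using False by (simp add: aug_step_def)
      qed (use that in \<open>simp add: aug_step_def\<close>)
    qed
    have "foldl (%F _. aug_step (fst z) (fst (snd z)) (snd (snd z)) F) {||} (ys :: bool list) |\<subseteq>| fst z"
      by (induction ys rule: rev_induct) (auto intro: sub[THEN fsubsetD])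
    thus "sz (foldl (%F _. aug_step (fst z) (fst (snd z)) (snd (snd z)) F) {||} ys) <= sz (fst z)"
      by (rule sz_fset_mono)
  qed (intro comp_intros comp_size)+

lemma comp_mincut [comp_intros]:
  assumes "ptime D T f" "ptime D T g" "ptime D T h" shows "ptime D T (%x. mincut (f x) (g x) (h x))"
proof -
  have "ptime UNIV (%_. 0) (%z. mincut (fst z) (fst (snd z)) (snd (snd z)))"
    unfolding mincut_def by (intro comp_intros comp_op2[OF comp_search_base] comp_maxflow_base)
  from comp_op3[OF this assms] show ?thesis .
qed

subsection \<open>Approximating the treewidth\<close>

definition fadj :: "'v fset fset => 'v => 'v => bool" where
  "fadj H u v \<longleftrightarrow> fBex H (%h. u |\<in>| h & v |\<in>| h)"

abbreviation sets :: "'v fset fset => 'v set set" where "sets H \<equiv> fset ` fset H"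

lemma fadj_adj: "fadj H u v \<longleftrightarrow> adj (sets H) u v"
  by (auto simp: fadj_def adj_def)

text \<open>Every vertex is split into an entrance and an exit joined by an arc, so that minimum arc cuts
  yield minimum vertex separators.\<close>

definition network :: "'v fset fset => 'v fset => ((bool \<times> 'v) \<times> (bool \<times> 'v)) fset" where
  "network H V = (%v. ((False, v), (True, v))) |`| V |\<union>|
     ffUnion ((%u. (%v. ((True, u), (False, v))) |`| ffilter (%v. fadj H u v) V) |`| V)"

text \<open>Sources are entrances of \<open>Z1\<close> and sinks are exits of \<open>Z2\<close>, so
  vertices of \<open>Z1\<close> and \<open>Z2\<close> may themselves be used as separators. Arcs
  between different vertices have unit capacity too and may be cut; the heads of such arcs are put
  into the separator as well.\<close>

definition sepcut :: "'v::enc fset fset => 'v fset => 'v fset => 'v fset => 'v fset \<times> 'v fset" where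
  "sepcut H V Z1 Z2 =
     (let S = mincut (network H V) ((%z. (False, z)) |`| Z1) ((%z. (True, z)) |`| Z2) in
      (ffilter (%v. (True, v) |\<in>| S) V,
       ffilter (%v. ~ (True, v) |\<in>| S & ((False, v) |\<in>| S | fBex V (%u. (True, u) |\<in>| S & fadj H u v))) V))"

lemma in_network: "e |\<in>| network H V \<longleftrightarrow> (EX v. v |\<in>| V & e = ((False, v), (True, v))) |
   (EX u v. u |\<in>| V & v |\<in>| V & fadj H u v & e = ((True, u), (False, v)))"
  unfolding network_def by (auto simp: ffUnion.rep_eq)

lemma sepcut:
  assumes "sepcut H V Z1 Z2 = (U, X)" "Z1 |\<subseteq>| V" "Z2 |\<subseteq>| V"
  shows "U |\<subseteq>| V" "X |\<subseteq>| V" "Z1 |\<subseteq>| U |\<union>| X" "Z2 |\<inter>| U = {||}"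
    and "!!u y. u |\<in>| U ==> y |\<in>| V ==> fadj H u y ==> y |\<in>| U | y |\<in>| X"
    and "!!U' X'. U' |\<subseteq>| V ==> X' |\<subseteq>| V ==> Z1 |\<subseteq>| U' |\<union>| X' ==> Z2 |\<inter>| U' = {||} ==>
      (!!u y. u |\<in>| U' ==> y |\<in>| V ==> fadj H u y ==> y |\<in>| U' | y |\<in>| X') ==> fcard X <= fcard X'"
proof -
  let ?D = "network H V"
  let ?s = "(%z. (False, z)) |`| Z1" and ?t = "(%z. (True, z)) |`| Z2"
  define S where "S = mincut ?D ?s ?t"
  have U: "U = ffilter (%v. (True, v) |\<in>| S) V" and
    X: "X = ffilter (%v. (True, v) |\<notin>| S & ((False, v) |\<in>| S | fBex V (%u. (True, u) |\<in>| S & fadj H u v))) V"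
    using assms(1) unfolding sepcut_def Let_def S_def by auto
  have disj: "?s |\<inter>| ?t = {||}" by auto
  note mc = mincut[OF disj, where D="?D", folded S_def]
  show "U |\<subseteq>| V" "X |\<subseteq>| V" by (auto simp: U X)
  have "(False, z) |\<in>| S" if "z |\<in>| Z1" for z using fsubsetD[OF mc(1)] that by auto
  moreover have "z |\<in>| V" if "z |\<in>| Z1" for z using assms(2) that by blast
  ultimately show "Z1 |\<subseteq>| U |\<union>| X" unfolding U X by fastforce
  show "Z2 |\<inter>| U = {||}" using mc(2) by (auto simp: U)
  show "y |\<in>| U | y |\<in>| X" if "u |\<in>| U" "y |\<in>| V" "fadj H u y" for u y
    using that by (auto simp: U X)
  fix U' X' assume a: "U' |\<subseteq>| V" "X' |\<subseteq>| V" "Z1 |\<subseteq>| U' |\<union>| X'" "Z2 |\<inter>| U' = {||}"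
    and sep: "!!u y. u |\<in>| U' ==> y |\<in>| V ==> fadj H u y ==> y |\<in>| U' | y |\<in>| X'"
  \<comment> \<open>The cut induced by a rival separation: only the inner arcs of vertices in
    \<open>X'\<close> leave it, so its capacity is at most the size of \<open>X'\<close>.\<close>
  let ?S' = "(%z. (False, z)) |`| (U' |\<union>| X') |\<union>| (%z. (True, z)) |`| U'"
  \<comment> \<open>Each vertex of \<open>X\<close> is charged to a cut arc that ends in its
    entrance or exit, hence \<open>X\<close> is no larger than the cut.\<close>
  have "fset X <= (%e. snd (snd e)) ` leaving (fset ?D) (fset S)"
  proof
    fix v assume v: "v |\<in>| X"
    hence vV: "v |\<in>| V" "(True, v) |\<notin>| S" by (auto simp: X)
    show "v \<in> (%e. snd (snd e)) ` leaving (fset ?D) (fset S)"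
    proof (cases "(False, v) |\<in>| S")
      case True
      hence "((False, v), (True, v)) \<in> leaving (fset ?D) (fset S)" using vV by (auto simp: leaving_def in_network)
      thus ?thesis by (force simp: image_iff)
    next
      case False
      then obtain u where "u |\<in>| V" "(True, u) |\<in>| S" "fadj H u v" using v by (auto simp: X)
      hence "((True, u), (False, v)) \<in> leaving (fset ?D) (fset S)" using False vV by (auto simp: leaving_def in_network)
      thus ?thesis by (force simp: image_iff)
    qed
  qed
  hence "fcard X <= card ((%e. snd (snd e)) ` leaving (fset ?D) (fset S))"
    unfolding fcard.rep_eq by (intro card_mono) (auto simp: leaving_def)
  also have "... <= card (leaving (fset ?D) (fset S))" by (rule card_image_le) (auto simp: leaving_def)
  also have "... <= card (leaving (fset ?D) (fset ?S'))"
    by (rule mc(3)) (use a in auto)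
  also have "... <= card ((%v. ((False, v), (True, v))) ` fset X')"
  proof (rule card_mono)
    show "leaving (fset ?D) (fset ?S') <= (%v. ((False, v), (True, v))) ` fset X'"
      using sep by (fastforce simp: leaving_def in_network)
  qed simp
  also have "... <= fcard X'" unfolding fcard.rep_eq by (rule card_image_le) simp
  finally show "fcard X <= fcard X'" .
qed

text \<open>A separator smaller than the two equally large sets is a gain: on either side it
  replaces one of the sets in the frontier.\<close>

definition good_pair :: "'v::enc fset fset => 'v fset => 'v fset \<times> 'v fset => bool" where
  "good_pair H V z \<longleftrightarrow> ~ fcard (fst z) < fcard (snd z) & ~ fcard (snd z) < fcard (fst z) &
     fcard (snd (sepcut H V (fst z) (snd z))) < fcard (fst z)"

definition candidates :: "'v::enc fset fset => 'v fset => 'v fset => ('v fset \<times> 'v fset) list" where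
  "candidates H V W = filter (%z. good_pair H V z) (elems (ffUnion ((%Z1. (%Z2. (Z1, Z2)) |`| fPow W) |`| fPow W)))"

definition split_piece :: "'v::enc fset fset => 'v fset => 'v fset => 'v fset \<times> 'v fset" where
  "split_piece H V W = (if candidates H V W = [] then (V, {||})
     else sepcut H V (fst (hd (candidates H V W))) (snd (hd (candidates H V W))))"

lemma candidates_mem: "z \<in> set (candidates H V W) \<longleftrightarrow> fst z |\<subseteq>| W & snd z |\<subseteq>| W & good_pair H V z"
  unfolding candidates_def by (cases z) (auto simp: ffUnion.rep_eq)

lemma split_piece:
  assumes "split_piece H V W = (U, X)" "W |\<subseteq>| V"
  shows "U |\<subseteq>| V" "X |\<subseteq>| V" "!!u y. u |\<in>| U ==> y |\<in>| V ==> fadj H u y ==> y |\<in>| U | y |\<in>| X"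
    "fcard X <= fcard W"
    "candidates H V W ~= [] ==> fcard ((W |\<inter>| U) |\<union>| X) < fcard W & fcard ((W |-| U) |\<union>| X) < fcard W"
    "candidates H V W = [] ==> U = V & X = {||}"
proof -
  have "U |\<subseteq>| V & X |\<subseteq>| V & (ALL u y. u |\<in>| U --> y |\<in>| V --> fadj H u y --> y |\<in>| U | y |\<in>| X) & fcard X <= fcard W &
    (candidates H V W ~= [] --> fcard ((W |\<inter>| U) |\<union>| X) < fcard W & fcard ((W |-| U) |\<union>| X) < fcard W)"
  proof (cases "candidates H V W = []")
    case True
    thus ?thesis using assms by (auto simp: split_piece_def fcard_fempty)
  next
    case False
    define Z1 Z2 where "Z1 = fst (hd (candidates H V W))" and "Z2 = snd (hd (candidates H V W))"
    have "hd (candidates H V W) \<in> set (candidates H V W)" using False by (rule hd_in_set)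
    hence Z: "Z1 |\<subseteq>| W" "Z2 |\<subseteq>| W" and g: "good_pair H V (hd (candidates H V W))"
      by (auto simp: candidates_mem Z1_def Z2_def)
    have sc: "sepcut H V Z1 Z2 = (U, X)" using assms(1) False by (simp add: split_piece_def Z1_def Z2_def)
    have c: "fcard Z1 = fcard Z2" "fcard X < fcard Z1" using g sc by (auto simp: good_pair_def Z1_def Z2_def)
    have ZV: "Z1 |\<subseteq>| V" "Z2 |\<subseteq>| V" using Z assms(2) by auto
    note sp = sepcut[OF sc ZV]
    have fin: "finite (fset W)" "finite (fset X)" by auto
    \<comment> \<open>Passing to one side loses the part of \<open>Z\<close> outside
      \<open>X\<close> and adds the part of \<open>X\<close> outside \<open>W\<close>. Counting
      \<open>Z\<close> inside \<open>X\<close> on both sides of the balance, the frontier changes by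
      at most the size of \<open>X\<close> minus that of \<open>Z\<close>, which is
      negative.\<close>
    have key: "card (A Un fset X) < card (fset W)"
      if A: "A <= fset W" "A Int (Z - fset X) = {}" and Z: "Z <= fset W" "card Z = fcard Z1" for A Z
    proof -
      have "A Un fset X <= (fset W - (Z - fset X)) Un (fset X - fset W)" using A by auto
      hence "card (A Un fset X) <= card ((fset W - (Z - fset X)) Un (fset X - fset W))" by (intro card_mono) auto
      also have "... <= card (fset W - (Z - fset X)) + card (fset X - fset W)" by (rule card_Un_le)
      also have "card (fset W - (Z - fset X)) = card (fset W) - card (Z - fset X)"
        using Z(1) by (intro card_Diff_subset) (auto intro: finite_subset)
      finally have 1: "card (A Un fset X) <= card (fset W) - card (Z - fset X) + card (fset X - fset W)" .
      have "finite Z" using finite_subset[OF Z(1)] by simp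
      have "card (Z Int fset X) + card (fset X - fset W) <= card (fset X)"
        using Z(1) by (subst card_Un_disjoint[symmetric]) (auto intro!: card_mono)
      moreover have "card Z = card (Z - fset X) + card (Z Int fset X)"
        using card_Int_Diff[OF \<open>finite Z\<close>, of "fset X"] by simp
      moreover have "card (Z - fset X) <= card (fset W)" using Z(1) by (intro card_mono) auto
      ultimately show ?thesis using 1 Z(2) c(2) by (simp add: fcard.rep_eq)
    qed
    have "card ((fset W Int fset U) Un fset X) < card (fset W)"
      by (rule key[of _ "fset Z2"]) (use sp(4) Z c(1) in \<open>auto simp: fcard.rep_eq less_eq_fset.rep_eq\<close>)
    moreover have "card ((fset W - fset U) Un fset X) < card (fset W)"
      by (rule key[of _ "fset Z1"]) (use sp(3) Z in \<open>auto simp: fcard.rep_eq less_eq_fset.rep_eq\<close>)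
    moreover have "fcard Z1 <= fcard W" using Z(1) by (rule fcard_mono)
    ultimately show ?thesis using sp c by (auto simp: fcard.rep_eq)
  qed
  thus "U |\<subseteq>| V" "X |\<subseteq>| V" "!!u y. u |\<in>| U ==> y |\<in>| V ==> fadj H u y ==> y |\<in>| U | y |\<in>| X"
    "fcard X <= fcard W"
    "candidates H V W ~= [] ==> fcard ((W |\<inter>| U) |\<union>| X) < fcard W & fcard ((W |-| U) |\<union>| X) < fcard W" by auto
  show "candidates H V W = [] ==> U = V & X = {||}" using assms(1) by (simp add: split_piece_def)
qed

text \<open>A balanced separation with \<open>m = b + 1\<close> puts between \<open>b + 1\<close>
  and \<open>2 * b + 1\<close> vertices of \<open>W\<close> into \<open>U\<close>. Of at least
  \<open>4 * b + 2\<close> vertices, at least \<open>b + 1\<close> then remain outside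
  \<open>U\<close> and the separator, so both sides contain \<open>b + 1\<close> vertices that are
  separated by at most \<open>b\<close>.\<close>

lemma candidates_exist:
  assumes "elim_width b vs (sets H)" "distinct vs" "set vs = \<Union>(sets H)" "fset V <= \<Union>(sets H)" "W |\<subseteq>| V"
    and "4 * b + 2 <= fcard W"
  shows "candidates H V W ~= []"
proof -
  have "fset W <= \<Union>(sets H)" using assms(4,5) by (auto simp: less_eq_fset.rep_eq)
  then obtain U X where UX: "finite X" "card X <= b" "separates (sets H) U X"
     "Suc b <= card (U Int fset W)" "card (U Int fset W) < 2 * Suc b"
    using balanced_separation[OF assms(1) _ assms(2,3), of "fset W" "Suc b"] assms(6) by (auto simp: fcard.rep_eq)
  obtain Z1 where Z1: "Z1 <= U Int fset W" "card Z1 = Suc b" using obtain_subset_with_card_n[OF UX(4)] by blast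
  have "card (fset W) <= card (fset W - U - X) + card ((U Int fset W) Un X)"
    by (rule order_trans[OF _ card_Un_le]) (auto intro!: card_mono simp: UX)
  moreover have "card ((U Int fset W) Un X) <= card (U Int fset W) + card X" by (rule card_Un_le)
  ultimately have le: "Suc b <= card (fset W - U - X)" using UX assms(6) by (simp add: fcard.rep_eq)
  obtain Z2 where Z2: "Z2 <= fset W - U - X" "card Z2 = Suc b" using obtain_subset_with_card_n[OF le] by blast
  have fin: "finite Z1" "finite Z2" using finite_subset[of Z1 "fset W"] finite_subset[of Z2 "fset W"] Z1 Z2 by auto
  let ?Z1 = "Abs_fset Z1" and ?Z2 = "Abs_fset Z2"
  let ?U = "Abs_fset (U Int fset V)" and ?X = "Abs_fset (X Int fset V)"
  have fs: "fset ?Z1 = Z1" "fset ?Z2 = Z2" "fset ?U = U Int fset V" "fset ?X = X Int fset V"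
    using fin UX(1) by (auto simp: Abs_fset_inverse)
  have ZW: "?Z1 |\<subseteq>| W" "?Z2 |\<subseteq>| W" using Z1 Z2 by (auto simp: less_eq_fset.rep_eq fs)
  hence ZV: "?Z1 |\<subseteq>| V" "?Z2 |\<subseteq>| V" using assms(5) by auto
  obtain U0 X0 where sc: "sepcut H V ?Z1 ?Z2 = (U0, X0)" by fastforce
  have "fcard X0 <= fcard ?X"
  proof (rule sepcut(6)[OF sc ZV])
    show "?U |\<subseteq>| V" "?X |\<subseteq>| V" by (auto simp: less_eq_fset.rep_eq fs)
    show "?Z1 |\<subseteq>| ?U |\<union>| ?X" using Z1 ZV by (auto simp: less_eq_fset.rep_eq fs)
    show "?Z2 |\<inter>| ?U = {||}" using Z2 by (intro fset_eqI) (auto simp: fs)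
    show "y |\<in>| ?U | y |\<in>| ?X" if "u |\<in>| ?U" "y |\<in>| V" "fadj H u y" for u y
      using that UX(3) by (auto simp: fs fadj_adj separates_def)
  qed
  also have "... <= card X" unfolding fcard.rep_eq fs using UX(1) by (intro card_mono) auto
  finally have "good_pair H V (?Z1, ?Z2)" using sc Z1 Z2 UX(2) by (simp add: good_pair_def fcard.rep_eq fs)
  hence "(?Z1, ?Z2) \<in> set (candidates H V W)" using ZW by (simp add: candidates_mem)
  thus ?thesis by auto
qed

text \<open>A piece is a set \<open>C\<close> of vertices still to be placed, with a frontier
  \<open>W\<close> of placed ones. The order grows at its front, so that a frontier is eliminated
  after its piece. Adding \<open>hd (elems C)\<close> to the separator ensures that each step places
  a vertex.\<close>

definition piece_step :: "'v::enc fset fset => ('v fset \<times> 'v fset) list \<times> 'v list => ('v fset \<times> 'v fset) list \<times> 'v list" where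
  "piece_step H st = (if fst st = [] then st else
     (let C = fst (hd (fst st)); W = snd (hd (fst st));
          UX = split_piece H (C |\<union>| W) W; U = fst UX; X = finsert (hd (elems C)) (snd UX)
      in (filter (%p. fst p ~= {||}) [(C |\<inter>| U |-| X, (W |\<inter>| U) |\<union>| X), (C |-| U |-| X, (W |-| U) |\<union>| X)] @ tl (fst st),
          elems (X |\<inter>| C) @ snd st)))"

definition elim_order :: "'v::enc fset fset => 'v list" where
  "elim_order H = snd (foldl (%st _. piece_step H st)
     (if ffUnion H = {||} then [] else [(ffUnion H, {||})], []) (elems (ffUnion H)))"

text \<open>While the block \<open>xs\<close> is eliminated, all edges that meet it stay inside
  \<open>Y\<close>; the edges described by \<open>P\<close> are left alone and handed to
  \<open>acc\<close>.\<close>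

lemma elim_width_append:
  assumes "!!h. h \<in> Hs ==> h <= Y | P h & h Int set xs = {}" "finite Y" "card Y <= b"
    and "!!Hs'. (!!h. h \<in> Hs' ==> h <= Y - set xs | P h) ==> elim_width b acc Hs'"
  shows "elim_width b (xs @ acc) Hs"
  using assms
proof (induction xs arbitrary: Y Hs)
  case Nil
  show ?case using Nil.prems(4)[of Hs] Nil.prems(1) by auto
next
  case (Cons x xs)
  have hit: "hits x Hs <= Y" using Cons.prems(1) by (fastforce simp: hits_def)
  hence "finite (hits x Hs)" "card (hits x Hs) <= b"
    using Cons.prems(2,3) finite_subset card_mono[OF Cons.prems(2) hit] by auto
  moreover have "elim_width b (xs @ acc) (elim x Hs)"
  proof (rule Cons.IH[of _ "Y - {x}"])
    fix h assume "h \<in> elim x Hs"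
    thus "h <= Y - {x} | P h & h Int set xs = {}" using hit Cons.prems(1) unfolding elim_def by fastforce
  next
    show "card (Y - {x}) <= b" using Cons.prems(2,3) card_mono[of Y "Y - {x}"] by auto
    show "elim_width b acc Hs'" if "!!h. h \<in> Hs' ==> h <= Y - {x} - set xs | P h" for Hs'
      using that by (intro Cons.prems(4)) (simp add: Diff_insert2 set_diff_eq, blast?)
  qed (use Cons.prems(2) in auto)
  ultimately show ?case by simp
qed

text \<open>Since the order is built from the back, the hypergraph that remains once the pieces are
  eliminated is not known yet. The last clause therefore covers every hypergraph whose edges lie
  within a frontier or within an original edge that avoids all pieces.\<close>

definition pieces_inv :: "'v fset fset => nat => ('v fset \<times> 'v fset) list \<times> 'v list => bool" where
  "pieces_inv H s st \<longleftrightarrow> (let Cs = (%p. fset (fst p)) ` set (fst st) in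
     distinct (snd st) & set (snd st) Int \<Union>Cs = {} & set (snd st) Un \<Union>Cs = \<Union>(sets H) &
     sorted_wrt (%p q. fst p |\<inter>| fst q = {||}) (fst st) &
     (\<forall>p\<in>set (fst st). fst p ~= {||} & fset (snd p) <= set (snd st) & fcard (snd p) <= s &
        (\<forall>h\<in>sets H. h Int fset (fst p) ~= {} --> h <= fset (fst p) Un fset (snd p))) &
     (ALL Hs. (\<forall>h\<in>Hs. (\<exists>p\<in>set (fst st). h <= fset (snd p)) | h = {} | (\<exists>e\<in>sets H. h <= e & e Int \<Union>Cs = {})) -->
        elim_width (2 * s + 1) (snd st) Hs))"

lemma pieces_inv_step:
  assumes H: "elim_width b vs (sets H)" "distinct vs" "set vs = \<Union>(sets H)"
    and inv: "pieces_inv H (4 * b + 2) st" and ne: "fst st ~= []"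
  shows "pieces_inv H (4 * b + 2) (piece_step H st) & length (snd st) < length (snd (piece_step H st))"
proof -
  obtain C W ps acc where st: "st = ((C, W) # ps, acc)" using ne by (cases st; cases "fst st") auto
  obtain U X0 where sp: "split_piece H (C |\<union>| W) W = (U, X0)" by fastforce
  define X where "X = finsert (hd (elems C)) X0"
  define P1 where "P1 = (C |\<inter>| U |-| X, (W |\<inter>| U) |\<union>| X)"
  define P2 where "P2 = (C |-| U |-| X, (W |-| U) |\<union>| X)"
  define ps' where "ps' = filter (%p. fst p ~= {||}) [P1, P2] @ ps"
  define xs where "xs = elems (X |\<inter>| C)"
  have step: "piece_step H st = (ps', xs @ acc)"
    unfolding piece_step_def st ps'_def P1_def P2_def xs_def X_def Let_def by (simp add: sp)
  define R where "R = (\<Union>p\<in>set ps. fset (fst p))"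
  note i = inv[unfolded pieces_inv_def st Let_def, simplified]
  have i1: "distinct acc" "fset C Int set acc = {}" "R Int set acc = {}" "set acc Un fset C Un R = \<Union>(sets H)"
    using i unfolding R_def by auto
  have i2: "fset C Int R = {}" "sorted_wrt (%p q. fst p |\<inter>| fst q = {||}) ps"
  proof -
    have "fset C Int fset (fst p) = {}" if "p \<in> set ps" for p
      using i that by (metis bot_fset.rep_eq inf_fset.rep_eq)
    thus "fset C Int R = {}" unfolding R_def by blast
    show "sorted_wrt (%p q. fst p |\<inter>| fst q = {||}) ps" using i by blast
  qed
  note i0 = inv[unfolded pieces_inv_def st Let_def fst_conv snd_conv]
  have all: "\<forall>p\<in>set ((C, W) # ps). fst p ~= {||} & fset (snd p) <= set acc & fcard (snd p) <= 4 * b + 2 &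
        (\<forall>h\<in>sets H. h Int fset (fst p) ~= {} --> h <= fset (fst p) Un fset (snd p))"
    using i0 by (elim conjE) assumption
  have i4': "fst p ~= {||}" "fset (snd p) <= set acc" "fcard (snd p) <= 4 * b + 2"
    "!!h. h \<in> sets H ==> h Int fset (fst p) ~= {} ==> h <= fset (fst p) Un fset (snd p)" if "p \<in> set ((C, W) # ps)" for p
    using bspec[OF all that] by blast+
  note i3 = i4'[of "(C, W)", OF list.set_intros(1), unfolded fst_conv snd_conv]
  note i4 = i4'[OF list.set_intros(2)]
  have i5: "elim_width (2 * (4 * b + 2) + 1) acc Hs"
    if "!!h. h \<in> Hs ==> h <= fset W | (\<exists>p\<in>set ps. h <= fset (snd p)) | h = {} | (\<exists>e\<in>sets H. h <= e & e Int (fset C Un R) = {})" for Hs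
  proof -
    have "(\<forall>h\<in>Hs. (\<exists>p\<in>set (fst st). h <= fset (snd p)) | h = {} |
       (\<exists>e\<in>sets H. h <= e & e Int \<Union>((%p. fset (fst p)) ` set (fst st)) = {}))"
      using that unfolding st R_def by auto
    thus ?thesis using inv unfolding pieces_inv_def Let_def st by auto
  qed
  have "hd (elems C) \<in> set (elems C)"
  proof (rule hd_in_set)
    show "elems C ~= []" using i3(1) set_elems[of C] by (metis bot_fset.rep_eq empty_set fset_inject)
  qed
  hence vC: "hd (elems C) |\<in>| C" by simp
  have WV: "W |\<subseteq>| C |\<union>| W" by auto
  note s = split_piece[OF sp WV]
  have WC: "fset W Int fset C = {}" "fset W Int R = {}" using i3(2) i1 by auto
  have XV: "fset X <= fset C Un fset W" using s(2) vC by (auto simp: X_def less_eq_fset.rep_eq)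
  have sepU: "y \<in> fset U Un fset X" if "u \<in> fset U" "y \<in> fset C Un fset W" "h \<in> sets H" "u \<in> h" "y \<in> h" for u y h
    using s(3)[of u y] that by (auto simp: fadj_adj adj_def X_def)
  \<comment> \<open>A split along a candidate pair saves at least one frontier vertex on each side,
    which pays for the additional vertex; without candidates the frontier has fewer than
    \<open>4 * b + 2\<close> vertices and can grow by one.\<close>
  have cardW: "fcard (snd P1) <= 4 * b + 2 & fcard (snd P2) <= 4 * b + 2"
  proof (cases "candidates H (C |\<union>| W) W = []")
    case True
    have "fset (C |\<union>| W) <= \<Union>(sets H)" using i1(4) i3(2) by auto
    hence "~ 4 * b + 2 <= fcard W" using candidates_exist[OF H _ WV] True by blast
    moreover have "snd P1 = finsert (hd (elems C)) W" "snd P2 = {|hd (elems C)|}"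
      using s(6)[OF True] by (auto simp: P1_def P2_def X_def)
    ultimately show ?thesis by (auto simp: fcard_finsert_if fcard_fempty)
  next
    case False
    have "snd P1 = finsert (hd (elems C)) ((W |\<inter>| U) |\<union>| X0)" "snd P2 = finsert (hd (elems C)) ((W |-| U) |\<union>| X0)"
      by (auto simp: P1_def P2_def X_def)
    thus ?thesis using s(5)[OF False] i3(3) by (auto simp: fcard_finsert_if)
  qed
  \<comment> \<open>The vertices placed now are eliminated inside the old frontier and the
    separator: \<open>4 * b + 2\<close> for each, plus the additional vertex. This is the origin of
    \<open>8 * b + 5\<close>.\<close>
  have cardX: "card (fset W Un fset X) <= 2 * (4 * b + 2) + 1"
  proof -
    have "card (fset W Un fset X) <= card (fset W) + card (fset X)" by (rule card_Un_le)
    also have "card (fset X) <= Suc (fcard X0)" unfolding X_def by (simp add: fcard.rep_eq card_insert_if)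
    finally show ?thesis using s(4) i3(3) by (simp add: fcard.rep_eq)
  qed
  have mem: "p \<in> set ps' \<longleftrightarrow> p \<in> {P1, P2} & fst p ~= {||} | p \<in> set ps" for p
    by (auto simp: ps'_def)
  have Cs': "\<Union>((%p. fset (fst p)) ` set ps') = (fset C - fset X) Un R"
  proof -
    have "\<Union>((%p. fset (fst p)) ` set ps') = fset (fst P1) Un fset (fst P2) Un R"
      unfolding R_def using mem by (auto simp: ps'_def)
    thus ?thesis by (auto simp: P1_def P2_def)
  qed
  have sx: "set xs = fset X Int fset C" by (simp add: xs_def)
  have "pieces_inv H (4 * b + 2) (ps', xs @ acc)"
    unfolding pieces_inv_def Let_def fst_conv snd_conv Cs'
  proof (intro conjI)
    show "distinct (xs @ acc)" using i1 sx by (auto simp: xs_def)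
    show "set (xs @ acc) Int (fset C - fset X Un R) = {}" using i1 i2 sx by auto
    show "set (xs @ acc) Un (fset C - fset X Un R) = \<Union> (sets H)" unfolding i1(4)[symmetric] using sx by auto
    have d12: "fst P1 |\<inter>| fst P2 = {||}" by (auto simp: P1_def P2_def)
    have "fst P1 |\<inter>| fst q = {||} & fst P2 |\<inter>| fst q = {||}" if "q \<in> set ps" for q
      using i2(1) that unfolding R_def P1_def P2_def by (auto intro!: fset_eqI)
    thus "sorted_wrt (%p q. fst p |\<inter>| fst q = {||}) ps'"
      unfolding ps'_def using d12 i2(2) by (auto simp: sorted_wrt_append)
    show "\<forall>p\<in>set ps'. fst p ~= {||} & fset (snd p) <= set (xs @ acc) & fcard (snd p) <= 4 * b + 2 &
        (\<forall>h\<in>sets H. h Int fset (fst p) ~= {} --> h <= fset (fst p) Un fset (snd p))"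
    proof
      fix p assume p: "p \<in> set ps'"
      have sub: "fset X Un fset W <= set (xs @ acc)" using XV i3(2) sx by auto
      have h1: "h <= fset (fst P1) Un fset (snd P1)" if h: "h \<in> sets H" "h Int fset (fst P1) ~= {}" for h
      proof -
        obtain u where u: "u \<in> h" "u \<in> fset C" "u \<in> fset U" using h(2) by (auto simp: P1_def)
        have "h <= fset C Un fset W" using i3(4)[OF h(1)] u by blast
        thus ?thesis using sepU[OF u(3) _ h(1) u(1)] unfolding P1_def by auto
      qed
      have h2: "h <= fset (fst P2) Un fset (snd P2)" if h: "h \<in> sets H" "h Int fset (fst P2) ~= {}" for h
      proof -
        obtain u where u: "u \<in> h" "u \<in> fset C" "u ~: fset U" "u ~: fset X" using h(2) by (auto simp: P2_def)
        have hs: "h <= fset C Un fset W" using i3(4)[OF h(1)] u by blast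
        have "y ~: fset U" if "y \<in> h" for y using sepU[of y u h] u h(1) that by auto
        thus ?thesis using hs unfolding P2_def by auto
      qed
      have "fset (snd P1) <= set (xs @ acc)" "fset (snd P2) <= set (xs @ acc)"
        using sub by (auto simp: P1_def P2_def)
      note P12 = this
      consider "p = P1" "fst p ~= {||}" | "p = P2" "fst p ~= {||}" | "p \<in> set ps" using p mem by blast
      thus "fst p ~= {||} & fset (snd p) <= set (xs @ acc) & fcard (snd p) <= 4 * b + 2 &
        (\<forall>h\<in>sets H. h Int fset (fst p) ~= {} --> h <= fset (fst p) Un fset (snd p))"
      proof cases
        case 1
        show ?thesis unfolding 1(1) using 1(2)[unfolded 1(1)] P12(1) conjunct1[OF cardW]
          by (intro conjI ballI impI) (assumption | rule h1, assumption+)+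
      next
        case 2
        show ?thesis unfolding 2(1) using 2(2)[unfolded 2(1)] P12(2) conjunct2[OF cardW]
          by (intro conjI ballI impI) (assumption | rule h2, assumption+)+
      next
        case 3
        show ?thesis
        proof (intro conjI ballI impI)
          show "fset (snd p) <= set (xs @ acc)" using i4(2)[OF 3] by auto
        qed (fact i4(1)[OF 3] i4(3)[OF 3] | rule i4(4)[OF 3], assumption+)+
      qed
    qed
    show "ALL Hs. (\<forall>h\<in>Hs. (\<exists>p\<in>set ps'. h <= fset (snd p)) | h = {} |
        (\<exists>e\<in>sets H. h <= e & e Int (fset C - fset X Un R) = {})) --> elim_width (2 * (4 * b + 2) + 1) (xs @ acc) Hs"
    proof (intro allI impI)
      fix Hs assume Hs: "\<forall>h\<in>Hs. (\<exists>p\<in>set ps'. h <= fset (snd p)) | h = {} |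
        (\<exists>e\<in>sets H. h <= e & e Int (fset C - fset X Un R) = {})"
      \<comment> \<open>Edges that may meet the newly placed vertices lie in \<open>?Y\<close>; all
        others satisfy \<open>?P\<close> and avoid these vertices.\<close>
      let ?Y = "fset W Un fset X"
      let ?P = "%h. (\<exists>p\<in>set ps. h <= fset (snd p)) | h = {} | (\<exists>e\<in>sets H. h <= e & e Int (fset C Un R) = {})"
      show "elim_width (2 * (4 * b + 2) + 1) (xs @ acc) Hs"
      proof (rule elim_width_append[of Hs ?Y ?P])
        fix h assume "h \<in> Hs"
        from bspec[OF Hs this] consider p where "p \<in> set ps'" "h <= fset (snd p)" | "h = {}" |
          e where "e \<in> sets H" "h <= e" "e Int (fset C - fset X Un R) = {}" by (elim disjE bexE conjE)
        thus "h <= ?Y | ?P h & h Int set xs = {}"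
        proof cases
          case 1
          show ?thesis
          proof (cases "p \<in> set ps")
            case True
            hence "h Int set xs = {}" using i4(2)[OF True] 1(2) i1(2) sx by auto
            moreover have "\<exists>p\<in>set ps. h <= fset (snd p)" using True 1(2) by blast
            ultimately show ?thesis by (intro disjI2 conjI disjI1[of "\<exists>p\<in>set ps. h <= fset (snd p)"])
          next
            case False
            hence "p = P1 | p = P2" using 1(1) mem by blast
            hence "fset (snd p) <= ?Y" by (auto simp: P1_def P2_def)
            thus ?thesis by (intro disjI1 order_trans[OF 1(2)])
          qed
        next
          case 2 thus ?thesis by simp
        next
          case 3
          show ?thesis
          proof (cases "e Int fset C = {}")
            case True
            hence "e Int (fset C Un R) = {}" using 3(3) by blast
            moreover have "h Int set xs = {}" using True 3(2) sx by auto
            moreover from calculation(1) have "\<exists>e\<in>sets H. h <= e & e Int (fset C Un R) = {}"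
              using 3(2) by (intro bexI[where x=e, OF _ 3(1)] conjI)
            ultimately show ?thesis by (intro disjI2 conjI)
          next
            case False
            hence "e <= fset C Un fset W" by (rule i3(4)[OF 3(1)])
            hence "h <= ?Y" using 3(2,3) by blast
            thus ?thesis by (rule disjI1)
          qed
        qed
      next
        fix Hs' assume a: "!!h. h \<in> Hs' ==> h <= ?Y - set xs | ?P h"
        have sub: "?Y - set xs <= fset W" using XV sx by auto
        show "elim_width (2 * (4 * b + 2) + 1) acc Hs'"
        proof (rule i5)
          fix h assume "h \<in> Hs'"
          from a[OF this] show "h <= fset W | (\<exists>p\<in>set ps. h <= fset (snd p)) | h = {} | (\<exists>e\<in>sets H. h <= e & e Int (fset C Un R) = {})"
            by (rule disj_forward) (use sub in auto)
        qed
      qed (use cardX in auto)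
    qed
  qed
  moreover have "hd (elems C) \<in> set xs" using vC sx by (simp add: X_def)
  hence "xs ~= []" by auto
  ultimately show ?thesis unfolding step by (simp add: st)
qed

text \<open>Disjoint nonempty pieces cannot outnumber the vertices; this keeps the state of the
  algorithm small.\<close>

lemma sum_disjoint_pieces:
  "sorted_wrt (%p q. fst p |\<inter>| fst q = {||}) ps ==> (!!p. p \<in> set ps ==> fst p ~= {||}) ==>
    length ps <= card (\<Union>p\<in>set ps. fset (fst p))"
proof (induction ps)
  case (Cons p ps)
  have "fset (fst p) Int (\<Union>p\<in>set ps. fset (fst p)) = {}"
    using Cons.prems(1) by (auto simp: fset_eq_iff)
  hence "card (\<Union>p\<in>set (p # ps). fset (fst p)) = card (fset (fst p)) + card (\<Union>p\<in>set ps. fset (fst p))"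
    by (simp add: card_Un_disjoint)
  moreover have "0 < card (fset (fst p))" using Cons.prems(2)[of p] by (auto simp: card_gt_0_iff)
  moreover have "length ps <= card (\<Union>p\<in>set ps. fset (fst p))" using Cons by auto
  ultimately show ?case by simp
qed simp

lemma piece_step_done: "fst st = [] ==> piece_step H st = st"
  by (simp add: piece_step_def)

context
  fixes H :: "'v::enc fset fset" and b vs
  assumes H: "elim_width b vs (sets H)" "distinct vs" "set vs = \<Union>(sets H)"
begin

abbreviation pieces_init :: "('v fset \<times> 'v fset) list \<times> 'v list" where
  "pieces_init \<equiv> (if ffUnion H = {||} then [] else [(ffUnion H, {||})], [])"

lemma pieces_init: "pieces_inv H (4 * b + 2) pieces_init"
proof -
  have "fset (ffUnion H) = \<Union>(sets H)" by (simp add: ffUnion.rep_eq)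
  moreover have "\<Union>(sets H) = {}" if "ffUnion H = {||}" using that calculation by simp
  moreover have "h <= fset (ffUnion H)" if "h \<in> sets H" for h using that by (auto simp: ffUnion.rep_eq)
  ultimately show ?thesis unfolding pieces_inv_def Let_def by (auto simp: fcard_fempty)
qed

lemma pieces_steps:
  fixes ks :: "'v list"
  defines "st \<equiv> foldl (%st _. piece_step H st) pieces_init ks"
  shows "pieces_inv H (4 * b + 2) st & (fst st = [] | length ks <= length (snd st))"
  unfolding st_def
proof (induction ks rule: rev_induct)
  case Nil
  thus ?case using pieces_init by simp
next
  case (snoc k ks)
  let ?st = "foldl (%st _. piece_step H st) pieces_init ks"
  show ?case
  proof (cases "fst ?st = []")
    case True
    hence "piece_step H ?st = ?st" by (rule piece_step_done)
    thus ?thesis using snoc True by simp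
  next
    case False
    thus ?thesis using pieces_inv_step[OF H conjunct1[OF snoc] False] snoc by auto
  qed
qed

theorem elim_order:
  "distinct (elim_order H)" "set (elim_order H) = \<Union>(sets H)" "elim_width (8 * b + 5) (elim_order H) (sets H)"
proof -
  let ?V = "ffUnion H"
  let ?st = "foldl (%st _. piece_step H st) pieces_init (elems ?V)"
  have V: "fset ?V = \<Union>(sets H)" by (simp add: ffUnion.rep_eq)
  have inv: "pieces_inv H (4 * b + 2) ?st" and l: "fst ?st = [] | fcard ?V <= length (snd ?st)"
    using pieces_steps[of "elems ?V"] by auto
  obtain ps acc where pa: "?st = (ps, acc)" by fastforce
  note inv = inv[unfolded pa pieces_inv_def Let_def fst_conv snd_conv]
  have i: "distinct acc" "set acc Int \<Union>((%p. fset (fst p)) ` set ps) = {}"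
    "set acc Un \<Union>((%p. fset (fst p)) ` set ps) = \<Union>(sets H)"
    by (fact conjunct1[OF inv] conjunct1[OF conjunct2[OF inv]] conjunct1[OF conjunct2[OF conjunct2[OF inv]]])+
  note inv5 = conjunct2[OF conjunct2[OF conjunct2[OF conjunct2[OF inv]]]]
  have ne: "fst p ~= {||}" if "p \<in> set ps" for p
    using bspec[OF conjunct1[OF inv5] that] by (rule conjunct1)
  \<comment> \<open>After as many steps as there are vertices, all of them are placed if any piece
    is left, and then none remains for a nonempty piece.\<close>
  have ps: "ps = []"
  proof (rule ccontr)
    assume "ps ~= []"
    hence p: "hd ps \<in> set ps" by (rule hd_in_set)
    have "fcard ?V <= card (set acc)" using l \<open>ps ~= []\<close> i(1) unfolding pa by (simp add: distinct_card)
    moreover have "set acc <= fset ?V" using i(3) V by blast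
    ultimately have eq: "set acc = fset ?V" by (intro card_seteq) (auto simp: fcard.rep_eq)
    have "fset (fst (hd ps)) <= \<Union>((%p. fset (fst p)) ` set ps)" using p by blast
    moreover have "fset (fst (hd ps)) ~= {}" using ne[OF p] by (metis bot_fset.rep_eq fset_inject)
    ultimately show False using i(2,3) eq V by blast
  qed
  have o: "elim_order H = acc" unfolding elim_order_def pa by simp
  have w: "ALL Hs. (\<forall>h\<in>Hs. (\<exists>p\<in>set ps. h <= fset (snd p)) | h = {} | (\<exists>e\<in>sets H. h <= e & e Int \<Union>((%p. fset (fst p)) ` set ps) = {})) -->
        elim_width (2 * (4 * b + 2) + 1) acc Hs"
    by (rule conjunct2[OF inv5])
  have "elim_width (2 * (4 * b + 2) + 1) acc (sets H)"
    by (rule w[rule_format]) (auto simp: ps)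
  thus "distinct (elim_order H)" "set (elim_order H) = \<Union>(sets H)" "elim_width (8 * b + 5) (elim_order H) (sets H)"
  proof -
    have e: "2 * (4 * b + 2) + 1 = 8 * b + 5" by simp
    assume "elim_width (2 * (4 * b + 2) + 1) acc (sets H)"
    thus "elim_width (8 * b + 5) (elim_order H) (sets H)" unfolding e o .
  qed (use i in \<open>auto simp: ps o\<close>)
qed

end

lemma comp_fadj [comp_intros]:
  assumes "ptime D T f" "ptime D T g" "ptime D T h" shows "ptime D T (%x. fadj (f x) (g x) (h x))"
proof -
  have "ptime UNIV (%_. 0) (%z. fadj (fst z) (fst (snd z)) (snd (snd z)))" unfolding fadj_def by (intro comp_intros)
  from comp_op3[OF this assms] show ?thesis .
qed

lemma comp_sepcut [comp_intros]:
  assumes "ptime D T f" "ptime D T g" "ptime D T h" "ptime D T k" shows "ptime D T (%x. sepcut (f x) (g x) (h x) (k x))"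
proof -
  have nw: "ptime UNIV (%_. 0) (%z. network (fst z) (snd z))" unfolding network_def by (intro comp_intros)
  have "ptime UNIV (%_. 0) (%z. sepcut (fst z) (fst (snd z)) (fst (snd (snd z))) (snd (snd (snd z))))"
    unfolding sepcut_def Let_def by (intro comp_intros comp_op2[OF nw])
  from comp_op4[OF this assms] show ?thesis .
qed

lemma comp_candidates_base: "ptime UNIV (%z. 2 ^ fcard (snd (snd z))) (%z. candidates (fst z) (fst (snd z)) (snd (snd z)))"
  unfolding candidates_def good_pair_def by (intro comp_intros comp_fPow) (rule pbd_le, simp)+

lemma comp_split_piece_base: "ptime UNIV (%z. 2 ^ fcard (snd (snd z))) (%z. split_piece (fst z) (fst (snd z)) (snd (snd z)))"
  unfolding split_piece_def by (intro comp_intros comp_candidates_base)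

lemma comp_piece_step_base: "ptime UNIV (%z. 2 ^ fcard (snd (hd (fst (snd z))))) (%z. piece_step (fst z) (snd z))"
proof -
  have "ptime UNIV (%z. 2 ^ fcard (snd (hd (fst (snd z)))))
    (%z. (%z. split_piece (fst z) (fst (snd z)) (snd (snd z))) (fst z, fst (hd (fst (snd z))) |\<union>| snd (hd (fst (snd z))), snd (hd (fst (snd z)))))"
    by (rule comp_compose[OF comp_split_piece_base]) (intro comp_intros | simp)+
  hence sp: "ptime UNIV (%z. 2 ^ fcard (snd (hd (fst (snd z)))))
    (%z. split_piece (fst z) (fst (hd (fst (snd z))) |\<union>| snd (hd (fst (snd z)))) (snd (hd (fst (snd z)))))"
    by simp
  show ?thesis
    unfolding piece_step_def Let_def by (intro comp_intros sp)
qed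

lemma sz_subset_list: "distinct xs ==> set xs <= fset S ==> sz xs <= sz S"
proof -
  assume a: "distinct xs" "set xs <= fset S"
  have "sz xs = 1 + (\<Sum>x\<in>set xs. sz x + 1)" unfolding sz_list by (subst sum_list_distinct_conv_sum_set) (use a in auto)
  also have "... <= sz S" unfolding sz_fset using a by (intro add_left_mono sum_mono2) auto
  finally show ?thesis .
qed

text \<open>The bound \<open>b\<close> is not an input: a split is made whenever some candidate pair
  exists. It only shows that frontiers stay below \<open>4 * b + 2\<close>, so that all pairs of
  their subsets can be tried in time polynomial in \<open>2 ^ b\<close>.\<close>

lemma comp_elim_order:
  assumes f: "ptime D T f" and b: "!!x. x \<in> D ==> EX vs. elim_width (b x) vs (sets (f x)) & distinct vs & set vs = \<Union>(sets (f x))"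
    and T: "pbd D (%x. 2 ^ b x) (%x. sz x + T x)"
  shows "ptime D T (%x. elim_order (f x))"
proof -
  let ?V = "%x. ffUnion (f x)"
  have V: "ptime D T ?V" by (intro comp_intros f)
  let ?init = "%x. (if ?V x = {||} then [] else [(?V x, {||})], []) :: ('b fset \<times> 'b fset) list \<times> 'b list"
  have st: "pieces_inv (f x) (4 * b x + 2) (foldl (%st _. piece_step (f x) st) (?init x) ys)" if "x \<in> D" for x and ys :: "'b list"
    using b[OF that] pieces_steps[of "b x" _ "f x" ys] by blast
  let ?D1 = "{z. fst z \<in> D & (EX ys zs. elems (?V (fst z)) = ys @ snd (snd z) # zs & fst (snd z) = foldl (%st _. piece_step (f (fst z)) st) (?init (fst z)) ys)}"
  let ?D2 = "{z. fst z \<in> D & (EX ys zs. elems (?V (fst z)) = ys @ zs & snd z = foldl (%st _. piece_step (f (fst z)) st) (?init (fst z)) ys)}"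
  have pw: "pbd D (%x. 2 ^ (4 * b x + 2)) (%x. sz x + T x)"
    using pbd_mult[OF pbd_power[OF T, of 4] pbd_const[of D 4]] by (simp add: power_add power_mult[symmetric] mult.commute)
  have f1: "ptime ?D1 (%z. T (fst z)) (%z. f (fst z))"
    by (rule comp_compose[OF f comp_fst[OF comp_id]]) (auto intro!: pbd_le)
  have "ptime ?D1 (%z. T (fst z)) (%z. (%z. piece_step (fst z) (snd z)) (f (fst z), fst (snd z)))"
  proof (rule comp_compose[OF comp_piece_step_base])
    show "ptime ?D1 (%z. T (fst z)) (%z. (f (fst z), fst (snd z)))" by (intro comp_intros f1)
    \<comment> \<open>The second summand is for states without pieces, where the time bound mentions
      the unspecified but constant \<open>hd []\<close>.\<close>
    have "2 ^ fcard (snd (hd (fst (fst (snd z))))) <= 2 ^ (4 * b (fst z) + 2) + (2::nat) ^ fcard (snd (hd [] :: 'b fset \<times> 'b fset))"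
      if z: "z \<in> ?D1" for z
    proof -
      obtain ys :: "'b list" where e: "fst (snd z) = foldl (%st _. piece_step (f (fst z)) st) (?init (fst z)) ys" "fst z \<in> D" using z by blast
      have inv: "pieces_inv (f (fst z)) (4 * b (fst z) + 2) (fst (snd z))" unfolding e(1) by (rule st[OF e(2)])
      show ?thesis
      proof (cases "fst (fst (snd z)) = []")
        case False
        hence "fcard (snd (hd (fst (fst (snd z))))) <= 4 * b (fst z) + 2"
          using inv hd_in_set[OF False] unfolding pieces_inv_def Let_def by blast
        thus ?thesis by (intro trans_le_add1) (rule power_increasing, simp_all)
      qed simp
    qed
    moreover have "pbd ?D1 (%z. 2 ^ (4 * b (fst z) + 2) + 2 ^ fcard (snd (hd [] :: 'b fset \<times> 'b fset))) (%z. sz z + T (fst z))"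
      by (intro pbd_add pbd_const pbd_mono2[OF pbd_compose[OF pw, of ?D1 fst]]) (auto simp: enc_prod_def)
    ultimately show "pbd ?D1 (%z. 2 ^ fcard (snd (hd (fst (snd (f (fst z), fst (snd z))))))) (%z. sz z + T (fst z))"
      unfolding snd_conv by (rule pbd_mono[rotated])
  qed simp
  hence step: "ptime ?D1 (%z. T (fst z)) (%z. piece_step (f (fst z)) (fst (snd z)))" by simp
  let ?B = "%x. 1 + (1 + sz (?V x) * (2 * sz (?V x) + 2)) + sz (?V x)"
  have bd: "sz (foldl (%st _. piece_step (f x) st) (?init x) ys) <= ?B x" if x: "x \<in> D" for x and ys :: "'b list"
  proof -
    obtain ps acc where pa: "foldl (%st _. piece_step (f x) st) (?init x) ys = (ps, acc)" by fastforce
    note i = st[OF x, of ys, unfolded pa pieces_inv_def Let_def fst_conv snd_conv]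
    have Vs: "fset (?V x) = \<Union>(sets (f x))" by (simp add: ffUnion.rep_eq)
    have acc: "sz acc <= sz (?V x)" by (rule sz_subset_list) (use i Vs in auto)
    have "length ps <= card (\<Union>p\<in>set ps. fset (fst p))" by (rule sum_disjoint_pieces) (use i in auto)
    also have "... <= card (fset (?V x))" using i Vs by (intro card_mono) auto
    also have "... <= sz (?V x)" using fcard_le_sz[of "?V x"] by (simp add: fcard.rep_eq)
    finally have len: "length ps <= sz (?V x)" .
    have "sz p + 1 <= 2 * sz (?V x) + 2" if p: "p \<in> set ps" for p
    proof -
      have un: "set acc Un \<Union>((%p. fset (fst p)) ` set ps) = fset (?V x)"
        unfolding Vs by (rule conjunct1[OF conjunct2[OF conjunct2[OF i]]])
      have "\<forall>p\<in>set ps. fset (snd p) <= set acc" using i by blast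
      hence "fset (snd p) <= fset (?V x)" using un p by blast
      moreover have "fset (fst p) <= fset (?V x)" using un p by blast
      ultimately have "fst p |\<subseteq>| ?V x" "snd p |\<subseteq>| ?V x" by (simp_all add: less_eq_fset.rep_eq)
      thus ?thesis using sz_fset_mono[of "fst p" "?V x"] sz_fset_mono[of "snd p" "?V x"] by (simp add: enc_prod_def)
    qed
    hence "(\<Sum>p\<leftarrow>ps. sz p + 1) <= length ps * (2 * sz (?V x) + 2)" by (rule sum_list_bound)
    also have "... <= sz (?V x) * (2 * sz (?V x) + 2)" using len by (rule mult_right_mono) simp
    finally have "sz ps <= 1 + sz (?V x) * (2 * sz (?V x) + 2)" by (simp add: sz_list)
    thus ?thesis using acc unfolding pa by simp
  qed
  have "ptime D T (%x. foldl (%st _. piece_step (f x) st) (?init x) (elems (?V x)))"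
  proof (rule comp_foldl[OF _ _ step])
    have "pbd D ?B (%x. sz x + T x)" by (intro pbd_add pbd_mult pbd_const comp_size V)
    thus "pbd ?D2 (%z. sz (snd z)) (%z. sz (fst z) + T (fst z))"
    proof (rule pbd_mono[OF pbd_compose[of D ?B _ ?D2 fst]])
      fix z assume "z \<in> ?D2"
      then obtain ys :: "'b list" where "snd z = foldl (%st _. piece_step (f (fst z)) st) (?init (fst z)) ys" "fst z \<in> D" by blast
      thus "sz (snd z) <= ?B (fst z)" using bd by (simp only:)
    qed auto
  qed (intro comp_intros f)+
  thus ?thesis unfolding elim_order_def by (rule comp_snd)
qed

section \<open>Dynamic programming for the number of world views\<close>

subsection \<open>Answer sets of epistemic reducts\<close>

definition lit_true :: "'a set => 'a set => 'a lit => bool" where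
  "lit_true J N l = (case l of Pos a => a \<in> N | Neg a => a ~: J)"

text \<open>\<open>J\<close> is the interpretation with respect to which the reduct is taken and decides negated atoms.\<close>

definition holds :: "'a lit set => 'a set => 'a set => 'a body_elem => bool" where
  "holds I J N b = (case b of Lit l => lit_true J N l | ENot l => l \<in> I --> lit_true J N (compl l)
     | NegENot l => l \<in> I & lit_true J N l)"

definition sat :: "'a lit set => 'a set => 'a set => 'a rule => bool" where
  "sat I J N r \<longleftrightarrow> (\<forall>b\<in>fset (body r). holds I J N b) --> (\<exists>h\<in>fset (head r). h \<in> N)"

abbreviation "AS P I \<equiv> answer_sets (epistemic_reduct P I)"

text \<open>Both reducts only rewrite or delete bodies, so a rule can be evaluated in place: the
  guess \<open>I\<close> resolves epistemic literals, \<open>J\<close> decides negated atoms and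
  \<open>N\<close> the positive ones.\<close>

lemma model_reduct:
  "model N (gl_reduct (epistemic_reduct P I) J) \<longleftrightarrow> (\<forall>r\<in>P. sat I J N r)"
proof -
  let ?red = "%r. Rule (head r) (reduce_elem |`| ffilter (%b. ALL l. b = ENot l --> l \<in> I) (body r))"
  let ?gl = "%r. Rule (head r) (ffilter (%b. EX a. b = Lit (Pos a)) (body r))"
  let ?P = "%r. ALL l. NegENot l |\<in>| body r --> l \<in> I"
  have gl: "gl_reduct Q J = ?gl ` {r\<in>Q. neg_body r Int J = {}}" for Q by (auto simp: gl_reduct_def)
  have er: "epistemic_reduct P I = ?red ` {r\<in>P. ?P r}" by (auto simp: epistemic_reduct_def)
  have "model N (gl_reduct (epistemic_reduct P I) J) \<longleftrightarrow>
    (\<forall>r\<in>P. ?P r --> neg_body (?red r) Int J = {} --> satisfies N (?gl (?red r)))"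
    unfolding model_def gl er by auto
  moreover have "(?P r --> neg_body (?red r) Int J = {} --> satisfies N (?gl (?red r))) \<longleftrightarrow> sat I J N r" for r
  proof -
    let ?hs = "fset (head r)" and ?bs = "fset (body r)"
    \<comment> \<open>A literal of the reduct has three possible origins: itself, an epistemic
      literal of its complement, or a negated epistemic literal.\<close>
    have red: "Lit l \<in> reduce_elem ` ({b. ALL l. b = ENot l --> l \<in> I} Int ?bs) \<longleftrightarrow>
       Lit l \<in> ?bs | (ENot (compl l) \<in> ?bs & compl l \<in> I) | NegENot l \<in> ?bs" for l
    proof -
      have cc: "compl (compl l) = l" for l :: "'a lit" by (cases l) auto
      have "Lit l = reduce_elem b \<longleftrightarrow> b = Lit l | b = ENot (compl l) | b = NegENot l" for b
        by (cases b) (auto simp: cc)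
      thus ?thesis by (auto simp: image_iff)
    qed
    have nb: "neg_body (?red r) = {a. Lit (Neg a) |\<in>| body r | (ENot (Pos a) |\<in>| body r & Pos a \<in> I) | NegENot (Neg a) |\<in>| body r}"
      using red[of "Neg _"] by (simp add: neg_body_def fimage.rep_eq)
    have pb: "pos_body (?gl (?red r)) = {a. Lit (Pos a) |\<in>| body r | (ENot (Neg a) |\<in>| body r & Neg a \<in> I) | NegENot (Pos a) |\<in>| body r}"
      using red[of "Pos _"] by (simp add: pos_body_def fimage.rep_eq)
    have nb2: "neg_body (?gl (?red r)) = {}" by (auto simp: neg_body_def)
    have "(?P r & neg_body (?red r) Int J = {} & pos_body (?gl (?red r)) <= N) \<longleftrightarrow> (\<forall>b\<in>?bs. holds I J N b)"
    proof
      assume a: "?P r & neg_body (?red r) Int J = {} & pos_body (?gl (?red r)) <= N"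
      show "\<forall>b\<in>?bs. holds I J N b"
      proof
        fix b assume b: "b \<in> ?bs"
        show "holds I J N b"
        proof (cases b)
          case (Lit l) thus ?thesis using a b unfolding nb pb by (cases l) (auto simp: holds_def lit_true_def)
        next
          case (ENot l) thus ?thesis using a b unfolding nb pb by (cases l) (auto simp: holds_def lit_true_def)
        next
          case (NegENot l) thus ?thesis using a b unfolding nb pb by (cases l) (auto simp: holds_def lit_true_def)
        qed
      qed
    next
      assume a: "\<forall>b\<in>?bs. holds I J N b"
      have "?P r" using a by (force simp: holds_def)
      moreover have "neg_body (?red r) Int J = {}" unfolding nb using a by (force simp: holds_def lit_true_def)
      moreover have "pos_body (?gl (?red r)) <= N" unfolding pb using a by (force simp: holds_def lit_true_def)
      ultimately show "?P r & neg_body (?red r) Int J = {} & pos_body (?gl (?red r)) <= N" by blast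
    qed
    thus ?thesis unfolding satisfies_def sat_def nb2 by auto
  qed
  ultimately show ?thesis by simp
qed

lemma answer_sets_reduct:
  "AS P I = {J. (\<forall>r\<in>P. sat I J J r) & (ALL N. N \<subset> J --> (\<exists>r\<in>P. ~ sat I J N r))}"
  unfolding answer_sets_def model_reduct by blast

fun lit_atom :: "'a lit => 'a" where "lit_atom (Pos a) = a" | "lit_atom (Neg a) = a"

fun elem_lit :: "'a body_elem => 'a lit" where
  "elem_lit (Lit l) = l" | "elem_lit (ENot l) = l" | "elem_lit (NegENot l) = l"

definition rule_atoms :: "'a rule => 'a fset" where
  "rule_atoms r = head r |\<union>| (%b. lit_atom (elem_lit b)) |`| body r"

abbreviation scopes_of :: "'a rule list => 'a set set" where
  "scopes_of rs \<equiv> sets (fset_of_list (map rule_atoms rs))"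

lemma set_lit_atom: "set_lit l = {lit_atom l}" by (cases l) auto

lemma set_body_elem_atom: "set_body_elem b = {lit_atom (elem_lit b)}" by (cases b) (auto simp: set_lit_atom)

lemma rule_atoms: "fset (rule_atoms r) = set_rule r"
  by (cases r) (auto simp: rule_atoms_def set_body_elem_atom)

abbreviation lits_of :: "'a set => 'a lit set" where "lits_of A \<equiv> {l. lit_atom l \<in> A}"

lemma lits_lits_of: "lits P = lits_of (atoms P)"
proof -
  have "l \<in> Pos ` A Un Neg ` A \<longleftrightarrow> lit_atom l \<in> A" for l :: "'a lit" and A by (cases l) auto
  thus ?thesis unfolding lits_def by blast
qed

lemma holds_local:
  assumes "I Int lits_of A = I' Int lits_of A" "J Int A = J' Int A" "N Int A = N' Int A" "lit_atom (elem_lit b) \<in> A"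
  shows "holds I J N b \<longleftrightarrow> holds I' J' N' b"
proof -
  have "l \<in> I \<longleftrightarrow> l \<in> I'" if "lit_atom l \<in> A" for l using assms(1) that by blast
  moreover have "lit_true J N l \<longleftrightarrow> lit_true J' N' l" if "lit_atom l \<in> A" for l
    using assms(2,3) that by (cases l) (auto simp: lit_true_def)
  moreover have "lit_atom (compl l) = lit_atom l" for l :: "'a lit" by (cases l) auto
  ultimately show ?thesis using assms(4) by (cases b) (auto simp: holds_def)
qed

lemma sat_local:
  assumes "I Int lits_of A = I' Int lits_of A" "J Int A = J' Int A" "N Int A = N' Int A" "set_rule r <= A"
  shows "sat I J N r \<longleftrightarrow> sat I' J' N' r"
proof -
  have "lit_atom (elem_lit b) \<in> A" if "b |\<in>| body r" for b
    using that assms(4) rule_atoms[of r] by (auto simp: rule_atoms_def)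
  hence "holds I J N b \<longleftrightarrow> holds I' J' N' b" if "b |\<in>| body r" for b
    using holds_local[OF assms(1-3)] that by blast
  moreover have "h \<in> N \<longleftrightarrow> h \<in> N'" if "h |\<in>| head r" for h
    using that assms(3,4) rule_atoms[of r] by (auto simp: rule_atoms_def)
  ultimately show ?thesis unfolding sat_def by simp
qed

lemma atoms_simps [simp]: "atoms {} = {}" "atoms {r} = fset (rule_atoms r)" "atoms (G1 Un G2) = atoms G1 Un atoms G2"
  by (auto simp: atoms_def rule_atoms)

lemma finite_atoms: "finite G ==> finite (atoms G)"
  unfolding atoms_def by (auto simp flip: rule_atoms)

subsection \<open>Counting world views by dynamic programming\<close>

definition guesses :: "'a set => 'a lit set set" where
  "guesses A = {I. I <= lits_of A & (ALL a. ~ (Pos a \<in> I & Neg a \<in> I))}"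

lemma lits_of_eq: "lits_of A = Pos ` A Un Neg ` A"
proof -
  have "l \<in> Pos ` A Un Neg ` A \<longleftrightarrow> lit_atom l \<in> A" for l :: "'a lit" by (cases l) auto
  thus ?thesis by blast
qed

lemma finite_lits_of: "finite A ==> finite (lits_of A)" by (simp add: lits_of_eq)

lemma finite_guesses: "finite A ==> finite (guesses A)"
  unfolding guesses_def by (rule finite_subset[OF _ finite_Pow_iff[THEN iffD2, OF finite_lits_of]]) auto

type_synonym ('a, 'q) key = "'a lit fset \<times> 'q fset \<times> 'q fset"

type_synonym ('a, 'q) table = "(('a, 'q) key \<times> nat) fset"

definition rflits :: "'a fset => 'a lit fset" where "rflits A = Pos |`| A |\<union>| Neg |`| A"

lemma rflits: "fset (rflits A) = lits_of (fset A)"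
  by (simp add: rflits_def lits_of_eq fimage.rep_eq)

definition consistent :: "'a lit fset => bool" where
  "consistent I \<longleftrightarrow> ~ fBex I (%l. compl l |\<in>| I)"

lemma consistent: "consistent I \<longleftrightarrow> (ALL a. ~ (Pos a |\<in>| I & Neg a |\<in>| I))"
proof -
  have "l |\<in>| I & compl l |\<in>| I \<longleftrightarrow> Pos (lit_atom l) |\<in>| I & Neg (lit_atom l) |\<in>| I" for l by (cases l) auto
  thus ?thesis unfolding consistent_def by (metis lit_atom.simps(1))
qed

text \<open>Tree automata that, guided by a guess \<open>I\<close>, recognise the answer sets of a program:
  \<open>St G X I\<close> contains the pairs of a candidate answer set \<open>J\<close> of the part \<open>G\<close> of the
  program and of a state, which only refers to the atoms of \<open>G\<close> that are not in \<open>X\<close>. The states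
  over the atoms \<open>B\<close> are in \<open>Qset B\<close>.\<close>

locale automaton =
  fixes leafq :: "'a::enc rule => 'a lit fset => 'q::enc fset"
    and joinq :: "'a fset => 'q => 'a fset => 'q => 'q fset"
    and forgetq :: "'a => 'q => 'q fset"
    and valq :: "'a => 'q => bool"
    and accq :: "'q => bool"
    and q0 :: 'q
    and St :: "'a rule set => 'a set => 'a lit set => ('a set \<times> 'q) set"
    and Qset :: "'a fset => 'q fset"
    and good :: "'a rule set => bool"
  assumes St_empty: "St {} {} I = {({}, q0)}"
    and St_leaf: "fset IB = I Int lits_of (fset (rule_atoms r)) ==> snd ` St {r} {} I = fset (leafq r IB)"
    and St_join: "X1 <= atoms G1 ==> X2 <= atoms G2 ==> X1 Int atoms G2 = {} ==> X2 Int atoms G1 = {} ==>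
      finite G1 ==> finite G2 ==> fset B1 = atoms G1 - X1 ==> fset B2 = atoms G2 - X2 ==> St (G1 Un G2) (X1 Un X2) I =
        {(J1 Un J2, q) |J1 J2 q q1 q2. (J1, q1) \<in> St G1 X1 I & (J2, q2) \<in> St G2 X2 I & q |\<in>| joinq B1 q1 B2 q2}"
    and St_forget: "finite G ==> X <= atoms G ==> v \<in> atoms G - X ==>
      St G (insert v X) I = {(J, q'). EX q. (J, q) \<in> St G X I & q' |\<in>| forgetq v q}"
    and St_val: "(J, q) \<in> St G X I ==> X <= atoms G ==> J <= atoms G & (\<forall>v\<in>atoms G - X. v \<in> J \<longleftrightarrow> valq v q)"
    and St_final: "finite G ==> good G ==> {J. EX q. (J, q) \<in> St G (atoms G) I & accq q} = AS G I"
    and St_local: "I Int lits_of (atoms G) = I' Int lits_of (atoms G) ==> St G X I = St G X I'"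
    and St_Qset: "(J, q) \<in> St G X I ==> finite G ==> X <= atoms G ==> fset B = atoms G - X ==> q |\<in>| Qset B"
begin

text \<open>Compatibility of one atom, relative to the candidates that reach a state in
  \<open>R\<close>. Only the existence of candidates is asked for, which is what a set of states can
  answer.\<close>

definition ok :: "'a rule set => 'a set => 'a lit set => 'q set => 'a => bool" where
  "ok G X I R v \<longleftrightarrow> ((EX J q. (J, q) \<in> St G X I & q \<in> R & v \<in> J) \<longleftrightarrow> Neg v ~: I) &
     ((EX J q. (J, q) \<in> St G X I & q \<in> R & v ~: J) \<longleftrightarrow> Pos v ~: I)"

definition kI :: "'a rule set => 'a set => 'a lit set => 'a lit fset" where
  "kI G X I = Abs_fset (I Int lits_of (atoms G - X))"

definition kS :: "'a rule set => 'a set => 'a lit set => 'q fset" where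
  "kS G X I = Abs_fset (snd ` St G X I)"

text \<open>The guesses for \<open>G\<close> with a given restriction \<open>fst k\<close> to the boundary and set \<open>fst (snd k)\<close> of
  reachable states that are correct for the atoms in \<open>X\<close>, provided that the states that are part
  of an accepting run are those in \<open>snd (snd k)\<close>.\<close>

definition cset :: "'a rule set => 'a set => ('a, 'q) key => 'a lit set set" where
  "cset G X k = {I\<in>guesses (atoms G). kI G X I = fst k & kS G X I = fst (snd k) & (\<forall>v\<in>X. ok G X I (fset (snd (snd k))) v)}"

definition keys :: "'a rule set => 'a set => ('a, 'q) key set" where
  "keys G X = {(kI G X I, kS G X I, R) |I R. I \<in> guesses (atoms G) & R |\<subseteq>| kS G X I}"

definition entry :: "'a rule set => 'a set => ('a, 'q) key => ('a, 'q) key \<times> nat" where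
  "entry G X k = (k, card (cset G X k))"

definition is_table :: "'a rule set => 'a set => ('a, 'q) table => bool" where
  "is_table G X t \<longleftrightarrow> fset t = entry G X ` keys G X"

lemma fset_kI: "finite G ==> fset (kI G X I) = I Int lits_of (atoms G - X)"
  unfolding kI_def by (rule Abs_fset_inverse) (simp add: finite_lits_of finite_atoms)

lemma fset_kS: "finite G ==> X <= atoms G ==> fset (kS G X I) = snd ` St G X I"
proof -
  assume G: "finite G" "X <= atoms G"
  let ?B = "Abs_fset (atoms G - X)"
  have "fset ?B = atoms G - X" by (rule Abs_fset_inverse) (simp add: finite_atoms G)
  hence "snd ` St G X I <= fset (Qset ?B)" using St_Qset[OF _ G] by fastforce
  from finite_subset[OF this] have "finite (snd ` St G X I)" by simp
  thus ?thesis unfolding kS_def by (simp add: Abs_fset_inverse)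
qed

lemma finite_cset: "finite G ==> finite (cset G X k)"
  unfolding cset_def by (rule finite_subset[OF _ finite_guesses[OF finite_atoms]]) auto

lemma St_restrict: "St G X (I Int lits_of (atoms G)) = St G X I"
  by (rule St_local) auto

lemma ok_restrict: "v \<in> atoms G ==> ok G X (I Int lits_of (atoms G)) R v \<longleftrightarrow> ok G X I R v"
  unfolding ok_def St_restrict by simp

subsubsection \<open>Single rules\<close>

definition leaf_table :: "'a rule => ('a, 'q) table" where
  "leaf_table r = ffUnion ((%I. (%R. ((I, leafq r I, R), 1)) |`| fPow (leafq r I)) |`|
     ffilter consistent (fPow (rflits (rule_atoms r))))"

definition unit_table :: "('a, 'q) table" where
  "unit_table = (%R. (({||}, {|q0|}, R), 1)) |`| fPow {|q0|}"

text \<open>As long as nothing is forgotten, the boundary part is the whole guess, so at most one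
  guess belongs to a key.\<close>

lemma card_cset_leaf:
  assumes "finite G" "I \<in> guesses (atoms G)" shows "card (cset G {} (kI G {} I, kS G {} I, R)) = 1"
proof -
  have "I' = I" if "I' \<in> guesses (atoms G)" "kI G {} I' = kI G {} I" for I'
    using that(1) assms(2) arg_cong[OF that(2), of fset] unfolding fset_kI[OF assms(1)] by (auto simp: guesses_def)
  hence "cset G {} (kI G {} I, kS G {} I, R) = {I}" using assms(2) by (auto simp: cset_def)
  thus ?thesis by simp
qed

lemma leaf_table: "is_table {r} {} (leaf_table r)"
proof -
  have kI: "kI {r} {} (fset I) = I" if "I |\<subseteq>| rflits (rule_atoms r)" for I
  proof -
    have "fset I <= lits_of (fset (rule_atoms r))" using that unfolding rflits[symmetric] by (simp add: less_eq_fset.rep_eq)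
    hence "fset (kI {r} {} (fset I)) = fset I" by (simp add: fset_kI Int_absorb2)
    thus ?thesis by (simp add: fset_inject)
  qed
  have kS: "kS {r} {} I = leafq r (kI {r} {} I)" for I
  proof -
    have "fset (kS {r} {} I) = snd ` St {r} {} I" by (rule fset_kS) auto
    also have "... = fset (leafq r (kI {r} {} I))" by (rule St_leaf) (simp add: fset_kI)
    finally show ?thesis by (simp add: fset_inject)
  qed
  have g: "fset I \<in> guesses (fset (rule_atoms r)) \<longleftrightarrow> consistent I & I |\<subseteq>| rflits (rule_atoms r)" for I
    unfolding guesses_def consistent by (auto simp: less_eq_fset.rep_eq rflits)
  have fin: "EX I'. I = fset I'" if "I \<in> guesses (fset (rule_atoms r))" for I
  proof -
    have "I <= lits_of (fset (rule_atoms r))" using that unfolding guesses_def by blast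
    hence "finite I" by (rule finite_subset) (simp add: finite_lits_of)
    thus ?thesis by (intro exI[of _ "Abs_fset I"]) (simp add: Abs_fset_inverse)
  qed
  have "keys {r} {} = {(I, leafq r I, R) |I R. consistent I & I |\<subseteq>| rflits (rule_atoms r) & R |\<subseteq>| leafq r I}"
  proof (intro set_eqI iffI)
    fix k assume "k \<in> keys {r} {}"
    then obtain I R where k: "k = (kI {r} {} I, kS {r} {} I, R)" "I \<in> guesses (fset (rule_atoms r))" "R |\<subseteq>| kS {r} {} I"
      unfolding keys_def by auto
    obtain I' where I': "I = fset I'" using fin[OF k(2)] by blast
    hence "consistent I'" "I' |\<subseteq>| rflits (rule_atoms r)" using k(2) g by auto
    thus "k \<in> {(I, leafq r I, R) |I R. consistent I & I |\<subseteq>| rflits (rule_atoms r) & R |\<subseteq>| leafq r I}"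
      using k I' kI[of I'] by (auto simp: kS)
  next
    fix k assume "k \<in> {(I, leafq r I, R) |I R. consistent I & I |\<subseteq>| rflits (rule_atoms r) & R |\<subseteq>| leafq r I}"
    then obtain I R where "k = (I, leafq r I, R)" "consistent I" "I |\<subseteq>| rflits (rule_atoms r)" "R |\<subseteq>| leafq r I" by blast
    moreover have "fset I \<in> guesses (atoms {r})" using calculation g by simp
    moreover have "kI {r} {} (fset I) = I" "kS {r} {} (fset I) = leafq r I" using calculation kI by (auto simp: kS)
    ultimately show "k \<in> keys {r} {}" unfolding keys_def by (metis (mono_tags, lifting) mem_Collect_eq)
  qed
  moreover have "entry {r} {} k = (k, 1)" if k: "k \<in> keys {r} {}" for k
  proof -
    obtain I R where "k = (kI {r} {} I, kS {r} {} I, R)" "I \<in> guesses (atoms {r})" using k unfolding keys_def by blast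
    thus ?thesis unfolding entry_def using card_cset_leaf[of "{r}" I R] by auto
  qed
  ultimately have "entry {r} {} ` keys {r} {} = (%k. (k, 1)) ` {(I, leafq r I, R) |I R. consistent I & I |\<subseteq>| rflits (rule_atoms r) & R |\<subseteq>| leafq r I}"
    by (metis (no_types, lifting) image_cong)
  thus ?thesis unfolding is_table_def leaf_table_def
    by (auto simp: ffUnion.rep_eq image_iff)
qed

lemma unit_table: "is_table {} {} unit_table"
proof -
  have g: "guesses {} = {{}}" by (auto simp: guesses_def)
  have "fset (kI {} {} {}) = {}" by (simp add: fset_kI)
  hence kI: "kI {} {} {} = {||}" by (metis bot_fset.rep_eq fset_inject)
  have "fset (kS {} {} {}) = {q0}" by (subst fset_kS) (auto simp: St_empty)
  hence kS: "kS {} {} {} = {|q0|}" by (metis bot_fset.rep_eq finsert.rep_eq fset_inject)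
  have "keys {} {} = {({||}, {|q0|}, R) |R. R |\<subseteq>| {|q0|}}" unfolding keys_def by (auto simp: g kI kS)
  moreover have "card (cset {} {} ({||}, {|q0|}, R)) = 1" for R
    using card_cset_leaf[of "{}" "{}" R] by (simp add: g kI kS)
  ultimately show ?thesis unfolding is_table_def unit_table_def by (auto simp: entry_def image_iff)
qed

subsubsection \<open>Forgetting an atom\<close>

definition forgetS :: "'a => 'q fset => 'q fset" where "forgetS v S = ffUnion (forgetq v |`| S)"

text \<open>Liveness runs backwards: a state extends to an accepting run if one of its successors
  does. The set \<open>R\<close> before forgetting is therefore determined by the one after it, and
  no guess is counted twice.\<close>

definition liftR :: "'a => 'q fset => 'q fset => 'q fset" where
  "liftR v S R = ffilter (%q. fBex (forgetq v q) (%q'. q' |\<in>| R)) S"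

definition dropI :: "'a => 'a lit fset => 'a lit fset" where "dropI v I = I |-| {|Pos v, Neg v|}"

definition check :: "'a => 'a lit fset => 'q fset => bool" where
  "check v I R \<longleftrightarrow> (fBex R (%q. valq v q) \<longleftrightarrow> ~ Neg v |\<in>| I) & (fBex R (%q. ~ valq v q) \<longleftrightarrow> ~ Pos v |\<in>| I)"

definition forget_keys :: "'a => ('a, 'q) table => ('a, 'q) key fset" where
  "forget_keys v t = ffUnion ((%e. (%R. (dropI v (fst (fst e)), forgetS v (fst (snd (fst e))), R)) |`|
     fPow (forgetS v (fst (snd (fst e))))) |`| t)"

definition forget_match :: "'a => ('a, 'q) key => ('a, 'q) key \<times> nat => bool" where
  "forget_match v k e \<longleftrightarrow> dropI v (fst (fst e)) = fst k & forgetS v (fst (snd (fst e))) = fst (snd k) &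
     snd (snd (fst e)) = liftR v (fst (snd (fst e))) (snd (snd k)) & check v (fst (fst e)) (snd (snd (fst e)))"

definition forget_table :: "'a => ('a, 'q) table => ('a, 'q) table" where
  "forget_table v t = (%k. (k, \<Sum>e\<in>fset (ffilter (forget_match v k) t). snd e)) |`| forget_keys v t"

lemma card_fibres:
  assumes "finite A" "finite T" "g ` A <= T" shows "card A = (\<Sum>y\<in>T. card {x\<in>A. g x = y})"
  using sum.group[OF assms, of "%_. 1::nat"] by simp

text \<open>Guesses stay the same when an atom is forgotten; only their keys become coarser and the
  atom is checked. The new count is the sum over all old keys that map to the new key, have the
  lifted \<open>R\<close> and pass the check.\<close>

lemma forget_table:
  assumes t: "is_table G X t" and G: "finite G" "X <= atoms G" "v \<in> atoms G - X"
  shows "is_table G (insert v X) (forget_table v t)"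
proof -
  let ?X = "insert v X"
  have X': "?X <= atoms G" using G by auto
  have kI: "kI G ?X I = dropI v (kI G X I)" for I
  proof -
    have "l = Pos v | l = Neg v" if "lit_atom l = v" for l using that by (cases l) auto
    hence "fset (kI G ?X I) = fset (dropI v (kI G X I))" by (auto simp: fset_kI G dropI_def)
    thus ?thesis by (simp add: fset_inject)
  qed
  have kS: "kS G ?X I = forgetS v (kS G X I)" for I
  proof -
    have "fset (kS G ?X I) = fset (forgetS v (kS G X I))"
      unfolding fset_kS[OF G(1) X'] St_forget[OF G] forgetS_def ffUnion.rep_eq fimage.rep_eq fset_kS[OF G(1,2)] by force
    thus ?thesis by (simp add: fset_inject)
  qed
  \<comment> \<open>Since a state is live exactly if one of its successors is, the live candidates
    are the same before and after forgetting.\<close>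
  have ex: "(EX J q. (J, q) \<in> St G ?X I & q |\<in>| R & P J) \<longleftrightarrow> (EX J q. (J, q) \<in> St G X I & q |\<in>| liftR v (kS G X I) R & P J)" for I R P
  proof -
    have "q |\<in>| liftR v (kS G X I) R \<longleftrightarrow> (EX q'. q' |\<in>| forgetq v q & q' |\<in>| R)" if "(J, q) \<in> St G X I" for J q
      using that fset_kS[OF G(1,2), of I] unfolding liftR_def by force
    thus ?thesis unfolding St_forget[OF G] by blast
  qed
  have ok: "ok G ?X I (fset R) u \<longleftrightarrow> ok G X I (fset (liftR v (kS G X I) R)) u" for I R u
    unfolding ok_def ex[of I R "%J. u \<in> J"] ex[of I R "%J. u ~: J"] ..
  have chk: "ok G X I (fset R) v \<longleftrightarrow> check v (kI G X I) R" if "R |\<subseteq>| kS G X I" for I R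
  proof -
    have R: "q |\<in>| R ==> EX J. (J, q) \<in> St G X I" for q
      using that fset_kS[OF G(1,2), of I] by (force simp: less_eq_fset.rep_eq)
    have val: "v \<in> J \<longleftrightarrow> valq v q" if "(J, q) \<in> St G X I" for J q
      using St_val[OF that G(2)] G(3) by blast
    have "(EX J q. (J, q) \<in> St G X I & q \<in> fset R & v \<in> J) \<longleftrightarrow> fBex R (%q. valq v q)"
      "(EX J q. (J, q) \<in> St G X I & q \<in> fset R & v ~: J) \<longleftrightarrow> fBex R (%q. ~ valq v q)"
      using R val by blast+
    thus ?thesis unfolding ok_def check_def fset_kI[OF G(1)] using G(3) by simp
  qed
  have keys: "fset (forget_keys v t) = keys G ?X"
  proof -
    have "fset (forget_keys v t) = (\<Union>k\<in>keys G X. (%R. (dropI v (fst k), forgetS v (fst (snd k)), R)) ` {R. R |\<subseteq>| forgetS v (fst (snd k))})"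
      unfolding forget_keys_def ffUnion.rep_eq fimage.rep_eq t[unfolded is_table_def] by (auto simp: entry_def)
    also have "... = keys G ?X" unfolding keys_def kI kS by force
    finally show ?thesis .
  qed
  have cnt: "(\<Sum>e\<in>fset (ffilter (forget_match v k) t). snd e) = card (cset G ?X k)" if k: "k \<in> keys G ?X" for k
  proof -
    let ?T = "fset (ffilter (forget_match v k) t)"
    \<comment> \<open>The unique old entry in which a guess is counted: boundary and reachable
      states are functions of the guess, and the live states are lifted from
      \<open>k\<close>.\<close>
    let ?g = "%I. entry G X (kI G X I, kS G X I, liftR v (kS G X I) (snd (snd k)))"
    have lR: "liftR v S R |\<subseteq>| S" for S R by (auto simp: liftR_def)
    have mem: "I \<in> cset G ?X k \<longleftrightarrow> I \<in> cset G X (kI G X I, kS G X I, liftR v (kS G X I) (snd (snd k))) &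
       forget_match v k (?g I)" for I
      unfolding cset_def kI kS using chk[OF lR] by (auto simp: forget_match_def entry_def ok)
    have img: "?g ` cset G ?X k <= ?T"
    proof
      fix e assume "e \<in> ?g ` cset G ?X k"
      then obtain I where I: "I \<in> cset G ?X k" "e = ?g I" by blast
      hence "(kI G X I, kS G X I, liftR v (kS G X I) (snd (snd k))) \<in> keys G X"
        using lR by (auto simp: keys_def cset_def)
      thus "e \<in> ?T" using t mem[of I] I unfolding is_table_def by simp
    qed
    have fib: "{I\<in>cset G ?X k. ?g I = e} = cset G X (fst e)" if e: "e \<in> ?T" for e
    proof (intro set_eqI iffI)
      fix I assume "I \<in> {I\<in>cset G ?X k. ?g I = e}"
      thus "I \<in> cset G X (fst e)" using mem[of I] by (auto simp: entry_def)
    next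
      fix I assume I: "I \<in> cset G X (fst e)"
      have e': "e = entry G X (fst e)" "forget_match v k e" using e t by (auto simp: is_table_def entry_def)
      have "fst e = (kI G X I, kS G X I, liftR v (kS G X I) (snd (snd k)))"
        using I e'(2) by (cases e) (auto simp: cset_def forget_match_def)
      thus "I \<in> {I\<in>cset G ?X k. ?g I = e}" using mem[of I] e' I by simp
    qed
    have "card (cset G ?X k) = (\<Sum>e\<in>?T. card {I\<in>cset G ?X k. ?g I = e})"
      by (rule card_fibres[OF finite_cset[OF G(1)] _ img]) simp
    also have "... = (\<Sum>e\<in>?T. snd e)"
    proof (rule sum.cong)
      fix e assume e: "e \<in> ?T"
      hence "e \<in> entry G X ` keys G X" using t by (auto simp: is_table_def)
      thus "card {I\<in>cset G ?X k. ?g I = e} = snd e" unfolding fib[OF e] by (auto simp: entry_def)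
    qed simp
    finally show ?thesis by simp
  qed
  show ?thesis unfolding is_table_def forget_table_def fimage.rep_eq keys
    by (rule image_cong) (simp_all only: entry_def cnt)
qed

end

type_synonym ('b, 'c) factor = "'b fset \<times> ('b, 'c) table"

text \<open>For a consistent guess and a nonempty set of answer sets, the conditions on an atom
  collapse into two equivalences about the existence of answer sets with and without it.\<close>

lemma world_views_guesses:
  "world_views G = {I\<in>guesses (atoms G). AS G I ~= {} &
    (\<forall>v\<in>atoms G. ((\<exists>J\<in>AS G I. v \<in> J) \<longleftrightarrow> Neg v ~: I) &
      ((\<exists>J\<in>AS G I. v ~: J) \<longleftrightarrow> Pos v ~: I))}"
proof -
  have wvi: "wvi G I \<longleftrightarrow> I \<in> guesses (atoms G)" for I by (simp add: wvi_def guesses_def lits_lits_of)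
  have "compatible G I A \<longleftrightarrow> A ~= {} & (\<forall>v\<in>atoms G. ((\<exists>J\<in>A. v \<in> J) \<longleftrightarrow> Neg v ~: I) & ((\<exists>J\<in>A. v ~: J) \<longleftrightarrow> Pos v ~: I))"
    if I: "I \<in> guesses (atoms G)" for I A
  proof -
    have out: "a \<in> atoms G" if "Pos a \<in> I | Neg a \<in> I" for a
      using I that by (auto simp: guesses_def)
    have cons: "~ (Pos a \<in> I & Neg a \<in> I)" for a using I by (auto simp: guesses_def)
    let ?c = "ALL a. (Pos a \<in> I --> (\<forall>J\<in>A. a \<in> J)) & (Neg a \<in> I --> (\<forall>J\<in>A. a ~: J)) &
        (a \<in> atoms G & Pos a ~: I & Neg a ~: I --> (\<exists>J\<in>A. a \<in> J) & (\<exists>J\<in>A. a ~: J))"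
    let ?d = "\<forall>v\<in>atoms G. ((\<exists>J\<in>A. v \<in> J) = (Neg v ~: I)) & ((\<exists>J\<in>A. v ~: J) = (Pos v ~: I))"
    have "?c \<longleftrightarrow> ?d" if nonempty: "A ~= {}"
    proof
      assume d: ?d
      show ?c
      proof
        fix a
        show "(Pos a \<in> I --> (\<forall>J\<in>A. a \<in> J)) & (Neg a \<in> I --> (\<forall>J\<in>A. a ~: J)) &
          (a \<in> atoms G & Pos a ~: I & Neg a ~: I --> (\<exists>J\<in>A. a \<in> J) & (\<exists>J\<in>A. a ~: J))"
          using bspec[OF d, of a] out[of a] by (cases "a \<in> atoms G") auto
      qed
    next
      assume c: ?c
      show ?d
      proof
        fix v assume v: "v \<in> atoms G"
        obtain J0 where "J0 \<in> A" using nonempty by blast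
        thus "((\<exists>J\<in>A. v \<in> J) = (Neg v ~: I)) & ((\<exists>J\<in>A. v ~: J) = (Pos v ~: I))"
          using spec[OF c, of v] v cons[of v] by (cases "Pos v \<in> I"; cases "Neg v \<in> I") auto
      qed
    qed
    thus ?thesis unfolding compatible_def by blast
  qed
  thus ?thesis unfolding world_views_def wvi by blast
qed

context automaton
begin

subsubsection \<open>Joining two parts\<close>

definition joinS :: "'a fset => 'q fset => 'a fset => 'q fset => 'q fset" where
  "joinS B1 S1 B2 S2 = ffUnion ((%q1. ffUnion ((%q2. joinq B1 q1 B2 q2) |`| S2)) |`| S1)"

text \<open>A state of one part is live if it combines with a reachable state of the other part into
  a live one; this is the counterpart of \<open>liftR\<close> for joins.\<close>

definition restr1 :: "'a fset => 'q fset => 'a fset => 'q fset => 'q fset => 'q fset" where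
  "restr1 B1 S1 B2 S2 R = ffilter (%q1. fBex S2 (%q2. fBex (joinq B1 q1 B2 q2) (%q. q |\<in>| R))) S1"

definition restr2 :: "'a fset => 'q fset => 'a fset => 'q fset => 'q fset => 'q fset" where
  "restr2 B1 S1 B2 S2 R = ffilter (%q2. fBex S1 (%q1. fBex (joinq B1 q1 B2 q2) (%q. q |\<in>| R))) S2"

text \<open>Forgotten atoms are private to their part, so agreement on the common boundary is
  agreement on all shared atoms.\<close>

definition compat :: "'a fset => 'a lit fset => 'a fset => 'a lit fset => bool" where
  "compat B1 I1 B2 I2 \<longleftrightarrow> ffilter (%l. lit_atom l |\<in>| B2) I1 = ffilter (%l. lit_atom l |\<in>| B1) I2"

definition join_pairs :: "'a fset => ('a, 'q) table => 'a fset => ('a, 'q) table =>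
    ((('a, 'q) key \<times> nat) \<times> (('a, 'q) key \<times> nat)) fset" where
  "join_pairs B1 t1 B2 t2 = ffilter (%e. compat B1 (fst (fst (fst e))) B2 (fst (fst (snd e))))
     (ffUnion ((%e1. (%e2. (e1, e2)) |`| t2) |`| t1))"

abbreviation pairS :: "'a fset => 'a fset => (('a, 'q) key \<times> nat) \<times> (('a, 'q) key \<times> nat) => 'q fset" where
  "pairS B1 B2 e \<equiv> joinS B1 (fst (snd (fst (fst e)))) B2 (fst (snd (fst (snd e))))"

definition join_keys :: "'a fset => ('a, 'q) table => 'a fset => ('a, 'q) table => ('a, 'q) key fset" where
  "join_keys B1 t1 B2 t2 = ffUnion ((%e. (%R. (fst (fst (fst e)) |\<union>| fst (fst (snd e)), pairS B1 B2 e, R)) |`|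
     fPow (pairS B1 B2 e)) |`| join_pairs B1 t1 B2 t2)"

definition join_match :: "'a fset => 'a fset => ('a, 'q) key => (('a, 'q) key \<times> nat) \<times> (('a, 'q) key \<times> nat) => bool" where
  "join_match B1 B2 k e \<longleftrightarrow> fst (fst (fst e)) |\<union>| fst (fst (snd e)) = fst k & pairS B1 B2 e = fst (snd k) &
     snd (snd (fst (fst e))) = restr1 B1 (fst (snd (fst (fst e)))) B2 (fst (snd (fst (snd e)))) (snd (snd k)) &
     snd (snd (fst (snd e))) = restr2 B1 (fst (snd (fst (fst e)))) B2 (fst (snd (fst (snd e)))) (snd (snd k))"

definition join_table :: "'a fset => ('a, 'q) table => 'a fset => ('a, 'q) table => ('a, 'q) table" where
  "join_table B1 t1 B2 t2 = (%k. (k, \<Sum>e\<in>fset (ffilter (join_match B1 B2 k) (join_pairs B1 t1 B2 t2)). snd (fst e) * snd (snd e)))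
     |`| join_keys B1 t1 B2 t2"

lemma in_kS: "finite G ==> X <= atoms G ==> q |\<in>| kS G X I \<longleftrightarrow> (EX J. (J, q) \<in> St G X I)"
  using fset_kS[of G X I] by (simp add: image_iff) force

context
  fixes G1 G2 :: "'a rule set" and X1 X2 :: "'a set" and B1 B2 :: "'a fset"
  assumes fin: "finite G1" "finite G2" and X: "X1 <= atoms G1" "X2 <= atoms G2"
    and priv: "X1 Int atoms G2 = {}" "X2 Int atoms G1 = {}"
    and B: "fset B1 = atoms G1 - X1" "fset B2 = atoms G2 - X2"
begin

lemma join_kI: "kI (G1 Un G2) (X1 Un X2) I = kI G1 X1 I |\<union>| kI G2 X2 I"
proof -
  have "fset (kI (G1 Un G2) (X1 Un X2) I) = fset (kI G1 X1 I |\<union>| kI G2 X2 I)"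
    using fin priv X by (auto simp: fset_kI)
  thus ?thesis by (rule fset_inject[THEN iffD1])
qed

lemma join_kS: "kS (G1 Un G2) (X1 Un X2) I = joinS B1 (kS G1 X1 I) B2 (kS G2 X2 I)"
proof -
  have XX: "X1 Un X2 <= atoms (G1 Un G2)" using X by auto
  have "q |\<in>| kS (G1 Un G2) (X1 Un X2) I \<longleftrightarrow> q |\<in>| joinS B1 (kS G1 X1 I) B2 (kS G2 X2 I)" for q
  proof -
    have "q |\<in>| kS (G1 Un G2) (X1 Un X2) I \<longleftrightarrow> (EX J. (J, q) \<in> St (G1 Un G2) (X1 Un X2) I)"
      using in_kS[OF _ XX] fin by simp
    also have "... \<longleftrightarrow> (EX q1 q2. (EX J. (J, q1) \<in> St G1 X1 I) & (EX J. (J, q2) \<in> St G2 X2 I) & q |\<in>| joinq B1 q1 B2 q2)"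
      unfolding St_join[OF X priv fin B] by blast
    also have "... \<longleftrightarrow> q |\<in>| joinS B1 (kS G1 X1 I) B2 (kS G2 X2 I)"
      unfolding in_kS[OF fin(1) X(1), symmetric] in_kS[OF fin(2) X(2), symmetric] by (auto simp: joinS_def ffUnion.rep_eq)
    finally show ?thesis .
  qed
  thus ?thesis by (rule fset_eqI)
qed

lemma join_compat: "compat B1 (kI G1 X1 I) B2 (kI G2 X2 I)"
proof -
  have "ffilter (%l. lit_atom l |\<in>| B2) (kI G1 X1 I) = ffilter (%l. lit_atom l |\<in>| B1) (kI G2 X2 I)"
    by (rule fset_eqI) (auto simp: fset_kI fin B)
  thus ?thesis by (simp add: compat_def)
qed

text \<open>The atom \<open>v\<close> does not occur in the candidates of the second part, so these
  matter only through the states they offer. The predicate \<open>P\<close> on truth values treats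
  membership and its negation at once.\<close>

lemma project_join:
  assumes S: "!!J q. (J, q) \<in> S \<longleftrightarrow> (EX J1 J2 q1 q2. J = J1 Un J2 & (J1, q1) \<in> S1 & (J2, q2) \<in> S2 & q |\<in>| j q1 q2)"
    and v: "!!J q. (J, q) \<in> S2 ==> v ~: J"
    and R: "!!J q1. (J, q1) \<in> S1 ==> q1 |\<in>| R' \<longleftrightarrow> (EX J2 q2 q. (J2, q2) \<in> S2 & q |\<in>| j q1 q2 & q |\<in>| R)"
  shows "(EX J q. (J, q) \<in> S & q |\<in>| R & P (v \<in> J)) \<longleftrightarrow> (EX J q. (J, q) \<in> S1 & q |\<in>| R' & P (v \<in> J))"
proof
  assume "EX J q. (J, q) \<in> S & q |\<in>| R & P (v \<in> J)"
  then obtain J1 J2 q q1 q2 where *: "(J1, q1) \<in> S1" "(J2, q2) \<in> S2" "q |\<in>| j q1 q2" "q |\<in>| R" "P (v \<in> J1 Un J2)"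
    unfolding S by blast
  thus "EX J q. (J, q) \<in> S1 & q |\<in>| R' & P (v \<in> J)"
    using v[OF *(2)] R[OF *(1)] by (intro exI[of _ J1] exI[of _ q1]) auto
next
  assume "EX J q. (J, q) \<in> S1 & q |\<in>| R' & P (v \<in> J)"
  then obtain J1 q1 where 1: "(J1, q1) \<in> S1" "q1 |\<in>| R'" "P (v \<in> J1)" by blast
  then obtain J2 q2 q where 2: "(J2, q2) \<in> S2" "q |\<in>| j q1 q2" "q |\<in>| R" using R[OF 1(1)] by blast
  have "P (v \<in> J1 Un J2)" using 1(3) v[OF 2(1)] by simp
  moreover have "(J1 Un J2, q) \<in> S" unfolding S using 1 2 by blast
  ultimately show "EX J q. (J, q) \<in> S & q |\<in>| R & P (v \<in> J)" using 2(3) by blast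
qed

lemma join_ok1:
  assumes "v \<in> X1"
  shows "ok (G1 Un G2) (X1 Un X2) I (fset R) v \<longleftrightarrow> ok G1 X1 I (fset (restr1 B1 (kS G1 X1 I) B2 (kS G2 X2 I) R)) v"
proof -
  have "(EX J q. (J, q) \<in> St (G1 Un G2) (X1 Un X2) I & q |\<in>| R & P (v \<in> J)) \<longleftrightarrow>
     (EX J q. (J, q) \<in> St G1 X1 I & q |\<in>| restr1 B1 (kS G1 X1 I) B2 (kS G2 X2 I) R & P (v \<in> J))" for P
  proof (rule project_join[where j="%q1 q2. joinq B1 q1 B2 q2"])
    show "v ~: J" if "(J, q) \<in> St G2 X2 I" for J q using St_val[OF that X(2)] assms priv by auto
    show "q1 |\<in>| restr1 B1 (kS G1 X1 I) B2 (kS G2 X2 I) R \<longleftrightarrow> (EX J2 q2 q. (J2, q2) \<in> St G2 X2 I & q |\<in>| joinq B1 q1 B2 q2 & q |\<in>| R)"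
      if "(J1, q1) \<in> St G1 X1 I" for J1 q1
    proof -
      have "q1 |\<in>| kS G1 X1 I" using that in_kS[OF fin(1) X(1)] by blast
      hence "q1 |\<in>| restr1 B1 (kS G1 X1 I) B2 (kS G2 X2 I) R \<longleftrightarrow> (EX q2. q2 |\<in>| kS G2 X2 I & (EX q. q |\<in>| joinq B1 q1 B2 q2 & q |\<in>| R))"
        unfolding restr1_def by auto
      thus ?thesis unfolding in_kS[OF fin(2) X(2)] by blast
    qed
  qed (unfold St_join[OF X priv fin B], blast)
  from this[of "%b. b"] this[of Not] show ?thesis unfolding ok_def by simp
qed

lemma join_ok2:
  assumes "v \<in> X2"
  shows "ok (G1 Un G2) (X1 Un X2) I (fset R) v \<longleftrightarrow> ok G2 X2 I (fset (restr2 B1 (kS G1 X1 I) B2 (kS G2 X2 I) R)) v"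
proof -
  have "(EX J q. (J, q) \<in> St (G1 Un G2) (X1 Un X2) I & q |\<in>| R & P (v \<in> J)) \<longleftrightarrow>
     (EX J q. (J, q) \<in> St G2 X2 I & q |\<in>| restr2 B1 (kS G1 X1 I) B2 (kS G2 X2 I) R & P (v \<in> J))" for P
  proof (rule project_join[where j="%q2 q1. joinq B1 q1 B2 q2"])
    show "v ~: J" if "(J, q) \<in> St G1 X1 I" for J q using St_val[OF that X(1)] assms priv by auto
    show "q2 |\<in>| restr2 B1 (kS G1 X1 I) B2 (kS G2 X2 I) R \<longleftrightarrow> (EX J1 q1 q. (J1, q1) \<in> St G1 X1 I & q |\<in>| joinq B1 q1 B2 q2 & q |\<in>| R)"
      if "(J2, q2) \<in> St G2 X2 I" for J2 q2
    proof -
      have "q2 |\<in>| kS G2 X2 I" using that in_kS[OF fin(2) X(2)] by blast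
      hence "q2 |\<in>| restr2 B1 (kS G1 X1 I) B2 (kS G2 X2 I) R \<longleftrightarrow> (EX q1. q1 |\<in>| kS G1 X1 I & (EX q. q |\<in>| joinq B1 q1 B2 q2 & q |\<in>| R))"
        unfolding restr2_def by auto
      thus ?thesis unfolding in_kS[OF fin(1) X(1)] by blast
    qed
  qed (unfold St_join[OF X priv fin B], blast)
  from this[of "%b. b"] this[of Not] show ?thesis unfolding ok_def by simp
qed

lemma kI_restrict: "kI G X (I Int lits_of (atoms G)) = kI G X I"
  unfolding kI_def by (rule arg_cong[of _ _ Abs_fset]) auto

lemma kS_restrict: "kS G X (I Int lits_of (atoms G)) = kS G X I"
  unfolding kS_def St_restrict ..

lemma merge_guesses:
  assumes I: "I1 \<in> guesses (atoms G1)" "I2 \<in> guesses (atoms G2)" and c: "compat B1 (kI G1 X1 I1) B2 (kI G2 X2 I2)"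
  shows "I1 Un I2 \<in> guesses (atoms (G1 Un G2))" "(I1 Un I2) Int lits_of (atoms G1) = I1" "(I1 Un I2) Int lits_of (atoms G2) = I2"
proof -
  have c': "l \<in> I1 & lit_atom l \<in> fset B2 & lit_atom l \<in> fset B1 \<longleftrightarrow> l \<in> I2 & lit_atom l \<in> fset B1 & lit_atom l \<in> fset B2" for l
    using c unfolding compat_def fset_eq_iff by (simp add: fset_kI fin flip: B) blast
  have both: "a \<in> fset B1 Int fset B2" if "a \<in> atoms G1" "a \<in> atoms G2" for a
    using that priv B X by auto
  have sub: "I1 <= lits_of (atoms G1)" "I2 <= lits_of (atoms G2)" using I by (auto simp: guesses_def)
  have 1: "l \<in> I1 \<longleftrightarrow> l \<in> I2" if "lit_atom l \<in> atoms G1" "lit_atom l \<in> atoms G2" for l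
    using c'[of l] both[OF that] by blast
  show e1: "(I1 Un I2) Int lits_of (atoms G1) = I1" and e2: "(I1 Un I2) Int lits_of (atoms G2) = I2"
    using sub 1 by auto
  have "~ (Pos a \<in> I1 Un I2 & Neg a \<in> I1 Un I2)" for a
  proof (cases "a \<in> atoms G1")
    case True
    hence "l \<in> I1 Un I2 \<longleftrightarrow> l \<in> I1" if "lit_atom l = a" for l using e1 that by blast
    thus ?thesis using I(1) by (auto simp: guesses_def)
  next
    case False
    hence "l \<in> I1 Un I2 \<longleftrightarrow> l \<in> I2" if "lit_atom l = a" for l using sub that by auto
    thus ?thesis using I(2) by (auto simp: guesses_def)
  qed
  thus "I1 Un I2 \<in> guesses (atoms (G1 Un G2))" using sub by (auto simp: guesses_def)
qed

text \<open>A guess for the union is a pair of compatible guesses, and the live states of each part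
  are determined by the joint key. Within a pair of matching entries the guesses combine freely, so
  counts are multiplied; over the matching pairs they are added.\<close>

lemma join_table:
  assumes t: "is_table G1 X1 t1" "is_table G2 X2 t2"
  shows "is_table (G1 Un G2) (X1 Un X2) (join_table B1 t1 B2 t2)"
proof -
  let ?G = "G1 Un G2" and ?X = "X1 Un X2"
  let ?r1 = "%I. I Int lits_of (atoms G1)" and ?r2 = "%I. I Int lits_of (atoms G2)"
  note t' = t[unfolded is_table_def]
  have guess: "?r1 I \<in> guesses (atoms G1)" "?r2 I \<in> guesses (atoms G2)" if "I \<in> guesses (atoms ?G)" for I
    using that by (auto simp: guesses_def)
  have pairs: "e |\<in>| join_pairs B1 t1 B2 t2 \<longleftrightarrow> (\<exists>k1\<in>keys G1 X1. \<exists>k2\<in>keys G2 X2. e = (entry G1 X1 k1, entry G2 X2 k2) & compat B1 (fst k1) B2 (fst k2))" for e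
    unfolding join_pairs_def using t' by (auto simp: ffUnion.rep_eq entry_def)
  have keys: "fset (join_keys B1 t1 B2 t2) = keys ?G ?X"
  proof (intro set_eqI iffI)
    fix k assume "k \<in> fset (join_keys B1 t1 B2 t2)"
    then obtain k1 k2 R where k: "k1 \<in> keys G1 X1" "k2 \<in> keys G2 X2" "compat B1 (fst k1) B2 (fst k2)"
      "R |\<subseteq>| joinS B1 (fst (snd k1)) B2 (fst (snd k2))" "k = (fst k1 |\<union>| fst k2, joinS B1 (fst (snd k1)) B2 (fst (snd k2)), R)"
      unfolding join_keys_def ffUnion.rep_eq fimage.rep_eq by (auto simp: pairs entry_def)
    obtain I1 I2 where I: "I1 \<in> guesses (atoms G1)" "fst k1 = kI G1 X1 I1" "fst (snd k1) = kS G1 X1 I1"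
      "I2 \<in> guesses (atoms G2)" "fst k2 = kI G2 X2 I2" "fst (snd k2) = kS G2 X2 I2"
      using k(1,2) unfolding keys_def by auto
    note m = merge_guesses[OF I(1,4) k(3)[unfolded I]]
    have "kI G1 X1 I1 = kI G1 X1 (I1 Un I2)" "kS G1 X1 I1 = kS G1 X1 (I1 Un I2)"
      using kI_restrict[of G1 X1 "I1 Un I2"] kS_restrict[of G1 X1 "I1 Un I2"] m(2) by simp_all
    moreover have "kI G2 X2 I2 = kI G2 X2 (I1 Un I2)" "kS G2 X2 I2 = kS G2 X2 (I1 Un I2)"
      using kI_restrict[of G2 X2 "I1 Un I2"] kS_restrict[of G2 X2 "I1 Un I2"] m(3) by simp_all
    ultimately show "k \<in> keys ?G ?X" unfolding keys_def mem_Collect_eq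
      using m(1) k(4,5) by (intro exI[of _ "I1 Un I2"] exI[of _ R]) (simp add: join_kI join_kS I)
  next
    fix k assume "k \<in> keys ?G ?X"
    then obtain I R where k: "I \<in> guesses (atoms ?G)" "k = (kI ?G ?X I, kS ?G ?X I, R)" "R |\<subseteq>| kS ?G ?X I"
      unfolding keys_def by blast
    \<comment> \<open>Every set of reachable states yields a key, so the empty one serves as a
      witness for the pair of boundaries and state sets.\<close>
    let ?k1 = "(kI G1 X1 I, kS G1 X1 I, {||} :: 'q fset)" and ?k2 = "(kI G2 X2 I, kS G2 X2 I, {||} :: 'q fset)"
    have "?k1 \<in> keys G1 X1" unfolding keys_def mem_Collect_eq
      using guess(1)[OF k(1)] by (intro exI[of _ "?r1 I"] exI[of _ "{||}"]) (simp add: kI_restrict kS_restrict)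
    moreover have "?k2 \<in> keys G2 X2" unfolding keys_def mem_Collect_eq
      using guess(2)[OF k(1)] by (intro exI[of _ "?r2 I"] exI[of _ "{||}"]) (simp add: kI_restrict kS_restrict)
    ultimately have "(entry G1 X1 ?k1, entry G2 X2 ?k2) |\<in>| join_pairs B1 t1 B2 t2"
      unfolding pairs using join_compat[of I] by (metis fst_conv)
    thus "k \<in> fset (join_keys B1 t1 B2 t2)" unfolding join_keys_def ffUnion.rep_eq fimage.rep_eq
      using k(3) by (auto simp: k(2) join_kI join_kS entry_def intro!: bexI[of _ "(entry G1 X1 ?k1, entry G2 X2 ?k2)"])
  qed
  have cnt: "(\<Sum>e\<in>fset (ffilter (join_match B1 B2 k) (join_pairs B1 t1 B2 t2)). snd (fst e) * snd (snd e)) = card (cset ?G ?X k)"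
    if k: "k \<in> keys ?G ?X" for k
  proof -
    let ?T = "fset (ffilter (join_match B1 B2 k) (join_pairs B1 t1 B2 t2))"
    let ?k1 = "%I. (kI G1 X1 I, kS G1 X1 I, restr1 B1 (kS G1 X1 I) B2 (kS G2 X2 I) (snd (snd k)))"
    let ?k2 = "%I. (kI G2 X2 I, kS G2 X2 I, restr2 B1 (kS G1 X1 I) B2 (kS G2 X2 I) (snd (snd k)))"
    let ?g = "%I. (entry G1 X1 (?k1 I), entry G2 X2 (?k2 I))"
    have mem: "I \<in> cset ?G ?X k \<longleftrightarrow> ?r1 I \<in> cset G1 X1 (?k1 I) & ?r2 I \<in> cset G2 X2 (?k2 I) & join_match B1 B2 k (?g I)"
      if I: "I \<in> guesses (atoms ?G)" for I
    proof -
      have o1: "ok ?G ?X I (fset (snd (snd k))) v \<longleftrightarrow> ok G1 X1 (?r1 I) (fset (snd (snd (?k1 I)))) v" if "v \<in> X1" for v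
        using join_ok1[OF that] ok_restrict[of v G1] that X by auto
      have o2: "ok ?G ?X I (fset (snd (snd k))) v \<longleftrightarrow> ok G2 X2 (?r2 I) (fset (snd (snd (?k2 I)))) v" if "v \<in> X2" for v
        using join_ok2[OF that] ok_restrict[of v G2] that X by auto
      show ?thesis using I guess[OF I] o1 o2
        unfolding cset_def join_match_def by (auto simp: join_kI join_kS kI_restrict kS_restrict entry_def)
    qed
    have csetg: "I \<in> guesses (atoms ?G)" if "I \<in> cset ?G ?X k" for I using that by (simp add: cset_def)
    have img: "?g ` cset ?G ?X k <= ?T"
    proof
      fix e assume "e \<in> ?g ` cset ?G ?X k"
      then obtain I where I: "I \<in> cset ?G ?X k" "e = ?g I" by blast
      note g = csetg[OF I(1)]
      have "?k1 I \<in> keys G1 X1" unfolding keys_def mem_Collect_eq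
        using guess(1)[OF g] by (intro exI[of _ "?r1 I"] exI) (auto simp: kI_restrict kS_restrict restr1_def)
      moreover have "?k2 I \<in> keys G2 X2" unfolding keys_def mem_Collect_eq
        using guess(2)[OF g] by (intro exI[of _ "?r2 I"] exI) (auto simp: kI_restrict kS_restrict restr2_def)
      ultimately have "e |\<in>| join_pairs B1 t1 B2 t2" unfolding pairs I(2) using join_compat[of I] by (metis fst_conv)
      thus "e \<in> ?T" using mem[OF g] I by simp
    qed
    have fib: "card {I\<in>cset ?G ?X k. ?g I = e} = snd (fst e) * snd (snd e)" if e: "e \<in> ?T" for e
    proof -
      obtain k1 k2 where e': "e = (entry G1 X1 k1, entry G2 X2 k2)" "compat B1 (fst k1) B2 (fst k2)" and m: "join_match B1 B2 k e"
        using e pairs[of e] by auto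
      let ?A = "{I\<in>cset ?G ?X k. ?g I = e}"
      \<comment> \<open>Restriction to the two sets of atoms splits a guess, and union puts it
        together again.\<close>
      have "bij_betw (%I. (?r1 I, ?r2 I)) ?A (cset G1 X1 k1 \<times> cset G2 X2 k2)"
      proof (rule bij_betw_byWitness[where f'="%p. fst p Un snd p"])
        show "(%I. (?r1 I, ?r2 I)) ` ?A <= cset G1 X1 k1 \<times> cset G2 X2 k2"
        proof (rule image_subsetI)
          fix I assume I: "I \<in> ?A"
          hence "?k1 I = k1" "?k2 I = k2" by (auto simp: e' entry_def)
          thus "(?r1 I, ?r2 I) \<in> cset G1 X1 k1 \<times> cset G2 X2 k2" using I mem[OF csetg] by auto
        qed
        have main: "fst p Un snd p \<in> ?A & (?r1 (fst p Un snd p), ?r2 (fst p Un snd p)) = p"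
          if p: "p \<in> cset G1 X1 k1 \<times> cset G2 X2 k2" for p
        proof -
          obtain I1 I2 where p': "p = (I1, I2)" "I1 \<in> cset G1 X1 k1" "I2 \<in> cset G2 X2 k2" using p by blast
          have I: "I1 \<in> guesses (atoms G1)" "kI G1 X1 I1 = fst k1" "kS G1 X1 I1 = fst (snd k1)"
            "I2 \<in> guesses (atoms G2)" "kI G2 X2 I2 = fst k2" "kS G2 X2 I2 = fst (snd k2)"
            using p'(2,3) by (auto simp: cset_def)
          have "compat B1 (kI G1 X1 I1) B2 (kI G2 X2 I2)" using e'(2) I by simp
          note mg = merge_guesses[OF I(1,4) this]
          have "kI G1 X1 (I1 Un I2) = fst k1" "kS G1 X1 (I1 Un I2) = fst (snd k1)"
            using kI_restrict[of G1 X1 "I1 Un I2"] kS_restrict[of G1 X1 "I1 Un I2"] mg(2) I by simp_all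
          moreover have "kI G2 X2 (I1 Un I2) = fst k2" "kS G2 X2 (I1 Un I2) = fst (snd k2)"
            using kI_restrict[of G2 X2 "I1 Un I2"] kS_restrict[of G2 X2 "I1 Un I2"] mg(3) I by simp_all
          ultimately have kk: "?k1 (I1 Un I2) = k1" "?k2 (I1 Un I2) = k2"
            using m by (cases k1; cases k2; simp add: e' entry_def join_match_def)+
          hence "?g (I1 Un I2) = e" by (simp only: e')
          moreover have "I1 Un I2 \<in> cset ?G ?X k"
            unfolding mem[OF mg(1)] kk mg(2,3) using p'(2,3) m e'(1) by simp
          ultimately show ?thesis using mg p'(1) by simp
        qed
        show "(%p. fst p Un snd p) ` (cset G1 X1 k1 \<times> cset G2 X2 k2) <= ?A"
          using main by (intro image_subsetI) (rule conjunct1)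
        show "\<forall>p\<in>cset G1 X1 k1 \<times> cset G2 X2 k2. (?r1 (fst p Un snd p), ?r2 (fst p Un snd p)) = p"
          using main by (intro ballI) (rule conjunct2)
        show "\<forall>I\<in>?A. fst (?r1 I, ?r2 I) Un snd (?r1 I, ?r2 I) = I"
          by (auto simp: cset_def guesses_def)
      qed
      hence "card ?A = card (cset G1 X1 k1) * card (cset G2 X2 k2)"
        by (simp add: bij_betw_same_card card_cartesian_product)
      thus ?thesis by (simp add: e' entry_def)
    qed
    have "card (cset ?G ?X k) = (\<Sum>e\<in>?T. card {I\<in>cset ?G ?X k. ?g I = e})"
      by (rule card_fibres[OF _ _ img]) (auto simp: finite_cset fin)
    also have "... = (\<Sum>e\<in>?T. snd (fst e) * snd (snd e))" by (rule sum.cong[OF refl fib])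
    finally show ?thesis by simp
  qed
  show ?thesis unfolding is_table_def join_table_def fimage.rep_eq keys
    by (rule image_cong) (simp_all only: entry_def cnt)
qed

end

subsubsection \<open>The number of world views\<close>

text \<open>With all atoms forgotten, the guess \<open>R\<close> can be verified: it must consist of
  the reachable accepting states. That it is nonempty says that there is an answer set.\<close>

definition count_table :: "('a, 'q) table => nat" where
  "count_table t = (\<Sum>e\<in>fset (ffilter (%e. snd (snd (fst e)) = ffilter (%q. accq q) (fst (snd (fst e))) & snd (snd (fst e)) ~= {||}) t). snd e)"

lemma world_views_ok:
  assumes G: "finite G" "good G"
  shows "world_views G = {I\<in>guesses (atoms G). ffilter accq (kS G (atoms G) I) ~= {||} &
    (\<forall>v\<in>atoms G. ok G (atoms G) I (fset (ffilter accq (kS G (atoms G) I))) v)}"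
proof -
  have "AS G I ~= {} \<longleftrightarrow> ffilter accq (kS G (atoms G) I) ~= {||}"
    "((\<exists>J\<in>AS G I. v \<in> J) \<longleftrightarrow> Neg v ~: I) & ((\<exists>J\<in>AS G I. v ~: J) \<longleftrightarrow> Pos v ~: I) \<longleftrightarrow>
      ok G (atoms G) I (fset (ffilter accq (kS G (atoms G) I))) v" for I v
  proof -
    let ?A = "AS G I" and ?R = "ffilter accq (kS G (atoms G) I)"
    have R: "q |\<in>| ?R \<longleftrightarrow> (EX J. (J, q) \<in> St G (atoms G) I) & accq q" for q
      using fset_kS[OF G(1), of "atoms G" I] by force
    have A: "J \<in> ?A \<longleftrightarrow> (EX q. (J, q) \<in> St G (atoms G) I & q |\<in>| ?R)" for J
      unfolding St_final[OF G, symmetric] R by blast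
    have "?R ~= {||} \<longleftrightarrow> (EX q. q |\<in>| ?R)" by (metis ex_fin_conv)
    thus "?A ~= {} \<longleftrightarrow> ?R ~= {||}" using A R by blast
    show "((\<exists>J\<in>?A. v \<in> J) \<longleftrightarrow> Neg v ~: I) & ((\<exists>J\<in>?A. v ~: J) \<longleftrightarrow> Pos v ~: I) \<longleftrightarrow> ok G (atoms G) I (fset ?R) v"
      unfolding ok_def using A by blast
  qed
  thus ?thesis unfolding world_views_guesses by simp
qed

theorem count_table:
  assumes G: "finite G" "good G" and t: "is_table G (atoms G) t"
  shows "count_table t = card (world_views G)"
proof -
  let ?X = "atoms G"
  let ?T = "fset (ffilter (%e. snd (snd (fst e)) = ffilter accq (fst (snd (fst e))) & snd (snd (fst e)) ~= {||}) t)"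
  let ?g = "%I. entry G ?X (kI G ?X I, kS G ?X I, ffilter accq (kS G ?X I))"
  have img: "?g ` world_views G <= ?T"
  proof
    fix e assume "e \<in> ?g ` world_views G"
    then obtain I where I: "I \<in> world_views G" "e = ?g I" by blast
    hence "(kI G ?X I, kS G ?X I, ffilter accq (kS G ?X I)) \<in> keys G ?X"
      unfolding world_views_ok[OF G] keys_def by auto
    hence "e |\<in>| t" using t I unfolding is_table_def by blast
    thus "e \<in> ?T" using I unfolding world_views_ok[OF G] by (simp add: entry_def)
  qed
  have fib: "{I\<in>world_views G. ?g I = e} = cset G ?X (fst e)" if e: "e \<in> ?T" for e
  proof -
    have e': "e = entry G ?X (fst e)" using e t by (auto simp: is_table_def entry_def)
    have k: "?g I = e \<longleftrightarrow> (kI G ?X I, kS G ?X I, ffilter accq (kS G ?X I)) = fst e" for I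
    proof
      assume "?g I = e"
      thus "(kI G ?X I, kS G ?X I, ffilter accq (kS G ?X I)) = fst e" by (auto simp: entry_def)
    next
      assume eq: "(kI G ?X I, kS G ?X I, ffilter accq (kS G ?X I)) = fst e"
      show "?g I = e" unfolding eq by (rule e'[symmetric])
    qed
    have "snd (snd (fst e)) = ffilter accq (fst (snd (fst e)))" "snd (snd (fst e)) ~= {||}" using e by auto
    thus ?thesis unfolding world_views_ok[OF G] k cset_def by (cases "fst e") auto
  qed
  have "finite (world_views G)" unfolding world_views_ok[OF G] using finite_guesses[OF finite_atoms[OF G(1)]] by simp
  hence "card (world_views G) = (\<Sum>e\<in>?T. card {I\<in>world_views G. ?g I = e})"
    by (rule card_fibres[OF _ _ img]) simp
  also have "... = (\<Sum>e\<in>?T. snd e)"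
  proof (rule sum.cong[OF refl])
    fix e assume e: "e \<in> ?T"
    hence "e = entry G ?X (fst e)" using t by (auto simp: is_table_def entry_def)
    thus "card {I\<in>world_views G. ?g I = e} = snd e" unfolding fib[OF e] by (metis entry_def snd_conv)
  qed
  finally show ?thesis by (simp add: count_table_def)
qed

subsubsection \<open>Bucket elimination\<close>

text \<open>The pair \<open>g\<close> of rules and forgotten atoms is a ghost that gives meaning to
  a factor; the algorithm handles only boundaries and tables.\<close>

definition fac :: "'a rule set \<times> 'a set => ('a, 'q) factor => bool" where
  "fac g f \<longleftrightarrow> finite (fst g) & snd g <= atoms (fst g) & fset (fst f) = atoms (fst g) - snd g & is_table (fst g) (snd g) (snd f)"

definition apart :: "'a rule set \<times> 'a set => 'a rule set \<times> 'a set => bool" where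
  "apart g h \<longleftrightarrow> snd g Int atoms (fst h) = {} & snd h Int atoms (fst g) = {}"

definition join_fac :: "('a, 'q) factor => ('a, 'q) factor => ('a, 'q) factor" where
  "join_fac f g = (fst f |\<union>| fst g, join_table (fst f) (snd f) (fst g) (snd g))"

definition forget_fac :: "'a => ('a, 'q) factor => ('a, 'q) factor" where
  "forget_fac v f = (fst f |-| {|v|}, forget_table v (snd f))"

definition join_all :: "('a, 'q) factor list => ('a, 'q) factor" where
  "join_all fs = foldl join_fac ({||}, unit_table) fs"

definition elim_fac :: "('a, 'q) factor list => 'a => ('a, 'q) factor list" where
  "elim_fac fs v = forget_fac v (join_all (filter (%f. v |\<in>| fst f) fs)) # filter (%f. ~ v |\<in>| fst f) fs"

definition leaf_fac :: "'a rule => ('a, 'q) factor" where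
  "leaf_fac r = (rule_atoms r, leaf_table r)"

definition wv_count :: "'a rule list => nat" where
  "wv_count rs = count_table (snd (join_all (foldl elim_fac (map leaf_fac rs) (elim_order (fset_of_list (map rule_atoms rs))))))"

lemma join_fac:
  assumes "fac g f" "fac g' f'" "apart g g'" shows "fac (fst g Un fst g', snd g Un snd g') (join_fac f f')"
proof -
  have "is_table (fst g Un fst g') (snd g Un snd g') (join_table (fst f) (snd f) (fst f') (snd f'))"
    by (rule join_table) (use assms in \<open>auto simp: fac_def apart_def\<close>)
  thus ?thesis using assms by (auto simp: fac_def apart_def join_fac_def)
qed

lemma forget_fac: "fac g f ==> v \<in> atoms (fst g) - snd g ==> fac (fst g, insert v (snd g)) (forget_fac v f)"
  using forget_table[of "fst g" "snd g" "snd f" v] by (auto simp: fac_def forget_fac_def)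

definition union_fac :: "(('a rule set \<times> 'a set) \<times> ('a, 'q) factor) list => 'a rule set \<times> 'a set" where
  "union_fac zs = (\<Union>z\<in>set zs. fst (fst z), \<Union>z\<in>set zs. snd (fst z))"

definition fac_list :: "(('a rule set \<times> 'a set) \<times> ('a, 'q) factor) list => bool" where
  "fac_list zs \<longleftrightarrow> (\<forall>z\<in>set zs. fac (fst z) (snd z)) & sorted_wrt (%z z'. apart (fst z) (fst z')) zs"

lemma apart_sym: "apart g h \<longleftrightarrow> apart h g" by (auto simp: apart_def)

lemma apart_union: "(!!z. z \<in> set zs ==> apart (fst z) g) ==> apart (union_fac zs) g"
  unfolding apart_def union_fac_def atoms_def by fastforce

lemma join_all:
  assumes "fac_list zs" shows "fac (union_fac zs) (join_all (map snd zs)) & fst (join_all (map snd zs)) = ffUnion (fset_of_list (map (%z. fst (snd z)) zs))"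
  using assms
proof (induction zs rule: rev_induct)
  case Nil
  have "is_table {} {} unit_table" by (rule unit_table)
  thus ?case by (simp add: join_all_def fac_def union_fac_def)
next
  case (snoc z zs)
  have IH: "fac (union_fac zs) (join_all (map snd zs))" "fst (join_all (map snd zs)) = ffUnion (fset_of_list (map (%z. fst (snd z)) zs))"
    using snoc by (auto simp: fac_list_def sorted_wrt_append)
  have "apart (union_fac zs) (fst z)"
    by (rule apart_union) (use snoc.prems in \<open>auto simp: fac_list_def sorted_wrt_append\<close>)
  from join_fac[OF IH(1) _ this, of "snd z"]
  have "fac (union_fac (zs @ [z])) (join_fac (join_all (map snd zs)) (snd z))"
    using snoc.prems by (simp add: fac_list_def union_fac_def Un_commute)
  thus ?case using IH(2) by (simp add: join_all_def join_fac_def funion_commute)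
qed

lemma sorted_wrt_split:
  assumes "sorted_wrt R zs" "!!x y. R x y ==> R y x" "x \<in> set zs" "y \<in> set zs" "P x" "~ P y" shows "R x y"
  using assms by (induction zs) auto

lemma fac_list_filter: "fac_list zs ==> fac_list (filter P zs)"
  by (auto simp: fac_list_def intro: sorted_wrt_filter)

text \<open>On the boundaries a round acts exactly like \<open>elim v\<close> on a hypergraph, which
  ties the tables to the width of the order. Forgetting \<open>v\<close> is sound because all rules
  that mention it have been joined before.\<close>

lemma elim_fac:
  assumes zs: "fac_list zs" and v: "v \<in> atoms (fst (union_fac zs))" "v ~: snd (union_fac zs)"
  shows "EX zs'. elim_fac (map snd zs) v = map snd zs' & fac_list zs' & union_fac zs' = (fst (union_fac zs), insert v (snd (union_fac zs)))
    & (%z. fset (fst (snd z))) ` set zs' = elim v ((%z. fset (fst (snd z))) ` set zs)"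
proof -
  let ?P = "%z. v |\<in>| fst (snd z)"
  let ?h = "filter ?P zs" and ?r = "filter (%z. ~ ?P z) zs"
  have h: "fac_list ?h" and r: "fac_list ?r" using fac_list_filter[OF zs] by auto
  have B: "fset (fst (snd z)) = atoms (fst (fst z)) - snd (fst z)" if "z \<in> set zs" for z
    using zs that by (auto simp: fac_list_def fac_def)
  have nX: "v ~: snd (fst z)" if "z \<in> set zs" for z using v(2) that by (auto simp: union_fac_def)
  have "\<exists>z\<in>set zs. v \<in> atoms (fst (fst z))" using v(1) by (simp add: union_fac_def atoms_def)
  then obtain z0 where z0: "z0 \<in> set zs" "v \<in> atoms (fst (fst z0))" by blast
  have "v |\<in>| fst (snd z0)" using B[OF z0(1)] z0(2) nX[OF z0(1)] by simp
  hence "z0 \<in> set ?h" using z0(1) by simp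
  hence "fst (fst z0) <= fst (union_fac ?h)" unfolding union_fac_def fst_conv by (rule UN_upper)
  hence "v \<in> atoms (fst (union_fac ?h))" using z0(2) unfolding atoms_def by blast
  moreover have "v ~: snd (union_fac ?h)" using nX by (simp add: union_fac_def)
  ultimately have vh: "v \<in> atoms (fst (union_fac ?h)) - snd (union_fac ?h)" by blast
  have nr: "v ~: atoms (fst (fst z))" if "z \<in> set ?r" for z using that B[of z] nX[of z] by auto
  note j = join_all[OF h]
  let ?f = "forget_fac v (join_all (map snd ?h))"
  let ?g = "(fst (union_fac ?h), insert v (snd (union_fac ?h)))"
  let ?zs = "(?g, ?f) # ?r"
  have f: "fac ?g ?f" by (rule forget_fac[OF conjunct1[OF j] vh])
  have "apart ?g (fst z)" if z: "z \<in> set ?r" for z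
  proof -
    have "apart (union_fac ?h) (fst z)"
    proof (rule apart_union)
      fix z' assume "z' \<in> set ?h"
      thus "apart (fst z') (fst z)"
        using sorted_wrt_split[of "%z z'. apart (fst z) (fst z')" zs z' z ?P] zs z apart_sym
        unfolding fac_list_def by auto
    qed
    thus ?thesis using nr[OF z] by (auto simp: apart_def)
  qed
  hence fl: "fac_list ?zs" using f r by (auto simp: fac_list_def)
  have "set zs = set ?h Un set ?r" by auto
  hence un: "union_fac ?zs = (fst (union_fac zs), insert v (snd (union_fac zs)))"
    unfolding union_fac_def by auto
  have map: "elim_fac (map snd zs) v = map snd ?zs"
    by (simp add: elim_fac_def filter_map comp_def)
  have "fset (fst ?f) = hits v ((%z. fset (fst (snd z))) ` set zs) - {v}"
    unfolding forget_fac_def using conjunct2[OF j] by (auto simp: hits_def ffUnion.rep_eq fset_of_list.rep_eq)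
  moreover have "(%z. fset (fst (snd z))) ` set ?r = {h \<in> (%z. fset (fst (snd z))) ` set zs. v ~: h}" by auto
  ultimately have "(%z. fset (fst (snd z))) ` set ?zs = elim v ((%z. fset (fst (snd z))) ` set zs)"
    by (simp add: elim_def)
  thus ?thesis using fl un map by blast
qed

end

section \<open>Cost of the table operations\<close>

instantiation rule :: (enc) enc
begin
definition enc_rule :: "'a rule => tree" where "enc_rule r = Node (enc (head r)) (enc (body r))"
instance by standard (auto simp: enc_rule_def rule.expand)
end

lemma comp_head [comp_intros]: "ptime D T f ==> ptime D T (%x. head (f x))"
  using comp_fst[OF comp_recode[of D T f "%x. (head (f x), body (f x))"]] by (simp add: enc_rule_def)

lemma comp_body [comp_intros]: "ptime D T f ==> ptime D T (%x. body (f x))"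
  using comp_snd[OF comp_recode[of D T f "%x. (head (f x), body (f x))"]] by (simp add: enc_rule_def)

lemma comp_Rule [comp_intros]: "ptime D T f ==> ptime D T g ==> ptime D T (%x. Rule (f x) (g x))"
  using comp_recode[OF comp_pair, of D T f g "%x. Rule (f x) (g x)"] by (simp add: enc_rule_def)

lemma snd_lit_pair: "snd (lit_pair l) = lit_atom l" by (cases l) auto

lemma compl_lit_pair: "compl l = (if fst (lit_pair l) then Neg (lit_atom l) else Pos (lit_atom l))" by (cases l) auto

lemma snd_body_elem_pair: "snd (body_elem_pair b) = elem_lit b" by (cases b) auto

lemma comp_lit_atom [comp_intros]:
  "ptime D T f ==> ptime D T (%x. lit_atom (f x))"
  unfolding snd_lit_pair[symmetric] by (intro comp_snd comp_lit_pair)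

lemma comp_compl [comp_intros]:
  "ptime D T f ==> ptime D T (%x. compl (f x))"
  unfolding compl_lit_pair by (intro comp_intros comp_lit_pair)

lemma comp_elem_lit [comp_intros]:
  "ptime D T f ==> ptime D T (%x. elem_lit (f x))"
  unfolding snd_body_elem_pair[symmetric] by (intro comp_snd comp_body_elem_pair)

lemma comp_rule_atoms [comp_intros]:
  assumes "ptime D T f" shows "ptime D T (%x. rule_atoms (f x))"
  unfolding rule_atoms_def by (intro comp_intros assms)

lemma comp_rflits [comp_intros]:
  assumes "ptime D T f" shows "ptime D T (%x. rflits (f x))"
  unfolding rflits_def by (intro comp_intros assms)

lemma comp_consistent [comp_intros]:
  assumes "ptime D T f" shows "ptime D T (%x. consistent (f x))"
proof -
  have "ptime UNIV (%_. 0) (%x. consistent x)" unfolding consistent_def by (intro comp_intros)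
  from comp_op1[OF this assms] show ?thesis .
qed

lemma fcard_rflits: "fcard (rflits B) <= 2 * fcard B"
proof -
  have "fcard (rflits B) <= card (Pos ` fset B) + card (Neg ` fset B)"
    unfolding rflits_def fcard.rep_eq union_fset fimage.rep_eq by (rule card_Un_le)
  also have "... <= card (fset B) + card (fset B)" by (intro add_mono card_image_le) auto
  finally show ?thesis by (simp add: fcard.rep_eq)
qed

text \<open>Here \<open>qn n\<close> bounds the number of states over \<open>n\<close> atoms. Tables
  are indexed by sets of states, so \<open>2 ^ qn n\<close> is the unit in which all costs are
  measured; single states may have a size polynomial in it, with exponent \<open>qc\<close>.\<close>

locale comp_automaton = automaton leafq joinq forgetq valq accq q0 St Qset good
  for leafq :: "'a::enc rule => 'a lit fset => 'q::enc fset" and joinq forgetq valq accq q0 St Qset good +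
  fixes qn :: "nat => nat" and qc :: nat
  assumes qn_mono: "m <= n ==> qn m <= qn n" and qn_ge: "n <= qn n"
    and Qcard: "fcard (Qset B) <= qn (fcard B)"
    and Qsize: "q |\<in>| Qset B ==> sz q <= (sz B + 2 ^ qn (fcard B) + 2) ^ qc"
    and comp_leafq: "ptime UNIV (%z. 2 ^ qn (fcard (rule_atoms (fst z)))) (%z. leafq (fst z) (snd z))"
    and comp_joinq: "ptime UNIV (%z. 2 ^ qn (fcard (fst z |\<union>| fst (snd (snd z)))))
      (%z. joinq (fst z) (fst (snd z)) (fst (snd (snd z))) (snd (snd (snd z))))"
    and comp_forgetq: "ptime UNIV (%_. 0) (%z. forgetq (fst z) (snd z))"
    and comp_valq: "ptime UNIV (%_. 0) (%z. valq (fst z) (snd z))"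
    and comp_accq: "ptime UNIV (%_. 0) (%q. accq q)"
begin

lemmas comp_forgetq' = comp_op2[OF comp_forgetq]
lemmas comp_valq' = comp_op2[OF comp_valq]
lemmas comp_accq' = comp_op1[OF comp_accq]

lemma comp_joinq':
  assumes "ptime D T f1" "ptime D T f2" "ptime D T f3" "ptime D T f4"
    "pbd D (%x. 2 ^ qn (fcard (f1 x |\<union>| f3 x))) (%x. sz x + T x)"
  shows "ptime D T (%x. joinq (f1 x) (f2 x) (f3 x) (f4 x))"
  using comp_compose[OF comp_joinq comp_pair[OF assms(1) comp_pair[OF assms(2) comp_pair[OF assms(3,4)]]]] assms(5) by simp

lemma comp_leafq':
  assumes "ptime D T f1" "ptime D T f2" "pbd D (%x. 2 ^ qn (fcard (rule_atoms (f1 x)))) (%x. sz x + T x)"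
  shows "ptime D T (%x. leafq (f1 x) (f2 x))"
  using comp_compose[OF comp_leafq comp_pair[OF assms(1,2)]] assms(3) by simp

lemma key_Qset:
  assumes "k \<in> keys G X" "finite G" "X <= atoms G" "fset B = atoms G - X"
  shows "fst (snd k) |\<subseteq>| Qset B" "snd (snd k) |\<subseteq>| fst (snd k)" "fst k |\<subseteq>| rflits B"
proof -
  obtain I R where k: "k = (kI G X I, kS G X I, R)" "R |\<subseteq>| kS G X I" using assms(1) unfolding keys_def by blast
  show "fst (snd k) |\<subseteq>| Qset B" unfolding k fst_conv snd_conv
    using in_kS[OF assms(2,3), of _ I] St_Qset[OF _ assms(2-4)] by blast
  show "snd (snd k) |\<subseteq>| fst (snd k)" using k by simp
  show "fst k |\<subseteq>| rflits B" unfolding k fst_conv by (simp add: less_eq_fset.rep_eq rflits fset_kI assms)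
qed

lemma table_mem: "is_table G X t ==> e |\<in>| t ==> fst e \<in> keys G X & e = entry G X (fst e)"
  by (auto simp: is_table_def entry_def)

lemma pow_le: "S |\<subseteq>| Qset B ==> fcard B <= n ==> 2 ^ fcard S <= (2::nat) ^ qn n"
  using fcard_mono[of S "Qset B"] Qcard[of B] qn_mono[of "fcard B" n] by (intro power_increasing) auto

subsubsection \<open>Running time of the table operations\<close>

lemma comp_leaf_fac: "ptime UNIV (%r. 2 ^ qn (fcard (rule_atoms r))) (%r. leaf_fac r)"
proof -
  let ?T = "%r :: 'a rule. 2 ^ qn (fcard (rule_atoms r)) :: nat"
  have "pbd UNIV (%r :: 'a rule. 2 ^ fcard (rflits (rule_atoms r))) (%r. sz r + ?T r)"
  proof (rule pbd_mono[OF pbd_power[OF pbd_T, where c=2]])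
    fix r :: "'a rule"
    have "fcard (rflits (rule_atoms r)) <= qn (fcard (rule_atoms r)) * 2"
      using fcard_rflits[of "rule_atoms r"] qn_ge[of "fcard (rule_atoms r)"] by linarith
    thus "2 ^ fcard (rflits (rule_atoms r)) <= (?T r) ^ 2"
      unfolding power_mult[symmetric] by (rule power_increasing) simp
  qed
  note pw = comp_fPow[OF comp_rflits[OF comp_rule_atoms[OF comp_id]] this]
  let ?D = "{z :: 'a rule \<times> 'a lit fset. fst z \<in> UNIV & snd z |\<in>| ffilter consistent (fPow (rflits (rule_atoms (fst z))))}"
  have pw2: "ptime ?D (%z. ?T (fst z)) (%z. fPow (leafq (fst z) (snd z)))"
  proof (rule comp_fPow)
    show "ptime ?D (%z. ?T (fst z)) (%z. leafq (fst z) (snd z))"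
      by (intro comp_leafq' comp_intros) (rule pbd_T)
    show "pbd ?D (%z. 2 ^ fcard (leafq (fst z) (snd z))) (%z. sz z + ?T (fst z))"
    proof (rule pbd_mono[OF pbd_T])
      fix z assume z: "z \<in> ?D"
      hence "fset (snd z) <= lits_of (fset (rule_atoms (fst z)))" unfolding rflits[symmetric] by (simp add: less_eq_fset.rep_eq)
      hence "snd ` St {fst z} {} (fset (snd z)) = fset (leafq (fst z) (snd z))"
        by (intro St_leaf) blast
      hence "leafq (fst z) (snd z) |\<subseteq>| Qset (rule_atoms (fst z))"
        using St_Qset[of _ _ "{fst z}" "{}" "fset (snd z)" "rule_atoms (fst z)"] by (fastforce simp: less_eq_fset.rep_eq)
      thus "2 ^ fcard (leafq (fst z) (snd z)) <= ?T (fst z)" by (rule pow_le) simp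
    qed
  qed
  show ?thesis unfolding leaf_fac_def leaf_table_def
    by (intro comp_intros pw pw2 comp_leafq') (rule pbd_T)+
qed

lemma ptime_forgetS: "ptime2 forgetS"
  unfolding forgetS_def by (intro comp_intros comp_forgetq')

lemmas comp_forgetS = comp_op2[OF ptime_forgetS]

lemma ptime_forget_match: "ptime3 forget_match"
  unfolding forget_match_def liftR_def check_def dropI_def by (intro comp_intros comp_forgetq' comp_valq' comp_forgetS)

lemmas comp_forget_match = comp_op3[OF ptime_forget_match]

text \<open>All subsets of the new state set are listed, which is affordable only for states in
  \<open>Qset\<close> of a small boundary. The ghost in the domain excludes tables without that
  property.\<close>

lemma comp_forget_fac:
  "ptime {z. EX g. fac g (snd z) & fst z \<in> atoms (fst g) - snd g} (%z. 2 ^ qn (fcard (fst (snd z)))) (%z. forget_fac (fst z) (snd z))"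
proof -
  let ?D = "{z. EX g. fac g (snd z) & fst z \<in> atoms (fst g) - snd g}"
  let ?T = "%z. 2 ^ qn (fcard (fst (snd z))) :: nat"
  let ?D1 = "{z. fst z \<in> ?D & snd z |\<in>| snd (snd (fst z))}"
  have "ptime ?D1 (%z. ?T (fst z)) (%z. fPow (forgetS (fst (fst z)) (fst (snd (fst (snd z))))))"
  proof (rule comp_fPow)
    show "pbd ?D1 (%z. 2 ^ fcard (forgetS (fst (fst z)) (fst (snd (fst (snd z)))))) (%z. sz z + ?T (fst z))"
    proof (rule pbd_mono[OF pbd_T])
      fix z assume "z \<in> ?D1"
      then obtain g where g: "fac g (snd (fst z))" "fst (fst z) \<in> atoms (fst g) - snd g" "snd z |\<in>| snd (snd (fst z))" by blast
      let ?v = "fst (fst z)" and ?B = "fst (snd (fst z))"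
      have t: "is_table (fst g) (insert ?v (snd g)) (forget_table ?v (snd (snd (fst z))))"
        using g(1,2) by (intro forget_table) (auto simp: fac_def)
      \<comment> \<open>With the empty \<open>R\<close> this is a key of the resulting table, from
        which it follows that the new states lie in \<open>Qset\<close> of the smaller
        boundary.\<close>
      let ?k = "(dropI ?v (fst (fst (snd z))), forgetS ?v (fst (snd (fst (snd z)))), {||} :: 'q fset)"
      have "?k |\<in>| forget_keys ?v (snd (snd (fst z)))"
        unfolding forget_keys_def ffUnion.rep_eq fimage.rep_eq using g(3) by (force intro!: bexI[of _ "snd z"])
      hence "EX e. e |\<in>| forget_table ?v (snd (snd (fst z))) & fst e = ?k"
        unfolding forget_table_def by force
      hence "?k \<in> keys (fst g) (insert ?v (snd g))" using table_mem[OF t] by metis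
      from key_Qset(1)[OF this, of "?B |-| {|?v|}"] have "forgetS ?v (fst (snd (fst (snd z)))) |\<subseteq>| Qset (?B |-| {|?v|})"
        using g by (auto simp: fac_def)
      thus "2 ^ fcard (forgetS ?v (fst (snd (fst (snd z))))) <= ?T (fst z)"
        by (rule pow_le) (auto intro: fcard_mono)
    qed
  qed (intro comp_intros comp_forgetS)
  thus ?thesis unfolding forget_fac_def forget_table_def forget_keys_def dropI_def
    by (intro comp_intros comp_forgetS comp_forget_match)
qed

lemma comp_joinS: "ptime UNIV (%z. 2 ^ qn (fcard (fst z |\<union>| fst (snd (snd z)))))
    (%z. joinS (fst z) (fst (snd z)) (fst (snd (snd z))) (snd (snd (snd z))))"
  unfolding joinS_def by (intro comp_intros comp_joinq') (rule pbd_T)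

lemma comp_restr:
  "ptime UNIV (%z. 2 ^ qn (fcard (fst z |\<union>| fst (snd (snd z)))))
    (%z. restr1 (fst z) (fst (snd z)) (fst (snd (snd z))) (fst (snd (snd (snd z)))) (snd (snd (snd (snd z)))))"
  "ptime UNIV (%z. 2 ^ qn (fcard (fst z |\<union>| fst (snd (snd z)))))
    (%z. restr2 (fst z) (fst (snd z)) (fst (snd (snd z))) (fst (snd (snd (snd z)))) (snd (snd (snd (snd z)))))"
  unfolding restr1_def restr2_def by (intro comp_intros comp_joinq', rule pbd_T)+

lemma comp_joinS':
  assumes "ptime D T f1" "ptime D T f2" "ptime D T f3" "ptime D T f4"
    "pbd D (%x. 2 ^ qn (fcard (f1 x |\<union>| f3 x))) (%x. sz x + T x)"
  shows "ptime D T (%x. joinS (f1 x) (f2 x) (f3 x) (f4 x))"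
  using comp_compose[OF comp_joinS comp_pair[OF assms(1) comp_pair[OF assms(2) comp_pair[OF assms(3,4)]]]] assms(5) by simp

lemma comp_restr':
  assumes "ptime D T f1" "ptime D T f2" "ptime D T f3" "ptime D T f4" "ptime D T f5"
    "pbd D (%x. 2 ^ qn (fcard (f1 x |\<union>| f3 x))) (%x. sz x + T x)"
  shows "ptime D T (%x. restr1 (f1 x) (f2 x) (f3 x) (f4 x) (f5 x))"
    "ptime D T (%x. restr2 (f1 x) (f2 x) (f3 x) (f4 x) (f5 x))"
  using comp_compose[OF comp_restr(1) comp_pair[OF assms(1) comp_pair[OF assms(2) comp_pair[OF assms(3) comp_pair[OF assms(4,5)]]]]]
    comp_compose[OF comp_restr(2) comp_pair[OF assms(1) comp_pair[OF assms(2) comp_pair[OF assms(3) comp_pair[OF assms(4,5)]]]]] assms(6) by simp_all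

lemma ptime_join_pairs: "ptime4 join_pairs"
  unfolding join_pairs_def compat_def by (intro comp_intros)

lemmas comp_join_pairs = comp_op4[OF ptime_join_pairs]

lemma comp_join_fac:
  "ptime {z. EX g h. fac g (fst z) & fac h (snd z) & apart g h} (%z. 2 ^ qn (fcard (fst (fst z) |\<union>| fst (snd z)))) (%z. join_fac (fst z) (snd z))"
proof -
  let ?D = "{z. EX g h. fac g (fst z) & fac h (snd z) & apart g h}"
  let ?T = "%z. 2 ^ qn (fcard (fst (fst z) |\<union>| fst (snd z))) :: nat"
  let ?ps = "%z. join_pairs (fst (fst z)) (snd (fst z)) (fst (snd z)) (snd (snd z))"
  let ?D1 = "{z. fst z \<in> ?D & snd z |\<in>| ?ps (fst z)}"
  let ?S = "%z. pairS (fst (fst (fst z))) (fst (snd (fst z))) (snd z)"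
  have pS: "ptime ?D1 (%z. ?T (fst z)) ?S" by (intro comp_intros comp_joinS') (rule pbd_T)
  have "ptime ?D1 (%z. ?T (fst z)) (%z. fPow (?S z))"
  proof (rule comp_fPow[OF pS])
    show "pbd ?D1 (%z. 2 ^ fcard (?S z)) (%z. sz z + ?T (fst z))"
    proof (rule pbd_mono[OF pbd_T])
      fix z assume "z \<in> ?D1"
      then obtain g h where g: "fac g (fst (fst z))" "fac h (snd (fst z))" "apart g h" "snd z |\<in>| ?ps (fst z)" by blast
      let ?t = "join_table (fst (fst (fst z))) (snd (fst (fst z))) (fst (snd (fst z))) (snd (snd (fst z)))"
      let ?B = "fst (fst (fst z)) |\<union>| fst (snd (fst z))"
      have fj: "fac (fst g Un fst h, snd g Un snd h) (join_fac (fst (fst z)) (snd (fst z)))"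
        by (rule join_fac[OF g(1-3)])
      hence t: "is_table (fst g Un fst h) (snd g Un snd h) ?t" by (simp add: fac_def join_fac_def)
      let ?k = "(fst (fst (fst (snd z))) |\<union>| fst (fst (snd (snd z))), ?S z, {||} :: 'q fset)"
      have "?k |\<in>| join_keys (fst (fst (fst z))) (snd (fst (fst z))) (fst (snd (fst z))) (snd (snd (fst z)))"
        unfolding join_keys_def ffUnion.rep_eq fimage.rep_eq using g(4) by (force intro!: bexI[of _ "snd z"])
      hence "EX e. e |\<in>| ?t & fst e = ?k" unfolding join_table_def by force
      hence "?k \<in> keys (fst g Un fst h) (snd g Un snd h)" using table_mem[OF t] by metis
      from key_Qset(1)[OF this, of ?B] have "?S z |\<subseteq>| Qset ?B"
        using fj by (auto simp: fac_def join_fac_def)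
      thus "2 ^ fcard (?S z) <= ?T (fst z)" by (rule pow_le) simp
    qed
  qed
  note fp = this
  show ?thesis unfolding join_fac_def join_table_def join_keys_def join_match_def
    by (intro comp_intros comp_joinS' comp_restr' comp_join_pairs fp) (rule pbd_T)+
qed

end

context comp_automaton
begin

definition scopes :: "(('a rule set \<times> 'a set) \<times> ('a, 'q) factor) list => 'a set set" where
  "scopes zl = (%z. fset (fst (snd z))) ` set zl"

text \<open>State of the elimination after \<open>ys\<close>, with \<open>zs\<close> still to come.
  The number of factors is bounded crudely, by one additional factor per round.\<close>

definition elim_state :: "'a rule list => nat => 'a list => 'a list => ('a, 'q) factor list => bool" where
  "elim_state rs w ys zs fs \<longleftrightarrow> (EX zl. fs = map snd zl & fac_list zl & union_fac zl = (set rs, set ys) &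
     elim_width w zs (scopes zl) & (\<forall>h\<in>scopes zl. card h <= w) & length zl <= length rs + length ys)"

definition join_state :: "'a rule list => nat => ('a, 'q) factor list => bool" where
  "join_state rs w fs \<longleftrightarrow> (EX zl. fs = map snd zl & fac_list zl & fst (union_fac zl) <= set rs & card (\<Union>(scopes zl)) <= w)"

lemma fac_leaf: "fac ({r}, {}) (leaf_fac r)"
  using leaf_table[of r] by (simp add: fac_def leaf_fac_def)

lemma elim_state_init:
  assumes "elim_width w zs (scopes_of rs)" "!!r. r \<in> set rs ==> fcard (rule_atoms r) <= w"
  shows "elim_state rs w [] zs (map leaf_fac rs)"
proof -
  let ?zl = "map (%r. (({r}, {}), leaf_fac r)) rs"
  have 1: "map leaf_fac rs = map snd ?zl" by (induction rs) auto
  have "sorted_wrt (%z z'. apart (fst z) (fst z')) ?zl" by (simp add: sorted_wrt_map apart_def sorted_wrt_iff_nth_less)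
  hence 2: "fac_list ?zl" by (auto simp: fac_list_def fac_leaf)
  have 3: "union_fac ?zl = (set rs, set [])" by (auto simp: union_fac_def)
  have "scopes ?zl = fset ` set (map rule_atoms rs)" by (auto simp: scopes_def leaf_fac_def image_iff)
  also have "... = scopes_of rs" by (simp only: fset_of_list.rep_eq)
  finally have 4: "scopes ?zl = scopes_of rs" .
  have "\<forall>h\<in>scopes ?zl. card h <= w" using assms(2) by (auto simp: scopes_def leaf_fac_def fcard.rep_eq)
  thus ?thesis unfolding elim_state_def using 1 2 3 4 assms(1) by (intro exI[of _ ?zl]) simp
qed

lemma elim_state_step:
  assumes "elim_state rs w ys (v # zs) fs" "v \<in> atoms (set rs)" "v ~: set ys"
  shows "elim_state rs w (ys @ [v]) zs (elim_fac fs v)"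
proof -
  obtain zl where zl: "fs = map snd zl" "fac_list zl" "union_fac zl = (set rs, set ys)"
     "elim_width w (v # zs) (scopes zl)" "\<forall>h\<in>scopes zl. card h <= w" "length zl <= length rs + length ys"
    using assms(1) unfolding elim_state_def by (elim exE conjE)
  obtain zl' where zl': "elim_fac (map snd zl) v = map snd zl'" "fac_list zl'"
     "union_fac zl' = (fst (union_fac zl), insert v (snd (union_fac zl)))" "scopes zl' = elim v (scopes zl)"
    using elim_fac[OF zl(2), of v] assms(2,3) zl(3) unfolding scopes_def by auto
  have "length (map snd zl') <= length (map snd zl) + 1"
    unfolding zl'(1)[symmetric] elim_fac_def using length_filter_le[of _ "map snd zl"] by (auto intro: le_SucI)
  hence len: "length zl' <= length rs + length (ys @ [v])" using zl(6) by simp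
  have "card (hits v (scopes zl) - {v}) <= w"
    using zl(4) card_Diff1_le[of "hits v (scopes zl)" v] by simp
  hence "\<forall>h\<in>scopes zl'. card h <= w" unfolding zl'(4) elim_def using zl(5) by blast
  thus ?thesis unfolding elim_state_def
    using zl zl' len by (intro exI[of _ zl']) simp
qed

lemma elim_state_foldl:
  assumes "elim_state rs w [] (ys @ zs) fs" "set (ys @ zs) <= atoms (set rs)" "distinct (ys @ zs)"
  shows "elim_state rs w ys zs (foldl elim_fac fs ys)"
  using assms
proof (induction ys arbitrary: zs rule: rev_induct)
  case (snoc v ys)
  hence "elim_state rs w ys (v # zs) (foldl elim_fac fs ys)" by simp
  from elim_state_step[OF this] snoc.prems show ?case by simp
qed simp

lemma union_fac_filter: "fst (union_fac (filter P zl)) <= fst (union_fac zl)"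
  by (auto simp: union_fac_def)

text \<open>The boundaries of the factors to be joined unite to \<open>hits v\<close>, so no
  intermediate join exceeds the width.\<close>

lemma hits_join_state:
  assumes "elim_state rs w ys (v # zs) fs" shows "join_state rs w (filter (%f. v |\<in>| fst f) fs)"
proof -
  obtain zl where zl: "fs = map snd zl" "fac_list zl" "union_fac zl = (set rs, set ys)" "elim_width w (v # zs) (scopes zl)"
    using assms unfolding elim_state_def by (elim exE conjE)
  have "\<Union>(scopes (filter (%z. v |\<in>| fst (snd z)) zl)) = hits v (scopes zl)" by (auto simp: scopes_def hits_def)
  hence c: "card (\<Union>(scopes (filter (%z. v |\<in>| fst (snd z)) zl))) <= w" using zl(4) by simp
  have "filter (%f. v |\<in>| fst f) fs = map snd (filter (%z. v |\<in>| fst (snd z)) zl)"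
    unfolding zl(1) by (simp add: filter_map comp_def)
  thus ?thesis unfolding join_state_def
    using c fac_list_filter[OF zl(2)] union_fac_filter[of _ zl] zl(3) by (intro exI conjI) auto
qed

lemma hits_fac:
  assumes "elim_state rs w ys (v # zs) fs" "v \<in> atoms (set rs)" "v ~: set ys"
  shows "EX g. fac g (join_all (filter (%f. v |\<in>| fst f) fs)) & v \<in> atoms (fst g) - snd g"
proof -
  obtain zl where zl: "fs = map snd zl" "fac_list zl" "union_fac zl = (set rs, set ys)"
    using assms(1) unfolding elim_state_def by (elim exE conjE)
  let ?h = "filter (%z. v |\<in>| fst (snd z)) zl"
  have B: "fset (fst (snd z)) = atoms (fst (fst z)) - snd (fst z)" if "z \<in> set zl" for z
    using zl(2) that by (auto simp: fac_list_def fac_def)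
  have X: "snd (fst z) <= set ys" if "z \<in> set zl" for z using zl(3) that by (auto simp: union_fac_def)
  have nX: "v ~: snd (union_fac ?h)"
  proof
    assume "v \<in> snd (union_fac ?h)"
    then obtain z where "z \<in> set zl" "v \<in> snd (fst z)" unfolding union_fac_def by fastforce
    thus False using X assms(3) by blast
  qed
  have "set rs = (\<Union>z\<in>set zl. fst (fst z))" using zl(3) by (simp add: union_fac_def)
  then obtain z0 where z0: "z0 \<in> set zl" "v \<in> atoms (fst (fst z0))" using assms(2) unfolding atoms_def by blast
  hence "v |\<in>| fst (snd z0)" using B[OF z0(1)] X[OF z0(1)] assms(3) by auto
  hence "fst (fst z0) <= fst (union_fac ?h)" unfolding union_fac_def using z0(1) by auto
  hence "v \<in> atoms (fst (union_fac ?h))" using z0(2) unfolding atoms_def by blast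
  moreover have "filter (%f. v |\<in>| fst f) fs = map snd ?h" unfolding zl(1) by (simp add: filter_map comp_def)
  ultimately show ?thesis using join_all[OF fac_list_filter[OF zl(2)]] nX by (intro exI[of _ "union_fac ?h"]) simp
qed

lemma scopes_join_all:
  "fac_list zl ==> fset (fst (join_all (map snd zl))) = \<Union>(scopes zl)"
  using join_all[of zl] by (auto simp: scopes_def ffUnion.rep_eq fset_of_list.rep_eq)

text \<open>When all atoms are forgotten every boundary is empty, so the final join is
  harmless.\<close>

lemma end_join_state:
  assumes "elim_state rs w ys [] fs" "set ys = atoms (set rs)"
  shows "join_state rs w fs" "fac (set rs, atoms (set rs)) (join_all fs)"
proof -
  obtain zl where zl: "fs = map snd zl" "fac_list zl" "union_fac zl = (set rs, set ys)"
    using assms unfolding elim_state_def by (elim exE conjE)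
  have j: "fac (set rs, atoms (set rs)) (join_all (map snd zl))" using join_all[OF zl(2)] zl(3) assms(2) by simp
  thus "fac (set rs, atoms (set rs)) (join_all fs)" using zl by simp
  have "\<Union>(scopes zl) = {}" using j unfolding scopes_join_all[OF zl(2), symmetric] by (simp add: fac_def)
  hence "card (\<Union>(scopes zl)) <= w" by (simp only: card.empty le0)
  thus "join_state rs w fs" unfolding join_state_def
    using zl by (intro exI[of _ zl]) simp
qed

lemma set_elim_order_rules:
  assumes "elim_width b vs (scopes_of rs)" "distinct vs" "set vs = \<Union>(scopes_of rs)"
  shows "set (elim_order (fset_of_list (map rule_atoms rs))) = atoms (set rs)"
proof -
  have "\<Union>(scopes_of rs) = \<Union>(fset ` set (map rule_atoms rs))" by (simp only: fset_of_list.rep_eq)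
  also have "... = atoms (set rs)" by (auto simp: atoms_def rule_atoms)
  finally show ?thesis using elim_order(2)[OF assms] by simp
qed

lemma rule_atoms_le_width:
  assumes "elim_width b vs (scopes_of rs)" "set vs = \<Union>(scopes_of rs)" "r \<in> set rs"
  shows "fcard (rule_atoms r) <= b"
proof (cases "fset (rule_atoms r) = {}")
  case True thus ?thesis by (simp add: fcard.rep_eq)
next
  case False
  have "fset (rule_atoms r) \<in> scopes_of rs"
    by (rule imageI) (use assms(3) in \<open>simp add: fset_of_list.rep_eq\<close>)
  hence "EX k. finite k & card k <= b & fset (rule_atoms r) <= k"
    using elim_width_cover[OF assms(1) equalityD2[OF assms(2)]] False by (elim exE conjE) (drule bspec, assumption, blast)
  then obtain k where "finite k" "card k <= b" "fset (rule_atoms r) <= k" by (elim exE conjE)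
  thus ?thesis unfolding fcard.rep_eq using card_mono[of k "fset (rule_atoms r)"] by linarith
qed

context
  fixes rs :: "'a rule list" and b :: nat and vs :: "'a list"
  assumes vs: "elim_width b vs (scopes_of rs)" "distinct vs"
    "set vs = \<Union>(scopes_of rs)"
begin

lemma elim_order_state:
  assumes "elim_order (fset_of_list (map rule_atoms rs)) = ys @ zs"
  shows "elim_state rs (8 * b + 5) ys zs (foldl elim_fac (map leaf_fac rs) ys)"
proof (rule elim_state_foldl)
  show "elim_state rs (8 * b + 5) [] (ys @ zs) (map leaf_fac rs)"
  proof (rule elim_state_init)
    show "elim_width (8 * b + 5) (ys @ zs) (scopes_of rs)"
      unfolding assms[symmetric] by (rule elim_order(3)[OF vs])
    fix r assume "r \<in> set rs"
    thus "fcard (rule_atoms r) <= 8 * b + 5" using rule_atoms_le_width[OF vs(1,3)] by fastforce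
  qed
  show "set (ys @ zs) <= atoms (set rs)" unfolding assms[symmetric] set_elim_order_rules[OF vs] ..
  show "distinct (ys @ zs)" unfolding assms[symmetric] by (rule elim_order(1)[OF vs])
qed

theorem wv_count: "good (set rs) ==> wv_count rs = card (world_views (set rs))"
proof -
  assume g: "good (set rs)"
  let ?o = "elim_order (fset_of_list (map rule_atoms rs))"
  have "elim_state rs (8 * b + 5) ?o [] (foldl elim_fac (map leaf_fac rs) ?o)" by (rule elim_order_state) simp
  from end_join_state(2)[OF this set_elim_order_rules[OF vs]]
  have "is_table (set rs) (atoms (set rs)) (snd (join_all (foldl elim_fac (map leaf_fac rs) ?o)))" by (simp add: fac_def)
  from count_table[OF _ g this] show ?thesis by (simp add: wv_count_def)
qed

end

definition sbound :: "nat => 'a fset => nat" where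
  "sbound w V = 1 + 2 ^ qn w * ((sz V + 2 ^ qn w + 2) ^ qc + 1)"

text \<open>At most \<open>2 ^ (2 * qn w)\<close> guesses on the boundary, times
  \<open>2 ^ qn w\<close> for each of \<open>S\<close> and \<open>R\<close>, give the fourth power.
  Counts are at most \<open>2 ^ (2 * fcard V)\<close>, whose binary form accounts for
  \<open>8 * fcard V\<close>.\<close>

definition fbound :: "nat => 'a fset => nat" where
  "fbound w V = sz V + 2 + (2 ^ qn w) ^ 4 * (sz (rflits V) + 2 * sbound w V + 8 * fcard V + 20)"

lemma sz_states: "S |\<subseteq>| Qset B ==> B |\<subseteq>| V ==> fcard B <= w ==> sz S <= sbound w V"
proof -
  assume a: "S |\<subseteq>| Qset B" "B |\<subseteq>| V" "fcard B <= w"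
  have le: "2 ^ qn (fcard B) <= (2::nat) ^ qn w" using qn_mono[OF a(3)] by (rule power_increasing) simp
  have "sz q <= (sz V + 2 ^ qn w + 2) ^ qc" if "q |\<in>| S" for q
  proof -
    have "sz q <= (sz B + 2 ^ qn (fcard B) + 2) ^ qc" by (rule Qsize) (use a that in blast)
    also have "... <= (sz V + 2 ^ qn w + 2) ^ qc" by (intro power_mono add_mono sz_fset_mono a le) simp_all
    finally show ?thesis .
  qed
  hence "sz S <= 1 + fcard S * ((sz V + 2 ^ qn w + 2) ^ qc + 1)" by (rule sz_fset_le)
  moreover have "fcard S <= 2 ^ qn w"
    using fcard_mono[OF a(1)] Qcard[of B] qn_mono[OF a(3)] less_exp[of "qn w"] by linarith
  ultimately show ?thesis unfolding sbound_def by (meson add_left_mono le_trans mult_le_mono1)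
qed

lemma sz_factor:
  assumes f: "fac g f" and V: "atoms (fst g) <= fset V" and w: "fcard (fst f) <= w"
  shows "sz f <= fbound w V"
proof -
  obtain G X B t where e: "g = (G, X)" "f = (B, t)" by fastforce
  have G: "finite G" "X <= atoms G" "fset B = atoms G - X" "is_table G X t" "atoms G <= fset V" "fcard B <= w"
    using assms by (auto simp: e fac_def)
  have BV: "B |\<subseteq>| V" using G by (auto simp: less_eq_fset.rep_eq)
  have key: "fst (fst e) |\<subseteq>| rflits B" "fst (snd (fst e)) |\<subseteq>| Qset B" "snd (snd (fst e)) |\<subseteq>| Qset B" if "e |\<in>| t" for e
    using key_Qset[of "fst e", OF _ G(1-3)] table_mem[OF G(4) that] by blast+
  have rV: "rflits B |\<subseteq>| rflits V" using BV unfolding less_eq_fset.rep_eq rflits by blast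
  have el: "sz e <= sz (rflits V) + 2 * sbound w V + 8 * fcard V + 10" if te: "e |\<in>| t" for e
  proof -
    have 1: "sz (fst (fst e)) <= sz (rflits V)" by (rule sz_fset_mono) (use key(1)[OF te] rV in blast)
    have 2: "sz (fst (snd (fst e))) <= sbound w V" "sz (snd (snd (fst e))) <= sbound w V"
      using key(2,3)[OF te] BV G(6) by (auto intro: sz_states)
    have "snd e = card (cset G X (fst e))" using table_mem[OF G(4) te] by (metis entry_def snd_conv)
    also have "... <= card (Pow (fset (rflits V)))"
    proof (rule card_mono)
      show "cset G X (fst e) <= Pow (fset (rflits V))" using G(5) unfolding cset_def guesses_def rflits by blast
    qed simp
    also have "... = 2 ^ fcard (rflits V)" by (simp add: card_Pow fcard.rep_eq)
    also have "... <= 2 ^ (2 * fcard V)" using fcard_rflits[of V] by (intro power_increasing) auto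
    also have "... < 2 ^ (2 * fcard V + 1)" by simp
    finally have "sz (snd e) <= 1 + 4 * (2 * fcard V + 1)" by (rule sz_nat_le)
    moreover have "sz e = sz (fst (fst e)) + (sz (fst (snd (fst e))) + sz (snd (snd (fst e))) + 1) + 1 + sz (snd e) + 1"
      by (simp add: enc_prod_def)
    moreover have "e <= r + 2 * s + 8 * m + 10" if "a <= r" "b <= s" "c <= s" "d <= 1 + 4 * (2 * m + 1)" "e = a + (b + c + 1) + 1 + d + 1"
      for a b c d e r s m :: nat using that by simp
    ultimately show ?thesis using 1 2 by blast
  qed
  have cardt: "fcard t <= (2 ^ qn w) ^ 4"
  proof -
    let ?K = "Pow (fset (rflits B)) \<times> Pow (fset (Qset B)) \<times> Pow (fset (Qset B))"
    let ?h = "%e. (fset (fst (fst e)), fset (fst (snd (fst e))), fset (snd (snd (fst e))))"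
    have "inj_on ?h (fset t)"
    proof (rule inj_onI)
      fix e e' assume e: "e \<in> fset t" "e' \<in> fset t" "?h e = ?h e'"
      hence "fst e = fst e'" by (auto simp: fset_inject prod_eq_iff)
      thus "e = e'" using table_mem[OF G(4), of e] table_mem[OF G(4), of e'] e(1,2) by metis
    qed
    moreover have "?h ` fset t <= ?K" by (intro image_subsetI SigmaI PowI key[unfolded less_eq_fset.rep_eq])
    ultimately have "card (fset t) <= card ?K" by (rule card_inj_on_le) auto
    also have "... = 2 ^ fcard (rflits B) * (2 ^ fcard (Qset B) * 2 ^ fcard (Qset B))"
      by (simp add: card_cartesian_product card_Pow fcard.rep_eq)
    also have "... <= 2 ^ (2 * qn w) * (2 ^ qn w * 2 ^ qn w)"
    proof (intro mult_le_mono power_increasing)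
      show "fcard (rflits B) <= 2 * qn w" using fcard_rflits[of B] G(6) qn_ge[of w] by linarith
      show "fcard (Qset B) <= qn w" using Qcard[of B] qn_mono[OF G(6)] by linarith
      thus "fcard (Qset B) <= qn w" .
    qed auto
    also have "... = (2 ^ qn w) ^ 4" by (simp flip: power_add power_mult add: mult_2 algebra_simps)
    finally show ?thesis by (simp add: fcard.rep_eq)
  qed
  have "sz t <= 1 + fcard t * (sz (rflits V) + 2 * sbound w V + 8 * fcard V + 10 + 1)" by (rule sz_fset_le[OF el])
  also have "... <= 1 + (2 ^ qn w) ^ 4 * (sz (rflits V) + 2 * sbound w V + 8 * fcard V + 20)"
    by (intro add_left_mono mult_le_mono cardt) simp
  finally have "sz t <= 1 + (2 ^ qn w) ^ 4 * (sz (rflits V) + 2 * sbound w V + 8 * fcard V + 20)" .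
  moreover have "sz B <= sz V" by (rule sz_fset_mono[OF BV])
  ultimately show ?thesis unfolding fbound_def e(2) by (simp add: enc_prod_def)
qed

lemma pbd_fbound:
  assumes V: "ptime D T V" and w: "pbd D (%x. 2 ^ qn (w x)) (%x. sz x + T x)"
  shows "pbd D (%x. fbound (w x) (V x)) (%x. sz x + T x)"
proof -
  note s = comp_size[OF V]
  have c: "pbd D (%x. fcard (V x)) (%x. sz x + T x)" by (rule pbd_mono[OF s]) (rule fcard_le_sz)
  show ?thesis unfolding fbound_def sbound_def
    by (intro pbd_add pbd_mult pbd_power pbd_const w s c comp_size[OF comp_rflits[OF V]])
qed

text \<open>Every prefix of the list joins into a genuine factor with at most \<open>w\<close>
  boundary atoms, and only for such states are the join and its size bound polynomial. The rules
  \<open>f x\<close> supply the universe of atoms for that bound.\<close>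

lemma comp_join_all:
  fixes f :: "'c::enc => 'a rule list"
  assumes fs: "ptime D T fs" and st: "!!x. x \<in> D ==> join_state (f x) (w x) (fs x)"
    and f: "ptime D T f" and w: "pbd D (%x. 2 ^ qn (w x)) (%x. sz x + T x)"
  shows "ptime D T (%x. join_all (fs x))"
  unfolding join_all_def
proof (rule comp_foldl[OF comp_const fs])
  let ?V = "%x. ffUnion (fset_of_list (map rule_atoms (f x)))"
  have V: "ptime D T ?V" by (intro comp_intros f)
  have Vs: "fset (?V x) = atoms (set (f x))" for x
    by (simp add: ffUnion.rep_eq fset_of_list.rep_eq atoms_def rule_atoms)
  have pre: "EX g. fac g (join_all ys) & fst g <= set (f x) & fcard (fst (join_all ys)) <= w x &
     (ALL e zs'. zs = e # zs' --> (EX h. fac h e & apart g h & fcard (fst (join_all ys) |\<union>| fst e) <= w x))"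
    if x: "x \<in> D" "fs x = ys @ zs" for x ys zs
  proof -
    obtain zl where zl: "fs x = map snd zl" "fac_list zl" "fst (union_fac zl) <= set (f x)" "card (\<Union>(scopes zl)) <= w x"
      using st[OF x(1)] unfolding join_state_def by (elim exE conjE)
    define l1 where "l1 = take (length ys) zl"
    define l2 where "l2 = drop (length ys) zl"
    have e: "map snd zl = ys @ zs" using x(2) zl(1) by simp
    have l: "zl = l1 @ l2" "ys = map snd l1" "zs = map snd l2"
      by (simp_all add: l1_def l2_def e flip: take_map drop_map)
    have l1: "fac_list l1" using zl(2) by (auto simp: l fac_list_def sorted_wrt_append)
    have fin: "finite (\<Union>(scopes zl))" by (auto simp: scopes_def)
    have sc: "fset (fst (join_all ys)) = \<Union>(scopes l1)" unfolding l(2) by (rule scopes_join_all[OF l1])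
    also have "... <= \<Union>(scopes zl)" by (auto simp: l(1) scopes_def)
    finally have sub: "fset (fst (join_all ys)) <= \<Union>(scopes zl)" .
    show ?thesis
    proof (rule exI[of _ "union_fac l1"], intro conjI allI impI)
      show "fac (union_fac l1) (join_all ys)" using join_all[OF l1] l(2) by simp
      show "fst (union_fac l1) <= set (f x)" using zl(3) unfolding l(1) by (auto simp: union_fac_def)
      show "fcard (fst (join_all ys)) <= w x" unfolding fcard.rep_eq
        using card_mono[OF fin sub] zl(4) by linarith
      fix e zs' assume "zs = e # zs'"
      then obtain y l2' where y: "l2 = y # l2'" "e = snd y" using l(3) by auto
      hence yz: "y \<in> set zl" using l(1) by simp
      have a: "fac (fst y) e" using zl(2) yz y(2) by (auto simp: fac_list_def)
      have b: "apart (union_fac l1) (fst y)"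
        by (rule apart_union) (use zl(2) y(1) in \<open>auto simp: l(1) fac_list_def sorted_wrt_append\<close>)
      have "fset (fst (join_all ys) |\<union>| fst e) <= \<Union>(scopes zl)" using sub yz y(2) by (auto simp: scopes_def)
      from card_mono[OF fin this] have c: "fcard (fst (join_all ys) |\<union>| fst e) <= w x"
        unfolding fcard.rep_eq using zl(4) by linarith
      show "EX h. fac h e & apart (union_fac l1) h & fcard (fst (join_all ys) |\<union>| fst e) <= w x"
        by (intro exI[of _ "fst y"] conjI a b c)
    qed
  qed
  let ?D1 = "{z. fst z \<in> D & (EX ys zs. fs (fst z) = ys @ snd (snd z) # zs & fst (snd z) = foldl join_fac ({||}, unit_table) ys)}"
  show "ptime ?D1 (%z. T (fst z)) (%z. join_fac (fst (snd z)) (snd (snd z)))"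
  proof -
    have "ptime ?D1 (%z. T (fst z)) (%z. join_fac (fst (snd z)) (snd (snd z)))"
      if k: "ptime ?D1 (%z. T (fst z)) (%z. snd z)"
    proof (rule comp_compose[OF comp_join_fac k])
      fix z assume z: "z \<in> ?D1"
      then obtain ys zs where y: "fst z \<in> D" "fs (fst z) = ys @ snd (snd z) # zs" "fst (snd z) = join_all ys"
        unfolding join_all_def by blast
      show "snd z \<in> {z. EX g h. fac g (fst z) & fac h (snd z) & apart g h}" using pre[OF y(1,2)] unfolding y(3)[symmetric] by blast
    next
      show "pbd ?D1 (%x. 2 ^ qn (fcard (fst (fst (snd x)) |\<union>| fst (snd (snd x))))) (%x. sz x + T (fst x))"
      proof (rule pbd_mono[OF pbd_mono2[OF pbd_compose[OF w, of ?D1 fst]]])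
        fix z assume "z \<in> ?D1"
        then obtain ys zs where y: "fst z \<in> D" "fs (fst z) = ys @ snd (snd z) # zs" "fst (snd z) = join_all ys"
          unfolding join_all_def by blast
        have "fcard (fst (fst (snd z)) |\<union>| fst (snd (snd z))) <= w (fst z)"
          using pre[OF y(1,2)] unfolding y(3)[symmetric] by blast
        from qn_mono[OF this] show "(2::nat) ^ qn (fcard (fst (fst (snd z)) |\<union>| fst (snd (snd z)))) <= 2 ^ qn (w (fst z))"
          by (rule power_increasing) simp
      qed (auto simp: enc_prod_def)
    qed
    from this[OF comp_snd[OF comp_id]] show ?thesis .
  qed
  let ?D2 = "{z. fst z \<in> D & (EX ys zs. fs (fst z) = ys @ zs & snd z = foldl join_fac ({||}, unit_table) ys)}"
  show "pbd ?D2 (%z. sz (snd z)) (%z. sz (fst z) + T (fst z))"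
  proof (rule pbd_mono[OF pbd_compose[OF pbd_fbound[OF V w], of ?D2 fst]])
    fix z assume "z \<in> ?D2"
    then obtain ys zs where y: "fst z \<in> D" "fs (fst z) = ys @ zs" "snd z = join_all ys"
      unfolding join_all_def by blast
    obtain g where g: "fac g (snd z)" "fst g <= set (f (fst z))" "fcard (fst (snd z)) <= w (fst z)"
      using pre[OF y(1,2)] unfolding y(3)[symmetric] by blast
    have "atoms (fst g) <= fset (?V (fst z))" using g(2) unfolding Vs atoms_def by blast
    from sz_factor[OF g(1) this g(3)] show "sz (snd z) <= fbound (w (fst z)) (?V (fst z))" .
  qed auto
qed

text \<open>If any order of width \<open>b x\<close> exists, the computed one has width at most
  \<open>8 * b x + 5\<close>; this is where the argument of \<open>qn\<close> comes from.\<close>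

theorem comp_wv_count:
  fixes f :: "'c::enc => 'a rule list"
  assumes f: "ptime D T f"
    and b: "!!x. x \<in> D ==> EX vs. elim_width (b x) vs (scopes_of (f x)) & distinct vs &
      set vs = \<Union>(scopes_of (f x))"
    and w: "pbd D (%x. 2 ^ qn (8 * b x + 5)) (%x. sz x + T x)"
  shows "ptime D T (%x. wv_count (f x))"
proof -
  let ?o = "%x. elim_order (fset_of_list (map rule_atoms (f x)))"
  let ?w = "%x. 8 * b x + 5"
  let ?V = "%x. ffUnion (fset_of_list (map rule_atoms (f x)))"
  have V: "ptime D T ?V" by (intro comp_intros f)
  have Vs: "fset (?V x) = atoms (set (f x))" for x
    by (simp add: ffUnion.rep_eq fset_of_list.rep_eq atoms_def rule_atoms)
  have o: "ptime D T ?o"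
  proof (rule comp_elim_order[OF _ b])
    show "pbd D (%x. 2 ^ b x) (%x. sz x + T x)"
    proof (rule pbd_mono[OF w])
      fix x
      have "b x <= qn (8 * b x + 5)" using qn_ge[of "8 * b x + 5"] by linarith
      thus "(2::nat) ^ b x <= 2 ^ qn (8 * b x + 5)" by (rule power_increasing) simp
    qed
  qed (intro comp_intros f)
  have st: "elim_state (f x) (?w x) ys zs (foldl elim_fac (map leaf_fac (f x)) ys)" if "x \<in> D" "?o x = ys @ zs" for x ys zs
    using b[OF that(1)] by (elim exE conjE) (rule elim_order_state[OF _ _ _ that(2)])
  have vo: "distinct (?o x) & set (?o x) = atoms (set (f x))" if "x \<in> D" for x
    using b[OF that] by (elim exE conjE) (intro conjI elim_order(1) set_elim_order_rules)
  have leaf: "ptime D T (%x. map leaf_fac (f x))"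
  proof (rule comp_map[OF f])
    let ?E = "{z. fst z \<in> D & snd z \<in> set (f (fst z))}"
    show "ptime ?E (%z. T (fst z)) (%z. leaf_fac (snd z))"
    proof (rule comp_compose[OF comp_leaf_fac])
      show "ptime ?E (%z. T (fst z)) snd" by (intro comp_snd comp_id)
      show "pbd ?E (%x. 2 ^ qn (fcard (rule_atoms (snd x)))) (%x. sz x + T (fst x))"
      proof (rule pbd_mono[OF pbd_mono2[OF pbd_compose[OF w, of ?E fst]]])
        fix z assume z: "z \<in> ?E"
        hence "fst z \<in> D" "snd z \<in> set (f (fst z))" by auto
        hence "fcard (rule_atoms (snd z)) <= b (fst z)"
          using b[of "fst z"] by (elim meta_impE exE conjE) (assumption, rule rule_atoms_le_width)
        hence "fcard (rule_atoms (snd z)) <= ?w (fst z)" by simp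
        from qn_mono[OF this] show "(2::nat) ^ qn (fcard (rule_atoms (snd z))) <= 2 ^ qn (?w (fst z))"
          by (rule power_increasing) simp
      qed (auto simp: enc_prod_def)
    qed simp
  qed
  have fold: "ptime D T (%x. foldl elim_fac (map leaf_fac (f x)) (?o x))"
  proof (rule comp_foldl[OF leaf o])
    let ?D1 = "{z. fst z \<in> D & (EX ys zs. ?o (fst z) = ys @ snd (snd z) # zs & fst (snd z) = foldl elim_fac (map leaf_fac (f (fst z))) ys)}"
    have w1: "pbd ?D1 (%z. 2 ^ qn (?w (fst z))) (%z. sz z + T (fst z))"
      by (rule pbd_mono2[OF pbd_compose[OF w, of ?D1 fst]]) (auto simp: enc_prod_def)
    have s1: "EX ys zs. elim_state (f (fst z)) (?w (fst z)) ys (snd (snd z) # zs) (fst (snd z)) & snd (snd z) \<in> atoms (set (f (fst z))) & snd (snd z) ~: set ys"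
      if z: "z \<in> ?D1" for z
    proof -
      obtain ys zs where y: "fst z \<in> D" "?o (fst z) = ys @ snd (snd z) # zs" "fst (snd z) = foldl elim_fac (map leaf_fac (f (fst z))) ys"
        using z by blast
      show ?thesis using st[OF y(1,2)] vo[OF y(1)] unfolding y(2,3) by (intro exI[of _ ys] exI[of _ zs]) auto
    qed
    let ?hs = "%z. filter (%h. snd (snd z) |\<in>| fst h) (fst (snd z))"
    have f1: "ptime ?D1 (%z. T (fst z)) (%z. f (fst z))"
      by (rule comp_compose[OF f comp_fst[OF comp_id]]) (auto intro: pbd_T)
    have ja: "ptime ?D1 (%z. T (fst z)) (%z. join_all (?hs z))"
    proof (rule comp_join_all[OF _ _ f1 w1])
      fix z assume z: "z \<in> ?D1"
      thus "join_state (f (fst z)) (?w (fst z)) (?hs z)" using s1[OF z] hits_join_state by blast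
    qed (intro comp_intros)
    have "ptime ?D1 (%z. T (fst z)) (%z. forget_fac (fst (snd (snd z), join_all (?hs z))) (snd (snd (snd z), join_all (?hs z))))"
    proof (rule comp_compose[OF comp_forget_fac])
      fix z assume z: "z \<in> ?D1"
      obtain ys zs where s: "elim_state (f (fst z)) (?w (fst z)) ys (snd (snd z) # zs) (fst (snd z))"
        "snd (snd z) \<in> atoms (set (f (fst z)))" "snd (snd z) ~: set ys" using s1[OF z] by blast
      have "EX g. fac g (join_all (?hs z)) & snd (snd z) \<in> atoms (fst g) - snd g" by (rule hits_fac[OF s])
      thus "(snd (snd z), join_all (?hs z)) \<in> {z. EX g. fac g (snd z) & fst z \<in> atoms (fst g) - snd g}" by simp
    next
      show "pbd ?D1 (%z. 2 ^ qn (fcard (fst (snd (snd (snd z), join_all (?hs z)))))) (%z. sz z + T (fst z))"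
      proof (rule pbd_mono[OF w1])
        fix z assume z: "z \<in> ?D1"
        hence "join_state (f (fst z)) (?w (fst z)) (?hs z)" using s1[OF z] hits_join_state by blast
        hence "fcard (fst (join_all (?hs z))) <= ?w (fst z)"
          unfolding join_state_def fcard.rep_eq using scopes_join_all by auto
        from qn_mono[OF this] show "(2::nat) ^ qn (fcard (fst (snd (snd (snd z), join_all (?hs z))))) <= 2 ^ qn (?w (fst z))"
          by (intro power_increasing) simp_all
      qed
    qed (intro comp_intros ja)
    thus "ptime ?D1 (%z. T (fst z)) (%z. elim_fac (fst (snd z)) (snd (snd z)))"
      unfolding elim_fac_def fst_conv snd_conv by (intro comp_intros)
    let ?D2 = "{z. fst z \<in> D & (EX ys zs. ?o (fst z) = ys @ zs & snd z = foldl elim_fac (map leaf_fac (f (fst z))) ys)}"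
    let ?B = "%x. 1 + (sz (f x) + sz (?V x)) * (fbound (?w x) (?V x) + 1)"
    show "pbd ?D2 (%z. sz (snd z)) (%z. sz (fst z) + T (fst z))"
    proof (rule pbd_mono[OF pbd_compose[of D ?B _ ?D2 fst]])
      show "pbd D ?B (%x. sz x + T x)"
        by (intro pbd_add pbd_mult pbd_const comp_size[OF f] comp_size[OF V] pbd_fbound[OF V w])
      fix z assume "z \<in> ?D2"
      then obtain ys zs where y: "fst z \<in> D" "?o (fst z) = ys @ zs" "snd z = foldl elim_fac (map leaf_fac (f (fst z))) ys"
        by blast
      obtain zl where zl: "snd z = map snd zl" "fac_list zl" "union_fac zl = (set (f (fst z)), set ys)"
        "\<forall>h\<in>scopes zl. card h <= ?w (fst z)" "length zl <= length (f (fst z)) + length ys"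
        using st[OF y(1,2)] unfolding elim_state_def y(3) by (elim exE conjE)
      have "sz p + 1 <= fbound (?w (fst z)) (?V (fst z)) + 1" if "p \<in> set (snd z)" for p
      proof -
        obtain q where q: "q \<in> set zl" "p = snd q" using \<open>p \<in> set (snd z)\<close> zl(1) by auto
        have "fst (fst q) <= set (f (fst z))" using zl(3) q(1) by (auto simp: union_fac_def)
        hence at: "atoms (fst (fst q)) <= fset (?V (fst z))" unfolding Vs atoms_def by blast
        have fq: "fac (fst q) p" using zl(2) q by (auto simp: fac_list_def)
        have "fset (fst p) \<in> scopes zl" using q by (auto simp: scopes_def)
        hence "fcard (fst p) <= ?w (fst z)" using zl(4) by (simp add: fcard.rep_eq)
        from sz_factor[OF fq at this] show ?thesis by simp
      qed
      hence "(\<Sum>p\<leftarrow>snd z. sz p + 1) <= length (snd z) * (fbound (?w (fst z)) (?V (fst z)) + 1)" by (rule sum_list_bound)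
      moreover have "length (snd z) <= sz (f (fst z)) + sz (?V (fst z))"
      proof -
        have "length ys = card (set ys)" using vo[OF y(1)] y(2) by (simp add: distinct_card)
        also have "... <= card (fset (?V (fst z)))"
        proof (rule card_mono)
          show "set ys <= fset (?V (fst z))" unfolding Vs using vo[OF y(1)] y(2) by auto
        qed simp
        also have "... <= sz (?V (fst z))" using fcard_le_sz[of "?V (fst z)"] by (simp add: fcard.rep_eq)
        finally show ?thesis using zl(1,5) length_le_sz[of "f (fst z)"] by simp
      qed
      ultimately show "sz (snd z) <= ?B (fst z)" unfolding sz_list by (meson add_left_mono le_trans mult_le_mono1)
    qed auto
  qed
  have "ptime D T (%x. join_all (foldl elim_fac (map leaf_fac (f x)) (?o x)))"
  proof (rule comp_join_all[OF fold _ f w])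
    fix x assume x: "x \<in> D"
    have "elim_state (f x) (?w x) (?o x) [] (foldl elim_fac (map leaf_fac (f x)) (?o x))" by (rule st[OF x]) simp
    from end_join_state(1)[OF this] vo[OF x] show "join_state (f x) (?w x) (foldl elim_fac (map leaf_fac (f x)) (?o x))" by blast
  qed
  thus ?thesis unfolding wv_count_def count_table_def by (intro comp_intros comp_accq')
qed

end

section \<open>The two automata\<close>

subsection \<open>Disjunctive programs\<close>

definition fprod :: "'a fset => 'b fset => ('a \<times> 'b) fset" where
  "fprod A B = ffUnion ((%x. (%y. (x, y)) |`| B) |`| A)"

lemma fprod [simp]: "z |\<in>| fprod A B \<longleftrightarrow> fst z |\<in>| A & snd z |\<in>| B"
  by (cases z) (auto simp: fprod_def ffUnion.rep_eq)

lemma ptime_fprod: "ptime2 fprod"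
  unfolding fprod_def by (intro comp_intros)

lemmas comp_fprod [comp_intros] = comp_op2[OF ptime_fprod]

lemma fcard_fprod: "fcard (fprod A B) = fcard A * fcard B"
proof -
  have "fset (fprod A B) = fset A \<times> fset B" using fprod[of _ A B] by auto
  thus ?thesis by (simp add: fcard.rep_eq card_cartesian_product)
qed

lemma fcard_fPow: "fcard (fPow A) = 2 ^ fcard A"
proof -
  have "fset ` fset (fPow A) = Pow (fset A)"
  proof
    show "Pow (fset A) <= fset ` fset (fPow A)"
    proof
      fix X assume X: "X \<in> Pow (fset A)"
      hence fX: "fset (Abs_fset X) = X" by (intro Abs_fset_inverse) (auto intro: finite_subset[OF _ finite_fset])
      hence "Abs_fset X |\<in>| fPow A" using X by (simp add: less_eq_fset.rep_eq)
      thus "X \<in> fset ` fset (fPow A)" using fX by (metis imageI)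
    qed
  qed (auto simp: less_eq_fset.rep_eq)
  moreover have "inj_on fset (fset (fPow A))" by (auto simp: inj_on_def fset_inject)
  ultimately have "card (fset (fPow A)) = card (Pow (fset A))" by (metis card_image)
  thus ?thesis by (simp add: fcard.rep_eq card_Pow)
qed

definition restr :: "'a set => 'a set => 'a fset" where
  "restr X N = Abs_fset (N - X)"

lemma fset_restr [simp]: "finite N ==> fset (restr X N) = N - X"
  unfolding restr_def by (rule Abs_fset_inverse) simp

lemma restr_empty: "N <= X ==> restr X N = {||}"
  by (simp only: restr_def Diff_eq_empty_iff[THEN iffD2] bot_fset_def)

lemma fimage_ffilter_iff: "p |\<in>| f |`| ffilter P S \<longleftrightarrow> (EX e. e |\<in>| S & P e & p = f e)"
  by auto

definition agree :: "'a fset => 'a fset => 'a fset => 'a fset => bool" where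
  "agree B1 n1 B2 n2 \<longleftrightarrow> ffilter (%x. x |\<in>| B2) n1 = ffilter (%x. x |\<in>| B1) n2"

lemma ptime_agree: "ptime4 agree"
  unfolding agree_def by (intro comp_intros)

lemmas comp_agree [comp_intros] = comp_op4[OF ptime_agree]

definition satf :: "'a lit fset => 'a fset => 'a fset => 'a rule => bool" where
  "satf I J N r \<longleftrightarrow> fBall (body r) (%b. holds (fset I) (fset J) (fset N) b) --> fBex (head r) (%h. h |\<in>| N)"

lemma satf: "satf I J N r \<longleftrightarrow> sat (fset I) (fset J) (fset N) r"
  by (auto simp: satf_def sat_def)

lemma ptime_lit_true: "ptime3 (%a b c. lit_true (fset a) (fset b) c)"
  unfolding lit_true_def by (intro comp_intros)

lemmas comp_lit_true = comp_op3[OF ptime_lit_true]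

lemma ptime_holds: "ptime4 (%a b c d. holds (fset a) (fset b) (fset c) d)"
  unfolding holds_def by (intro comp_intros comp_lit_true)

lemmas comp_holds = comp_op4[OF ptime_holds]

lemma ptime_satf: "ptime4 satf"
  unfolding satf_def by (intro comp_intros comp_holds)

lemmas comp_satf [comp_intros] = comp_op4[OF ptime_satf]

lemma sat_restrict_guess: "sat (I Int lits_of (fset (rule_atoms r))) J N r \<longleftrightarrow> sat I J N r"
  by (rule sat_local[of _ "fset (rule_atoms r)"]) (auto simp: rule_atoms)

lemma sat_part:
  assumes "r \<in> G1" "(J1 Un J2) Int atoms G1 = J1" "(N1 Un N2) Int atoms G1 = N1"
  shows "sat I (J1 Un J2) (N1 Un N2) r \<longleftrightarrow> sat I J1 N1 r"
  by (rule sat_local[of _ "atoms G1"]) (use assms in \<open>auto simp: atoms_def\<close>)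

lemma agree_restr:
  assumes "X1 Int atoms G2 = {}" "X2 Int atoms G1 = {}" "fset B1 = atoms G1 - X1" "fset B2 = atoms G2 - X2"
    "N1 <= atoms G1" "N2 <= atoms G2" "finite N1" "finite N2"
  shows "agree B1 (restr X1 N1) B2 (restr X2 N2) \<longleftrightarrow> N1 Int atoms G2 = N2 Int atoms G1"
proof -
  have "fset (ffilter (%x. x |\<in>| B2) (restr X1 N1)) = N1 Int atoms G2" using assms by auto
  moreover have "fset (ffilter (%x. x |\<in>| B1) (restr X2 N2)) = N2 Int atoms G1" using assms by auto
  ultimately show ?thesis unfolding agree_def fset_inject[symmetric] by simp
qed

type_synonym 'a state = "'a fset \<times> ('a fset \<times> bool) fset"

definition submods :: "'a rule set => 'a lit set => 'a set => 'a set set" where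
  "submods G I J = {N. N <= J & (\<forall>r\<in>G. sat I J N r)}"

text \<open>The flag tells whether the submodel is proper: a proper one rules out that \<open>J\<close> is an answer set.\<close>

definition subs :: "'a set => 'a rule set => 'a lit set => 'a set => ('a fset \<times> bool) fset" where
  "subs X G I J = (%N. (restr X N, N ~= J)) |`| Abs_fset (submods G I J)"

definition full_St :: "'a rule set => 'a set => 'a lit set => ('a set \<times> 'a state) set" where
  "full_St G X I = {(J, restr X J, subs X G I J) | J. finite J & J <= atoms G & (\<forall>r\<in>G. sat I J J r)}"

definition full_leafq :: "'a rule => 'a lit fset => 'a state fset" where
  "full_leafq r I = (%J. (J, (%N. (N, N ~= J)) |`| ffilter (%N. satf I J N r) (fPow J))) |`|
     ffilter (%J. satf I J J r) (fPow (rule_atoms r))"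

text \<open>A union of submodels is proper as soon as one of them is, because both lie below their
  candidates and agree on shared atoms; hence the disjunction of the flags.\<close>

definition full_joinq :: "'a fset => 'a state => 'a fset => 'a state =>
    'a state fset" where
  "full_joinq B1 q1 B2 q2 = (if agree B1 (fst q1) B2 (fst q2) then
     {|(fst q1 |\<union>| fst q2, (%e. (fst (fst e) |\<union>| fst (snd e), snd (fst e) | snd (snd e))) |`|
        ffilter (%e. agree B1 (fst (fst e)) B2 (fst (snd e))) (fprod (snd q1) (snd q2)))|} else {||})"

definition full_forgetq :: "'a => 'a state => 'a state fset" where
  "full_forgetq v q = {|(fst q |-| {|v|}, (%p. (fst p |-| {|v|}, snd p)) |`| snd q)|}"

definition full_Qset :: "'a fset => 'a state fset" where
  "full_Qset B = fprod (fPow B) (fPow (fprod (fPow B) {|True, False|}))"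

lemma finite_submods: "finite J ==> finite (submods G I J)"
  unfolding submods_def by (rule finite_subset[of _ "Pow J"]) auto

lemma in_subs: "finite J ==> p |\<in>| subs X G I J \<longleftrightarrow> (\<exists>N\<in>submods G I J. p = (restr X N, N ~= J))"
  unfolding subs_def fimage.rep_eq using finite_submods[of J G I] by (auto simp: Abs_fset_inverse)

text \<open>Restricting to the atoms of each part inverts the union, and a rule only sees the atoms
  of its own part.\<close>

lemma submods_union:
  assumes J: "J1 <= atoms G1" "J2 <= atoms G2" "J1 Int atoms G2 = J2 Int atoms G1"
  shows "submods (G1 Un G2) I (J1 Un J2) = {N1 Un N2 | N1 N2. N1 \<in> submods G1 I J1 & N2 \<in> submods G2 I J2 & N1 Int atoms G2 = N2 Int atoms G1}"
proof -
  have 1: "sat I (J1 Un J2) (N1 Un N2) r \<longleftrightarrow> sat I J1 N1 r"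
    if "N1 <= atoms G1" "N2 <= atoms G2" "N1 Int atoms G2 = N2 Int atoms G1" "r \<in> G1" for N1 N2 r
    by (rule sat_part[OF that(4)]) (use J that in blast)+
  have 2: "sat I (J1 Un J2) (N1 Un N2) r \<longleftrightarrow> sat I J2 N2 r"
    if "N1 <= atoms G1" "N2 <= atoms G2" "N1 Int atoms G2 = N2 Int atoms G1" "r \<in> G2" for N1 N2 r
    unfolding Un_commute[of J1] Un_commute[of N1] by (rule sat_part[OF that(4)]) (use J that in blast)+
  show ?thesis
  proof (intro equalityI subsetI)
    fix N assume N: "N \<in> submods (G1 Un G2) I (J1 Un J2)"
    let ?N1 = "N Int atoms G1" and ?N2 = "N Int atoms G2"
    have e: "?N1 Un ?N2 = N" using N J by (auto simp: submods_def)
    have a: "?N1 Int atoms G2 = ?N2 Int atoms G1" by blast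
    have s: "?N1 <= J1" "?N2 <= J2" using N J by (auto simp: submods_def)
    have "\<forall>r\<in>G1. sat I J1 ?N1 r" using N 1[of ?N1 ?N2] e by (auto simp: submods_def)
    moreover have "\<forall>r\<in>G2. sat I J2 ?N2 r" using N 2[of ?N1 ?N2] e by (auto simp: submods_def)
    ultimately have "?N1 \<in> submods G1 I J1" "?N2 \<in> submods G2 I J2" using s by (simp_all add: submods_def)
    thus "N \<in> {N1 Un N2 | N1 N2. N1 \<in> submods G1 I J1 & N2 \<in> submods G2 I J2 & N1 Int atoms G2 = N2 Int atoms G1}"
      using e a by blast
  next
    fix N assume "N \<in> {N1 Un N2 | N1 N2. N1 \<in> submods G1 I J1 & N2 \<in> submods G2 I J2 & N1 Int atoms G2 = N2 Int atoms G1}"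
    then obtain N1 N2 where N: "N = N1 Un N2" "N1 \<in> submods G1 I J1" "N2 \<in> submods G2 I J2" "N1 Int atoms G2 = N2 Int atoms G1" by blast
    have s: "N1 <= atoms G1" "N2 <= atoms G2" using N J by (auto simp: submods_def)
    show "N \<in> submods (G1 Un G2) I (J1 Un J2)"
      using N 1[OF s N(4)] 2[OF s N(4)] unfolding N(1) submods_def by auto
  qed
qed

lemma subs_union:
  assumes J: "J1 <= atoms G1" "J2 <= atoms G2" "J1 Int atoms G2 = J2 Int atoms G1" "finite J1" "finite J2"
    and X: "X1 Int atoms G2 = {}" "X2 Int atoms G1 = {}" "fset B1 = atoms G1 - X1" "fset B2 = atoms G2 - X2"
  shows "subs (X1 Un X2) (G1 Un G2) I (J1 Un J2) = (%e. (fst (fst e) |\<union>| fst (snd e), snd (fst e) | snd (snd e))) |`|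
        ffilter (%e. agree B1 (fst (fst e)) B2 (fst (snd e))) (fprod (subs X1 G1 I J1) (subs X2 G2 I J2))" (is "?l = ?r")
proof (rule fset_eqI)
  fix p
  let ?c = "%N1 N2. N1 \<in> submods G1 I J1 & N2 \<in> submods G2 I J2 & N1 Int atoms G2 = N2 Int atoms G1"
  have "p |\<in>| ?l \<longleftrightarrow> (EX N1 N2. ?c N1 N2 & p = (restr (X1 Un X2) (N1 Un N2), N1 Un N2 ~= J1 Un J2))"
    using J(4,5) by (simp add: in_subs submods_union[OF J(1-3)]) blast
  also have "... \<longleftrightarrow> (EX N1 N2. ?c N1 N2 & p = (restr X1 N1 |\<union>| restr X2 N2, N1 ~= J1 | N2 ~= J2))"
  proof -
    have "(restr (X1 Un X2) (N1 Un N2), N1 Un N2 ~= J1 Un J2) = (restr X1 N1 |\<union>| restr X2 N2, N1 ~= J1 | N2 ~= J2)"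
      if c: "?c N1 N2" for N1 N2
    proof -
      have s: "N1 <= J1" "N2 <= J2" using c by (auto simp: submods_def)
      hence fin: "finite N1" "finite N2" using J(4,5) finite_subset by blast+
      have "fset (restr (X1 Un X2) (N1 Un N2)) = fset (restr X1 N1 |\<union>| restr X2 N2)" using fin s J X by auto
      hence "restr (X1 Un X2) (N1 Un N2) = restr X1 N1 |\<union>| restr X2 N2" by (rule fset_inject[THEN iffD1])
      moreover have "N1 Un N2 = J1 Un J2 \<longleftrightarrow> N1 = J1 & N2 = J2" using c s J by blast
      ultimately show ?thesis by simp
    qed
    thus ?thesis by (intro ex_cong1 conj_cong refl) simp
  qed
  also have "... \<longleftrightarrow> p |\<in>| ?r"
  proof -
    have ag: "agree B1 (restr X1 N1) B2 (restr X2 N2) \<longleftrightarrow> N1 Int atoms G2 = N2 Int atoms G1"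
      if "N1 \<in> submods G1 I J1" "N2 \<in> submods G2 I J2" for N1 N2
    proof (rule agree_restr[OF X])
      show "N1 <= atoms G1" "N2 <= atoms G2" using that J by (auto simp: submods_def)
      show "finite N1" "finite N2" using that J(4,5) finite_subset by (auto simp: submods_def)
    qed
    have "p |\<in>| ?r \<longleftrightarrow> (EX p1 p2. p1 |\<in>| subs X1 G1 I J1 & p2 |\<in>| subs X2 G2 I J2 & agree B1 (fst p1) B2 (fst p2) &
       p = (fst p1 |\<union>| fst p2, snd p1 | snd p2))"
      by (simp only: fimage_ffilter_iff fprod split_paired_Ex fst_conv snd_conv conj_assoc)
    also have "... \<longleftrightarrow> (EX N1 N2. N1 \<in> submods G1 I J1 & N2 \<in> submods G2 I J2 & agree B1 (restr X1 N1) B2 (restr X2 N2) &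
       p = (restr X1 N1 |\<union>| restr X2 N2, N1 ~= J1 | N2 ~= J2))"
      unfolding in_subs[OF J(4)] in_subs[OF J(5)] by (metis fst_conv snd_conv)
    also have "... \<longleftrightarrow> (EX N1 N2. ?c N1 N2 & p = (restr X1 N1 |\<union>| restr X2 N2, N1 ~= J1 | N2 ~= J2))"
      using ag by blast
    finally show ?thesis by simp
  qed
  finally show "p |\<in>| ?l \<longleftrightarrow> p |\<in>| ?r" .
qed

lemma full_join:
  assumes X: "X1 Int atoms G2 = {}" "X2 Int atoms G1 = {}" "fset B1 = atoms G1 - X1" "fset B2 = atoms G2 - X2"
  shows "full_St (G1 Un G2) (X1 Un X2) I =
    {(J1 Un J2, q) |J1 J2 q q1 q2. (J1, q1) \<in> full_St G1 X1 I & (J2, q2) \<in> full_St G2 X2 I & q |\<in>| full_joinq B1 q1 B2 q2}"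
proof -
  let ?m = "%G J. finite J & J <= atoms G & (\<forall>r\<in>G. sat I J J r)"
  let ?q = "%X G J. (restr X J, subs X G I J)"
  have m: "?m (G1 Un G2) (J1 Un J2) \<longleftrightarrow> ?m G1 J1 & ?m G2 J2"
    if c: "J1 <= atoms G1" "J2 <= atoms G2" "J1 Int atoms G2 = J2 Int atoms G1" for J1 J2
  proof -
    have "sat I (J1 Un J2) (J1 Un J2) r \<longleftrightarrow> sat I J1 J1 r" if r: "r \<in> G1" for r
      by (rule sat_part[OF r]) (use c in blast)+
    moreover have "sat I (J1 Un J2) (J1 Un J2) r \<longleftrightarrow> sat I J2 J2 r" if r: "r \<in> G2" for r
      unfolding Un_commute[of J1] by (rule sat_part[OF r]) (use c in blast)+
    ultimately show ?thesis using c by auto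
  qed
  have q: "q |\<in>| full_joinq B1 (?q X1 G1 J1) B2 (?q X2 G2 J2) \<longleftrightarrow> J1 Int atoms G2 = J2 Int atoms G1 & q = ?q (X1 Un X2) (G1 Un G2) (J1 Un J2)"
    if J: "?m G1 J1" "?m G2 J2" for J1 J2 q
  proof (cases "J1 Int atoms G2 = J2 Int atoms G1")
    case True
    hence a: "agree B1 (restr X1 J1) B2 (restr X2 J2)" using agree_restr[OF X] J by simp
    have "fset (restr X1 J1 |\<union>| restr X2 J2) = fset (restr (X1 Un X2) (J1 Un J2))" using J X by auto
    hence "restr X1 J1 |\<union>| restr X2 J2 = restr (X1 Un X2) (J1 Un J2)" by (rule fset_inject[THEN iffD1])
    thus ?thesis using True a subs_union[OF _ _ True _ _ X, of I] J by (simp add: full_joinq_def)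
  next
    case False
    hence a: "~ agree B1 (restr X1 J1) B2 (restr X2 J2)" using agree_restr[OF X] J by simp
    thus ?thesis using False by (simp add: full_joinq_def)
  qed
  have "p \<in> full_St (G1 Un G2) (X1 Un X2) I \<longleftrightarrow> (EX J1 J2 q q1 q2. p = (J1 Un J2, q) & (J1, q1) \<in> full_St G1 X1 I & (J2, q2) \<in> full_St G2 X2 I & q |\<in>| full_joinq B1 q1 B2 q2)" for p
  proof -
    have "(EX J1 J2 q q1 q2. p = (J1 Un J2, q) & (J1, q1) \<in> full_St G1 X1 I & (J2, q2) \<in> full_St G2 X2 I & q |\<in>| full_joinq B1 q1 B2 q2)
      \<longleftrightarrow> (EX J1 J2 q. p = (J1 Un J2, q) & ?m G1 J1 & ?m G2 J2 & q |\<in>| full_joinq B1 (?q X1 G1 J1) B2 (?q X2 G2 J2))"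
      unfolding full_St_def by blast
    also have "... \<longleftrightarrow> (EX J1 J2 q. p = (J1 Un J2, q) & ?m G1 J1 & ?m G2 J2 & J1 Int atoms G2 = J2 Int atoms G1 & q = ?q (X1 Un X2) (G1 Un G2) (J1 Un J2))"
      by (intro ex_cong1 conj_cong refl) (rule q; simp)
    also have "... \<longleftrightarrow> (EX J1 J2. p = (J1 Un J2, ?q (X1 Un X2) (G1 Un G2) (J1 Un J2)) & J1 <= atoms G1 & J2 <= atoms G2 & J1 Int atoms G2 = J2 Int atoms G1 & ?m (G1 Un G2) (J1 Un J2))"
    proof (intro ex_cong1)
      fix J1 J2
      have "?m G1 J1 & ?m G2 J2 & J1 Int atoms G2 = J2 Int atoms G1 \<longleftrightarrow>
        J1 <= atoms G1 & J2 <= atoms G2 & J1 Int atoms G2 = J2 Int atoms G1 & ?m (G1 Un G2) (J1 Un J2)"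
        using m[of J1 J2] by blast
      thus "(EX q. p = (J1 Un J2, q) & ?m G1 J1 & ?m G2 J2 & J1 Int atoms G2 = J2 Int atoms G1 & q = ?q (X1 Un X2) (G1 Un G2) (J1 Un J2))
        \<longleftrightarrow> p = (J1 Un J2, ?q (X1 Un X2) (G1 Un G2) (J1 Un J2)) & J1 <= atoms G1 & J2 <= atoms G2 & J1 Int atoms G2 = J2 Int atoms G1 & ?m (G1 Un G2) (J1 Un J2)"
        by (cases p) (simp, blast)
    qed
    also have "... \<longleftrightarrow> (EX J. p = (J, ?q (X1 Un X2) (G1 Un G2) J) & ?m (G1 Un G2) J)"
    proof
      assume "EX J. p = (J, ?q (X1 Un X2) (G1 Un G2) J) & ?m (G1 Un G2) J"
      then obtain J where J: "p = (J, ?q (X1 Un X2) (G1 Un G2) J)" "?m (G1 Un G2) J" by blast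
      have e: "J Int atoms G1 Un J Int atoms G2 = J" using J(2) by auto
      show "EX J1 J2. p = (J1 Un J2, ?q (X1 Un X2) (G1 Un G2) (J1 Un J2)) & J1 <= atoms G1 & J2 <= atoms G2 & J1 Int atoms G2 = J2 Int atoms G1 & ?m (G1 Un G2) (J1 Un J2)"
        by (rule exI[of _ "J Int atoms G1"], rule exI[of _ "J Int atoms G2"]) (use J in \<open>auto simp: e\<close>)
    qed blast
    finally show ?thesis unfolding full_St_def by blast
  qed
  thus ?thesis by blast
qed

lemma full_leaf:
  assumes I: "fset IB = I Int lits_of (fset (rule_atoms r))"
  shows "snd ` full_St {r} {} I = fset (full_leafq r IB)"
proof -
  have s: "satf IB J N r \<longleftrightarrow> sat I (fset J) (fset N) r" for J N
    unfolding satf I by (rule sat_restrict_guess)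
  have ab: "EX J'. J = fset J'" if "finite J" for J :: "'a set" using that by (metis Abs_fset_inverse mem_Collect_eq)
  have r0: "restr {} (fset J) = J" for J :: "'a fset" by (simp add: restr_def fset_inverse)
  have sb: "subs {} {r} I (fset J) = (%N. (N, N ~= J)) |`| ffilter (%N. satf IB J N r) (fPow J)" for J
  proof (rule fset_eqI)
    fix p
    have "p |\<in>| subs {} {r} I (fset J) \<longleftrightarrow> (EX N. fset N <= fset J & sat I (fset J) (fset N) r & p = (N, fset N ~= fset J))"
      unfolding in_subs[OF finite_fset] submods_def
    proof
      assume "\<exists>N\<in>{N. N <= fset J & (\<forall>r\<in>{r}. sat I (fset J) N r)}. p = (restr {} N, N ~= fset J)"
      then obtain N where N: "N <= fset J" "sat I (fset J) N r" "p = (restr {} N, N ~= fset J)" by blast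
      obtain N' where "N = fset N'" using ab[OF finite_subset[OF N(1) finite_fset]] by blast
      thus "EX N. fset N <= fset J & sat I (fset J) (fset N) r & p = (N, fset N ~= fset J)" using N by (auto simp: r0)
    next
      assume "EX N. fset N <= fset J & sat I (fset J) (fset N) r & p = (N, fset N ~= fset J)"
      then obtain N where N: "fset N <= fset J" "sat I (fset J) (fset N) r" "p = (N, fset N ~= fset J)" by blast
      thus "\<exists>N\<in>{N. N <= fset J & (\<forall>r\<in>{r}. sat I (fset J) N r)}. p = (restr {} N, N ~= fset J)"
        by (intro bexI[of _ "fset N"]) (auto simp: r0)
    qed
    also have "... \<longleftrightarrow> p |\<in>| (%N. (N, N ~= J)) |`| ffilter (%N. satf IB J N r) (fPow J)"
      unfolding s by (auto simp: less_eq_fset.rep_eq fset_inject fimage.rep_eq image_iff)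
    finally show "p |\<in>| subs {} {r} I (fset J) \<longleftrightarrow> p |\<in>| (%N. (N, N ~= J)) |`| ffilter (%N. satf IB J N r) (fPow J)" .
  qed
  have main: "q \<in> snd ` full_St {r} {} I \<longleftrightarrow> (EX J. fset J <= fset (rule_atoms r) & sat I (fset J) (fset J) r & q = (J, subs {} {r} I (fset J)))" for q
  proof -
    have "q \<in> snd ` full_St {r} {} I \<longleftrightarrow> (EX J. finite J & J <= fset (rule_atoms r) & sat I J J r & q = (restr {} J, subs {} {r} I J))"
      by (auto simp: full_St_def image_iff)
    also have "... \<longleftrightarrow> (EX J. fset J <= fset (rule_atoms r) & sat I (fset J) (fset J) r & q = (J, subs {} {r} I (fset J)))"
      using ab r0 by (metis finite_fset)
    finally show ?thesis .
  qed
  have "q \<in> snd ` full_St {r} {} I \<longleftrightarrow> q \<in> fset (full_leafq r IB)" for q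
    unfolding main full_leafq_def sb fimage_ffilter_iff s fPow_iff less_eq_fset.rep_eq ..
  thus ?thesis by blast
qed

lemma full_forget:
  "full_St G (insert v X) I = {(J, q'). EX q. (J, q) \<in> full_St G X I & q' |\<in>| full_forgetq v q}"
proof -
  have r: "restr (insert v X) N = restr X N |-| {|v|}" if "finite N" for N
  proof -
    have "fset (restr (insert v X) N) = fset (restr X N |-| {|v|})" using that by auto
    thus ?thesis by (rule fset_inject[THEN iffD1])
  qed
  have sb: "subs (insert v X) G I J = (%p. (fst p |-| {|v|}, snd p)) |`| subs X G I J" if J: "finite J" for J
  proof -
    have "restr (insert v X) N = restr X N |-| {|v|}" if "N \<in> fset (Abs_fset (submods G I J))" for N
    proof (rule r)
      have "N <= J" using that by (simp add: Abs_fset_inverse finite_submods J) (simp add: submods_def)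
      thus "finite N" by (rule finite_subset[OF _ J])
    qed
    thus ?thesis unfolding subs_def fset.map_comp comp_def fst_conv snd_conv by (intro fset.map_cong refl) simp
  qed
  let ?m = "%J. finite J & J <= atoms G & (\<forall>r\<in>G. sat I J J r)"
  have "(J, q') \<in> full_St G (insert v X) I \<longleftrightarrow> (EX q. (J, q) \<in> full_St G X I & q' |\<in>| full_forgetq v q)" for J q'
  proof -
    have "(J, q') \<in> full_St G (insert v X) I \<longleftrightarrow> ?m J & q' = (restr (insert v X) J, subs (insert v X) G I J)"
      by (auto simp: full_St_def)
    also have "... \<longleftrightarrow> ?m J & q' = (restr X J |-| {|v|}, (%p. (fst p |-| {|v|}, snd p)) |`| subs X G I J)"
      using r[of J] sb[of J] by (intro conj_cong refl) simp
    also have "... \<longleftrightarrow> (EX q. (J, q) \<in> full_St G X I & q' |\<in>| full_forgetq v q)"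
      by (simp add: full_St_def full_forgetq_def)
    finally show ?thesis .
  qed
  thus ?thesis by blast
qed

text \<open>Removing atoms that do not occur in the program keeps all rules satisfied, so minimality
  excludes them.\<close>

lemma answer_set_subset: "J \<in> AS G I ==> J <= atoms G"
proof -
  assume "J \<in> AS G I"
  hence J: "\<forall>r\<in>G. sat I J J r" "!!N. N \<subset> J ==> \<exists>r\<in>G. ~ sat I J N r" unfolding answer_sets_reduct by auto
  have "sat I J (J Int atoms G) r" if "r \<in> G" for r
    using sat_local[of I "atoms G" I J J "J Int atoms G" J r] that J(1) by (auto simp: atoms_def)
  hence "J Int atoms G = J" using J(2)[of "J Int atoms G"] by blast
  thus ?thesis by blast
qed

text \<open>Once all atoms are forgotten every trace is empty and only the flags remain, so a proper
  submodel of the reduct shows up as \<open>({||}, True)\<close>.\<close>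

lemma full_final:
  assumes G: "finite G"
  shows "{J. EX q. (J, q) \<in> full_St G (atoms G) I & ({||}, True) |\<notin>| snd q} = AS G I"
proof -
  have "(EX q. (J, q) \<in> full_St G (atoms G) I & ({||}, True) |\<notin>| snd q) \<longleftrightarrow> J \<in> AS G I" for J
  proof (cases "finite J & J <= atoms G")
    case True
    have "({||}, True) |\<in>| subs (atoms G) G I J \<longleftrightarrow> (EX N. N \<subset> J & (\<forall>r\<in>G. sat I J N r))"
    proof -
      have "restr (atoms G) N = {||}" if "N <= J" for N
        by (rule restr_empty) (use that True in blast)
      hence e: "({||}, True) |\<in>| subs (atoms G) G I J \<longleftrightarrow> (\<exists>N\<in>submods G I J. N ~= J)"
        unfolding in_subs[OF conjunct1[OF True]] by (intro bex_cong refl) (simp add: submods_def)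
      show ?thesis unfolding e submods_def psubset_eq by blast
    qed
    moreover have "(EX q. (J, q) \<in> full_St G (atoms G) I & ({||}, True) |\<notin>| snd q) \<longleftrightarrow>
      (\<forall>r\<in>G. sat I J J r) & ({||}, True) |\<notin>| subs (atoms G) G I J"
      using True by (simp add: full_St_def)
    ultimately show ?thesis unfolding answer_sets_reduct by blast
  next
    case False
    have "J ~: AS G I"
      using False answer_set_subset finite_subset[OF _ finite_atoms[OF G]] by blast
    thus ?thesis using False unfolding full_St_def by auto
  qed
  thus ?thesis by blast
qed

text \<open>The number of states over \<open>b\<close> atoms: a subset, together with a set of pairs
  of a subset and a flag. Sets of states add another exponential, which makes three.\<close>

definition full_qn :: "nat => nat" where "full_qn b = 2 ^ (b + 2 * 2 ^ b)"

lemma full_qn_ge: "b + 2 * 2 ^ b <= full_qn b"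
  unfolding full_qn_def using less_exp[of "b + 2 * 2 ^ b"] by linarith

interpretation full: comp_automaton full_leafq full_joinq full_forgetq "%v q. v |\<in>| fst q" "%q. ({||}, True) |\<notin>| snd q"
  "({||}, {|({||}, False)|})" full_St full_Qset "%_. True" full_qn 4
proof
  show "full_St {} {} I = {({}, {||}, {|({||}, False)|})}" for I :: "'a lit set"
  proof -
    have "submods {} I {} = {{}}" by (auto simp: submods_def)
    hence "subs {} {} I {} = {|({||}, False)|}" by (intro fset_eqI) (simp add: in_subs restr_empty)
    thus ?thesis by (auto simp: full_St_def restr_empty)
  qed
  show "J <= atoms G & (\<forall>v\<in>atoms G - X. (v \<in> J) = (v |\<in>| fst q))" if "(J, q) \<in> full_St G X I" for J q and G :: "'a rule set" and X I
    using that by (auto simp: full_St_def)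
  show "full_St G X I = full_St G X I'" if "I Int lits_of (atoms G) = I' Int lits_of (atoms G)" for I I' and G :: "'a rule set" and X
  proof -
    have s: "sat I J N r \<longleftrightarrow> sat I' J N r" if "r \<in> G" for r J N
      by (rule sat_local[of _ "atoms G"]) (use that \<open>I Int lits_of (atoms G) = I' Int lits_of (atoms G)\<close> in \<open>auto simp: atoms_def\<close>)
    hence "submods G I J = submods G I' J" for J by (auto simp: submods_def)
    hence "subs X G I J = subs X G I' J" for J by (simp add: subs_def)
    thus ?thesis using s by (auto simp: full_St_def)
  qed
  show "q |\<in>| full_Qset B" if "(J, q) \<in> full_St G X I" "finite G" "X <= atoms G" "fset B = atoms G - X"
    for J q and G :: "'a rule set" and X I B
  proof -
    have J: "finite J" "J <= atoms G" "q = (restr X J, subs X G I J)" using that(1) by (auto simp: full_St_def)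
    have r: "restr X N |\<subseteq>| B" if "N <= J" for N
      using that J finite_subset[OF that J(1)] \<open>fset B = atoms G - X\<close> by (auto simp: less_eq_fset.rep_eq)
    have "p |\<in>| fprod (fPow B) {|True, False|}" if "p |\<in>| subs X G I J" for p
      using that unfolding in_subs[OF J(1)] submods_def by (elim bexE) (simp add: r)
    thus ?thesis using r[of J] by (auto simp: full_Qset_def J(3))
  qed
  show "full_qn m <= full_qn n" if "m <= n" for m n
  proof -
    have "(2::nat) ^ m <= 2 ^ n" using that by (rule power_increasing) simp
    hence "m + 2 * 2 ^ m <= n + 2 * 2 ^ n" using that by linarith
    thus ?thesis unfolding full_qn_def by (rule power_increasing) simp
  qed
  show "n <= full_qn n" for n using full_qn_ge[of n] by linarith
  show "fcard (full_Qset B) <= full_qn (fcard B)" for B :: "'a fset"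
  proof -
    have "fcard {|True, False|} = 2" by (simp add: fcard.rep_eq)
    thus ?thesis unfolding full_Qset_def fcard_fprod fcard_fPow full_qn_def power_add by (simp add: mult.commute)
  qed
  show "sz q <= (sz B + 2 ^ full_qn (fcard B) + 2) ^ 4" if "q |\<in>| full_Qset B" for q and B :: "'a fset"
  proof -
    let ?T = "2 ^ full_qn (fcard B) :: nat" and ?s = "sz B"
    have q: "fst q |\<subseteq>| B" "snd q |\<subseteq>| fprod (fPow B) {|True, False|}" using that by (auto simp: full_Qset_def)
    have el: "sz p <= ?s + 4" if "p |\<in>| snd q" for p
    proof -
      have "p |\<in>| fprod (fPow B) {|True, False|}" using that q(2) by blast
      hence "fst p |\<subseteq>| B" by simp
      thus ?thesis using sz_fset_mono[of "fst p" B] sz_bool[of "snd p"] by (simp add: enc_prod_def)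
    qed
    have "fcard (snd q) <= fcard (fprod (fPow B) {|True, False|})" by (rule fcard_mono[OF q(2)])
    also have "... = 2 ^ fcard B * 2" unfolding fcard_fprod fcard_fPow by (simp add: fcard.rep_eq)
    also have "... <= ?T" using full_qn_ge[of "fcard B"] less_exp[of "full_qn (fcard B)"] by linarith
    finally have "fcard (snd q) * (?s + 4 + 1) <= ?T * (?s + 4 + 1)" by (rule mult_right_mono) simp
    hence "sz (snd q) <= 1 + ?T * (?s + 5)" using sz_fset_le[of "snd q" "?s + 4", OF el] by (simp add: algebra_simps)
    hence "sz q <= ?s + 2 + ?T * (?s + 5)" using sz_fset_mono[OF q(1)] by (simp add: enc_prod_def)
    also have "... <= (?s + ?T + 2) * (?s + ?T + 6)" by (simp add: algebra_simps)
    also have "... <= (?s + ?T + 2) * ((?s + ?T + 2) * 4)" by (intro mult_le_mono) auto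
    also have "... <= (?s + ?T + 2) * ((?s + ?T + 2) * ((?s + ?T + 2) * (?s + ?T + 2)))"
    proof (intro mult_le_mono order_refl)
      have "2 * 2 <= (?s + ?T + 2) * (?s + ?T + 2)" by (intro mult_le_mono) auto
      thus "4 <= (?s + ?T + 2) * (?s + ?T + 2)" by simp
    qed
    also have "... = (?s + ?T + 2) ^ 4" by (simp add: power4_eq_xxxx mult.assoc)
    finally show ?thesis .
  qed
  show "ptime UNIV (%z :: 'a rule \<times> 'a lit fset. 2 ^ full_qn (fcard (rule_atoms (fst z)))) (%z. full_leafq (fst z) (snd z))"
  proof -
    let ?T = "%z :: 'a rule \<times> 'a lit fset. 2 ^ full_qn (fcard (rule_atoms (fst z))) :: nat"
    have le: "2 ^ fcard J <= ?T z" if "J |\<subseteq>| rule_atoms (fst z)" for J z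
      using fcard_mono[OF that] full_qn_ge[of "fcard (rule_atoms (fst z))"] by (intro power_increasing) auto
    have 1: "ptime UNIV ?T (%z. fPow (rule_atoms (fst z)))"
      by (intro comp_fPow comp_intros pbd_mono[OF pbd_T]) (rule le, simp)
    have 2: "ptime {z. fst z \<in> UNIV & snd z |\<in>| ffilter (%J. satf (snd (fst z)) J J (fst (fst z))) (fPow (rule_atoms (fst (fst z))))}
       (%z. ?T (fst z)) (%z. fPow (snd z))"
      by (intro comp_fPow comp_intros pbd_mono[OF pbd_T]) (rule le, simp)
    show ?thesis unfolding full_leafq_def by (intro comp_intros 1 2)
  qed
  have "ptime UNIV (%_. 0) (%z :: 'a fset \<times> _. full_joinq (fst z) (fst (snd z)) (fst (snd (snd z))) (snd (snd (snd z))))"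
    unfolding full_joinq_def by (intro comp_intros)
  thus "ptime UNIV (%z :: 'a fset \<times> _. 2 ^ full_qn (fcard (fst z |\<union>| fst (snd (snd z)))))
      (%z. full_joinq (fst z) (fst (snd z)) (fst (snd (snd z))) (snd (snd (snd z))))"
    by (rule comp_weaken) auto
  show "ptime UNIV (%_. 0) (%z. full_forgetq (fst z :: 'a) (snd z))" unfolding full_forgetq_def by (intro comp_intros)
  show "ptime UNIV (%_. 0) (%z. (fst z :: 'a) |\<in>| fst (snd z :: 'a state))" by (intro comp_intros)
  show "ptime UNIV (%_. 0) (%q :: 'a state. ({||}, True) |\<notin>| snd q)" by (intro comp_intros)
qed (rule full_leaf full_join full_forget full_final; assumption)+

subsection \<open>Normal and tight programs\<close>

text \<open>The answer sets of such programs are the models whose atoms can be listed in such a way that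
  each one is the only true atom in the head of a rule whose body holds by virtue of the atoms
  before it.\<close>

definition supports :: "'a rule => 'a lit set => 'a list => 'a => bool" where
  "supports r I zs a \<longleftrightarrow> fset (head r) Int set zs = {a} & (\<forall>b\<in>fset (body r). holds I (set zs) (set (takeWhile (%x. x ~= a) zs)) b)"

text \<open>The property that groundings of normal and of tight programs share, and from which
  derivation orders are obtained.\<close>

definition ordered :: "'a rule set => bool" where
  "ordered G \<longleftrightarrow> (\<forall>r\<in>G. fcard (head r) <= 1) | acyclic (dependency_graph G)"

lemma holds_mono: "N <= N' ==> holds I J N b ==> holds I J N' b"
proof -
  assume "N <= N'"
  hence "lit_true J N l ==> lit_true J N' l" for l by (cases l) (auto simp: lit_true_def)
  thus "holds I J N b ==> holds I J N' b" by (cases b) (auto simp: holds_def)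
qed

text \<open>By minimality of \<open>J\<close>, some rule fails in each proper subset. For normal
  programs the rule failing in \<open>N\<close> has a single head atom, which is the wanted one. For
  tight programs minimality is applied to \<open>J\<close> without one atom that is missing in
  \<open>N\<close> and minimal in the dependency graph.\<close>

lemma next_supported:
  assumes G: "ordered G" "finite J" and J: "J \<in> AS G I" and N: "N \<subset> J"
  shows "\<exists>a\<in>J - N. \<exists>r\<in>G. fset (head r) Int J = {a} & (\<forall>b\<in>fset (body r). holds I J N b)"
proof -
  have Jm: "!!r. r \<in> G ==> sat I J J r" "!!N. N \<subset> J ==> \<exists>r\<in>G. ~ sat I J N r" using J unfolding answer_sets_reduct by auto
  consider "\<forall>r\<in>G. fcard (head r) <= 1" | "acyclic (dependency_graph G)" using G unfolding ordered_def by blast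
  thus ?thesis
  proof cases
    case 1
    obtain r where r: "r \<in> G" "~ sat I J N r" using Jm(2)[OF N] by blast
    hence b: "\<forall>b\<in>fset (body r). holds I J N b" "fset (head r) Int N = {}" unfolding sat_def by auto
    have "\<forall>b\<in>fset (body r). holds I J J b" using b holds_mono N by blast
    then obtain a where a: "a \<in> fset (head r)" "a \<in> J" using Jm(1)[OF r(1)] unfolding sat_def by blast
    have "card (fset (head r)) <= 1" using 1 r(1) by (auto simp: fcard.rep_eq)
    hence "fset (head r) = {a}" using a(1) by (metis card_le_Suc0_iff_eq finite_fset One_nat_def singletonI subsetI subset_singletonD empty_iff)
    thus ?thesis using r(1) b a(2) by (intro bexI[of _ a] bexI[of _ r]) auto
  next
    case 2
    let ?R = "{(c, a). (c, a) \<in> dependency_graph G & c \<in> J & a \<in> J}"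
    have "finite ?R" by (rule finite_subset[of _ "J \<times> J"]) (use G in auto)
    moreover have "acyclic ?R" by (rule acyclic_subset[OF 2]) auto
    ultimately have wf: "wf ?R" by (rule finite_acyclic_wf)
    obtain x where x: "x \<in> J - N" using N by blast
    \<comment> \<open>A missing atom that is minimal with respect to dependency: whatever it depends
      on inside \<open>J\<close> already belongs to \<open>N\<close>.\<close>
    obtain a where a: "a \<in> J - N" "!!c. (c, a) \<in> ?R ==> c ~: J - N"
    proof (rule wfE_min[OF wf x])
      fix z assume z: "z \<in> J - N" "!!y. (y, z) \<in> ?R ==> y ~: J - N"
      show thesis by (rule that[OF z])
    qed
    have sub: "J - {a} \<subset> J" using a(1) by blast
    obtain r where r: "r \<in> G" "~ sat I J (J - {a}) r" using Jm(2)[OF sub] by blast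
    hence b: "\<forall>b\<in>fset (body r). holds I J (J - {a}) b" "fset (head r) Int (J - {a}) = {}" unfolding sat_def by auto
    have "\<forall>b\<in>fset (body r). holds I J J b" using b(1) holds_mono[of "J - {a}" J] by blast
    hence h: "fset (head r) Int J = {a}" using Jm(1)[OF r(1)] b(2) unfolding sat_def by blast
    have pos: "c \<in> N" if "c \<in> J" "(c, a) \<in> dependency_graph G" for c using a that by blast
    have "holds I J N e" if e: "e \<in> fset (body r)" for e
    proof -
      have h': "holds I J (J - {a}) e" using b(1) e by blast
      \<comment> \<open>The graph has an edge for each atom that the body may use positively,
        including the epistemic forms that the reduct turns into positive literals.\<close>
      have dep: "(c, a) \<in> dependency_graph G" if "Lit (Pos c) = e | ENot (Neg c) = e | NegENot (Pos c) = e" for c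
        using h r(1) e that unfolding dependency_graph_def pos_body_def by blast
      have t: "lit_true J N l" if "lit_true J (J - {a}) l" "Lit l = e | ENot (compl l) = e | NegENot l = e" for l
        using that dep[of "lit_atom l"] pos[of "lit_atom l"] by (cases l) (auto simp: lit_true_def)
      have cc: "compl (compl l) = l" for l :: "'a lit" by (cases l) auto
      show ?thesis
      proof (cases e)
        case (Lit l) thus ?thesis using h' t[of l] by (simp add: holds_def)
      next
        case (ENot l) thus ?thesis using h' t[of "compl l"] by (simp add: holds_def cc)
      next
        case (NegENot l) thus ?thesis using h' t[of l] by (simp add: holds_def)
      qed
    qed
    thus ?thesis using a(1) r(1) h by blast
  qed
qed

lemma takeWhile_notin: "a ~: set xs ==> takeWhile (%x. x ~= a) (xs @ ys) = xs @ takeWhile (%x. x ~= a) ys"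
  by (rule takeWhile_append2) auto

text \<open>A longest list of supported atoms must exhaust \<open>J\<close>, since otherwise
  \<open>next_supported\<close> would extend it.\<close>

lemma supported_order:
  assumes G: "ordered G" "finite J" and J: "J \<in> AS G I"
  shows "EX zs. distinct zs & set zs = J & (\<forall>a\<in>J. \<exists>r\<in>G. supports r I zs a)"
proof -
  define s where "s zs \<longleftrightarrow> distinct zs & set zs <= J & (\<forall>a\<in>set zs. \<exists>r\<in>G. fset (head r) Int J = {a} &
     (\<forall>b\<in>fset (body r). holds I J (set (takeWhile (%x. x ~= a) zs)) b))" for zs
  have "length zs < Suc (card J)" if "s zs" for zs
    using that card_mono[OF G(2), of "set zs"] distinct_card[of zs] by (auto simp: s_def)
  hence bd: "ALL zs. s zs --> length zs < Suc (card J)" by blast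
  have "s []" by (simp add: s_def)
  from ex_has_greatest_nat[of s, OF this bd]
  obtain zs where zs: "s zs" "!!ys. s ys ==> length ys <= length zs" by blast
  have "set zs = J"
  proof (rule ccontr)
    assume "set zs ~= J"
    hence "set zs \<subset> J" using zs(1) unfolding s_def by blast
    from next_supported[OF G J this] obtain a r where a: "a \<in> J - set zs" "r \<in> G" "fset (head r) Int J = {a}"
      "\<forall>b\<in>fset (body r). holds I J (set zs) b" by (elim bexE conjE)
    have t: "takeWhile (%x. x ~= c) (zs @ [a]) = takeWhile (%x. x ~= c) zs" if "c \<in> set zs" for c
      using that by (intro takeWhile_append1) auto
    have "takeWhile (%x. x ~= a) (zs @ [a]) = zs" using takeWhile_notin[of a zs "[a]"] a(1) by simp
    hence "s (zs @ [a])" using zs(1) a t by (auto simp: s_def)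
    from zs(2)[OF this] show False by simp
  qed
  thus ?thesis using zs(1) by (intro exI[of _ zs]) (auto simp: supports_def s_def)
qed

text \<open>In a proper subset \<open>N\<close>, the first atom of the order that is missing has a
  rule whose body holds by the atoms before it, while no head atom is in \<open>N\<close>; so
  \<open>N\<close> is no model of the reduct.\<close>

lemma order_answer_set:
  assumes J: "\<forall>r\<in>G. sat I (set zs) (set zs) r" and s: "\<forall>a\<in>set zs. \<exists>r\<in>G. supports r I zs a"
  shows "set zs \<in> AS G I"
proof -
  have "\<exists>r\<in>G. ~ sat I (set zs) N r" if N: "N \<subset> set zs" for N
  proof -
    have "\<exists>a\<in>set zs. a ~: N" using N by blast
    then obtain us a vs where u: "zs = us @ a # vs" "a ~: N" "\<forall>x\<in>set us. ~ x ~: N"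
      by (elim split_list_first_propE)
    then obtain r where r: "r \<in> G" "supports r I zs a" using s by auto
    have "a ~: set us" using u by blast
    hence "takeWhile (%x. x ~= a) zs = us" unfolding u(1) by (simp add: takeWhile_notin)
    hence "\<forall>b\<in>fset (body r). holds I (set zs) N b"
      using r(2) holds_mono[of "set us" N] u(3) unfolding supports_def by blast
    moreover have "h ~: N" if h: "h \<in> fset (head r)" for h
    proof
      assume hN: "h \<in> N"
      hence "h \<in> fset (head r) Int set zs" using h N by blast
      hence "h = a" using r(2) unfolding supports_def by simp
      thus False using hN u(2) by simp
    qed
    ultimately show ?thesis using r(1) unfolding sat_def by blast
  qed
  thus ?thesis using J unfolding answer_sets_reduct by blast
qed

lemma takeWhile_filter: "P a ==> takeWhile (%x. x ~= a) (filter P zs) = filter P (takeWhile (%x. x ~= a) zs)"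
  by (induction zs) auto

lemma supports_local:
  assumes "I Int lits_of A = I' Int lits_of A" "set_rule r <= A" "filter (%x. x \<in> A) zs = filter (%x. x \<in> A) zs'"
  shows "supports r I zs a \<longleftrightarrow> supports r I' zs' a"
proof (cases "a \<in> A")
  case True
  have f: "set zs Int A = set (filter (%x. x \<in> A) zs)" for zs by auto
  have zs: "set zs Int A = set zs' Int A" unfolding f assms(3) ..
  have p: "set (takeWhile (%x. x ~= a) zs) Int A = set (takeWhile (%x. x ~= a) zs') Int A"
    unfolding f takeWhile_filter[of "%x. x \<in> A", OF True, symmetric] assms(3) ..
  have "lit_atom (elem_lit b) \<in> A" "fset (head r) <= A" if "b \<in> fset (body r)" for b
    using that assms(2) rule_atoms[of r] by (auto simp: rule_atoms_def)
  hence "holds I (set zs) (set (takeWhile (%x. x ~= a) zs)) b \<longleftrightarrow> holds I' (set zs') (set (takeWhile (%x. x ~= a) zs')) b"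
    if "b \<in> fset (body r)" for b using holds_local[OF assms(1) zs p] that by blast
  moreover have "fset (head r) <= A" using assms(2) rule_atoms[of r] by (auto simp: rule_atoms_def)
  hence "fset (head r) Int set zs = fset (head r) Int set zs'" using zs by blast
  ultimately show ?thesis unfolding supports_def by simp
next
  case False
  hence "a ~: fset (head r)" using assms(2) rule_atoms[of r] by (auto simp: rule_atoms_def)
  thus ?thesis unfolding supports_def by blast
qed

lemma supports_atom: "supports r I zs a ==> a \<in> set_rule r & a \<in> set zs"
  unfolding supports_def rule_atoms[symmetric] rule_atoms_def by auto

definition amalgam :: "'a list => 'a list => 'a list => bool" where
  "amalgam y u w \<longleftrightarrow> distinct y & set y = set u Un set w & filter (%x. x \<in> set u) y = u & filter (%x. x \<in> set w) y = w"

lemma amalgam_commute: "amalgam y u w \<longleftrightarrow> amalgam y w u" by (auto simp: amalgam_def)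

lemma amalgam_Cons:
  assumes "amalgam y u w" "a ~: set u" "a ~: set w" shows "amalgam (a # y) (a # u) w"
proof -
  have "filter (%x. x \<in> set (a # u)) y = filter (%x. x \<in> set u) y"
    by (rule filter_cong) (use assms in \<open>auto simp: amalgam_def\<close>)
  thus ?thesis using assms by (auto simp: amalgam_def)
qed

lemma amalgam_Cons_both:
  assumes "amalgam y u w" "a ~: set u" "a ~: set w" shows "amalgam (a # y) (a # u) (a # w)"
proof -
  have "filter (%x. x \<in> set (a # u)) y = filter (%x. x \<in> set u) y" "filter (%x. x \<in> set (a # w)) y = filter (%x. x \<in> set w) y"
    by (rule filter_cong; use assms in \<open>auto simp: amalgam_def\<close>)+
  thus ?thesis using assms by (auto simp: amalgam_def)
qed

lemma filter_drop_Cons: "a ~: set w ==> filter (%x. x \<in> set (a # u)) w = filter (%x. x \<in> set u) w"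
  by (rule filter_cong) auto

text \<open>Two linear orders that agree on common elements have a common extension. A first element
  private to one list is emitted at once; if both first elements are shared, the agreement forces
  them to be equal.\<close>

lemma amalgamation:
  assumes "distinct u" "distinct w" "filter (%x. x \<in> set w) u = filter (%x. x \<in> set u) w"
  shows "EX y. amalgam y u w"
  using assms
proof (induction "length u + length w" arbitrary: u w rule: less_induct)
  case less
  show ?case
  proof (cases u)
    case Nil
    thus ?thesis using less.prems by (intro exI[of _ w]) (auto simp: amalgam_def)
  next
    case u: (Cons a u')
    show ?thesis
    proof (cases "a \<in> set w")
      case False
      have "filter (%x. x \<in> set w) u' = filter (%x. x \<in> set u') w"
        using less.prems(3) filter_drop_Cons[OF False, of u'] False unfolding u by simp
      then obtain y where "amalgam y u' w" using less.hyps[of u' w] less.prems u by auto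
      from amalgam_Cons[OF this _ False] show ?thesis using less.prems(1) u by auto
    next
      case aw: True
      then obtain b w' where w: "w = b # w'" by (cases w) auto
      show ?thesis
      proof (cases "b \<in> set u")
        case False
        have "filter (%x. x \<in> set w') u = filter (%x. x \<in> set u) w'"
          using less.prems(3) filter_drop_Cons[OF False, of w'] False unfolding w by simp
        then obtain y where "amalgam y w' u" using less.hyps[of u w'] less.prems w amalgam_commute by auto
        from amalgam_Cons[OF this _ False] show ?thesis using less.prems(2) w amalgam_commute by auto
      next
        case True
        have ab: "a = b" "filter (%x. x \<in> set w) u' = filter (%x. x \<in> set u) w'"
          using less.prems(3) aw True unfolding u w by simp_all
        have n: "a ~: set u'" "a ~: set w'" using less.prems(1,2) u w ab(1) by auto
        have "filter (%x. x \<in> set w') u' = filter (%x. x \<in> set u') w'"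
          using ab(2) filter_drop_Cons[OF n(1), of w'] filter_drop_Cons[OF n(2), of u'] unfolding u w ab(1) by simp
        then obtain y where "amalgam y u' w'" using less.hyps[of u' w'] less.prems(1,2) u w by auto
        from amalgam_Cons_both[OF this n] show ?thesis using u w ab(1) by auto
      qed
    qed
  qed
qed

text \<open>The empty list is kept in each round, so after as many rounds as there are elements all
  duplicate-free lists of all lengths have appeared.\<close>

definition arr_step :: "'a fset => 'a list fset => 'a list fset" where
  "arr_step B S = finsert [] ((%e. fst e # snd e) |`| ffilter (%e. fst e ~: set (snd e)) (fprod B S))"

definition arrangements :: "'a::enc fset => 'a list fset" where
  "arrangements B = foldl (%S _. arr_step B S) {|[]|} (elems B)"

lemma arr_steps:
  "xs |\<in>| foldl (%S _. arr_step B S) {|[]|} ys \<longleftrightarrow> distinct xs & set xs <= fset B & length xs <= length ys"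
proof (induction ys arbitrary: xs rule: rev_induct)
  case (snoc y ys)
  have "xs |\<in>| foldl (%S _. arr_step B S) {|[]|} (ys @ [y]) \<longleftrightarrow>
    xs = [] | (EX x us. x |\<in>| B & us |\<in>| foldl (%S _. arr_step B S) {|[]|} ys & x ~: set us & xs = x # us)"
    by (simp only: foldl_append foldl.simps arr_step_def finsert_iff fimage_ffilter_iff fprod split_paired_Ex fst_conv snd_conv conj_assoc)
  also have "... \<longleftrightarrow> distinct xs & set xs <= fset B & length xs <= length (ys @ [y])"
    unfolding snoc.IH by (cases xs) auto
  finally show ?case .
qed auto

lemma arrangements [simp]: "xs |\<in>| arrangements B \<longleftrightarrow> distinct xs & set xs <= fset B"
proof -
  have "length xs <= fcard B" if "distinct xs" "set xs <= fset B"
    using card_mono[OF finite_fset that(2)] distinct_card[OF that(1)] by (simp add: fcard.rep_eq)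
  thus ?thesis unfolding arrangements_def arr_steps by auto
qed

lemma fcard_arr_steps: "fcard (foldl (%S _. arr_step B S) {|[]|} ys) <= (fcard B + 1) ^ length ys"
proof (induction ys rule: rev_induct)
  case (snoc y ys)
  let ?S = "foldl (%S _. arr_step B S) {|[]|} ys"
  have "fcard ((%e. fst e # snd e) |`| ffilter (%e. fst e ~: set (snd e)) (fprod B ?S)) <= fcard (ffilter (%e. fst e ~: set (snd e)) (fprod B ?S))"
    unfolding fcard.rep_eq fimage.rep_eq by (rule card_image_le) simp
  also have "... <= fcard (fprod B ?S)" by (rule fcard_mono) auto
  also have "... <= fcard B * (fcard B + 1) ^ length ys" unfolding fcard_fprod by (rule mult_left_mono[OF snoc.IH]) simp
  finally have "fcard (arr_step B ?S) <= Suc (fcard B * (fcard B + 1) ^ length ys)"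
    unfolding arr_step_def fcard_finsert_if by auto
  also have "... <= (fcard B + 1) ^ length (ys @ [y])" by simp
  finally show ?case by simp
qed (simp add: fcard.rep_eq)

text \<open>At most \<open>(b + 1) ^ b\<close> arrangements, which \<open>2 ^ (b * b)\<close>
  covers, times \<open>2 ^ b\<close> sets of derived atoms.\<close>

definition ord_qn :: "nat => nat" where "ord_qn b = 2 ^ (b * b + b)"

lemma ord_qn_ge: "b * b + b <= ord_qn b"
  unfolding ord_qn_def using less_exp[of "b * b + b"] by linarith

lemma Suc_power_le: "(b + 1) ^ n <= 2 ^ (b * n)" for b :: nat
proof -
  have "b + 1 <= 2 ^ b" using less_exp[of b] by (simp only: Suc_eq_plus1[symmetric] Suc_le_eq)
  hence "(b + 1) ^ n <= (2 ^ b) ^ n" by (rule power_mono) simp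
  thus ?thesis by (simp add: power_mult)
qed

lemma fcard_arrangements: "fcard (arrangements B) <= 2 ^ (fcard B * fcard B)"
  unfolding arrangements_def using le_trans[OF fcard_arr_steps Suc_power_le, of B "elems B"] by simp

lemma comp_arrangements: "ptime UNIV (%B. 2 ^ ord_qn (fcard B)) (%B :: 'a::enc fset. arrangements B)"
  unfolding arrangements_def
proof (rule comp_foldl_bd)
  let ?T = "%B :: 'a fset. 2 ^ ord_qn (fcard B) :: nat"
  let ?B = "%B :: 'a fset. 1 + ?T B * (sz B + 1)"
  show "ptime {z. fst z \<in> UNIV & snd (snd z) \<in> set (elems (fst z))} (%z. ?T (fst z)) (%z. arr_step (fst z) (fst (snd z)))"
    unfolding arr_step_def by (intro comp_intros)
  show "pbd UNIV ?B (%B. sz B + ?T B)" by (intro pbd_add pbd_mult pbd_const pbd_T pbd_sz)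
  fix B :: "'a fset" and ys zs :: "'a list"
  assume e: "elems B = ys @ zs"
  let ?S = "foldl (%S _. arr_step B S) {|[]|} ys"
  have "length ys <= fcard B" using arg_cong[OF e, of length] by simp
  hence "(fcard B + 1) ^ length ys <= (fcard B + 1) ^ fcard B" by (rule power_increasing) simp
  also have "... <= 2 ^ (fcard B * fcard B)" by (rule Suc_power_le)
  also have "... <= ?T B" using ord_qn_ge[of "fcard B"] by (intro power_increasing) auto
  finally have c: "fcard ?S <= ?T B" using fcard_arr_steps[of B ys] by linarith
  have "sz xs <= sz B" if "xs |\<in>| ?S" for xs using that unfolding arr_steps by (intro sz_subset_list) auto
  hence "sz ?S <= 1 + fcard ?S * (sz B + 1)" by (rule sz_fset_le)
  also have "... <= ?B B" using c by (intro add_left_mono mult_right_mono) auto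
  finally show "sz ?S <= ?B B" .
qed (intro comp_intros)+

text \<open>The flag records that \<open>a\<close> has been met; this makes \<open>takeWhile\<close>
  a fold with a small state.\<close>

definition before_step :: "'a => 'a fset \<times> bool => 'a => 'a fset \<times> bool" where
  "before_step a s e = (if snd s | e = a then (fst s, True) else (finsert e (fst s), False))"

definition before :: "'a => 'a list => 'a fset" where
  "before a zs = fst (foldl (before_step a) ({||}, False) zs)"

lemma foldl_before: "fset (fst (foldl (before_step a) s zs)) = fset (fst s) Un (if snd s then {} else set (takeWhile (%x. x ~= a) zs))"
  by (induction zs arbitrary: s) (auto simp: before_step_def)

lemma before: "fset (before a zs) = set (takeWhile (%x. x ~= a) zs)"
  by (simp add: before_def foldl_before)

lemma comp_before [comp_intros]: "ptime D T f ==> ptime D T g ==> ptime D T (%x. before (f x) (g x))"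
proof (erule (1) comp_op2[rotated])
  have "ptime UNIV (%_. 0) (%z :: 'b \<times> 'b list. foldl (before_step (fst z)) ({||}, False) (snd z))"
  proof (rule comp_foldl_bd)
    show "ptime {z :: ('b \<times> 'b list) \<times> ('b fset \<times> bool) \<times> 'b. fst z \<in> UNIV & snd (snd z) \<in> set (snd (fst z))} (%_. 0) (%z. before_step (fst (fst z)) (fst (snd z)) (snd (snd z)))"
      unfolding before_step_def by (intro comp_intros)
    show "pbd UNIV (%z :: 'b \<times> 'b list. sz z + 4) (%z. sz z + 0)" by (intro pbd_add pbd_const pbd_sz)
    fix z :: "'b \<times> 'b list" and ys zs assume e: "snd z = ys @ zs"
    let ?s = "foldl (before_step (fst z)) ({||}, False) ys"
    have "fset (fst ?s) <= fset (fset_of_list (snd z))"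
      unfolding foldl_before fset_of_list.rep_eq e by (auto dest: set_takeWhileD)
    hence "sz (fst ?s) <= sz (fset_of_list (snd z))" by (intro sz_fset_mono) (simp add: less_eq_fset.rep_eq)
    also have "... <= sz (snd z)" by (rule sz_fset_of_list)
    finally show "sz ?s <= sz z + 4" using sz_bool[of "snd ?s"] by (simp add: enc_prod_def)
  qed (intro comp_intros)+
  thus "ptime UNIV (%_. 0) (%z :: 'b \<times> 'b list. before (fst z) (snd z))" unfolding before_def by (rule comp_fst)
qed

definition supf :: "'a rule => 'a lit fset => 'a list => 'a => bool" where
  "supf r I zs a \<longleftrightarrow> head r |\<inter>| fset_of_list zs = {|a|} & fBall (body r) (%b. holds (fset I) (fset (fset_of_list zs)) (fset (before a zs)) b)"

lemma supf: "supf r I zs a \<longleftrightarrow> supports r (fset I) zs a"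
proof -
  have "head r |\<inter>| fset_of_list zs = {|a|} \<longleftrightarrow> fset (head r) Int set zs = {a}"
    unfolding fset_inject[symmetric] by (simp add: fset_of_list.rep_eq)
  thus ?thesis unfolding supf_def supports_def before fset_of_list.rep_eq by simp
qed

lemma ptime_supf: "ptime4 supf"
  unfolding supf_def by (intro comp_intros comp_holds)

lemmas comp_supf [comp_intros] = comp_op4[OF ptime_supf]

definition supported :: "'a rule set => 'a lit set => 'a list => 'a => bool" where
  "supported G I zs a \<longleftrightarrow> (\<exists>r\<in>G. supports r I zs a)"

definition proven :: "'a set => 'a rule set => 'a lit set => 'a list => 'a fset" where
  "proven X G I zs = Abs_fset {a \<in> set zs - X. supported G I zs a}"

text \<open>Support is demanded for forgotten atoms only: a boundary atom may still be derived by a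
  rule of another part.\<close>

definition ord_run :: "'a rule set => 'a set => 'a lit set => 'a list => bool" where
  "ord_run G X I zs \<longleftrightarrow> distinct zs & set zs <= atoms G & (\<forall>r\<in>G. sat I (set zs) (set zs) r) &
     (\<forall>a\<in>set zs Int X. supported G I zs a)"

definition ord_St :: "'a rule set => 'a set => 'a lit set => ('a set \<times> 'a list \<times> 'a fset) set" where
  "ord_St G X I = {(set zs, filter (%x. x ~: X) zs, proven X G I zs) | zs. ord_run G X I zs}"

definition ord_leafq :: "'a::enc rule => 'a lit fset => ('a list \<times> 'a fset) fset" where
  "ord_leafq r I = (%zs. (zs, ffilter (%a. supf r I zs a) (fset_of_list zs))) |`|
     ffilter (%zs. satf I (fset_of_list zs) (fset_of_list zs) r) (arrangements (rule_atoms r))"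

text \<open>The two boundary orders do not determine their relative order, so every arrangement that
  restricts to both is a possible result. A derivation in either part is enough.\<close>

definition ord_joinq :: "'a::enc fset => 'a list \<times> 'a fset => 'a fset => 'a list \<times> 'a fset => ('a list \<times> 'a fset) fset" where
  "ord_joinq B1 q1 B2 q2 = (%xs. (xs, snd q1 |\<union>| snd q2)) |`|
     ffilter (%xs. filter (%x. x |\<in>| B1) xs = fst q1 & filter (%x. x |\<in>| B2) xs = fst q2) (arrangements (B1 |\<union>| B2))"

text \<open>When an atom is forgotten, all its rules have been seen; a true atom without a
  derivation ends the run.\<close>

definition ord_forgetq :: "'a => 'a list \<times> 'a fset => ('a list \<times> 'a fset) fset" where
  "ord_forgetq v q = (if v \<in> set (fst q) & v |\<notin>| snd q then {||} else {|(filter (%x. x ~= v) (fst q), snd q |-| {|v|})|})"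

definition ord_Qset :: "'a::enc fset => ('a list \<times> 'a fset) fset" where
  "ord_Qset B = fprod (arrangements B) (fPow B)"

lemma fset_proven: "fset (proven X G I zs) = {a \<in> set zs - X. supported G I zs a}"
  unfolding proven_def by (rule Abs_fset_inverse) simp

lemma supported_atom: "supported G I zs a ==> a \<in> atoms G"
  unfolding supported_def atoms_def using supports_atom by fast

lemma supported_part:
  assumes "set zs <= A" shows "supported G I (filter (%x. x \<in> atoms G) zs) a \<longleftrightarrow> supported G I zs a"
  unfolding supported_def
proof (rule bex_cong[OF refl])
  fix r assume "r \<in> G"
  thus "supports r I (filter (%x. x \<in> atoms G) zs) a = supports r I zs a"
    by (intro supports_local[of _ "atoms G"]) (auto simp: atoms_def)
qed

lemma sat_filter: "r \<in> G ==> sat I (set (filter (%x. x \<in> atoms G) zs)) (set (filter (%x. x \<in> atoms G) zs)) r \<longleftrightarrow> sat I (set zs) (set zs) r"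
  by (rule sat_local[of _ "atoms G"]) (auto simp: atoms_def)

lemma supported_Un: "supported (G1 Un G2) I zs a \<longleftrightarrow> supported G1 I zs a | supported G2 I zs a"
  by (auto simp: supported_def)

context
  fixes G1 G2 :: "'a rule set" and X1 X2 :: "'a set" and I :: "'a lit set"
  assumes X: "X1 <= atoms G1" "X2 <= atoms G2" "X1 Int atoms G2 = {}" "X2 Int atoms G1 = {}"
begin

text \<open>A forgotten atom is private, so only rules of its own part can support it, and their
  support depends only on the order of the atoms of that part.\<close>

lemma ord_run_split:
  assumes "distinct zs" "set zs <= atoms (G1 Un G2)"
  shows "ord_run (G1 Un G2) (X1 Un X2) I zs \<longleftrightarrow>
     ord_run G1 X1 I (filter (%x. x \<in> atoms G1) zs) & ord_run G2 X2 I (filter (%x. x \<in> atoms G2) zs)"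
proof -
  have 1: "supported (G1 Un G2) I zs a \<longleftrightarrow> supported G1 I zs a" if "a \<in> X1" for a
    using that X supported_atom[of G2 I zs a] by (auto simp: supported_Un)
  have 2: "supported (G1 Un G2) I zs a \<longleftrightarrow> supported G2 I zs a" if "a \<in> X2" for a
    using that X supported_atom[of G1 I zs a] by (auto simp: supported_Un)
  have e: "set (filter (%x. x \<in> atoms G1) zs) Int X1 = set zs Int X1" "set (filter (%x. x \<in> atoms G2) zs) Int X2 = set zs Int X2"
    using X by auto
  have s: "(\<forall>r\<in>G. sat I (set (filter (%x. x \<in> atoms G) zs)) (set (filter (%x. x \<in> atoms G) zs)) r) \<longleftrightarrow> (\<forall>r\<in>G. sat I (set zs) (set zs) r)" for G
    by (rule ball_cong[OF refl sat_filter])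
  have p: "(\<forall>a\<in>set zs Int X1. supported G1 I zs a) \<longleftrightarrow> (\<forall>a\<in>set zs Int X1. supported (G1 Un G2) I zs a)"
    "(\<forall>a\<in>set zs Int X2. supported G2 I zs a) \<longleftrightarrow> (\<forall>a\<in>set zs Int X2. supported (G1 Un G2) I zs a)"
    by (intro ball_cong refl; simp add: 1 2)+
  have "distinct (filter (%x. x \<in> atoms G) zs)" "set (filter (%x. x \<in> atoms G) zs) <= atoms G" for G using assms(1) by auto
  thus ?thesis unfolding ord_run_def supported_part[OF assms(2)] e s p Int_Un_distrib ball_Un using assms by blast
qed

lemma proven_split:
  assumes "set zs <= atoms (G1 Un G2)"
  shows "proven (X1 Un X2) (G1 Un G2) I zs =
    proven X1 G1 I (filter (%x. x \<in> atoms G1) zs) |\<union>| proven X2 G2 I (filter (%x. x \<in> atoms G2) zs)"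
proof -
  have "a \<in> set zs - (X1 Un X2) & supported (G1 Un G2) I zs a \<longleftrightarrow>
     (a \<in> set zs & a \<in> atoms G1 & a ~: X1 & supported G1 I zs a) | (a \<in> set zs & a \<in> atoms G2 & a ~: X2 & supported G2 I zs a)" for a
    using X supported_atom[of G1 I zs a] supported_atom[of G2 I zs a] unfolding supported_Un by blast
  hence "fset (proven (X1 Un X2) (G1 Un G2) I zs) =
    fset (proven X1 G1 I (filter (%x. x \<in> atoms G1) zs) |\<union>| proven X2 G2 I (filter (%x. x \<in> atoms G2) zs))"
    unfolding fset_proven union_fset supported_part[OF assms] by auto
  thus ?thesis by (rule fset_inject[THEN iffD1])
qed

text \<open>Amalgamation is applied twice: to the boundary order and the first run, and then to the
  result and the second run. This works because any overlap consists of boundary atoms, on which the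
  orders agree with \<open>xs\<close>.\<close>

lemma merge_orders:
  assumes zs: "distinct zs1" "set zs1 <= atoms G1" "distinct zs2" "set zs2 <= atoms G2"
    and xs: "distinct xs" "set xs <= (atoms G1 - X1) Un (atoms G2 - X2)"
      "filter (%x. x \<in> atoms G1 - X1) xs = filter (%x. x ~: X1) zs1" "filter (%x. x \<in> atoms G2 - X2) xs = filter (%x. x ~: X2) zs2"
  shows "EX zs. distinct zs & set zs <= atoms (G1 Un G2) & filter (%x. x \<in> atoms G1) zs = zs1 & filter (%x. x \<in> atoms G2) zs = zs2 &
    filter (%x. x ~: X1 Un X2) zs = xs"
proof -
  have s1: "x \<in> set xs & x \<in> atoms G1 \<longleftrightarrow> x \<in> set zs1 & x ~: X1" for x
  proof -
    have "{x \<in> set xs. x \<in> atoms G1 - X1} = {x \<in> set zs1. x ~: X1}" using arg_cong[OF xs(3), of set] by simp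
    hence "x \<in> set xs & x \<in> atoms G1 - X1 \<longleftrightarrow> x \<in> set zs1 & x ~: X1" unfolding set_eq_iff by simp
    thus ?thesis using xs(2) X zs by blast
  qed
  have s2: "x \<in> set xs & x \<in> atoms G2 \<longleftrightarrow> x \<in> set zs2 & x ~: X2" for x
  proof -
    have "{x \<in> set xs. x \<in> atoms G2 - X2} = {x \<in> set zs2. x ~: X2}" using arg_cong[OF xs(4), of set] by simp
    hence "x \<in> set xs & x \<in> atoms G2 - X2 \<longleftrightarrow> x \<in> set zs2 & x ~: X2" unfolding set_eq_iff by simp
    thus ?thesis using xs(2) X zs by blast
  qed
  have s3: "x \<in> set xs" if "x \<in> set zs1" "x \<in> atoms G2 | x \<in> set zs2" for x
  proof -
    have "x ~: X1" using that(2) X(3) zs(4) by blast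
    thus ?thesis using s1[of x] that(1) by simp
  qed
  have s4: "x \<in> set xs" if "x \<in> set zs2" "x \<in> atoms G1 | x \<in> set zs1" for x
  proof -
    have "x ~: X2" using that(2) X(4) zs(2) by blast
    thus ?thesis using s2[of x] that(1) by simp
  qed
  have s5: "x ~: X1 & x ~: X2" if "x \<in> set xs" for x using that xs(2) X by blast
  have "filter (%x. x \<in> set zs1) xs = filter (%x. x \<in> atoms G1 - X1) xs"
    by (rule filter_cong[OF refl]) (use s1 zs X xs(2) in blast)
  moreover have "filter (%x. x \<in> set xs) zs1 = filter (%x. x ~: X1) zs1"
    by (rule filter_cong[OF refl]) (use s1 zs X xs(2) in blast)
  ultimately obtain y where y: "amalgam y xs zs1" using amalgamation[OF xs(1) zs(1)] xs(3) by auto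
  have "filter (%x. x \<in> set zs2) y = filter (%x. x \<in> set zs2) (filter (%x. x \<in> set xs) y)"
    unfolding filter_filter by (rule filter_cong[OF refl]) (use y s1 s2 s3 s4 s5 zs X in \<open>auto simp: amalgam_def\<close>)
  also have "... = filter (%x. x \<in> set zs2) xs" using y by (simp add: amalgam_def)
  also have "... = filter (%x. x \<in> atoms G2 - X2) xs"
    by (rule filter_cong[OF refl]) (use s2 zs X xs(2) in blast)
  also have "... = filter (%x. x \<in> set y) zs2"
    unfolding xs(4) by (rule filter_cong[OF refl]) (use y s1 s2 s3 s4 s5 zs X in \<open>auto simp: amalgam_def\<close>)
  finally obtain z where z: "amalgam z y zs2" using amalgamation[of y zs2] y zs(3) by (auto simp: amalgam_def)
  have sz: "set z = set xs Un set zs1 Un set zs2" and sy: "set y = set xs Un set zs1" using y z by (auto simp: amalgam_def)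
  have "filter (%x. x \<in> atoms G1) z = filter (%x. x \<in> set zs1) (filter (%x. x \<in> set y) z)"
    unfolding filter_filter by (rule filter_cong[OF refl]) (use s1 s2 s3 s4 s5 zs X in \<open>auto simp: sz sy\<close>)
  also have "... = zs1" using y z by (simp add: amalgam_def)
  finally have 1: "filter (%x. x \<in> atoms G1) z = zs1" .
  have "filter (%x. x \<in> atoms G2) z = filter (%x. x \<in> set zs2) z"
    by (rule filter_cong[OF refl]) (use s1 s2 s3 s4 s5 zs X in \<open>auto simp: sz\<close>)
  also have "... = zs2" using z by (simp add: amalgam_def)
  finally have 2: "filter (%x. x \<in> atoms G2) z = zs2" .
  have "filter (%x. x ~: X1 Un X2) z = filter (%x. x \<in> set xs) (filter (%x. x \<in> set y) z)"
    unfolding filter_filter by (rule filter_cong[OF refl]) (use s1 s2 s3 s4 s5 zs X xs(2) in \<open>auto simp: sz sy\<close>)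
  also have "... = xs" using y z by (simp add: amalgam_def)
  finally have 3: "filter (%x. x ~: X1 Un X2) z = xs" .
  have "set z <= atoms (G1 Un G2)" using sz zs xs(2) by auto
  thus ?thesis using 1 2 3 z by (intro exI[of _ z]) (simp add: amalgam_def)
qed

end

lemma ord_join:
  assumes X: "X1 <= atoms G1" "X2 <= atoms G2" "X1 Int atoms G2 = {}" "X2 Int atoms G1 = {}"
    and B: "fset B1 = atoms G1 - X1" "fset B2 = atoms G2 - X2"
  shows "ord_St (G1 Un G2) (X1 Un X2) I =
    {(J1 Un J2, q) |J1 J2 q q1 q2. (J1, q1) \<in> ord_St G1 X1 I & (J2, q2) \<in> ord_St G2 X2 I & q |\<in>| ord_joinq B1 q1 B2 q2}"
    (is "?l = ?r")
proof (intro equalityI subsetI)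
  fix p assume "p \<in> ?l"
  then obtain zs where p: "p = (set zs, filter (%x. x ~: X1 Un X2) zs, proven (X1 Un X2) (G1 Un G2) I zs)"
    and r: "ord_run (G1 Un G2) (X1 Un X2) I zs" unfolding ord_St_def by blast
  have d: "distinct zs" "set zs <= atoms (G1 Un G2)" using r by (auto simp: ord_run_def)
  let ?xs = "filter (%x. x ~: X1 Un X2) zs" and ?zs1 = "filter (%x. x \<in> atoms G1) zs" and ?zs2 = "filter (%x. x \<in> atoms G2) zs"
  have r12: "ord_run G1 X1 I ?zs1" "ord_run G2 X2 I ?zs2" using r ord_run_split[OF X d] by auto
  have "filter (%x. x |\<in>| B1) ?xs = filter (%x. x ~: X1) ?zs1" "filter (%x. x |\<in>| B2) ?xs = filter (%x. x ~: X2) ?zs2"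
    unfolding filter_filter B by (rule filter_cong[OF refl]; use X in blast)+
  moreover have "?xs |\<in>| arrangements (B1 |\<union>| B2)" using d B by auto
  ultimately have "(?xs, proven X1 G1 I ?zs1 |\<union>| proven X2 G2 I ?zs2) |\<in>|
     ord_joinq B1 (filter (%x. x ~: X1) ?zs1, proven X1 G1 I ?zs1) B2 (filter (%x. x ~: X2) ?zs2, proven X2 G2 I ?zs2)"
    unfolding ord_joinq_def fimage_ffilter_iff by (intro exI[of _ ?xs]) simp
  moreover have "set zs = set ?zs1 Un set ?zs2" using d(2) by auto
  ultimately show "p \<in> ?r" unfolding p proven_split[OF X d(2)] using r12 unfolding ord_St_def by blast
next
  fix p assume "p \<in> ?r"
  then obtain zs1 zs2 q where r: "ord_run G1 X1 I zs1" "ord_run G2 X2 I zs2" and p: "p = (set zs1 Un set zs2, q)"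
    and q: "q |\<in>| ord_joinq B1 (filter (%x. x ~: X1) zs1, proven X1 G1 I zs1) B2 (filter (%x. x ~: X2) zs2, proven X2 G2 I zs2)"
    unfolding ord_St_def by blast
  obtain xs where xs: "distinct xs" "set xs <= fset B1 Un fset B2" "filter (%x. x |\<in>| B1) xs = filter (%x. x ~: X1) zs1"
    "filter (%x. x |\<in>| B2) xs = filter (%x. x ~: X2) zs2" "q = (xs, proven X1 G1 I zs1 |\<union>| proven X2 G2 I zs2)"
    using q unfolding ord_joinq_def fimage_ffilter_iff fst_conv snd_conv arrangements union_fset by (elim exE conjE)
  have "distinct zs1" "set zs1 <= atoms G1" "distinct zs2" "set zs2 <= atoms G2" using r by (auto simp: ord_run_def)
  from merge_orders[OF X this xs(1-4)[unfolded B]]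
  obtain zs where zs: "distinct zs" "set zs <= atoms (G1 Un G2)" "filter (%x. x \<in> atoms G1) zs = zs1" "filter (%x. x \<in> atoms G2) zs = zs2"
    "filter (%x. x ~: X1 Un X2) zs = xs" by (elim exE conjE)
  have "ord_run (G1 Un G2) (X1 Un X2) I zs" unfolding ord_run_split[OF X zs(1,2)] zs(3,4) using r by simp
  moreover have "set zs = set zs1 Un set zs2" using zs(2) unfolding zs(3,4)[symmetric] by auto
  moreover have "proven (X1 Un X2) (G1 Un G2) I zs = proven X1 G1 I zs1 |\<union>| proven X2 G2 I zs2"
    using proven_split[OF X zs(2), of I] unfolding zs(3,4) .
  ultimately show "p \<in> ?l" unfolding p xs(5) ord_St_def mem_Collect_eq
    by (intro exI[of _ zs] conjI) (simp_all add: zs(5)[symmetric])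
qed

lemma ord_leaf:
  assumes I: "fset IB = I Int lits_of (fset (rule_atoms r))"
  shows "snd ` ord_St {r} {} I = fset (ord_leafq r IB)"
proof -
  have s: "satf IB J N r \<longleftrightarrow> sat I (fset J) (fset N) r" for J N
    unfolding satf I by (rule sat_restrict_guess)
  have u: "supf r IB zs a \<longleftrightarrow> supports r I zs a" for zs a
    unfolding supf I by (rule supports_local[of _ "fset (rule_atoms r)"]) (auto simp: rule_atoms)
  have pr: "proven {} {r} I zs = ffilter (%a. supf r IB zs a) (fset_of_list zs)" for zs
  proof -
    have "fset (proven {} {r} I zs) = fset (ffilter (%a. supf r IB zs a) (fset_of_list zs))"
      unfolding fset_proven by (auto simp: u supported_def fset_of_list.rep_eq)
    thus ?thesis by (rule fset_inject[THEN iffD1])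
  qed
  have "q \<in> snd ` ord_St {r} {} I \<longleftrightarrow> (EX zs. ord_run {r} {} I zs & q = (zs, proven {} {r} I zs))" for q
    unfolding ord_St_def image_iff by (simp add: Bex_def)
  moreover have "ord_run {r} {} I zs \<longleftrightarrow> zs |\<in>| arrangements (rule_atoms r) & satf IB (fset_of_list zs) (fset_of_list zs) r" for zs
    unfolding ord_run_def s by (simp add: fset_of_list.rep_eq)
  ultimately have "q \<in> snd ` ord_St {r} {} I \<longleftrightarrow> q \<in> fset (ord_leafq r IB)" for q
    unfolding ord_leafq_def fimage_ffilter_iff pr by simp
  thus ?thesis by blast
qed

lemma ord_forget:
  assumes v: "v ~: X"
  shows "ord_St G (insert v X) I = {(J, q'). EX q. (J, q) \<in> ord_St G X I & q' |\<in>| ord_forgetq v q}"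
proof -
  let ?q = "%X zs. (filter (%x. x ~: X) zs, proven X G I zs)"
  have eq: "ord_run G (insert v X) I zs & q' = ?q (insert v X) zs \<longleftrightarrow> ord_run G X I zs & q' |\<in>| ord_forgetq v (?q X zs)" for zs q'
  proof -
    have f: "filter (%x. x ~: insert v X) zs = filter (%x. x ~= v) (filter (%x. x ~: X) zs)"
      unfolding filter_filter by (rule filter_cong) auto
    have "fset (proven (insert v X) G I zs) = fset (proven X G I zs |-| {|v|})" by (auto simp: fset_proven)
    hence p: "proven (insert v X) G I zs = proven X G I zs |-| {|v|}" by (rule fset_inject[THEN iffD1])
    have "ord_run G (insert v X) I zs \<longleftrightarrow> ord_run G X I zs & ~ (v \<in> set (fst (?q X zs)) & v |\<notin>| snd (?q X zs))"
      using v by (auto simp: ord_run_def fset_proven)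
    thus ?thesis unfolding ord_forgetq_def f p by auto
  qed
  have "(J, q') \<in> ord_St G (insert v X) I \<longleftrightarrow> (EX q. (J, q) \<in> ord_St G X I & q' |\<in>| ord_forgetq v q)" for J q'
  proof -
    have "(J, q') \<in> ord_St G (insert v X) I \<longleftrightarrow> (EX zs. J = set zs & (ord_run G (insert v X) I zs & q' = ?q (insert v X) zs))"
      by (auto simp: ord_St_def)
    also have "... \<longleftrightarrow> (EX zs. J = set zs & (ord_run G X I zs & q' |\<in>| ord_forgetq v (?q X zs)))" unfolding eq ..
    also have "... \<longleftrightarrow> (EX q. (J, q) \<in> ord_St G X I & q' |\<in>| ord_forgetq v q)" unfolding ord_St_def by blast
    finally show ?thesis .
  qed
  thus ?thesis by blast
qed

text \<open>With all atoms forgotten, every true atom has been found to be supported, so each run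
  accepts. That an answer set may have several orders does no harm, since guesses are counted and
  not runs.\<close>

lemma ord_final:
  assumes G: "finite G" "ordered G"
  shows "{J. EX q. (J, q) \<in> ord_St G (atoms G) I} = AS G I"
proof (intro equalityI subsetI)
  fix J assume "J \<in> {J. EX q. (J, q) \<in> ord_St G (atoms G) I}"
  then obtain zs where J: "J = set zs" "ord_run G (atoms G) I zs" unfolding ord_St_def by blast
  hence "\<forall>a\<in>set zs. \<exists>r\<in>G. supports r I zs a" unfolding ord_run_def supported_def by blast
  with J(2) show "J \<in> AS G I" unfolding J(1) ord_run_def by (intro order_answer_set) auto
next
  fix J assume J: "J \<in> AS G I"
  have sub: "J <= atoms G" by (rule answer_set_subset[OF J])
  obtain zs where zs: "distinct zs" "set zs = J" "\<forall>a\<in>J. \<exists>r\<in>G. supports r I zs a"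
    using supported_order[OF G(2) finite_subset[OF sub finite_atoms[OF G(1)]] J] by (elim exE conjE)
  have "ord_run G (atoms G) I zs" using zs J sub unfolding ord_run_def supported_def answer_sets_reduct by auto
  thus "J \<in> {J. EX q. (J, q) \<in> ord_St G (atoms G) I}" using zs(2) unfolding ord_St_def by blast
qed

interpretation ord: comp_automaton ord_leafq ord_joinq ord_forgetq "%v q. v \<in> set (fst q)" "%_. True"
  "([], {||})" ord_St ord_Qset ordered ord_qn 2
proof
  show "ord_St {} {} I = {({}, [], {||})}" for I :: "'a lit set"
  proof -
    have "proven {} {} I [] = {||}" by (simp add: proven_def bot_fset_def)
    moreover have "ord_run {} {} I zs \<longleftrightarrow> zs = []" for zs by (auto simp: ord_run_def)
    ultimately show ?thesis by (simp add: ord_St_def)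
  qed
  show "J <= atoms G & (\<forall>v\<in>atoms G - X. (v \<in> J) = (v \<in> set (fst q)))" if "(J, q) \<in> ord_St G X I" for J q and G :: "'a rule set" and X I
    using that by (auto simp: ord_St_def ord_run_def)
  show "ord_St G X I = ord_St G X I'" if I: "I Int lits_of (atoms G) = I' Int lits_of (atoms G)" for I I' and G :: "'a rule set" and X
  proof -
    have s: "sat I J N r \<longleftrightarrow> sat I' J N r" if "r \<in> G" for r J N
      by (rule sat_local[of _ "atoms G"]) (use that I in \<open>auto simp: atoms_def\<close>)
    have "supports r I zs a \<longleftrightarrow> supports r I' zs a" if "r \<in> G" for r zs a
      by (rule supports_local[of _ "atoms G"]) (use that I in \<open>auto simp: atoms_def\<close>)
    hence u: "supported G I = supported G I'" by (auto simp: supported_def fun_eq_iff)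
    have "ord_run G X I zs \<longleftrightarrow> ord_run G X I' zs" for zs using s by (simp add: ord_run_def u)
    thus ?thesis by (simp add: ord_St_def proven_def u)
  qed
  show "q |\<in>| ord_Qset B" if "(J, q) \<in> ord_St G X I" "finite G" "X <= atoms G" "fset B = atoms G - X"
    for J q and G :: "'a rule set" and X I B
    using that by (auto simp: ord_St_def ord_Qset_def ord_run_def less_eq_fset.rep_eq fset_proven)
  show "ord_qn m <= ord_qn n" if "m <= n" for m n
  proof -
    have "m * m + m <= n * n + n" using that by (intro add_mono mult_le_mono)
    thus ?thesis unfolding ord_qn_def by (rule power_increasing) simp
  qed
  show "n <= ord_qn n" for n using ord_qn_ge[of n] by linarith
  show "fcard (ord_Qset B) <= ord_qn (fcard B)" for B :: "'a fset"
    unfolding ord_Qset_def fcard_fprod fcard_fPow ord_qn_def power_add by (intro mult_le_mono fcard_arrangements order_refl)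
  show "sz q <= (sz B + 2 ^ ord_qn (fcard B) + 2) ^ 2" if "q |\<in>| ord_Qset B" for q and B :: "'a fset"
  proof -
    have q: "distinct (fst q)" "set (fst q) <= fset B" "snd q |\<subseteq>| B" using that by (auto simp: ord_Qset_def)
    have "sz q <= 2 * (sz B + 2 ^ ord_qn (fcard B) + 2)"
      using sz_subset_list[OF q(1,2)] sz_fset_mono[OF q(3)] by (simp add: enc_prod_def)
    also have "... <= (sz B + 2 ^ ord_qn (fcard B) + 2) ^ 2" unfolding power2_eq_square by (intro mult_right_mono) auto
    finally show ?thesis .
  qed
  show "ptime UNIV (%z :: 'a rule \<times> 'a lit fset. 2 ^ ord_qn (fcard (rule_atoms (fst z)))) (%z. ord_leafq (fst z) (snd z))"
  proof -
    have 1: "ptime UNIV (%z :: 'a rule \<times> 'a lit fset. 2 ^ ord_qn (fcard (rule_atoms (fst z)))) (%z. arrangements (rule_atoms (fst z)))"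
      by (rule comp_compose[OF comp_arrangements]) (intro comp_intros, auto)
    show ?thesis unfolding ord_leafq_def by (intro comp_intros 1)
  qed
  show "ptime UNIV (%z :: 'a fset \<times> _. 2 ^ ord_qn (fcard (fst z |\<union>| fst (snd (snd z)))))
      (%z. ord_joinq (fst z) (fst (snd z)) (fst (snd (snd z))) (snd (snd (snd z))))"
  proof -
    have 1: "ptime UNIV (%z :: 'a fset \<times> ('a list \<times> 'a fset) \<times> 'a fset \<times> ('a list \<times> 'a fset). 2 ^ ord_qn (fcard (fst z |\<union>| fst (snd (snd z)))))
      (%z. arrangements (fst z |\<union>| fst (snd (snd z))))"
      by (rule comp_compose[OF comp_arrangements]) (intro comp_intros, auto)
    show ?thesis unfolding ord_joinq_def by (intro comp_intros 1)
  qed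
  show "ptime UNIV (%_. 0) (%z. ord_forgetq (fst z :: 'a) (snd z))" unfolding ord_forgetq_def by (intro comp_intros)
  show "ptime UNIV (%_. 0) (%z. (fst z :: 'a) \<in> set (fst (snd z :: 'a list \<times> 'a fset)))" by (intro comp_intros)
  show "ptime UNIV (%_. 0) (%q :: 'a list \<times> 'a fset. True)" by (intro comp_intros)
  show "{J. EX q. (J, q) \<in> ord_St G (atoms G) I & True} = AS G I" if "finite G" "ordered G" for G :: "'a rule set" and I
    using ord_final[OF that] by simp
  show "ord_St G (insert v X) I = {(J, q'). EX q. (J, q) \<in> ord_St G X I & q' |\<in>| ord_forgetq v q}"
    if "v \<in> atoms G - X" for G :: "'a rule set" and X v I
    using ord_forget[of v X G I] that by blast
qed (rule ord_leaf ord_join; assumption)+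

section \<open>From the grounding to the input of the algorithm\<close>

subsection \<open>Renaming of atoms\<close>

context
  fixes f :: "'a => 'b" and A :: "'a set"
  assumes f: "inj_on f A"
begin

lemma inj_map_lit: "inj_on (map_lit f) (lits_of A)"
proof (rule inj_onI)
  fix l l' assume "l \<in> lits_of A" "l' \<in> lits_of A" "map_lit f l = map_lit f l'"
  thus "l = l'" using f by (cases l; cases l') (auto simp: inj_on_def)
qed

lemma holds_image:
  assumes "I <= lits_of A" "J <= A" "N <= A" "lit_atom (elem_lit b) \<in> A"
  shows "holds (map_lit f ` I) (f ` J) (f ` N) (map_body_elem f b) \<longleftrightarrow> holds I J N b"
proof -
  have t: "lit_true (f ` J) (f ` N) (map_lit f l) \<longleftrightarrow> lit_true J N l" if "lit_atom l \<in> A" for l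
    using that inj_on_image_mem_iff[OF f _ assms(2)] inj_on_image_mem_iff[OF f _ assms(3)] by (cases l) (auto simp: lit_true_def)
  have i: "map_lit f l \<in> map_lit f ` I \<longleftrightarrow> l \<in> I" if "lit_atom l \<in> A" for l
    using inj_on_image_mem_iff[OF inj_map_lit _ assms(1)] that by simp
  have c: "compl (map_lit f l) = map_lit f (compl l)" "lit_atom (compl l) = lit_atom l" for l by (cases l; simp)+
  show ?thesis using assms(4) t i by (cases b) (auto simp: holds_def c)
qed

lemma sat_image:
  assumes "I <= lits_of A" "J <= A" "N <= A" "set_rule r <= A"
  shows "sat (map_lit f ` I) (f ` J) (f ` N) (map_rule f r) \<longleftrightarrow> sat I J N r"
proof -
  have "lit_atom (elem_lit b) \<in> A" if "b \<in> fset (body r)" for b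
    using that assms(4) rule_atoms[of r] by (auto simp: rule_atoms_def)
  hence "(\<forall>b\<in>fset (body (map_rule f r)). holds (map_lit f ` I) (f ` J) (f ` N) b) \<longleftrightarrow> (\<forall>b\<in>fset (body r). holds I J N b)"
    using holds_image[OF assms(1-3)] by (simp add: rule.map_sel fimage.rep_eq)
  moreover have "h \<in> A" if "h \<in> fset (head r)" for h
    using that assms(4) rule_atoms[of r] by (auto simp: rule_atoms_def)
  hence "(\<exists>h\<in>fset (head (map_rule f r)). h \<in> f ` N) \<longleftrightarrow> (\<exists>h\<in>fset (head r). h \<in> N)"
    using inj_on_image_mem_iff[OF f _ assms(3)] by (simp add: rule.map_sel fimage.rep_eq)
  ultimately show ?thesis unfolding sat_def by simp
qed

end

lemma atoms_image: "atoms (map_rule f ` G) = f ` atoms G"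
  by (auto simp: atoms_def rule.set_map)

text \<open>Answer sets on both sides consist of atoms of the program, where \<open>f\<close> is
  injective, so subsets and therefore minimality correspond.\<close>

lemma answer_sets_image:
  assumes f: "inj_on f (atoms G)" and I: "I <= lits_of (atoms G)"
  shows "AS (map_rule f ` G) (map_lit f ` I) = (`) f ` AS G I"
proof -
  let ?A = "atoms G"
  have s: "sat (map_lit f ` I) (f ` J) (f ` N) (map_rule f r) \<longleftrightarrow> sat I J N r" if "J <= ?A" "N <= ?A" "r \<in> G" for J N r
    by (rule sat_image[OF f I]) (use that in \<open>auto simp: atoms_def\<close>)
  have m: "f ` J \<in> AS (map_rule f ` G) (map_lit f ` I) \<longleftrightarrow> J \<in> AS G I"
    if J: "J <= ?A" for J
  proof -
    have "(ALL N. N \<subset> f ` J --> (\<exists>r\<in>G. ~ sat (map_lit f ` I) (f ` J) N (map_rule f r))) \<longleftrightarrow> (ALL N. N \<subset> J --> (\<exists>r\<in>G. ~ sat I J N r))"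
    proof (intro iffI allI impI)
      fix N assume a: "ALL N. N \<subset> f ` J --> (\<exists>r\<in>G. ~ sat (map_lit f ` I) (f ` J) N (map_rule f r))" and N: "N \<subset> J"
      have "f ` N \<subset> f ` J" using inj_on_image_eq_iff[OF f, of N J] N J by blast
      with a have "\<exists>r\<in>G. ~ sat (map_lit f ` I) (f ` J) (f ` N) (map_rule f r)" by (elim allE impE)
      moreover have "N <= ?A" using N J by blast
      ultimately show "\<exists>r\<in>G. ~ sat I J N r" using s[OF J] by simp
    next
      fix N assume a: "ALL N. N \<subset> J --> (\<exists>r\<in>G. ~ sat I J N r)" and N: "N \<subset> f ` J"
      obtain N' where N': "N' <= J" "N = f ` N'" using subset_imageE[OF psubset_imp_subset[OF N]] .
      hence "N' \<subset> J" using N by blast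
      with a have "\<exists>r\<in>G. ~ sat I J N' r" by (elim allE impE)
      moreover have "N' <= ?A" using N' J by blast
      ultimately show "\<exists>r\<in>G. ~ sat (map_lit f ` I) (f ` J) N (map_rule f r)" unfolding N'(2) using s[OF J] by simp
    qed
    thus ?thesis unfolding answer_sets_reduct using s[OF J J] by simp
  qed
  show ?thesis
  proof (intro equalityI subsetI)
    fix J assume J: "J \<in> AS (map_rule f ` G) (map_lit f ` I)"
    have "J <= f ` ?A" using answer_set_subset[OF J] by (simp add: atoms_image)
    then obtain J' where "J' <= ?A" "J = f ` J'" by (rule subset_imageE)
    thus "J \<in> (`) f ` AS G I" using m J by blast
  next
    fix J assume "J \<in> (`) f ` AS G I"
    then obtain J' where J': "J' \<in> AS G I" "J = f ` J'" by blast
    thus "J \<in> AS (map_rule f ` G) (map_lit f ` I)" using m[OF answer_set_subset] by blast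
  qed
qed

lemma guesses_image:
  assumes f: "inj_on f A" shows "guesses (f ` A) = (`) (map_lit f) ` guesses A"
proof (intro equalityI subsetI)
  have l: "map_lit f ` lits_of A = lits_of (f ` A)" by (auto simp: lits_of_eq image_Un image_image)
  have m: "map_lit f l \<in> map_lit f ` I \<longleftrightarrow> l \<in> I" if "I <= lits_of A" "lit_atom l \<in> A" for l I
    using inj_on_image_mem_iff[OF inj_map_lit[OF f] _ that(1)] that(2) by simp
  fix I assume I: "I \<in> guesses (f ` A)"
  then obtain I' where I': "I' <= lits_of A" "I = map_lit f ` I'" unfolding guesses_def l[symmetric] by (auto elim: subset_imageE)
  have "~ (Pos a \<in> I' & Neg a \<in> I')" for a
  proof
    assume "Pos a \<in> I' & Neg a \<in> I'"
    hence "Pos (f a) \<in> I & Neg (f a) \<in> I" unfolding I'(2) by (metis image_eqI lit.map)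
    thus False using I unfolding guesses_def by blast
  qed
  thus "I \<in> (`) (map_lit f) ` guesses A" using I' by (auto simp: guesses_def)
next
  have m: "map_lit f l \<in> map_lit f ` I \<longleftrightarrow> l \<in> I" if "I <= lits_of A" "lit_atom l \<in> A" for l I
    using inj_on_image_mem_iff[OF inj_map_lit[OF f] _ that(1)] that(2) by simp
  fix I assume "I \<in> (`) (map_lit f) ` guesses A"
  then obtain I' where I': "I' \<in> guesses A" "I = map_lit f ` I'" by blast
  have sub: "I' <= lits_of A" using I' by (auto simp: guesses_def)
  have at: "lit_atom (map_lit f l) = f (lit_atom l)" for l by (cases l) auto
  have "I <= lits_of (f ` A)" using sub unfolding I'(2) by (auto simp: at)
  moreover have "~ (Pos a \<in> I & Neg a \<in> I)" for a
  proof
    assume a: "Pos a \<in> I & Neg a \<in> I"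
    then obtain b where b: "b \<in> A" "a = f b" using \<open>I <= lits_of (f ` A)\<close> by force
    thus False using a m[OF sub, of "Pos b"] m[OF sub, of "Neg b"] I' by (auto simp: guesses_def)
  qed
  ultimately show "I \<in> guesses (f ` A)" by (simp add: guesses_def)
qed

lemma Collect_image: "(!!x. x \<in> S ==> Q (g x) \<longleftrightarrow> P x) ==> {y \<in> g ` S. Q y} = g ` {x \<in> S. P x}"
  by auto

lemma world_views_image:
  assumes f: "inj_on f (atoms G)"
  shows "world_views (map_rule f ` G) = (`) (map_lit f) ` world_views G"
proof -
  let ?A = "atoms G"
  let ?P = "%G I. AS G I ~= {} &
    (\<forall>v\<in>atoms G. ((\<exists>J\<in>AS G I. v \<in> J) \<longleftrightarrow> Neg v ~: I) &
      ((\<exists>J\<in>AS G I. v ~: J) \<longleftrightarrow> Pos v ~: I))"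
  have key: "?P (map_rule f ` G) (map_lit f ` I) \<longleftrightarrow> ?P G I" if I: "I \<in> guesses ?A" for I
  proof -
    have sub: "I <= lits_of ?A" using I by (auto simp: guesses_def)
    have m: "map_lit f l \<in> map_lit f ` I \<longleftrightarrow> l \<in> I" if "lit_atom l \<in> ?A" for l
      using inj_on_image_mem_iff[OF inj_map_lit[OF f] _ sub] that by simp
    have mm: "Pos (f v) \<in> map_lit f ` I \<longleftrightarrow> Pos v \<in> I" "Neg (f v) \<in> map_lit f ` I \<longleftrightarrow> Neg v \<in> I" if "v \<in> ?A" for v
      using m[of "Pos v"] m[of "Neg v"] that by simp_all
    have v: "f v \<in> f ` J \<longleftrightarrow> v \<in> J" if "v \<in> ?A" "J \<in> AS G I" for v J
      by (rule inj_on_image_mem_iff[OF f that(1) answer_set_subset[OF that(2)]])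
    have e: "(\<exists>J\<in>(`) f ` AS G I. f v \<in> J) \<longleftrightarrow> (\<exists>J\<in>AS G I. v \<in> J)"
      "(\<exists>J\<in>(`) f ` AS G I. f v ~: J) \<longleftrightarrow> (\<exists>J\<in>AS G I. v ~: J)" if "v \<in> ?A" for v
      unfolding Set.bex_simps(7) by (intro bex_cong refl; simp add: v[OF that])+
    show ?thesis unfolding atoms_image answer_sets_image[OF f sub] Set.ball_simps(9) image_is_empty
      by (intro conj_cong refl ball_cong) (simp_all only: mm e)
  qed
  have g: "guesses (atoms (map_rule f ` G)) = (`) (map_lit f) ` guesses ?A" by (simp only: atoms_image guesses_image[OF f])
  show ?thesis unfolding world_views_guesses[of "map_rule f ` G"] world_views_guesses[of G] g by (rule Collect_image) (rule key)
qed

lemma card_world_views_image: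
  assumes f: "inj_on f (atoms G)" shows "card (world_views (map_rule f ` G)) = card (world_views G)"
proof -
  have "inj_on ((`) (map_lit f)) (world_views G)"
    by (rule inj_on_subset[OF inj_on_image_Pow[OF inj_map_lit[OF f]]]) (auto simp: world_views_guesses guesses_def)
  thus ?thesis unfolding world_views_image[OF f] by (rule card_image)
qed

lemma finite_world_views: "finite G ==> finite (world_views G)"
  unfolding world_views_guesses by (rule finite_subset[OF _ finite_guesses[OF finite_atoms]]) auto

lemma dependency_image:
  "dependency_graph (map_rule f ` G) = map_prod f f ` dependency_graph G"
proof -
  have b: "Lit (Pos c) = map_body_elem f b \<longleftrightarrow> (EX a. b = Lit (Pos a) & c = f a)"
    "ENot (Neg c) = map_body_elem f b \<longleftrightarrow> (EX a. b = ENot (Neg a) & c = f a)"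
    "NegENot (Pos c) = map_body_elem f b \<longleftrightarrow> (EX a. b = NegENot (Pos a) & c = f a)" for b c
    by (cases b; cases "elem_lit b"; auto)+
  have "(c, d) \<in> dependency_graph (map_rule f ` G) \<longleftrightarrow> (c, d) \<in> map_prod f f ` dependency_graph G" for c d
    unfolding dependency_graph_def pos_body_def by (simp add: rule.map_sel fimage.rep_eq image_iff b) blast
  thus ?thesis by auto
qed

text \<open>Paths lift along \<open>f\<close>: consecutive arcs of an image path meet in one vertex,
  whose preimage in \<open>A\<close> is unique.\<close>

lemma acyclic_image:
  assumes "acyclic R" "R <= A \<times> A" "inj_on f A" shows "acyclic (map_prod f f ` R)"
proof -
  have tr: "R\<^sup>+ <= A \<times> A" by (rule trancl_subset_Sigma[OF assms(2)])
  have main: "EX a b. (a, b) \<in> R\<^sup>+ & x = f a & y = f b" if "(x, y) \<in> (map_prod f f ` R)\<^sup>+" for x y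
    using that
  proof (induction rule: trancl_induct)
    case (base y)
    thus ?case by auto
  next
    case (step y z)
    then obtain a b b' c where 1: "(a, b) \<in> R\<^sup>+" "x = f a" "y = f b" "(b', c) \<in> R" "y = f b'" "z = f c" by auto
    have "b \<in> A" "b' \<in> A" using 1(1,4) assms(2) tr by blast+
    hence "b = b'" using 1 assms(3) by (auto dest: inj_onD)
    hence "(a, c) \<in> R\<^sup>+" using 1(1,4) by (simp add: trancl.trancl_into_trancl)
    thus ?case using 1(2,6) by blast
  qed
  have "(x, x) ~: (map_prod f f ` R)\<^sup>+" for x
  proof
    assume "(x, x) \<in> (map_prod f f ` R)\<^sup>+"
    from main[OF this] obtain a b where ab: "(a, b) \<in> R\<^sup>+" "x = f a" "x = f b" by blast
    hence "a \<in> A" "b \<in> A" using tr by blast+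
    hence "a = b" using ab assms(3) by (auto dest: inj_onD)
    thus False using ab(1) assms(1) unfolding acyclic_def by blast
  qed
  thus ?thesis unfolding acyclic_def by blast
qed

lemma in_set_rule:
  "a |\<in>| head r | Lit (Pos a) |\<in>| body r | ENot (Neg a) |\<in>| body r | NegENot (Pos a) |\<in>| body r ==> a \<in> set_rule r"
  unfolding rule_atoms[symmetric] rule_atoms_def by (force simp: fimage.rep_eq image_iff)

lemma ordered_image:
  assumes "ordered G" "inj_on f (atoms G)" shows "ordered (map_rule f ` G)"
proof -
  consider "\<forall>r\<in>G. fcard (head r) <= 1" | "acyclic (dependency_graph G)" using assms(1) unfolding ordered_def by blast
  thus ?thesis
  proof cases
    case 1
    have "fcard (head (map_rule f r)) <= fcard (head r)" for r
      by (simp add: rule.map_sel fcard.rep_eq fimage.rep_eq card_image_le)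
    hence "\<forall>r\<in>map_rule f ` G. fcard (head r) <= 1" using 1 le_trans by blast
    thus ?thesis by (simp add: ordered_def)
  next
    case 2
    have "dependency_graph G <= atoms G \<times> atoms G"
    proof (rule subrelI)
      fix a b assume "(a, b) \<in> dependency_graph G"
      then obtain r where "r \<in> G" "b |\<in>| head r" "Lit (Pos a) |\<in>| body r | ENot (Neg a) |\<in>| body r | NegENot (Pos a) |\<in>| body r"
        unfolding dependency_graph_def pos_body_def by auto
      hence "r \<in> G" "a \<in> set_rule r" "b \<in> set_rule r" using in_set_rule[of a r] in_set_rule[of b r] by simp_all
      thus "(a, b) \<in> atoms G \<times> atoms G" unfolding atoms_def by auto
    qed
    from acyclic_image[OF 2 this assms(2)] show ?thesis unfolding ordered_def dependency_image by blast
  qed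
qed

subsection \<open>The width of the grounding\<close>

lemma finite_herbrand: "finite P ==> finite (herbrand P) & herbrand P ~= {}"
proof -
  assume P: "finite P"
  let ?C = "{c. \<exists>(p, ts)\<in>atoms P. Const c \<in> set ts}"
  have "?C = (\<Union>A\<in>atoms P. Const -` set (snd A))" by fastforce
  moreover have "finite (Const -` set (snd A))" for A :: atom by (rule finite_vimageI) (auto simp: inj_def)
  ultimately have "finite ?C" using finite_atoms[OF P] by simp
  thus ?thesis by (simp add: herbrand_def Let_def)
qed

lemma atoms_grd:
  assumes A: "A \<in> atoms (grd P)"
  shows "\<exists>B\<in>atoms P. fst A = fst B & length (snd A) = length (snd B) & set (snd A) <= herbrand P"
proof -
  obtain r \<sigma> where r: "r \<in> P" "range \<sigma> <= herbrand P" "A \<in> set_rule (map_rule (inst \<sigma>) r)"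
    using A unfolding atoms_def grd_def by blast
  then obtain B where B: "B \<in> set_rule r" "A = inst \<sigma> B" by (auto simp: rule.set_map)
  hence BP: "B \<in> atoms P" using r(1) by (auto simp: atoms_def)
  have "inst_trm \<sigma> t \<in> herbrand P" if "t \<in> set (snd B)" for t
  proof (cases t)
    case (Var v) thus ?thesis using r(2) by auto
  next
    case (Const c)
    hence "c \<in> {c. \<exists>(p, ts)\<in>atoms P. Const c \<in> set ts}" using that BP by (cases B) auto
    thus ?thesis using Const unfolding herbrand_def Let_def by auto
  qed
  thus ?thesis using BP B(2) by (intro bexI[of _ B]) (auto simp: inst_def)
qed

lemma finite_atoms_grd:
  assumes "elp P" "bounded_arity a P" "finite S"
  shows "finite {A \<in> atoms (grd P). fst A \<in> S} & card {A \<in> atoms (grd P). fst A \<in> S} <= card S * card (herbrand P) ^ a"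
proof -
  have P: "finite P" using assms(1) by (simp add: elp_def)
  note H = finite_herbrand[OF P]
  obtain ar where ar: "\<forall>(p, ts)\<in>atoms P. length ts = ar p" using assms(1) by (auto simp: elp_def)
  \<comment> \<open>The set \<open>S\<close> may contain predicates that do not occur in
    \<open>P\<close>, for which the arity is not known to be bounded; the minimum caps it.\<close>
  let ?L = "%p. Pair p ` {xs. set xs <= herbrand P & length xs = min (ar p) a}"
  have sub: "{A \<in> atoms (grd P). fst A \<in> S} <= (\<Union>p\<in>S. ?L p)"
  proof
    fix A assume A: "A \<in> {A \<in> atoms (grd P). fst A \<in> S}"
    then obtain B where B: "B \<in> atoms P" "fst A = fst B" "length (snd A) = length (snd B)" "set (snd A) <= herbrand P"
      using atoms_grd by blast
    have "length (snd B) = ar (fst B)" "length (snd B) <= a"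
      using ar assms(2) B(1) unfolding bounded_arity_def by (cases B; fastforce)+
    hence "snd A \<in> {xs. set xs <= herbrand P & length xs = min (ar (fst A)) a}" using B by simp
    hence "(fst A, snd A) \<in> ?L (fst A)" by (rule imageI)
    hence "A \<in> ?L (fst A)" unfolding prod.collapse .
    thus "A \<in> (\<Union>p\<in>S. ?L p)" using A by blast
  qed
  have fin: "finite (?L p)" for p using finite_lists_length_eq[OF conjunct1[OF H]] by blast
  have d: "card (herbrand P) >= 1" using H by (simp add: Suc_leI card_gt_0_iff)
  have "card (?L p) <= card (herbrand P) ^ a" for p
  proof -
    have "card (?L p) <= card {xs. set xs <= herbrand P & length xs = min (ar p) a}"
      by (rule card_image_le[OF finite_lists_length_eq[OF conjunct1[OF H]]])
    also have "... = card (herbrand P) ^ min (ar p) a" by (rule card_lists_length_eq[OF conjunct1[OF H]])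
    also have "... <= card (herbrand P) ^ a" using d by (intro power_increasing) auto
    finally show ?thesis .
  qed
  hence "card (\<Union>p\<in>S. ?L p) <= card S * card (herbrand P) ^ a"
    using card_UN_le[OF assms(3), of ?L] sum_bounded_above[of S "%p. card (?L p)" "card (herbrand P) ^ a"] by simp
  moreover have fu: "finite (\<Union>p\<in>S. ?L p)" using fin assms(3) by blast
  ultimately show ?thesis using card_mono[OF fu sub] finite_subset[OF sub fu] by linarith
qed

lemma preds_grd: "preds (grd P) <= preds P"
  using atoms_grd unfolding preds_def by fastforce

lemma card_atoms_grd:
  assumes "elp P" "bounded_arity a P"
  shows "finite (atoms (grd P)) & card (atoms (grd P)) <= card (atoms P) * card (herbrand P) ^ a"
proof -
  have f: "finite (atoms P)" using assms(1) by (intro finite_atoms) (simp add: elp_def)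
  hence fp: "finite (preds P)" by (simp add: preds_def)
  have e: "{A \<in> atoms (grd P). fst A \<in> preds P} = atoms (grd P)" using preds_grd[of P] by (auto simp: preds_def)
  have "card (preds P) <= card (atoms P)" unfolding preds_def by (rule card_image_le[OF f])
  hence "card (preds P) * card (herbrand P) ^ a <= card (atoms P) * card (herbrand P) ^ a" by (rule mult_right_mono) simp
  thus ?thesis using finite_atoms_grd[OF assms fp] unfolding e by linarith
qed

text \<open>The renaming \<open>f\<close> allows two uses: for the ground atoms themselves, to bound
  the length of the input, and for their encodings, on which the algorithm works.\<close>

lemma ground_elim_order:
  assumes P: "elp P" "bounded_arity a P" and f: "inj_on f (atoms (grd P))"
  shows "EX vs. distinct vs & set vs = f ` atoms (grd P) &
    elim_width ((primal_treewidth P + 1) * card (herbrand P) ^ a) vs (set_rule ` map_rule f ` grd P)"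
proof -
  have fP: "finite (preds P)" using P(1) by (simp add: preds_def finite_atoms elp_def)
  have eP: "e <= preds P" if "e \<in> primal_edges P" for e
    using that unfolding primal_edges_def preds_def atoms_def by blast
  obtain N T bag where td: "tree_decomposition (preds P) (primal_edges P) N T bag"
    and w: "!!n. n \<in> N ==> card (bag n) <= primal_treewidth P + 1"
    using treewidth_decomposition[OF fP eP] unfolding primal_treewidth_def by blast
  have tree: "finite N" "N ~= {}" "connected_on N T" "simple_graph N T" "~ has_cycle T"
    using td by (auto simp: tree_decomposition_def is_tree_def)
  have cov: "(\<Union>n\<in>N. bag n) = preds P" and edg: "!!e. e \<in> primal_edges P ==> \<exists>n\<in>N. e <= bag n"
    and con: "!!p. p \<in> preds P ==> connected_on {n\<in>N. p \<in> bag n} T"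
    using td by (auto simp: tree_decomposition_def)
  let ?g = "%n. {A \<in> atoms (grd P). fst A \<in> bag n}"
  have pr: "fst A \<in> preds P" if "A \<in> atoms (grd P)" for A using that preds_grd[of P] by (auto simp: preds_def)
  have "EX vs. distinct vs & set vs = (\<Union>n\<in>N. f ` ?g n) &
    elim_width ((primal_treewidth P + 1) * card (herbrand P) ^ a) vs (set_rule ` map_rule f ` grd P)"
  proof (rule tree_elim_order[OF tree])
    fix v
    show "connected_on {n \<in> N. v \<in> f ` ?g n} T"
    proof (cases "v \<in> f ` atoms (grd P)")
      case True
      then obtain A where A: "A \<in> atoms (grd P)" "v = f A" by blast
      have "v \<in> f ` ?g n \<longleftrightarrow> fst A \<in> bag n" for n
        using inj_on_image_mem_iff[OF f A(1), of "?g n"] A by auto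
      thus ?thesis using con[OF pr[OF A(1)]] by simp
    next
      case False
      hence "{n \<in> N. v \<in> f ` ?g n} = {}" by blast
      thus ?thesis by (simp only:) (simp add: connected_on_def)
    qed
  next
    fix n assume n: "n \<in> N"
    have fb: "finite (bag n)" using cov n by (intro finite_subset[OF _ fP]) blast
    note g = finite_atoms_grd[OF P fb]
    have "card (f ` ?g n) <= card (?g n)" by (rule card_image_le[OF conjunct1[OF g]])
    also have "... <= card (bag n) * card (herbrand P) ^ a" using g by simp
    also have "... <= (primal_treewidth P + 1) * card (herbrand P) ^ a" using w[OF n] by (rule mult_right_mono) simp
    finally show "finite (f ` ?g n) & card (f ` ?g n) <= (primal_treewidth P + 1) * card (herbrand P) ^ a" using g by blast
  next
    fix h u v assume h: "h \<in> set_rule ` map_rule f ` grd P" "u \<in> h" "v \<in> h"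
    then obtain r where r: "r \<in> grd P" "h = f ` set_rule r" by (auto simp: rule.set_map)
    obtain A B where AB: "A \<in> set_rule r" "B \<in> set_rule r" "u = f A" "v = f B" using h r by blast
    hence at: "A \<in> atoms (grd P)" "B \<in> atoms (grd P)" using r(1) by (auto simp: atoms_def)
    obtain r0 \<sigma> where r0: "r0 \<in> P" "r = map_rule (inst \<sigma>) r0" using r(1) unfolding grd_def by blast
    have "fst ` set_rule r = fst ` set_rule r0" by (simp add: r0(2) rule.set_map image_image inst_def)
    hence p: "fst A \<in> fst ` set_rule r0" "fst B \<in> fst ` set_rule r0" using imageI[OF AB(1), of fst] imageI[OF AB(2), of fst] by simp_all
    \<comment> \<open>Two atoms of the same predicate share every bag of that predicate; only
      different predicates give an edge of the primal graph.\<close>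
    have "\<exists>n\<in>N. fst A \<in> bag n & fst B \<in> bag n"
    proof (cases "fst A = fst B")
      case True
      thus ?thesis using cov pr[OF at(1)] by auto
    next
      case False
      hence "{fst A, fst B} \<in> primal_edges P" using p r0(1) unfolding primal_edges_def by blast
      from edg[OF this] show ?thesis by blast
    qed
    thus "\<exists>n\<in>N. u \<in> f ` ?g n & v \<in> f ` ?g n" using at AB(3,4) by blast
  qed
  moreover have "(\<Union>n\<in>N. f ` ?g n) = f ` atoms (grd P)" using cov pr by blast
  ultimately show ?thesis by simp
qed

subsection \<open>Size of the input\<close>

type_synonym input = "(tree list \<times> tree body_elem list) list"

definition dec :: "input => tree rule list" where
  "dec ys = map (%y. Rule (fset_of_list (fst y)) (fset_of_list (snd y))) ys"

lemma comp_dec: "ptime D T f ==> ptime D T (%x. dec (f x))"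
  unfolding dec_def by (intro comp_intros)

definition rule_code :: "('a => tree) => 'a rule => tree list \<times> tree body_elem list => bool" where
  "rule_code f r y \<longleftrightarrow> (EX hs bs. distinct hs & set hs = fset (head r) & distinct bs & set bs = fset (body r) &
     y = (map f hs, map (map_body_elem f) bs))"

lemma enc_list_map2: "enc_list h (map f xs) = enc_list (%x. h (f x)) xs"
  by (induction xs) auto

lemma enc_map_body_elem: "enc (map_body_elem f b) = enc_body_elem f b" for f :: "'a => tree"
  unfolding enc_body_elem' by (cases b; cases "elem_lit b") (auto simp: enc_lit')

lemma encodes_rule_code: "encodes_rule f r x \<longleftrightarrow> (EX y. rule_code f r y & x = enc y)"
proof -
  have "enc (map f hs, map (map_body_elem f) bs) = Node (enc_list f hs) (enc_list (enc_body_elem f) bs)" for hs bs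
    by (simp add: enc_list' enc_list_map2 enc_map_body_elem)
  thus ?thesis unfolding encodes_rule_def rule_code_def by metis
qed

lemma encodes_list_code:
  assumes "list_all2 (encodes_rule f) rs xs" shows "\<exists>ys :: input. list_all2 (rule_code f) rs ys & enc_list id xs = enc ys"
  using assms
proof (induction rule: list_all2_induct)
  case Nil
  thus ?case by (intro exI[of _ "[]"]) simp
next
  case (Cons r rs x xs)
  then obtain ys :: input and y where "list_all2 (rule_code f) rs ys" "enc_list id xs = enc ys" "rule_code f r y" "x = enc y"
    unfolding encodes_rule_code by blast
  thus ?case by (intro exI[of _ "y # ys"]) (simp add: id_def)
qed

lemma rule_code_dec:
  assumes "rule_code f r y" shows "Rule (fset_of_list (fst y)) (fset_of_list (snd y)) = map_rule f r"
proof -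
  obtain hs bs where y: "set hs = fset (head r)" "set bs = fset (body r)" "y = (map f hs, map (map_body_elem f) bs)"
    using assms unfolding rule_code_def by blast
  have "fset (fset_of_list (fst y)) = fset (head (map_rule f r))" "fset (fset_of_list (snd y)) = fset (body (map_rule f r))"
    using y by (simp_all add: fset_of_list.rep_eq rule.map_sel fimage.rep_eq)
  thus ?thesis by (intro rule.expand) (simp add: fset_inject)
qed

lemma dec_rule_codes: "list_all2 (rule_code f) rs ys ==> dec ys = map (map_rule f) rs"
  unfolding dec_def by (induction rule: list_all2_induct) (simp_all add: rule_code_dec)

lemma enc_atom_inj:
  assumes "bij_betw \<pi> (preds G) S" "bij_betw \<kappa> (\<Union>A\<in>atoms G. set (snd A)) S'"
  shows "inj_on (enc_atom \<pi> \<kappa>) (atoms G)"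
proof (rule inj_onI)
  fix A B assume AB: "A \<in> atoms G" "B \<in> atoms G" "enc_atom \<pi> \<kappa> A = enc_atom \<pi> \<kappa> B"
  have "enc (\<pi> (fst A)) = enc (\<pi> (fst B))" using AB(3) by (simp add: enc_atom_def enc_nat')
  hence "fst A = fst B" using bij_betw_imp_inj_on[OF assms(1)] AB(1,2) by (auto simp: preds_def inj_on_def)
  moreover have "enc (map \<kappa> (snd A)) = enc (map \<kappa> (snd B))" using AB(3) by (simp add: enc_atom_def enc_list' enc_nat' enc_list_map2 comp_def)
  hence "map \<kappa> (snd A) = map \<kappa> (snd B)" by simp
  hence "snd A = snd B"
  proof (rule map_inj_on)
    show "inj_on \<kappa> (set (snd A) Un set (snd B))"
      by (rule inj_on_subset[OF bij_betw_imp_inj_on[OF assms(2)]]) (use AB in blast)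
  qed
  ultimately show "A = B" by (simp add: prod_eq_iff)
qed

lemma size_enc_atom:
  assumes "\<pi> (fst A) < n" "!!c. c \<in> set (snd A) ==> \<kappa> c < d" "length (snd A) <= a"
  shows "tsize (enc_atom \<pi> \<kappa> A) <= 3 + 4 * n + a * (2 + 4 * d)"
proof -
  have "\<pi> (fst A) < 2 ^ n" using assms(1) less_exp[of n] by linarith
  hence 1: "sz (\<pi> (fst A)) <= 1 + 4 * n" by (rule sz_nat_le)
  have "sz (\<kappa> c) + 1 <= 2 + 4 * d" if "c \<in> set (snd A)" for c
  proof -
    have "\<kappa> c < 2 ^ d" using assms(2)[OF that] less_exp[of d] by linarith
    thus ?thesis using sz_nat_le[of "\<kappa> c" d] by simp
  qed
  hence "(\<Sum>c\<leftarrow>snd A. sz (\<kappa> c) + 1) <= length (snd A) * (2 + 4 * d)" by (rule sum_list_bound)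
  also have "... <= a * (2 + 4 * d)" using assms(3) by (rule mult_right_mono) simp
  finally have "sz (map \<kappa> (snd A)) <= 1 + a * (2 + 4 * d)" by (simp add: sz_list comp_def)
  moreover have "enc_atom \<pi> \<kappa> A = Node (enc (\<pi> (fst A))) (enc (map \<kappa> (snd A)))"
    by (simp add: enc_atom_def enc_list' enc_nat' enc_list_map2 comp_def)
  ultimately show ?thesis using 1 by simp
qed

text \<open>The factor 6 counts two signs and three kinds of body elements.\<close>

lemma belems: "finite k ==> finite {b. lit_atom (elem_lit b) \<in> k} & card {b. lit_atom (elem_lit b) \<in> k} <= 6 * card k"
proof -
  assume k: "finite k"
  have l: "finite (lits_of k)" by (rule finite_lits_of[OF k])
  have "card (lits_of k) <= card (Pos ` k) + card (Neg ` k)" unfolding lits_of_eq by (rule card_Un_le)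
  also have "... <= card k + card k" by (intro add_mono card_image_le k)
  finally have c: "card (lits_of k) <= 2 * card k" by simp
  have "lit_atom (elem_lit b) \<in> k \<longleftrightarrow> b \<in> Lit ` lits_of k Un (ENot ` lits_of k Un NegENot ` lits_of k)" for b by (cases b) auto
  hence e: "{b. lit_atom (elem_lit b) \<in> k} = Lit ` lits_of k Un (ENot ` lits_of k Un NegENot ` lits_of k)" by blast
  have "card (Lit ` lits_of k Un (ENot ` lits_of k Un NegENot ` lits_of k)) <= card (Lit ` lits_of k) + (card (ENot ` lits_of k) + card (NegENot ` lits_of k))"
    by (intro le_trans[OF card_Un_le] add_left_mono card_Un_le)
  also have "... <= card (lits_of k) + (card (lits_of k) + card (lits_of k))" by (intro add_mono card_image_le l)
  finally show ?thesis unfolding e using c l by simp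
qed

lemma rule_parts:
  assumes "set_rule r <= k" shows "fset (head r) <= k" "fset (body r) <= {b. lit_atom (elem_lit b) \<in> k}"
  using assms unfolding rule_atoms[symmetric] rule_atoms_def by auto

lemma edge_le_width:
  assumes "elim_width b vs H" "\<Union>H <= set vs" "h \<in> H" shows "finite h & card h <= b"
proof (cases "h = {}")
  case False
  from elim_width_cover[OF assms(1,2)] obtain K where K: "\<forall>k\<in>K. finite k & card k <= b"
    "\<forall>h\<in>H. h ~= {} --> (\<exists>k\<in>K. h <= k)" by (elim exE conjE)
  from bspec[OF K(2) assms(3)] False obtain k where "k \<in> K" "h <= k" by blast
  thus ?thesis using K(1) card_mono[of k h] finite_subset[of h k] by fastforce
qed simp

text \<open>A rule over \<open>k\<close> is a subset of \<open>k\<close> as head and a subset of at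
  most \<open>6 * card k\<close> body elements.\<close>

lemma card_rules_over:
  assumes "finite k" shows "finite {r. set_rule r <= k} & card {r. set_rule r <= k} <= 2 ^ (7 * card k)"
proof -
  let ?S = "Pow k \<times> Pow {b. lit_atom (elem_lit b) \<in> k}"
  let ?h = "%r. (fset (head r), fset (body r))"
  note b = belems[OF assms]
  have inj: "inj_on ?h {r. set_rule r <= k}" by (rule inj_onI) (auto simp: fset_inject intro: rule.expand)
  have im: "?h ` {r. set_rule r <= k} <= ?S"
    by (intro image_subsetI SigmaI PowI rule_parts) simp_all
  have fin: "finite ?S" using assms b by simp
  have "card {r. set_rule r <= k} <= card ?S" by (rule card_inj_on_le[OF inj im fin])
  also have "... = 2 ^ card k * 2 ^ card {b. lit_atom (elem_lit b) \<in> k}" using assms b by (simp add: card_cartesian_product card_Pow)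
  also have "... <= 2 ^ card k * 2 ^ (6 * card k)" using b by (intro mult_left_mono power_increasing) auto
  also have "... = 2 ^ (7 * card k)" by (simp flip: power_add)
  finally show ?thesis using inj_on_finite[OF inj im fin] by blast
qed

text \<open>Each rule with atoms fits into one of the \<open>length vs\<close> sets of an
  elimination order; the summand 1 is for the empty rule. In this way the number of rules is
  controlled by atoms and width.\<close>

lemma card_rules:
  assumes "elim_width w vs (set_rule ` G)" "set vs = atoms G"
  shows "card G <= 1 + length vs * 2 ^ (7 * w)"
proof -
  have "\<Union>(set_rule ` G) <= set vs" using assms(2) by (simp add: atoms_def)
  from elim_width_cover[OF assms(1) this] obtain K where K: "finite K" "card K <= length vs" "\<forall>k\<in>K. finite k & card k <= w"
    "\<forall>h\<in>set_rule ` G. h ~= {} --> (\<exists>k\<in>K. h <= k)" by (elim exE conjE)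
  have sub: "G <= insert (Rule {||} {||}) (\<Union>k\<in>K. {r. set_rule r <= k})"
  proof
    fix r assume r: "r \<in> G"
    show "r \<in> insert (Rule {||} {||}) (\<Union>k\<in>K. {r. set_rule r <= k})"
    proof (cases "set_rule r = {}")
      case True
      hence "fset (head r) = {}" "fset (body r) = {}" using rule_parts[of r "{}"] by auto
      hence "r = Rule {||} {||}" by (intro rule.expand) (simp add: fset_inject[symmetric])
      thus ?thesis by simp
    next
      case False
      have "set_rule r \<in> set_rule ` G" using r by (rule imageI)
      hence "\<exists>k\<in>K. set_rule r <= k" using K(4) False by blast
      thus ?thesis by blast
    qed
  qed
  have fin: "finite (\<Union>k\<in>K. {r. set_rule r <= k})" using K(1,3) card_rules_over by blast
  have "card (\<Union>k\<in>K. {r. set_rule r <= k}) <= (\<Sum>k\<in>K. card {r. set_rule r <= k})" by (rule card_UN_le[OF K(1)])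
  also have "... <= (\<Sum>k\<in>K. 2 ^ (7 * w))"
  proof (rule sum_mono)
    fix k assume "k \<in> K"
    hence "finite k" "card k <= w" using K(3) by blast+
    thus "card {r. set_rule r <= k} <= 2 ^ (7 * w)"
      using card_rules_over[of k] power_increasing[of "7 * card k" "7 * w" "2 :: nat"] by linarith
  qed
  also have "... <= length vs * 2 ^ (7 * w)" using K(2) by simp
  finally have "card (\<Union>k\<in>K. {r. set_rule r <= k}) <= length vs * 2 ^ (7 * w)" .
  moreover have "card G <= card (insert (Rule {||} {||}) (\<Union>k\<in>K. {r. set_rule r <= k}))" using fin by (intro card_mono sub) simp
  moreover have "card (insert (Rule {||} {||}) (\<Union>k\<in>K. {r. set_rule r <= k})) <= Suc (card (\<Union>k\<in>K. {r. set_rule r <= k}))"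
    by (rule card_insert_le_m1) (simp_all add: fin)
  ultimately show ?thesis by linarith
qed

lemma size_rule_code:
  assumes y: "rule_code f r y" and k: "finite k" "card k <= w" "set_rule r <= k" and s: "!!A. A \<in> set_rule r ==> tsize (f A) <= s"
  shows "sz y <= 3 + w * (s + 1) + 6 * w * (s + 13)"
proof -
  obtain hs bs where y: "distinct hs" "set hs = fset (head r)" "distinct bs" "set bs = fset (body r)" "y = (map f hs, map (map_body_elem f) bs)"
    using y unfolding rule_code_def by blast
  have "length hs <= card k" using rule_parts(1)[OF k(3)] distinct_card[OF y(1)] card_mono[OF k(1), of "set hs"] y(2) by simp
  hence lh: "length hs <= w" using k(2) by linarith
  note b = belems[OF k(1)]
  have "length bs <= card {b. lit_atom (elem_lit b) \<in> k}"
    using rule_parts(2)[OF k(3)] distinct_card[OF y(3)] card_mono[OF conjunct1[OF b], of "set bs"] y(4) by simp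
  hence lb: "length bs <= 6 * w" using b k(2) by linarith
  have "sz h + 1 <= s + 1" if "h \<in> set (map f hs)" for h
    using that y(2) s rule_parts(1)[of r "set_rule r"] by auto
  hence "(\<Sum>h\<leftarrow>map f hs. sz h + 1) <= length (map f hs) * (s + 1)" by (rule sum_list_bound)
  also have "... <= w * (s + 1)" unfolding length_map using lh by (rule mult_right_mono) simp
  finally have 1: "sz (map f hs) <= 1 + w * (s + 1)" unfolding sz_list by simp
  \<comment> \<open>The worst case is a negated epistemic literal: 7 for its tag, 3 for a positive
    sign, two inner nodes and the list cell.\<close>
  have "sz b + 1 <= s + 13" if b: "b \<in> set (map (map_body_elem f) bs)" for b
  proof -
    obtain b' where b': "b = map_body_elem f b'" "b' \<in> fset (body r)" using b y(4) by auto
    hence "lit_atom (elem_lit b') \<in> set_rule r" using rule_parts(2)[of r "set_rule r"] by blast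
    from s[OF this] show ?thesis unfolding b'(1) by (cases b'; cases "elem_lit b'") auto
  qed
  hence "(\<Sum>b\<leftarrow>map (map_body_elem f) bs. sz b + 1) <= length (map (map_body_elem f) bs) * (s + 13)" by (rule sum_list_bound)
  also have "... <= 6 * w * (s + 13)" unfolding length_map using lb by (rule mult_right_mono) simp
  finally have "sz (map (map_body_elem f) bs) <= 1 + 6 * w * (s + 13)" unfolding sz_list by simp
  thus ?thesis using 1 y(5) by simp
qed

text \<open>From \<open>4 <= X\<close> on, numerical factors disappear in powers of
  \<open>X\<close>: exponent 4 for an atom, 7 for a rule and 10 for the number of rules.\<close>

lemma size_arith:
  fixes X :: nat
  assumes X: "4 <= X" and s: "s <= 3 + 6 * X + 4 * X\<^sup>2" and R: "R <= 3 + X * (s + 1) + 6 * X * (s + 13)"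
    and len: "len <= 1 + X\<^sup>2 * X ^ 7" and S: "S <= 1 + len * (R + 1)"
  shows "S <= X ^ 19"
proof -
  have X2: "4 * X <= X\<^sup>2" "16 <= X\<^sup>2" using mult_right_mono[OF X, of X] mult_mono[OF X X] by (simp_all add: power2_eq_square)
  have p: "X ^ m * X ^ n = X ^ (m + n)" for m n by (simp add: power_add)
  have "s <= 7 * X\<^sup>2" using s X2 by linarith
  also have "... <= X\<^sup>2 * X\<^sup>2" using X2(2) by (intro mult_right_mono) auto
  also have "... = X ^ 4" by (simp flip: power_add)
  finally have s4: "s <= X ^ 4" .
  have "X * (s + 1) <= X * (X ^ 4 + 1)" "6 * X * (s + 13) <= 6 * X * (X ^ 4 + 13)" using s4 by (intro mult_left_mono; simp)+
  hence "R + 1 <= 4 + X * (X ^ 4 + 1) + 6 * X * (X ^ 4 + 13)" using R by linarith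
  also have "... = 4 + 7 * X ^ 5 + 79 * X" by (simp add: algebra_simps eval_nat_numeral)
  also have "... <= 9 * X ^ 5"
  proof -
    have "4 ^ 4 * X <= X ^ 4 * X" using X by (intro mult_right_mono power_mono) auto
    hence "256 * X <= X ^ 5" by (simp add: eval_nat_numeral)
    thus ?thesis using X by linarith
  qed
  also have "... <= X\<^sup>2 * X ^ 5" using X2(2) by (intro mult_right_mono) auto
  finally have R7: "R + 1 <= X ^ 7" unfolding p by simp
  have one: "1 + X ^ m <= X ^ (Suc m)" for m
  proof -
    have "1 <= X ^ m" using X by (intro one_le_power) simp
    hence "1 + X ^ m <= 4 * X ^ m" by linarith
    also have "... <= X * X ^ m" using X by (rule mult_right_mono) simp
    finally show ?thesis by simp
  qed
  have "len <= X ^ 10" using len one[of 9] unfolding p by simp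
  hence "len * (R + 1) <= X ^ 10 * X ^ 7" using R7 by (rule mult_mono) auto
  hence "S <= X ^ 18" using S one[of 17] unfolding p by simp
  also have "... <= X ^ 19" using X by (intro power_increasing) auto
  finally show ?thesis .
qed

text \<open>Serves to name the least width of an input in time bounds; the algorithm does not
  compute it.\<close>

definition narrow :: "nat => input => bool" where
  "narrow b ys \<longleftrightarrow> (EX vs. elim_width b vs (scopes_of (dec ys)) & distinct vs &
     set vs = \<Union>(scopes_of (dec ys)))"

text \<open>The number \<open>u\<close> dominates all parameters except the number of atoms of
  \<open>P\<close>, so that the length of the input splits into a power of that number and a power
  of \<open>2 ^ u\<close>.\<close>

lemma decode_input:
  assumes P: "elp P" "bounded_arity a P" and x: "encodes_prog (grd P) x"
    and w: "w = (primal_treewidth P + 1) * card (herbrand P) ^ a"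
    and u: "2 <= u" "w <= u" "card (herbrand P) <= u" "card (herbrand P) ^ a <= u" "a <= u"
  shows "EX f ys. inj_on f (atoms (grd P)) & x = enc ys & set (dec ys) = map_rule f ` grd P & finite (grd P) & narrow w ys &
    sz ys <= ((card (atoms P) + 1) * 2 ^ u) ^ 19"
proof -
  let ?G = "grd P" and ?n = "card (atoms P)" and ?d = "card (herbrand P)"
  have fP: "finite P" using P(1) by (simp add: elp_def)
  obtain \<pi> \<kappa> rs xs where e: "bij_betw \<pi> (preds ?G) {..<card (preds ?G)}"
     "bij_betw \<kappa> (\<Union>A\<in>atoms ?G. set (snd A)) {..<card (\<Union>A\<in>atoms ?G. set (snd A))}"
     "distinct rs" "set rs = ?G" "list_all2 (encodes_rule (enc_atom \<pi> \<kappa>)) rs xs" "x = enc_list id xs"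
    using x unfolding encodes_prog_def Let_def by (elim exE conjE)
  let ?f = "enc_atom \<pi> \<kappa>"
  obtain ys :: input where ys: "list_all2 (rule_code ?f) rs ys" "x = enc ys"
    using encodes_list_code[OF e(5)] e(6) by auto
  have inj: "inj_on ?f (atoms ?G)" by (rule enc_atom_inj[OF e(1,2)])
  have dec: "set (dec ys) = map_rule ?f ` ?G" unfolding dec_rule_codes[OF ys(1)] using e(4) by simp
  have H: "scopes_of (dec ys) = set_rule ` map_rule ?f ` ?G"
    unfolding dec[symmetric] fset_of_list.rep_eq set_map image_image rule_atoms ..
  have U: "\<Union>(set_rule ` map_rule ?f ` ?G) = ?f ` atoms ?G" using atoms_image[of ?f ?G] unfolding atoms_def .
  have nar: "narrow w ys"
    using ground_elim_order[OF P inj] unfolding narrow_def H U w by (elim exE conjE) (intro exI conjI)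
  have fG: "finite ?G" using e(4) by (metis List.finite_set)
  obtain vs where vs: "distinct vs" "set vs = atoms ?G" "elim_width w vs (set_rule ` ?G)"
    using ground_elim_order[OF P, of id] unfolding w by (simp add: rule.map_id0) blast
  note ca = card_atoms_grd[OF P]
  let ?X = "(?n + 1) * 2 ^ u"
  have u2: "(4::nat) <= 2 ^ u" using power_increasing[OF u(1), of "2 :: nat"] by simp
  have uu: "u <= 2 ^ u" using less_exp[of u] by simp
  have nX: "?n <= ?X" using mult_mono[of ?n "?n + 1" 1 "2 ^ u"] by simp
  have uX: "2 ^ u <= ?X" by simp
  have X4: "4 <= ?X" using u2 uX by linarith
  have s: "tsize (?f A) <= 3 + 4 * ?n + a * (2 + 4 * ?d)" if A: "A \<in> atoms ?G" for A
  proof (rule size_enc_atom)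
    have "card (preds ?G) <= card (preds P)" using finite_atoms[OF fP] by (intro card_mono preds_grd) (simp add: preds_def)
    also have "... <= ?n" unfolding preds_def by (rule card_image_le[OF finite_atoms[OF fP]])
    finally show "\<pi> (fst A) < ?n" using bij_betwE[OF e(1)] A by (force simp: preds_def)
    obtain B where B: "B \<in> atoms P" "length (snd A) = length (snd B)" using atoms_grd[OF A] by blast
    thus "length (snd A) <= a" using P(2) unfolding bounded_arity_def by (cases B) fastforce
    fix c assume "c \<in> set (snd A)"
    hence c: "c \<in> (\<Union>A\<in>atoms ?G. set (snd A))" using A by blast
    have "(\<Union>A\<in>atoms ?G. set (snd A)) <= herbrand P" using atoms_grd by fast
    hence "card (\<Union>A\<in>atoms ?G. set (snd A)) <= ?d" using finite_herbrand[OF fP] by (intro card_mono) auto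
    thus "\<kappa> c < ?d" using bij_betwE[OF e(2)] c by fastforce
  qed
  let ?s = "3 + 4 * ?n + a * (2 + 4 * ?d)"
  let ?R = "3 + w * (?s + 1) + 6 * w * (?s + 13)"
  have wX: "w <= ?X" and aX: "a <= ?X" and dX: "?d <= ?X" and daX: "?d ^ a <= ?X" using u uu uX by linarith+
  have yR: "sz y <= ?R" if y: "y \<in> set ys" for y
  proof -
    obtain r where r: "r \<in> ?G" "rule_code ?f r y"
      using y ys(1) e(4) by (metis in_set_conv_nth list_all2_conv_all_nth)
    have "set_rule r \<in> set_rule ` ?G" using r(1) by (rule imageI)
    moreover have "\<Union>(set_rule ` ?G) <= set vs" using vs(2) by (simp add: atoms_def)
    ultimately have k: "finite (set_rule r)" "card (set_rule r) <= w" using edge_le_width[OF vs(3)] by simp_all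
    show ?thesis by (rule size_rule_code[OF r(2) k subset_refl s]) (use r(1) in \<open>auto simp: atoms_def\<close>)
  qed
  have "sz ys <= ?X ^ 19"
  proof (rule size_arith[OF X4])
    have "a * (2 + 4 * ?d) <= ?X * (2 + 4 * ?X)" using aX dX by (intro mult_mono) auto
    thus "?s <= 3 + 6 * ?X + 4 * ?X\<^sup>2" using nX by (simp add: algebra_simps power2_eq_square)
    show "?R <= 3 + ?X * (?s + 1) + 6 * ?X * (?s + 13)" using wX by (intro add_mono mult_mono order_refl) auto
    have "length ys = card ?G" using list_all2_lengthD[OF ys(1)] distinct_card[OF e(3)] e(4) by simp
    also have "... <= 1 + length vs * 2 ^ (7 * w)" by (rule card_rules[OF vs(3,2)])
    also have "... <= 1 + ?X\<^sup>2 * ?X ^ 7"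
    proof (intro add_left_mono mult_mono)
      have "length vs = card (atoms ?G)" using distinct_card[OF vs(1)] vs(2) by simp
      also have "... <= ?n * ?d ^ a" using ca by blast
      also have "... <= ?X\<^sup>2" unfolding power2_eq_square using nX daX by (intro mult_mono) auto
      finally show "length vs <= ?X\<^sup>2" .
      have "(2::nat) ^ (7 * w) <= 2 ^ (u * 7)" using u(2) by (intro power_increasing) auto
      also have "... = (2 ^ u) ^ 7" by (rule power_mult)
      also have "... <= ?X ^ 7" using uX by (intro power_mono) auto
      finally show "2 ^ (7 * w) <= ?X ^ 7" .
    qed auto
    finally show "length ys <= 1 + ?X\<^sup>2 * ?X ^ 7" .
    have "(\<Sum>y\<leftarrow>ys. sz y + 1) <= length ys * (?R + 1)" by (rule sum_list_bound) (use yR in auto)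
    thus "sz ys <= 1 + length ys * (?R + 1)" by (simp only: sz_list)
  qed
  thus ?thesis using inj ys(2) dec fG nar by blast
qed

section \<open>Assembling the tower bounds\<close>

subsection \<open>Time bounds\<close>

lemma exp_tower_mono: "m <= n ==> exp_tower j m <= exp_tower j n"
  by (induction j) (auto intro: power_increasing)

text \<open>Everything is bounded by a power of \<open>(n + 1) * U\<close>, which factors into a
  part for the tower and a polynomial in \<open>n\<close>. One exponent beyond the 19 of the size
  bound absorbs the summands.\<close>

lemma time_arith:
  fixes n u s T U c :: nat
  assumes u: "2 <= u" and size: "s <= ((n + 1) * 2 ^ u) ^ 19" and T: "T <= U" and uU: "2 ^ u <= U" and t: "t <= (s + T + 2) ^ c"
  shows "t + 2 <= U ^ (20 * c + 1) * poly ([:1, 1:] ^ (20 * c + 1)) n"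
proof -
  let ?Y = "(n + 1) * U"
  have "(2::nat) ^ 2 <= 2 ^ u" using u by (rule power_increasing) simp
  hence "4 <= U" using uU by simp
  moreover have UY: "U <= ?Y" by simp
  ultimately have Y: "4 <= ?Y" by linarith
  have "(n + 1) * 2 ^ u <= ?Y" using uU by (rule mult_left_mono) simp
  hence "((n + 1) * 2 ^ u) ^ 19 <= ?Y ^ 19" by (rule power_mono) simp
  hence "s <= ?Y ^ 19" using size by linarith
  moreover have "?Y ^ 1 <= ?Y ^ 19" using Y by (intro power_increasing) linarith+
  hence "?Y <= ?Y ^ 19" by (simp only: power_one_right)
  ultimately have "s + T + 2 <= 3 * ?Y ^ 19" using T UY Y by linarith
  also have "... <= ?Y * ?Y ^ 19" using Y by (intro mult_right_mono) linarith+
  also have "... = ?Y ^ 20" by (simp flip: power_Suc)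
  finally have "(s + T + 2) ^ c <= (?Y ^ 20) ^ c" by (rule power_mono) simp
  hence "t + 2 <= ?Y ^ (20 * c) + 2" using t unfolding power_mult by linarith
  also have "... <= ?Y * ?Y ^ (20 * c)"
  proof -
    have "1 <= ?Y ^ (20 * c)" using Y by (intro one_le_power) linarith
    moreover have "4 * ?Y ^ (20 * c) <= ?Y * ?Y ^ (20 * c)" using Y by (rule mult_right_mono) simp
    ultimately show ?thesis by linarith
  qed
  also have "... = ?Y ^ (20 * c + 1)" by simp
  also have "... = U ^ (20 * c + 1) * poly ([:1, 1:] ^ (20 * c + 1)) n"
  proof -
    have "poly ([:1, 1:] ^ (20 * c + 1)) n = (n + 1) ^ (20 * c + 1)" by (simp only: poly_power) simp
    thus ?thesis by (simp only: power_mult_distrib mult.commute)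
  qed
  finally show ?thesis .
qed

text \<open>In \<open>arith\<close>, the room \<open>u\<^sup>2 * 2 ^ e\<close> is free of charge:
  \<open>u\<close> will be a power of a base at least 2 with exponent linear in the treewidth, so
  squaring and constant factors only change that linear exponent. The square is what the quadratic
  exponent in \<open>ord_qn\<close> requires.\<close>

theorem computable_in_tower_timeI:
  fixes g :: "input => 'b::enc" and qn :: "nat => nat"
  assumes g: "ptime {ys. EX b. narrow b ys} (%ys. 2 ^ qn (8 * (LEAST b. narrow b ys) + 5)) g"
    and correct: "!!P f ys. P \<in> F ==> inj_on f (atoms (grd P)) ==> finite (grd P) ==> set (dec ys) = map_rule f ` grd P ==>
      EX b. narrow b ys ==> enc (g ys) = target (grd P)"
    and F: "!!P. P \<in> F ==> elp P"
    and qn: "!!m n. m <= n ==> qn m <= qn n" "!!n. n <= qn n"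
    and arith: "!!M. EX e. \<forall>u\<ge>2. (2 ^ qn (8 * u + 5)) ^ M <= exp_tower j (u\<^sup>2 * 2 ^ e)"
  shows "computable_in_tower_time a F target j"
proof -
  let ?T = "%ys. 2 ^ qn (8 * (LEAST b. narrow b ys) + 5) :: nat"
  obtain A tm c where A: "computes_at A 0 {ys. EX b. narrow b ys} g tm"
    and c: "!!ys. EX b. narrow b ys ==> tm ys <= (sz ys + ?T ys + 2) ^ c"
    using g unfolding ptime_def pbd_def by auto
  let ?M = "20 * c + 1"
  obtain e where e: "!!u. u >= 2 ==> (2 ^ qn (8 * u + 5)) ^ ?M <= exp_tower j (u\<^sup>2 * 2 ^ e)" using arith[of ?M] by blast
  \<comment> \<open>Doubling pays for the square of \<open>u\<close>, and \<open>e\<close> for the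
    constant factor \<open>2 ^ e\<close>.\<close>
  let ?h = "%k. 2 * (k + a + 1) + e"
  let ?p = "[:1, 1:] ^ ?M :: nat poly"
  have "(%k. real (?h k)) \<in> O(%k. real k)"
  proof (rule bigoI)
    show "\<forall>\<^sub>F k in at_top. norm (real (?h k)) <= (2 * a + 4 + e) * norm (real k)"
    \<comment> \<open>For \<open>1 <= k\<close> the constant part of the exponent is at most a
      multiple of \<open>k\<close>, which suffices for large \<open>k\<close>.\<close>
    proof (rule eventually_mono[OF eventually_ge_at_top[of 1]])
      fix k :: nat assume k: "1 <= k"
      have "?h k <= 2 * k + (2 * a + 2 + e) * 1" by simp
      also have "... <= 2 * k + (2 * a + 2 + e) * k" using k by (intro add_left_mono mult_left_mono) auto
      also have "... = (2 * a + 4 + e) * k" by (simp add: algebra_simps)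
      finally have "real (?h k) <= real ((2 * a + 4 + e) * k)" by (rule of_nat_mono)
      thus "norm (real (?h k)) <= (2 * a + 4 + e) * norm (real k)" by simp
    qed
  qed
  moreover have "outputs_within A x (target (grd P)) (exp_tower j (max 2 (card (herbrand P)) ^ ?h (primal_treewidth P)) * poly ?p (card (atoms P)))"
    if P: "P \<in> F" "bounded_arity a P" "encodes_prog (grd P) x" for P x
  proof -
    let ?k = "primal_treewidth P" and ?D = "max 2 (card (herbrand P))" and ?n = "card (atoms P)"
    let ?w = "(?k + 1) * card (herbrand P) ^ a"
    let ?u = "?D ^ (?k + a + 1)"
    have D: "2 <= ?D" by simp
    have le: "m <= ?D ^ m" for m
    proof -
      have "m <= 2 ^ m" using less_exp[of m] by simp
      also have "... <= ?D ^ m" by (rule power_mono) simp_all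
      finally show ?thesis .
    qed
    have inc: "?D ^ m <= ?D ^ n" if "m <= n" for m n using that by (intro power_increasing) auto
    have u: "2 <= ?u" "card (herbrand P) <= ?u" using inc[of 1 "?k + a + 1"] by simp_all
    \<comment> \<open>The factor \<open>k + 1\<close> of the width becomes a power of the base as
      well, by \<open>m <= ?D ^ m\<close>; hence the exponent \<open>k + a + 1\<close> in
      \<open>?u\<close>.\<close>
    have da: "card (herbrand P) ^ a <= ?D ^ a" by (rule power_mono) simp_all
    hence u2: "card (herbrand P) ^ a <= ?u" by (rule le_trans[OF _ inc]) simp
    have u3: "a <= ?u" by (rule le_trans[OF le inc]) simp
    have "?w <= ?D ^ (?k + 1) * ?D ^ a" using le[of "?k + 1"] da by (rule mult_mono) simp_all
    hence wu: "?w <= ?u" by (simp add: power_add mult.commute mult.left_commute)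
    obtain f ys where f: "inj_on f (atoms (grd P))" "x = enc ys" "set (dec ys) = map_rule f ` grd P" "finite (grd P)" "narrow ?w ys"
      and size: "sz ys <= ((?n + 1) * 2 ^ ?u) ^ 19"
      using decode_input[OF F[OF P(1)] P(2,3) refl u(1) wu u(2) u2 u3] by (elim exE conjE)
    have ex: "EX b. narrow b ys" using f(5) by blast
    obtain t where t: "t <= tm ys + 2" "eval A [enc ys] (ECall 0 [EVar 0]) (enc (g ys)) t"
      using computes_at_call[OF A, of ys 0 "[enc ys]"] ex by auto
    let ?Tu = "2 ^ qn (8 * ?u + 5) :: nat"
    have "(LEAST b. narrow b ys) <= ?u" using Least_le[of "%b. narrow b ys", OF f(5)] wu by linarith
    hence "8 * (LEAST b. narrow b ys) + 5 <= 8 * ?u + 5" by simp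
    from qn(1)[OF this] have T: "?T ys <= ?Tu" by (rule power_increasing) simp
    have "?u <= qn (8 * ?u + 5)" using qn(2)[of "8 * ?u + 5"] by linarith
    hence uT: "2 ^ ?u <= ?Tu" by (rule power_increasing) simp
    have "tm ys + 2 <= ?Tu ^ ?M * poly ?p ?n" by (rule time_arith[OF u(1) size T uT c[OF ex]])
    also have "... <= exp_tower j (?D ^ ?h ?k) * poly ?p ?n"
    proof (rule mult_right_mono)
      have "?u\<^sup>2 * 2 ^ e <= ?u\<^sup>2 * ?D ^ e" by (intro mult_left_mono power_mono) auto
      also have "... = ?D ^ ?h ?k"
        unfolding mult.commute[of 2 "?k + a + 1"] power_add[of ?D "(?k + a + 1) * 2" e] power_mult ..
      finally have "exp_tower j (?u\<^sup>2 * 2 ^ e) <= exp_tower j (?D ^ ?h ?k)" by (rule exp_tower_mono)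
      with e[OF u(1)] show "?Tu ^ ?M <= exp_tower j (?D ^ ?h ?k)" by (rule order_trans)
    qed simp
    finally have "t <= exp_tower j (?D ^ ?h ?k) * poly ?p ?n" using t(1) by linarith
    thus ?thesis unfolding outputs_within_def f(2) correct[OF P(1) f(1,4,3) ex, symmetric] using t(2) by blast
  qed
  ultimately show ?thesis unfolding computable_in_tower_time_def by (intro exI[of _ A] exI[of _ ?h] exI[of _ ?p]) blast
qed

lemma narrow_Least: "EX b. narrow b ys ==> narrow (LEAST b. narrow b ys) ys"
  by (rule LeastI_ex)

lemma exp_tower_simps: "exp_tower 2 n = 2 ^ 2 ^ n" "exp_tower 3 n = 2 ^ 2 ^ 2 ^ n"
  by (simp_all add: eval_nat_numeral)

text \<open>The three exponentials stem from sets of states, from sets of traces within a state, and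
  from the traces.\<close>

lemma full_arith: "EX e. \<forall>u\<ge>2. (2 ^ full_qn (8 * u + 5)) ^ M <= exp_tower 3 (u\<^sup>2 * 2 ^ e)"
proof (intro exI[of _ "M + 15"] allI impI)
  fix u :: nat assume u: "2 <= u"
  let ?B = "8 * u + 5"
  have "?B <= 2 ^ ?B" using less_exp[of ?B] by simp
  hence q: "?B + 2 * 2 ^ ?B + M <= 2 ^ (?B + 2 + M)"
  proof -
    have "M + 1 <= 2 ^ M" using less_exp[of M] by linarith
    hence "4 * 2 ^ ?B * (M + 1) <= 4 * 2 ^ ?B * 2 ^ M" by (rule mult_left_mono) simp
    moreover have "1 * M <= 4 * 2 ^ ?B * M" by (rule mult_right_mono) simp_all
    ultimately have "4 * 2 ^ ?B + M <= 4 * 2 ^ ?B * 2 ^ M" unfolding distrib_left by linarith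
    moreover have "4 * 2 ^ ?B * 2 ^ M = (2::nat) ^ (?B + 2 + M)" by (simp add: power_add)
    ultimately show ?thesis using \<open>?B <= 2 ^ ?B\<close> by linarith
  qed
  have "(2 ^ full_qn ?B) ^ M = (2::nat) ^ (full_qn ?B * M)" by (simp add: power_mult)
  also have "... <= 2 ^ (full_qn ?B * 2 ^ M)" using less_exp[of M] by (intro power_increasing mult_left_mono) auto
  also have "... = 2 ^ 2 ^ (?B + 2 * 2 ^ ?B + M)" by (simp only: full_qn_def power_add)
  also have "... <= 2 ^ 2 ^ 2 ^ (?B + 2 + M)" using q by (intro power_increasing) auto
  also have "... = exp_tower 3 (?B + 2 + M)" by (rule exp_tower_simps(2)[symmetric])
  also have "... <= exp_tower 3 (u\<^sup>2 * 2 ^ (M + 15))"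
  proof (rule exp_tower_mono)
    have "?B + 2 + M <= u * (M + 15)"
    proof -
      have "M <= u * M" using u by simp
      thus ?thesis using u unfolding distrib_left by linarith
    qed
    also have "... <= (u * u) * 2 ^ (M + 15)" using u less_exp[of "M + 15"] by (intro mult_mono) auto
    finally show "?B + 2 + M <= u\<^sup>2 * 2 ^ (M + 15)" by (simp add: power2_eq_square)
  qed
  finally show "(2 ^ full_qn ?B) ^ M <= exp_tower 3 (u\<^sup>2 * 2 ^ (M + 15))" .
qed

text \<open>Only sets of states and the states themselves are exponential. The exponent is quadratic
  in \<open>u\<close>, with coefficients of sum 182, for which 200 leaves room.\<close>

lemma ord_arith: "EX e. \<forall>u\<ge>2. (2 ^ ord_qn (8 * u + 5)) ^ M <= exp_tower 2 (u\<^sup>2 * 2 ^ e)"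
proof (intro exI[of _ "M + 200"] allI impI)
  fix u :: nat assume u: "2 <= u"
  let ?B = "8 * u + 5"
  have "(2 ^ ord_qn ?B) ^ M = (2::nat) ^ (ord_qn ?B * M)" by (simp add: power_mult)
  also have "... <= 2 ^ (ord_qn ?B * 2 ^ M)" using less_exp[of M] by (intro power_increasing mult_left_mono) auto
  also have "... = 2 ^ 2 ^ (?B * ?B + ?B + M)" by (simp only: ord_qn_def power_add)
  also have "... = exp_tower 2 (?B * ?B + ?B + M)" by (rule exp_tower_simps(1)[symmetric])
  also have "... <= exp_tower 2 (u\<^sup>2 * 2 ^ (M + 200))"
  proof (rule exp_tower_mono)
    have uu: "u <= u * u" "1 <= u * u" using u mult_mono[of 1 u 1 u] by simp_all
    have "1 * M <= u * u * M" using uu(2) by (rule mult_right_mono) simp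
    moreover have "?B * ?B + ?B = 64 * (u * u) + 88 * u + 30" by (simp add: algebra_simps)
    ultimately have "?B * ?B + ?B + M <= (u * u) * (M + 200)" using uu unfolding distrib_left by linarith
    also have "... <= (u * u) * 2 ^ (M + 200)" using less_exp[of "M + 200"] by (intro mult_left_mono) auto
    finally show "?B * ?B + ?B + M <= u\<^sup>2 * 2 ^ (M + 200)" by (simp only: power2_eq_square)
  qed
  finally show "(2 ^ ord_qn ?B) ^ M <= exp_tower 2 (u\<^sup>2 * 2 ^ (M + 200))" .
qed

lemma plausibility_empty: "plausibility G {} = card (world_views G)"
  by (simp add: plausibility_def add_query_def Let_def)

lemma ordered_Normal: "P \<in> Normal ==> ordered (grd P)"
proof -
  assume P: "P \<in> Normal"
  have "fcard (head (map_rule f r)) <= 1" if "r \<in> P" for f :: "atom => gatom" and r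
    using P that card_image_le[of "fset (head r)" f]
    by (fastforce simp: Normal_def rule.map_sel fcard.rep_eq fimage.rep_eq)
  thus ?thesis by (auto simp: ordered_def grd_def)
qed

text \<open>Existence is read off the count: there are finitely many world views, so the count is 0
  exactly if there is none.\<close>

lemma tower_time_both:
  fixes cnt :: "tree rule list => nat" and qn :: "nat => nat" and F :: "atom prog set"
  assumes g: "ptime {ys. EX b. narrow b ys} (%ys. 2 ^ qn (8 * (LEAST b. narrow b ys) + 5)) (%ys. cnt (dec ys))"
    and correct: "!!P f ys b. P \<in> F ==> inj_on f (atoms (grd P)) ==> set (dec ys) = map_rule f ` grd P ==>
      narrow b ys ==> cnt (dec ys) = card (world_views (set (dec ys)))"
    and F: "!!P. P \<in> F ==> elp P"
    and qn: "!!m n. m <= n ==> qn m <= qn n" "!!n. n <= qn n"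
    and arith: "!!M. EX e. \<forall>u\<ge>2. (2 ^ qn (8 * u + 5)) ^ M <= exp_tower j (u\<^sup>2 * 2 ^ e)"
  shows "computable_in_tower_time a F (%G. enc_bool (EX I. I \<in> world_views G)) j &
    computable_in_tower_time a F (%G. enc_nat (plausibility G {})) j"
proof -
  have c: "cnt (dec ys) = card (world_views (grd P))"
    if "P \<in> F" "inj_on f (atoms (grd P))" "set (dec ys) = map_rule f ` grd P" "EX b. narrow b ys" for P f ys
    using correct[OF that(1-3)] that(4) card_world_views_image[OF that(2)] unfolding that(3) by auto
  show ?thesis
  proof
    show "computable_in_tower_time a F (%G. enc_bool (EX I. I \<in> world_views G)) j"
    proof (rule computable_in_tower_timeI[OF _ _ F qn arith])
      show "ptime {ys. EX b. narrow b ys} (%ys. 2 ^ qn (8 * (LEAST b. narrow b ys) + 5)) (%ys. cnt (dec ys) ~= 0)"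
        by (intro comp_intros g)
      fix P f ys assume a: "P \<in> F" "inj_on f (atoms (grd P))" "finite (grd P)" "set (dec ys) = map_rule f ` grd P" "EX b. narrow b ys"
      have "(cnt (dec ys) ~= 0) = (EX I. I \<in> world_views (grd P))"
        unfolding c[OF a(1,2,4,5)] using finite_world_views[OF a(3)] by auto
      thus "enc (cnt (dec ys) ~= 0) = enc_bool (EX I. I \<in> world_views (grd P))" by (simp only: enc_bool')
    qed
    show "computable_in_tower_time a F (%G. enc_nat (plausibility G {})) j"
    proof (rule computable_in_tower_timeI[OF g _ F qn arith])
      fix P f ys assume a: "P \<in> F" "inj_on f (atoms (grd P))" "finite (grd P)" "set (dec ys) = map_rule f ` grd P" "EX b. narrow b ys"
      show "enc (cnt (dec ys)) = enc_nat (plausibility (grd P) {})"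
        unfolding c[OF a(1,2,4,5)] plausibility_empty enc_nat' ..
    qed
  qed
qed

theorem theorem20:
  fixes F :: "atom prog set" and i a :: nat
  assumes "(F = Full \<and> i = 2) \<or> (F \<in> {Normal, Tight} \<and> i = 1)"
  shows "computable_in_tower_time a F (\<lambda>G. enc_bool (\<exists>I. I \<in> world_views G)) (i + 1) \<and>
         computable_in_tower_time a F (\<lambda>G. enc_nat (plausibility G {})) (i + 1)"
proof -
  have dec: "ptime D T dec" for D T by (rule comp_dec[OF comp_id])
  have nar: "EX vs. elim_width (LEAST b. narrow b ys) vs (scopes_of (dec ys)) & distinct vs &
     set vs = \<Union>(scopes_of (dec ys))" if "ys \<in> {ys. EX b. narrow b ys}" for ys
    using narrow_Least[of ys] that unfolding narrow_def[of "LEAST b. narrow b ys"] by blast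
  show ?thesis
  proof (cases "F = Full & i = 2")
    case True
    have "computable_in_tower_time a F (%G. enc_bool (EX I. I \<in> world_views G)) 3 &
      computable_in_tower_time a F (%G. enc_nat (plausibility G {})) 3"
    proof (rule tower_time_both[OF full.comp_wv_count[OF dec nar pbd_T] _ _ full.qn_mono full.qn_ge full_arith])
      show "full.wv_count (dec ys) = card (world_views (set (dec ys)))" if "narrow b ys" for b ys
        using that unfolding narrow_def by (elim exE conjE) (rule full.wv_count; simp)
      show "elp P" if "P \<in> F" for P using that True by (simp add: Full_def)
    qed
    thus ?thesis using True by simp
  next
    case False
    hence F: "F \<in> {Normal, Tight}" "i = 1" using assms by auto
    have o: "ordered (grd P)" if "P \<in> F" for P
      using that F ordered_Normal[of P] by (auto simp: Tight_def ordered_def)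
    have "computable_in_tower_time a F (%G. enc_bool (EX I. I \<in> world_views G)) 2 &
      computable_in_tower_time a F (%G. enc_nat (plausibility G {})) 2"
    proof (rule tower_time_both[OF ord.comp_wv_count[OF dec nar pbd_T] _ _ ord.qn_mono ord.qn_ge ord_arith])
      show "ord.wv_count (dec ys) = card (world_views (set (dec ys)))"
        if "P \<in> F" "inj_on f (atoms (grd P))" "set (dec ys) = map_rule f ` grd P" "narrow b ys" for P f ys b
      proof -
        \<comment> \<open>The algorithm sees the renamed atoms, so the property of the grounding is
          carried along the injective renaming.\<close>
        have "ordered (set (dec ys))" unfolding that(3) by (rule ordered_image[OF o[OF that(1)] that(2)])
        thus ?thesis using that(4) unfolding narrow_def by (elim exE conjE) (rule ord.wv_count)
      qed
      show "elp P" if "P \<in> F" for P using that F by (auto simp: Normal_def Tight_def)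
    qed
    thus ?thesis using F(2) by (simp only:) (simp add: numeral_2_eq_2)
  qed
qed

end
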